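(* Let $N=2$ and $\alpha\ge0$. There exists $\bar p=\bar p(\alpha)>1$ such that every $n$-invariant least energy nodal solution $U_{p,n}$ of $$-\Delta u=|x|^{\alpha}|u|^{p-1}u\ \text{ in } B,\qquad u=0\ \text{ on }\partial B$$ is nonradial when $p\in(1,\bar p)$ and $n=1,\dots,\left\lceil\frac{2+\alpha}{2}\beta-1\right\rceil$.
   Context: $B$ is the open unit disc of $\mathbb R^2$ and $(r,\theta)$ are polar coordinates. For an integer $n\ge1$, $H^1_{0,n}$ is the space of $u\in H^1_0(B)$ such that for every $r\in(0,1)$ the map $\theta\mapsto u(r,\theta)$ is even and $2\pi/n$-periodic. Put $$\mathcal E_p(u)=\frac12\int_B|\nabla u|^2-\frac1{p+1}\int_B|x|^\alpha|u|^{p+1},\qquad \mathcal E_p'(u)\cdot v=\int_B\nabla u\nabla v-\int_B|x|^\alpha|u|^{p-1}uv,$$ $$\mathcal N^{\mathrm{nod}}_{p,n}=\{v\in H^1_{0,n}: v^+\neq0,\ v^-\ne0,\ \mathcal E_p'(v)\cdot v^{+}=0,\ \mathcal E_p'(v)\cdot v^{-}=0\},$$ with $v^\pm$ the positive and negative parts of $v$. An $n$-invariant least energy nodal solution $U_{p,n}$ is a function attaining $\min_{\mathcal N^{\mathrm{nod}}_{p,n}}\mathcal E_p$; it exists for every $p>1$ and is a classical solution of the problem. $z_i(\nu)$ denotes the $i$-th positive zero of the Bessel function of the first kind of order $\nu$, and $\beta>0$ is the number such that $z_1(\beta)=z_2(0)$ ($\beta\approx2.305$). $\lceil s\rceil=\min\{k\in\mathbb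 Z:k\ge s\}$. *)

theory Defs
  imports "HOL-Analysis.Analysis"
begin

section \<open>The Sobolev space \<open>H\<^sup>1\<^sub>0\<close>\<close>

text \<open>
  Elements of Sobolev spaces are represented by functions on the whole space of which only the
  restriction to \<open>\<Omega>\<close>, up to null sets, matters.
\<close>

fun k_times_cont_diff :: "nat \<Rightarrow> (real^'n \<Rightarrow> real) \<Rightarrow> bool" where
  "k_times_cont_diff 0 f \<longleftrightarrow> continuous_on UNIV f"
| "k_times_cont_diff (Suc k) f \<longleftrightarrow>
     (\<forall>x. f differentiable (at x)) \<and>
     (\<forall>i. k_times_cont_diff k (\<lambda>x. frechet_derivative f (at x) (axis i 1)))"

definition test_function :: "(real^'n) set \<Rightarrow> (real^'n \<Rightarrow> real) \<Rightarrow> bool" where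
  "test_function \<Omega> \<phi> \<longleftrightarrow>
     (\<forall>k. k_times_cont_diff k \<phi>) \<and>
     compact (closure {x. \<phi> x \<noteq> 0}) \<and> closure {x. \<phi> x \<noteq> 0} \<subseteq> \<Omega>"

definition square_integrable_on ::
    "(real^'n \<Rightarrow> 'b::euclidean_space) \<Rightarrow> (real^'n) set \<Rightarrow> bool" (infix \<open>square'_integrable'_on\<close> 50) where
  "f square_integrable_on \<Omega> \<longleftrightarrow>
     f \<in> borel_measurable (lebesgue_on \<Omega>) \<and> integrable (lebesgue_on \<Omega>) (\<lambda>x. (norm (f x))\<^sup>2)"

definition has_weak_gradient ::
    "(real^'n) set \<Rightarrow> (real^'n \<Rightarrow> real) \<Rightarrow> (real^'n \<Rightarrow> real^'n) \<Rightarrow> bool" where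
  "has_weak_gradient \<Omega> u g \<longleftrightarrow>
     g square_integrable_on \<Omega> \<and>
     (\<forall>\<phi> i. test_function \<Omega> \<phi> \<longrightarrow>
        (\<integral>x. u x * frechet_derivative \<phi> (at x) (axis i 1) \<partial>lebesgue_on \<Omega>)
          = - (\<integral>x. g x $ i * \<phi> x \<partial>lebesgue_on \<Omega>))"

definition H1 :: "(real^'n) set \<Rightarrow> (real^'n \<Rightarrow> real) set" where
  "H1 \<Omega> = {u. u square_integrable_on \<Omega> \<and> (\<exists>g. has_weak_gradient \<Omega> u g)}"

text \<open>The weak gradient is unique only up to null sets; it is used only under integrals.\<close>

definition weak_gradient :: "(real^'n) set \<Rightarrow> (real^'n \<Rightarrow> real) \<Rightarrow> real^'n \<Rightarrow> real^'n" where
  "weak_gradient \<Omega> u = (SOME g. has_weak_gradient \<Omega> u g)"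

definition H1_norm :: "(real^'n) set \<Rightarrow> (real^'n \<Rightarrow> real) \<Rightarrow> real" where
  "H1_norm \<Omega> u =
     sqrt ((\<integral>x. (u x)\<^sup>2 \<partial>lebesgue_on \<Omega>) +
           (\<integral>x. (norm (weak_gradient \<Omega> u x))\<^sup>2 \<partial>lebesgue_on \<Omega>))"

definition H1_0 :: "(real^'n) set \<Rightarrow> (real^'n \<Rightarrow> real) set" where
  "H1_0 \<Omega> =
     {u \<in> H1 \<Omega>. \<forall>\<epsilon>>0. \<exists>\<phi>. test_function \<Omega> \<phi> \<and> H1_norm \<Omega> (\<lambda>x. u x - \<phi> x) < \<epsilon>}"


section \<open>Least energy nodal solutions of the Henon problem in the disc\<close>

abbreviation disc :: "(real^2) set" where
  "disc \<equiv> ball 0 1"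

definition polar :: "real \<Rightarrow> real \<Rightarrow> real^2" where
  "polar r \<theta> = vector [r * cos \<theta>, r * sin \<theta>]"

text \<open>The pointwise symmetry is required of some representative of the class of \<open>u\<close>.\<close>

definition H1_0_sym :: "nat \<Rightarrow> (real^2 \<Rightarrow> real) set" where
  "H1_0_sym n =
     {u \<in> H1_0 disc. \<exists>v. (AE x in lebesgue_on disc. v x = u x) \<and>
        (\<forall>r\<in>{0<..<1}. \<forall>\<theta>. v (polar r (- \<theta>)) = v (polar r \<theta>) \<and>
                          v (polar r (\<theta> + 2 * pi / real n)) = v (polar r \<theta>))}"

definition pos_part :: "('a \<Rightarrow> real) \<Rightarrow> 'a \<Rightarrow> real" where
  "pos_part v x = max (v x) 0"

definition neg_part :: "('a \<Rightarrow> real) \<Rightarrow> 'a \<Rightarrow> real" where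
  "neg_part v x = max (- v x) 0"

text \<open>
  For \<open>\<alpha> = 0\<close> the weight \<open>norm x powr \<alpha>\<close> takes the value \<open>0\<close> at the origin, a null set.
\<close>

definition energy :: "real \<Rightarrow> real \<Rightarrow> (real^2 \<Rightarrow> real) \<Rightarrow> real" where
  "energy \<alpha> p u =
     1 / 2 * (\<integral>x. (norm (weak_gradient disc u x))\<^sup>2 \<partial>lebesgue_on disc)
     - 1 / (p + 1) * (\<integral>x. norm x powr \<alpha> * \<bar>u x\<bar> powr (p + 1) \<partial>lebesgue_on disc)"

definition energy_deriv ::
    "real \<Rightarrow> real \<Rightarrow> (real^2 \<Rightarrow> real) \<Rightarrow> (real^2 \<Rightarrow> real) \<Rightarrow> real" where
  "energy_deriv \<alpha> p u v =
     (\<integral>x. weak_gradient disc u x \<bullet> weak_gradient disc v x \<partial>lebesgue_on disc)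
     - (\<integral>x. norm x powr \<alpha> * \<bar>u x\<bar> powr (p - 1) * u x * v x \<partial>lebesgue_on disc)"

definition nodal_Nehari :: "real \<Rightarrow> real \<Rightarrow> nat \<Rightarrow> (real^2 \<Rightarrow> real) set" where
  "nodal_Nehari \<alpha> p n =
     {v \<in> H1_0_sym n.
        \<not> (AE x in lebesgue_on disc. pos_part v x = 0) \<and>
        \<not> (AE x in lebesgue_on disc. neg_part v x = 0) \<and>
        energy_deriv \<alpha> p v (pos_part v) = 0 \<and>
        energy_deriv \<alpha> p v (neg_part v) = 0}"

definition least_energy_nodal :: "real \<Rightarrow> real \<Rightarrow> nat \<Rightarrow> (real^2 \<Rightarrow> real) \<Rightarrow> bool" where
  "least_energy_nodal \<alpha> p n u \<longleftrightarrow>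
     u \<in> nodal_Nehari \<alpha> p n \<and> (\<forall>w\<in>nodal_Nehari \<alpha> p n. energy \<alpha> p u \<le> energy \<alpha> p w)"

definition radial :: "(real^2 \<Rightarrow> real) \<Rightarrow> bool" where
  "radial u \<longleftrightarrow> (\<exists>f. AE x in lebesgue_on disc. u x = f (norm x))"


section \<open>Zeros of Bessel functions\<close>

text \<open>The function \<open>J\<^sub>\<nu>\<close>; the definition is meant for \<open>x > 0\<close> only.\<close>

definition Bessel_J :: "real \<Rightarrow> real \<Rightarrow> real" where
  "Bessel_J \<nu> x =
     (\<Sum>k. (- 1) ^ k / fact k * rGamma (real k + \<nu> + 1) * (x / 2) powr (2 * real k + \<nu>))"

text \<open>The \<open>i\<close>-th positive zero, for \<open>i \<ge> 1\<close>.\<close>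

definition Bessel_zero :: "nat \<Rightarrow> real \<Rightarrow> real" where
  "Bessel_zero i \<nu> =
     (THE x. 0 < x \<and> Bessel_J \<nu> x = 0 \<and> card {y. 0 < y \<and> y \<le> x \<and> Bessel_J \<nu> y = 0} = i)"

end

theory Submission
  imports Defs
begin

text \<open>
The reason is a comparison of energies as \<open>p\<close> tends to 1. Put \<open>p = 1 + 2 s\<close>,
\<open>\<gamma> = (2 + \<alpha>) / 2\<close>, \<open>\<kappa> = z\<^sub>2(0) = z\<^sub>1(\<beta>)\<close> and \<open>\<Lambda> = (\<gamma> \<kappa>)\<^sup>2\<close> (called \<open>lam\<close> below). The functions
\<open>J\<^sub>\<nu>(\<kappa> r\<^sup>\<gamma>) cos (\<gamma> \<nu> \<theta>)\<close> solve the linear equation \<open>- \<Delta> u = \<Lambda> |x|\<^sup>\<alpha> u\<close>; for \<open>\<nu> = 0\<close> this is the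
second radial eigenfunction of the disc. On the Nehari set the energy of a function is
\<open>1/2 - 1/(p + 1)\<close> times its Dirichlet integral, and a function whose Rayleigh quotient
\<open>\<integral>|\<nabla>u|\<^sup>2 / \<integral>|x|\<^sup>\<alpha> u\<^sup>2\<close> is \<open>\<mu>\<close> has, after scaling to the Nehari set, a Dirichlet integral of
roughly the order of the \<open>1/s\<close>-th power of \<open>\<mu>\<close>. For small \<open>s\<close> any gap between two Rayleigh quotients therefore
outweighs all constants (\<open>exponential_beats_constant\<close>).

Radial competitors. Let \<open>u\<close> be a radial function in the Nehari set and let \<open>r0\<close> be the zero of
\<open>\<psi>(r) = J\<^sub>0(\<kappa> r\<^sup>\<gamma>)\<close> in \<open>(0, 1)\<close>. If \<open>u\<close> is not positive at \<open>r0\<close>, then the positive part vanishes at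
\<open>r0\<close> and at 1, the two zeros of \<open>\<psi>\<close>, and Picone's identity gives
\<open>\<integral>|\<nabla>u\<^sup>+|\<^sup>2 \<ge> \<Lambda> \<integral>|x|\<^sup>\<alpha> (u\<^sup>+)\<^sup>2\<close>; otherwise the same holds for the negative part (\<open>radial_picone\<close>).
Interpolating the exponent \<open>p + 1\<close> of the Nehari identity between 2 and 4, where the fourth power
is controlled by \<open>radial_ladyzhenskaya\<close>, gives the lower bound \<open>radial_energy_bound\<close>. Elements of
\<open>H\<^sup>1\<^sub>0\<close> are only limits of test functions, so both inequalities are proved for the angular means of
test functions, one sign at \<open>r0\<close> is selected along a subsequence, and then the limit is taken
(\<open>radial_bounds\<close>).

A competitor with \<open>n\<close>-fold symmetry. The bound on \<open>n\<close> says exactly that \<open>n < \<gamma> \<beta>\<close>. Since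
\<open>\<kappa>\<close> is a zero of \<open>J\<^sub>\<beta>\<close>, the function \<open>J\<^sub>\<beta>(\<kappa> r\<^sup>\<gamma>) cos (\<gamma> \<beta> \<theta>)\<close> vanishes on the boundary and would have
the Rayleigh quotient \<open>\<Lambda>\<close> if it were single-valued; replacing the angular frequency \<open>\<gamma> \<beta>\<close> by the
smaller number \<open>n\<close> makes the quotient strictly smaller than \<open>\<Lambda>\<close> (\<open>\<Phi>_negative\<close>). Mollifying the
profile at the origin and at the boundary gives a test function \<open>w\<close> with this property
(\<open>good_test_function\<close>). The rotation by \<open>\<pi> / n\<close> exchanges the positive and the negative part of
\<open>w\<close>, so that a suitable multiple of \<open>w\<close> lies in the Nehari set (\<open>scaled_w_nodal_Nehari\<close>), and for
\<open>p\<close> close to 1 its energy is below that of every radial competitor (\<open>low_energy_nodal\<close>).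
Only finitely many \<open>n\<close> occur, hence a single \<open>pbar\<close> serves all of them.
\<close>

section \<open>The power series behind the Bessel functions\<close>

text \<open>The entire function with \<open>J\<^sub>\<nu>(x) = (x / 2)\<^sup>\<nu> B\<^sub>\<nu>(x\<^sup>2 / 4) / \<Gamma>(\<nu> + 1)\<close>. Splitting off the power of \<open>x\<close>
  removes the singularity at the origin and leaves all positive zeros in place.\<close>

definition bessel_series :: "real \<Rightarrow> real \<Rightarrow> real" where
  "bessel_series \<nu> t = (\<Sum>k. (- 1) ^ k / (fact k * pochhammer (\<nu> + 1) k) * t ^ k)"

lemma pochhammer_ge_1:
  fixes \<nu> :: real
  assumes "\<nu> \<ge> 0"
  shows "pochhammer (\<nu> + 1) k \<ge> 1"
proof (induction k)
  case (Suc k)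
  have "1 * 1 \<le> pochhammer (\<nu> + 1) k * (\<nu> + 1 + real k)"
    using Suc assms by (intro mult_mono) auto
  then show ?case by (simp add: pochhammer_Suc)
qed simp

lemma bessel_series_summable:
  fixes \<nu> t :: real
  assumes "\<nu> \<ge> 0"
  shows "summable (\<lambda>k. (- 1) ^ k / (fact k * pochhammer (\<nu> + 1) k) * t ^ k)"
proof (rule summable_comparison_test')
  show "summable (\<lambda>k. inverse (fact k) * \<bar>t\<bar> ^ k)"
    using summable_exp[of "\<bar>t\<bar>"] by simp
  fix k :: nat
  have "1 / (fact k * pochhammer (\<nu> + 1) k) \<le> 1 / fact k"
    using pochhammer_ge_1[OF assms, of k] by (simp add: field_simps)
  then have "1 / (fact k * pochhammer (\<nu> + 1) k) * \<bar>t\<bar> ^ k \<le> 1 / fact k * \<bar>t\<bar> ^ k"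
    by (intro mult_right_mono) auto
  then show "norm ((- 1) ^ k / (fact k * pochhammer (\<nu> + 1) k) * t ^ k)
      \<le> inverse (fact k) * \<bar>t\<bar> ^ k"
    using pochhammer_ge_1[OF assms, of k]
    by (simp add: abs_mult power_abs divide_inverse)
qed

lemma bessel_series_0: "bessel_series \<nu> 0 = 1"
  unfolding bessel_series_def by (subst powser_zero) simp

lemma bessel_series_deriv:
  assumes "\<nu> \<ge> 0"
  shows "(bessel_series \<nu> has_real_derivative - bessel_series (\<nu> + 1) t / (\<nu> + 1)) (at t)"
proof -
  define c where "c k = (- 1) ^ k / (fact k * pochhammer (\<nu> + 1) k)" for k
  have sm: "summable (\<lambda>k. c k * y ^ k)" for y
    unfolding c_def by (rule bessel_series_summable[OF assms])
  have "((\<lambda>x. \<Sum>k. c k * x ^ k) has_real_derivative (\<Sum>k. diffs c k * t ^ k)) (at t)"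
    by (rule termdiffs_strong_converges_everywhere[OF sm])
  moreover have "diffs c k = - 1 / (\<nu> + 1) * ((- 1) ^ k / (fact k * pochhammer (\<nu> + 1 + 1) k))" for k
    using assms by (simp add: diffs_def c_def pochhammer_rec divide_simps add_ac)
  then have "(\<Sum>k. diffs c k * t ^ k)
      = (\<Sum>k. - 1 / (\<nu> + 1) * ((- 1) ^ k / (fact k * pochhammer (\<nu> + 1 + 1) k) * t ^ k))"
    by (simp add: mult.assoc)
  also have "\<dots> = - 1 / (\<nu> + 1) * bessel_series (\<nu> + 1) t"
    unfolding bessel_series_def
    by (subst suminf_mult) (use bessel_series_summable[of "\<nu> + 1"] assms in auto)
  ultimately show ?thesis
    by (simp add: bessel_series_def[abs_def] c_def)
qed

text \<open>With \<open>B\<^sub>\<nu>' = - B\<^bsub>\<nu>+1\<^esub> / (\<nu> + 1)\<close> this is Bessel's differential equation; it is verified by comparing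
  coefficients.\<close>

lemma bessel_series_recurrence:
  assumes "\<nu> \<ge> 0"
  shows "bessel_series \<nu> t
           = bessel_series (\<nu> + 1) t - t / ((\<nu> + 1) * (\<nu> + 2)) * bessel_series (\<nu> + 2) t"
proof -
  define a where "a \<mu> k = (- 1) ^ k / (fact k * pochhammer (\<mu> + 1) k) * t ^ k" for \<mu> and k :: nat
  have s: "summable (a \<mu>)" if "\<mu> \<ge> 0" for \<mu>
    unfolding a_def by (rule bessel_series_summable[OF that])
  have coeffs: "a \<nu> (Suc k) = a (\<nu> + 1) (Suc k) - t / ((\<nu> + 1) * (\<nu> + 2)) * a (\<nu> + 2) k" for k
  proof -
    define p where "p = pochhammer (\<nu> + 3) k"
    define M where "M = (- 1) ^ k * t ^ k / (fact k * p)"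
    have pos: "p > 0" unfolding p_def using assms by (intro pochhammer_pos) auto
    have e: "\<nu> + 1 + 1 = \<nu> + 2" "\<nu> + 2 + 1 = \<nu> + 3" by auto
    have 1: "pochhammer (\<nu> + 2) (Suc k) = (\<nu> + 2) * p"
      by (simp only: pochhammer_rec e p_def)
    have "pochhammer (\<nu> + 1) (Suc k) * (\<nu> + 1 + real (Suc k)) = pochhammer (\<nu> + 1) (Suc (Suc k))"
      by (simp only: pochhammer_Suc[of _ "Suc k"])
    also have "\<dots> = (\<nu> + 1) * ((\<nu> + 2) * p)"
      by (simp only: pochhammer_rec[of "\<nu> + 1"] e 1)
    finally have 2: "pochhammer (\<nu> + 1) (Suc k) = (\<nu> + 1) * ((\<nu> + 2) * p) / (\<nu> + 1 + real (Suc k))"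
      using assms by (simp add: field_simps)
    have nz: "\<nu> + 1 > 0" "\<nu> + 2 > 0" "\<nu> + 1 + real (Suc k) > 0" "real (Suc k) > 0" using assms by auto
    have "a \<nu> (Suc k) = - M * t * (\<nu> + 1 + real (Suc k)) / (real (Suc k) * ((\<nu> + 1) * (\<nu> + 2)))"
      unfolding a_def 2 fact_Suc power_Suc M_def by (simp add: mult_ac)
    also have "\<dots> = - M * t / (real (Suc k) * (\<nu> + 2)) - t / ((\<nu> + 1) * (\<nu> + 2)) * M"
    proof -
      have "- M * t * (A + K) / (K * (A * C)) = - M * t / (K * C) - t / (A * C) * M"
        if "A > 0" "C > 0" "K > 0" for A C K :: real
        using that by (simp add: field_simps)
      from this[OF nz(1,2,4)] show ?thesis by simp
    qed
    also have "\<dots> = a (\<nu> + 1) (Suc k) - t / ((\<nu> + 1) * (\<nu> + 2)) * a (\<nu> + 2) k"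
      unfolding a_def e 1 fact_Suc power_Suc M_def by (simp add: p_def mult_ac)
    finally show ?thesis .
  qed
  have "(\<Sum>k. a \<nu> (Suc k)) = (\<Sum>k. a (\<nu> + 1) (Suc k) - t / ((\<nu> + 1) * (\<nu> + 2)) * a (\<nu> + 2) k)"
    by (intro arg_cong[where f = suminf] ext coeffs)
  also have "\<dots> = (\<Sum>k. a (\<nu> + 1) (Suc k)) - (\<Sum>k. t / ((\<nu> + 1) * (\<nu> + 2)) * a (\<nu> + 2) k)"
  proof (rule suminf_diff[symmetric])
    show "summable (\<lambda>k. a (\<nu> + 1) (Suc k))" using s[of "\<nu> + 1"] assms by (subst summable_Suc_iff) auto
    show "summable (\<lambda>k. t / ((\<nu> + 1) * (\<nu> + 2)) * a (\<nu> + 2) k)" using s[of "\<nu> + 2"] assms by (intro summable_mult) auto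
  qed
  also have "(\<Sum>k. t / ((\<nu> + 1) * (\<nu> + 2)) * a (\<nu> + 2) k) = t / ((\<nu> + 1) * (\<nu> + 2)) * suminf (a (\<nu> + 2))"
    by (intro suminf_mult s) (use assms in auto)
  finally have "suminf (a \<nu>) - a \<nu> 0 = suminf (a (\<nu> + 1)) - a (\<nu> + 1) 0 - t / ((\<nu> + 1) * (\<nu> + 2)) * suminf (a (\<nu> + 2))"
    using suminf_split_head[OF s[of \<nu>]] suminf_split_head[OF s[of "\<nu> + 1"]] assms by simp
  moreover have "bessel_series \<mu> t = suminf (a \<mu>)" for \<mu>
    unfolding bessel_series_def a_def ..
  ultimately show ?thesis by (simp add: a_def)
qed

definition bessel_series' :: "real \<Rightarrow> real \<Rightarrow> real" where
  "bessel_series' \<nu> t = - bessel_series (\<nu> + 1) t / (\<nu> + 1)"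

lemma bessel_series_has_deriv [derivative_intros]:
  assumes "\<nu> \<ge> 0" and "(f has_real_derivative f') (at x within S)"
  shows "((\<lambda>x. bessel_series \<nu> (f x)) has_real_derivative bessel_series' \<nu> (f x) * f') (at x within S)"
  unfolding bessel_series'_def
  by (rule DERIV_chain2[OF bessel_series_deriv[OF assms(1)] assms(2)])

text \<open>The equation \<open>t B'' + (\<nu> + 1) B' + B = 0\<close>, solved for \<open>(t B')'\<close>.\<close>

lemma bessel_ode:
  assumes "\<nu> \<ge> 0"
  shows "((\<lambda>t. t * bessel_series' \<nu> t) has_real_derivative
            - \<nu> * bessel_series' \<nu> t - bessel_series \<nu> t) (at t within S)"
proof -
  define c where "c = (\<nu> + 1) * (\<nu> + 2)"
  have "(bessel_series (\<nu> + 1) has_real_derivative - bessel_series (\<nu> + 2) t / (\<nu> + 2)) (at t within S)"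
    using has_field_derivative_at_within[OF bessel_series_deriv[of "\<nu> + 1" t]] assms by (simp add: add.assoc)
  from DERIV_cdivide[OF DERIV_minus[OF this], of "\<nu> + 1"]
  have "(bessel_series' \<nu> has_real_derivative bessel_series (\<nu> + 2) t / c) (at t within S)"
    by (simp add: bessel_series'_def[abs_def] c_def mult.commute)
  from DERIV_mult'[OF DERIV_ident this]
  have "((\<lambda>t. t * bessel_series' \<nu> t) has_real_derivative
            t * (bessel_series (\<nu> + 2) t / c) + bessel_series' \<nu> t) (at t within S)"
    by simp
  moreover have "t * (bessel_series (\<nu> + 2) t / c) + bessel_series' \<nu> t
      = - \<nu> * bessel_series' \<nu> t - bessel_series \<nu> t"
  proof -
    have "bessel_series \<nu> t = bessel_series (\<nu> + 1) t - t / c * bessel_series (\<nu> + 2) t"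
      using bessel_series_recurrence[OF assms] by (simp add: c_def)
    moreover have "bessel_series (\<nu> + 1) t = - (\<nu> + 1) * bessel_series' \<nu> t"
      using assms unfolding bessel_series'_def by (simp add: divide_simps) (simp add: algebra_simps)
    ultimately show ?thesis by (simp add: algebra_simps)
  qed
  ultimately show ?thesis by simp
qed

lemma continuous_on_bessel_series [continuous_intros]:
  assumes "\<nu> \<ge> 0" "continuous_on S f"
  shows "continuous_on S (\<lambda>x. bessel_series \<nu> (f x))"
proof -
  have "continuous_on UNIV (bessel_series \<nu>)"
    using bessel_series_deriv[OF assms(1)] by (intro DERIV_continuous_on) auto
  then show ?thesis
    using assms(2) by (rule continuous_on_compose2) auto
qed

lemma continuous_on_bessel_series' [continuous_intros]:
  assumes "\<nu> \<ge> 0" "continuous_on S f"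
  shows "continuous_on S (\<lambda>x. bessel_series' \<nu> (f x))"
  unfolding bessel_series'_def using assms
  by (intro continuous_on_divide continuous_on_minus continuous_on_bessel_series continuous_on_const) auto

section \<open>Zeros of Bessel functions\<close>

text \<open>The energy \<open>L = s\<^bsup>2\<nu>\<^esup> (s B')\<^sup>2 + s\<^bsup>2\<nu>+1\<^esup> B\<^sup>2\<close> is nondecreasing along the equation. At a double zero it would
  vanish, hence also to the left of it, and \<open>B\<close> would vanish up to the origin, where it equals 1.\<close>

lemma bessel_series_simple_zeros:
  assumes "\<nu> \<ge> 0" "t > 0" "bessel_series \<nu> t = 0"
  shows "bessel_series' \<nu> t \<noteq> 0"
proof
  assume "bessel_series' \<nu> t = 0"
  define B where "B = bessel_series \<nu>"
  define D where "D = bessel_series' \<nu>"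
  define m where "m = 2 * \<nu> + 1"
  define P where "P s = s * D s" for s
  have dP: "(P has_real_derivative - \<nu> * D s - B s) (at s)" for s
    using bessel_ode[OF assms(1), of s UNIV] by (simp add: P_def[abs_def] D_def B_def)
  have dB: "(B has_real_derivative D s) (at s)" for s
    using bessel_series_deriv[OF assms(1), of s] by (simp add: B_def D_def bessel_series'_def)
  define L where "L s = s powr (2 * \<nu>) * (P s)\<^sup>2 + s powr m * (B s)\<^sup>2" for s
  have L': "(L has_real_derivative m * s powr (m - 1) * (B s)\<^sup>2) (at s)" if "s > 0" for s
  proof -
    have e: "s powr (2 * \<nu> - 1) = s powr (2 * \<nu>) / s" "s powr m = s powr (2 * \<nu>) * s"
      "s powr (m - 1) = s powr (2 * \<nu>)"
      using that by (auto simp: m_def powr_diff powr_add)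
    have "(L has_real_derivative 2 * \<nu> * s powr (2 * \<nu> - 1) * (P s)\<^sup>2
        + s powr (2 * \<nu>) * (2 * P s * (- \<nu> * D s - B s))
        + (m * s powr (m - 1) * (B s)\<^sup>2 + s powr m * (2 * B s * D s))) (at s)"
      unfolding L_def
      by (rule derivative_eq_intros refl dP dB | use that in simp)+
    also have "2 * \<nu> * s powr (2 * \<nu> - 1) * (P s)\<^sup>2
        + s powr (2 * \<nu>) * (2 * P s * (- \<nu> * D s - B s))
        + (m * s powr (m - 1) * (B s)\<^sup>2 + s powr m * (2 * B s * D s)) = m * s powr (m - 1) * (B s)\<^sup>2"
    proof -
      have "s powr (2 * \<nu>) / s * (P s)\<^sup>2 = s powr (2 * \<nu>) * s * (D s)\<^sup>2"
        using that by (simp add: P_def power2_eq_square)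
      then show ?thesis unfolding e by (simp add: P_def power2_eq_square algebra_simps)
    qed
    finally show ?thesis .
  qed
  have inc: "L s \<le> L t" if "0 < s" "s \<le> t" for s
  proof (rule DERIV_nonneg_imp_nondecreasing[OF that(2)])
    fix x assume "s \<le> x" "x \<le> t"
    then show "\<exists>y. (L has_real_derivative y) (at x) \<and> 0 \<le> y"
      using L'[of x] that assms(1) by (intro exI[of _ "m * x powr (m - 1) * (B x)\<^sup>2"]) (auto simp: m_def)
  qed
  have "B s = 0" if "0 < s" "s \<le> t" for s
  proof -
    have "L t = 0" using assms(3) \<open>bessel_series' \<nu> t = 0\<close> by (simp add: L_def P_def B_def D_def)
    have "s powr m * (B s)\<^sup>2 \<le> L s" by (simp add: L_def)
    also have "\<dots> \<le> 0" using inc[OF that] \<open>L t = 0\<close> by simp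
    finally show ?thesis using that by (simp add: mult_le_0_iff)
  qed
  then have "(B \<longlongrightarrow> 0) (at_right 0)"
    using assms(2) by (intro tendsto_eventually eventually_at_rightI[of 0 t]) auto
  moreover have "(B \<longlongrightarrow> B 0) (at_right 0)"
    using DERIV_isCont[OF bessel_series_deriv[OF assms(1), of 0]] unfolding B_def isCont_def
    by (rule tendsto_within_subset) simp
  ultimately have "B 0 = 0"
    by (rule tendsto_unique[OF trivial_limit_at_right_real, rotated])
  then show False by (simp add: B_def bessel_series_0)
qed

text \<open>At an accumulation point of zeros both the function and its derivative would vanish.\<close>

lemma finite_bessel_series_zeros:
  assumes "\<nu> \<ge> 0"
  shows "finite {t. 0 \<le> t \<and> t \<le> T \<and> bessel_series \<nu> t = 0}" (is "finite ?Z")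
proof (rule ccontr)
  assume inf: "infinite ?Z"
  have "?Z \<subseteq> {0..T}" by auto
  then obtain x where x: "x \<in> {0..T}" "x islimpt ?Z"
    using Heine_Borel_imp_Bolzano_Weierstrass[OF compact_Icc inf] by meson
  have nt: "at x within ?Z \<noteq> bot" using x(2) by (simp add: trivial_limit_within)
  have "(bessel_series \<nu> \<longlongrightarrow> bessel_series \<nu> x) (at x within ?Z)"
    using DERIV_isCont[OF bessel_series_deriv[OF assms, of x]] unfolding isCont_def
    by (rule tendsto_within_subset) simp
  moreover have "(bessel_series \<nu> \<longlongrightarrow> 0) (at x within ?Z)"
    by (rule tendsto_eventually, unfold eventually_at_filter, rule always_eventually) simp
  ultimately have zero: "bessel_series \<nu> x = 0"
    by (rule tendsto_unique[OF nt])
  then have "x > 0" using x(1) bessel_series_0[of \<nu>] by (cases "x = 0") auto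
  have "((\<lambda>y. (bessel_series \<nu> y - bessel_series \<nu> x) / (y - x)) \<longlongrightarrow> bessel_series' \<nu> x) (at x within ?Z)"
    using bessel_series_deriv[OF assms, of x] unfolding has_field_derivative_iff bessel_series'_def
    by (rule tendsto_within_subset) simp
  moreover have "((\<lambda>y. (bessel_series \<nu> y - bessel_series \<nu> x) / (y - x)) \<longlongrightarrow> 0) (at x within ?Z)"
    by (rule tendsto_eventually, unfold eventually_at_filter, rule always_eventually) (simp add: zero)
  ultimately have "bessel_series' \<nu> x = 0" by (rule tendsto_unique[OF nt])
  then show False using bessel_series_simple_zeros[OF assms \<open>x > 0\<close> zero] by simp
qed

text \<open>Sturm comparison: \<open>v = \<surd>x J\<^sub>\<nu>(x)\<close>, up to a constant factor, satisfies
  \<open>v'' = ((\<nu>\<^sup>2 - 1/4) / x\<^sup>2 - 1) v\<close>, where the coefficient is at most \<open>- 1/4\<close> for large \<open>x\<close>. If \<open>v\<close> were positive from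
  \<open>a\<close> on, its Wronskian with the solution \<open>sin ((x - a) / 2)\<close> of \<open>y'' = - y / 4\<close> would not increase on
  \<open>[a, a + 2\<pi>]\<close>; but its values at the ends are \<open>- v(a) / 2\<close> and \<open>v(a + 2\<pi>) / 2\<close>.\<close>

lemma bessel_series_zeros_unbounded:
  assumes "\<nu> \<ge> 0"
  shows "\<exists>x>T. bessel_series \<nu> (x\<^sup>2 / 4) = 0"
proof (rule ccontr)
  assume nz: "\<not> ?thesis"
  \<comment> \<open>beyond \<open>2 \<nu>\<close> the coefficient in the equation for \<open>v\<close> is at most \<open>- 1/4\<close>\<close>
  define a where "a = max (max T 1) (2 * \<nu>) + 1"
  have a: "a > T" "a > 1" "a > 2 * \<nu>" by (auto simp: a_def)
  define m where "m = \<nu> + 1 / 2"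
  define B where "B x = bessel_series \<nu> (x\<^sup>2 / 4)" for x
  define D where "D x = bessel_series' \<nu> (x\<^sup>2 / 4)" for x
  have cont: "continuous_on S B" for S
    unfolding B_def by (intro continuous_intros assms) auto
  have Bnz: "B x \<noteq> 0" if "x \<ge> a" for x using nz a that by (auto simp: B_def)
  define \<sigma> where "\<sigma> = sgn (B a)"
  have sg: "\<sigma> * B x > 0" if "x \<ge> a" for x
  proof (rule ccontr)
    assume "\<not> \<sigma> * B x > 0"
    then have "\<sigma> * B x \<le> 0" by simp
    moreover have "\<sigma> * B a \<ge> 0" by (simp add: \<sigma>_def sgn_if)
    moreover have "continuous_on {a..x} (\<lambda>x. \<sigma> * B x)" by (intro continuous_intros cont)
    ultimately have "\<exists>y\<ge>a. y \<le> x \<and> \<sigma> * B y = 0"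
      using that by (intro IVT2')
    then obtain y where "a \<le> y" "\<sigma> * B y = 0" by blast
    then show False using Bnz[of y] Bnz[of a] by (simp add: \<sigma>_def sgn_zero_iff)
  qed
  define v where "v x = \<sigma> * (x powr m * B x)" for x
  define v1 where "v1 x = \<sigma> * (m * x powr (m - 1) * B x + 2 * x powr (m - 1) * (x\<^sup>2 / 4 * D x))" for x
  have v: "(v has_real_derivative v1 x) (at x)" if "x > 0" for x
  proof -
    have dB: "(B has_real_derivative D x * (x / 2)) (at x)"
      unfolding B_def D_def by (rule derivative_eq_intros refl assms | simp)+
    have "(v has_real_derivative \<sigma> * (m * x powr (m - 1) * B x + x powr m * (D x * (x / 2)))) (at x)"
      unfolding v_def by (rule derivative_eq_intros refl dB | use that in simp)+
    also have "x powr m = x powr (m - 1) * x" using that by (simp add: powr_diff)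
    finally show ?thesis unfolding v1_def by (simp add: power2_eq_square mult_ac)
  qed
  have ode: "((\<lambda>x. x\<^sup>2 / 4 * D x) has_real_derivative (- \<nu> * D x - B x) * (x / 2)) (at x)" for x
    unfolding D_def B_def
    by (rule DERIV_chain2[of "\<lambda>t. t * bessel_series' \<nu> t" _ "\<lambda>x. x\<^sup>2 / 4", OF bessel_ode[OF assms]])
       (auto intro!: derivative_eq_intros)
  have v1: "(v1 has_real_derivative ((\<nu>\<^sup>2 - 1 / 4) / x\<^sup>2 - 1) * v x) (at x)" if "x > 0" for x
  proof -
    define N where "N = x powr (m - 2)"
    have e: "x powr (m - 1) = N * x" "x powr m = N * x * x"
      using that powr_add[of x "m - 2" 1] powr_add[of x "m - 2" 2] by (auto simp: N_def power2_eq_square)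
    have dB: "(B has_real_derivative D x * (x / 2)) (at x)"
      unfolding B_def D_def by (rule derivative_eq_intros refl assms | simp)+
    have "(v1 has_real_derivative \<sigma> * (m * ((m - 1) * x powr (m - 2)) * B x + m * x powr (m - 1) * (D x * (x / 2))
       + (2 * ((m - 1) * x powr (m - 2)) * (x\<^sup>2 / 4 * D x) + 2 * x powr (m - 1) * ((- \<nu> * D x - B x) * (x / 2))))) (at x)"
      unfolding v1_def
      by (rule derivative_eq_intros refl ode dB | use that in simp)+
    also have "\<sigma> * (m * ((m - 1) * x powr (m - 2)) * B x + m * x powr (m - 1) * (D x * (x / 2))
       + (2 * ((m - 1) * x powr (m - 2)) * (x\<^sup>2 / 4 * D x) + 2 * x powr (m - 1) * ((- \<nu> * D x - B x) * (x / 2))))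
       = ((\<nu>\<^sup>2 - 1 / 4) / x\<^sup>2 - 1) * v x"
    proof -
      have 1: "((\<nu>\<^sup>2 - 1 / 4) / x\<^sup>2 - 1) * (N * x * x) = (\<nu>\<^sup>2 - 1 / 4 - x * x) * N"
        using that by (simp add: field_simps power2_eq_square)
      have "((\<nu>\<^sup>2 - 1 / 4) / x\<^sup>2 - 1) * v x = \<sigma> * B x * (((\<nu>\<^sup>2 - 1 / 4) / x\<^sup>2 - 1) * (N * x * x))"
        by (simp add: v_def e)
      also have "\<dots> = \<sigma> * B x * ((m * (m - 1) - x * x) * N)"
        unfolding 1 by (simp add: m_def power2_eq_square algebra_simps)
      finally have 2: "((\<nu>\<^sup>2 - 1 / 4) / x\<^sup>2 - 1) * v x = \<sigma> * B x * ((m * (m - 1) - x * x) * N)" .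
      show ?thesis unfolding 2 e N_def[symmetric]
        by (simp add: m_def power2_eq_square field_simps)
    qed
    finally show ?thesis .
  qed
  define W where "W x = v1 x * sin ((x - a) / 2) - v x * (cos ((x - a) / 2) / 2)" for x
  have W': "(W has_real_derivative ((\<nu>\<^sup>2 - 1 / 4) / x\<^sup>2 - 3 / 4) * v x * sin ((x - a) / 2)) (at x)" if "x > 0" for x
    unfolding W_def
    by (rule derivative_eq_intros refl v[OF that] v1[OF that] | simp)+ (simp add: algebra_simps)
  have vpos: "v x > 0" if "x \<ge> a" for x
    using mult_pos_pos[OF _ sg[OF that], of "x powr m"] that a by (simp add: v_def mult.left_commute)
  have "W (a + 2 * pi) \<le> W a"
  proof (rule DERIV_nonpos_imp_nonincreasing[of a "a + 2 * pi" W])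
    fix x assume x: "a \<le> x" "x \<le> a + 2 * pi"
    have "v x \<ge> 0" using vpos[OF x(1)] by simp
    moreover have "sin ((x - a) / 2) \<ge> 0" using x by (intro sin_ge_zero) auto
    moreover have "(\<nu>\<^sup>2 - 1 / 4) / x\<^sup>2 - 3 / 4 \<le> 0"
    proof -
      have "2 * \<nu> \<le> x" using x a by auto
      then have "(2 * \<nu>)\<^sup>2 \<le> x\<^sup>2" using assms by (intro power_mono) auto
      moreover have "(2 * \<nu>)\<^sup>2 = 4 * \<nu>\<^sup>2" by simp
      ultimately have "\<nu>\<^sup>2 - 1 / 4 \<le> 3 / 4 * x\<^sup>2" using zero_le_power2[of x] by linarith
      moreover have "0 < x\<^sup>2" using x a by simp
      ultimately show ?thesis by (simp add: divide_le_eq)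
    qed
    ultimately show "\<exists>y. (W has_real_derivative y) (at x) \<and> y \<le> 0"
      using W'[of x] x a by (intro exI conjI) (auto intro!: mult_nonpos_nonneg)
  qed (use pi_gt_zero in simp)
  moreover have "W a < 0" using vpos[of a] unfolding W_def by simp
  moreover have "W (a + 2 * pi) > 0"
    using vpos[of "a + 2 * pi"] pi_gt_zero unfolding W_def by simp
  ultimately show False by simp
qed

lemma Bessel_J_eq:
  assumes "\<nu> \<ge> 0" "x > 0"
  shows "Bessel_J \<nu> x = rGamma (\<nu> + 1) * (x / 2) powr \<nu> * bessel_series \<nu> (x\<^sup>2 / 4)"
proof -
  have "(- 1) ^ k / fact k * rGamma (real k + \<nu> + 1) * (x / 2) powr (2 * real k + \<nu>)
      = rGamma (\<nu> + 1) * (x / 2) powr \<nu> * ((- 1) ^ k / (fact k * pochhammer (\<nu> + 1) k) * (x\<^sup>2 / 4) ^ k)" for k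
  proof -
    have p: "pochhammer (\<nu> + 1) k > 0" using assms by (intro pochhammer_pos) auto
    have "rGamma (\<nu> + 1) = pochhammer (\<nu> + 1) k * rGamma (\<nu> + 1 + real k)"
      by (rule pochhammer_rGamma)
    then have r: "rGamma (real k + \<nu> + 1) = rGamma (\<nu> + 1) / pochhammer (\<nu> + 1) k"
      using p by (simp add: add_ac)
    have "(x / 2) powr (2 * real k + \<nu>) = (x / 2) powr real (2 * k) * (x / 2) powr \<nu>"
      by (simp add: powr_add)
    also have "(x / 2) powr real (2 * k) = (x\<^sup>2 / 4) ^ k"
      using assms by (subst powr_realpow) (auto simp: power_mult power_divide)
    finally have q: "(x / 2) powr (2 * real k + \<nu>) = (x\<^sup>2 / 4) ^ k * (x / 2) powr \<nu>" .
    show ?thesis unfolding r q by simp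
  qed
  then show ?thesis
    unfolding Bessel_J_def bessel_series_def
    using suminf_mult[OF bessel_series_summable[OF assms(1)]] by simp
qed

lemma Bessel_J_zero_iff:
  assumes "\<nu> \<ge> 0" "x > 0"
  shows "Bessel_J \<nu> x = 0 \<longleftrightarrow> bessel_series \<nu> (x\<^sup>2 / 4) = 0"
proof -
  have "Gamma (\<nu> + 1) > 0" using assms by (intro Gamma_real_pos) auto
  then show ?thesis
    using assms Gamma_eq_zero_iff[of "\<nu> + 1"] by (auto simp: Bessel_J_eq rGamma_inverse_Gamma)
qed

lemma finite_Bessel_J_zeros:
  assumes "\<nu> \<ge> 0"
  shows "finite {y. 0 < y \<and> y \<le> x \<and> Bessel_J \<nu> y = 0}"
proof -
  have "inj_on (\<lambda>y::real. y\<^sup>2 / 4) {y. 0 < y \<and> y \<le> x \<and> Bessel_J \<nu> y = 0}"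
    by (auto simp: inj_on_def)
  moreover have "(\<lambda>y::real. y\<^sup>2 / 4) ` {y. 0 < y \<and> y \<le> x \<and> Bessel_J \<nu> y = 0}
      \<subseteq> {t. 0 \<le> t \<and> t \<le> x\<^sup>2 / 4 \<and> bessel_series \<nu> t = 0}"
    using assms by (auto simp: Bessel_J_zero_iff intro!: power_mono)
  ultimately show ?thesis
    using finite_bessel_series_zeros[OF assms] by (meson finite_imageD finite_subset)
qed

text \<open>Zeros are isolated and unbounded, so they can be counted from the left: each value of the
  counting function is attained, and at one zero only. This justifies the definite description.\<close>

lemma Bessel_zero:
  assumes "\<nu> \<ge> 0" "i \<ge> 1"
  shows "0 < Bessel_zero i \<nu>" "Bessel_J \<nu> (Bessel_zero i \<nu>) = 0"
    "card {y. 0 < y \<and> y \<le> Bessel_zero i \<nu> \<and> Bessel_J \<nu> y = 0} = i"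
proof -
  define Z where "Z x = {y. 0 < y \<and> y \<le> x \<and> Bessel_J \<nu> y = 0}" for x
  define P where "P i x \<longleftrightarrow> 0 < x \<and> Bessel_J \<nu> x = 0 \<and> card (Z x) = i" for i x
  have fin: "finite (Z x)" for x unfolding Z_def by (rule finite_Bessel_J_zeros[OF assms(1)])
  have succ: "\<exists>x. 0 < x \<and> Bessel_J \<nu> x = 0 \<and> card (Z x) = Suc (card (Z a))" if "a \<ge> 0" for a
  proof -
    obtain b where b: "b > a" "bessel_series \<nu> (b\<^sup>2 / 4) = 0"
      using bessel_series_zeros_unbounded[OF assms(1)] by blast
    define S where "S = Z b - Z a"
    have S: "finite S" "b \<in> S"
      using fin b that assms by (auto simp: S_def) (auto simp: Z_def Bessel_J_zero_iff)
    define x where "x = Min S"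
    have x: "x \<in> S" using S unfolding x_def by (intro Min_in) auto
    have "Z x = insert x (Z a)"
    proof (intro equalityI subsetI)
      fix y assume y: "y \<in> Z x"
      show "y \<in> insert x (Z a)"
      proof (rule ccontr)
        assume n: "y \<notin> insert x (Z a)"
        then have "y \<in> S" using y x by (auto simp: Z_def S_def)
        then have "x \<le> y" unfolding x_def using S by (intro Min_le) auto
        then show False using y n by (auto simp: Z_def)
      qed
    qed (use x in \<open>auto simp: Z_def S_def\<close>)
    moreover have "x \<notin> Z a" using x by (simp add: S_def)
    ultimately have "card (Z x) = Suc (card (Z a))" using fin by simp
    then show ?thesis using x by (auto simp: S_def Z_def)
  qed
  have "\<exists>x. P (Suc j) x" for j
  proof (induction j)
    case 0
    have "Z 0 = {}" by (auto simp: Z_def)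
    then show ?case using succ[of 0] by (auto simp: P_def)
  next
    case (Suc j)
    then obtain a where "P (Suc j) a" by blast
    then show ?case using succ[of a] by (auto simp: P_def)
  qed
  then obtain x where x: "P i x" using assms(2) by (metis Suc_le_D One_nat_def)
  have lt: "\<not> u < w" if "P i u" "P i w" for u w
  proof
    assume "u < w"
    have "w \<in> Z w" "w \<notin> Z u" "Z u \<subseteq> Z w"
      using that(2) \<open>u < w\<close> by (auto simp: P_def Z_def)
    then have "Z u \<subset> Z w" by blast
    then have "card (Z u) < card (Z w)" using fin by (intro psubset_card_mono)
    then show False using that by (simp add: P_def)
  qed
  have "\<exists>!x. P i x" using x lt by (metis less_linear)
  then have "P i (THE x. P i x)" by (rule theI')
  moreover have "Bessel_zero i \<nu> = (THE x. P i x)" by (simp add: Bessel_zero_def P_def Z_def)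
  ultimately show "0 < Bessel_zero i \<nu>" "Bessel_J \<nu> (Bessel_zero i \<nu>) = 0"
    "card {y. 0 < y \<and> y \<le> Bessel_zero i \<nu> \<and> Bessel_J \<nu> y = 0} = i"
    by (auto simp: P_def Z_def)
qed

lemma Bessel_zero_2:
  assumes "\<nu> \<ge> 0"
  obtains z where "0 < z" "z < Bessel_zero 2 \<nu>"
    "\<And>y. 0 < y \<Longrightarrow> y \<le> Bessel_zero 2 \<nu> \<Longrightarrow> bessel_series \<nu> (y\<^sup>2 / 4) = 0 \<longleftrightarrow> y = z \<or> y = Bessel_zero 2 \<nu>"
proof -
  define k where "k = Bessel_zero 2 \<nu>"
  define Z where "Z = {y. 0 < y \<and> y \<le> k \<and> Bessel_J \<nu> y = 0}"
  note b = Bessel_zero[OF assms, of 2, folded k_def]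
  have "card Z = 2" using b(3) by (simp add: Z_def)
  moreover have "k \<in> Z" using b by (simp add: Z_def)
  ultimately obtain z where z: "Z = {z, k}" "z \<noteq> k"
  proof -
    assume Z: "card Z = 2" "k \<in> Z" and goal: "\<And>z. Z = {z, k} \<Longrightarrow> z \<noteq> k \<Longrightarrow> thesis"
    from Z(1) obtain a b where ab: "Z = {a, b}" "a \<noteq> b" unfolding card_2_iff by auto
    show thesis
    proof (cases "k = a")
      case True
      then show ?thesis using goal[of b] ab by (simp add: insert_commute)
    next
      case False
      then have "k = b" using Z(2) ab by simp
      then show ?thesis using goal[of a] ab by simp
    qed
  qed
  have zz: "z \<in> Z" using z by simp
  show ?thesis
  proof (rule that[of z])
    show "0 < z" "z < Bessel_zero 2 \<nu>" using zz z(2) by (auto simp: Z_def k_def)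
    fix y assume "0 < y" "y \<le> Bessel_zero 2 \<nu>"
    then show "bessel_series \<nu> (y\<^sup>2 / 4) = 0 \<longleftrightarrow> y = z \<or> y = Bessel_zero 2 \<nu>"
      using z(1) Bessel_J_zero_iff[OF assms, of y] by (auto simp: Z_def k_def[symmetric] set_eq_iff)
  qed
qed

section \<open>Test functions\<close>

text \<open>The classical smooth function that is flat at the origin, for \<open>m = 0\<close>; its derivatives are linear
  combinations of the other members of the family.\<close>

definition flat :: "nat \<Rightarrow> real \<Rightarrow> real" where
  "flat m t = (if t > 0 then exp (- 1 / t) / t ^ m else 0)"

lemma flat_tendsto_0: "(flat m \<longlongrightarrow> 0) (at_right 0)"
proof -
  have "((\<lambda>x::real. x ^ m / exp x) \<longlongrightarrow> 0) at_top"
    by (rule tendsto_power_div_exp_0)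
  then have "((\<lambda>t::real. inverse t ^ m / exp (inverse t)) \<longlongrightarrow> 0) (at_right 0)"
    by (rule filterlim_compose) (rule filterlim_inverse_at_top_right)
  then show ?thesis
    by (rule Lim_transform_eventually)
       (auto simp: flat_def eventually_at_filter exp_minus field_simps)
qed

lemma flat_deriv:
  "(flat m has_real_derivative flat (m + 2) t - real m * flat (m + 1) t) (at t)"
proof -
  consider "t > 0" | "t < 0" | "t = 0" by linarith
  then show ?thesis
  proof cases
    case 1
    have "((\<lambda>t. exp (- 1 / t) / t ^ m) has_real_derivative flat (m + 2) t - real m * flat (m + 1) t) (at t)"
      using 1 by (auto intro!: derivative_eq_intros simp: flat_def field_simps power2_eq_square)
        (cases m; simp add: field_simps)
    then show ?thesis
      by (rule has_field_derivative_transform_within_open[where S = "{0<..}"])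
         (use 1 in \<open>auto simp: flat_def\<close>)
  next
    case 2
    have "((\<lambda>t. 0) has_real_derivative 0) (at t)" by simp
    then have "(flat m has_real_derivative 0) (at t)"
      by (rule has_field_derivative_transform_within_open[where S = "{..<0}"])
         (use 2 in \<open>auto simp: flat_def\<close>)
    then show ?thesis using 2 by (simp add: flat_def)
  next
    case 3
    have "((\<lambda>y. (flat m y - flat m 0) / (y - 0)) \<longlongrightarrow> 0) (at 0)"
    proof (rule filterlim_split_at_real)
      show "((\<lambda>y. (flat m y - flat m 0) / (y - 0)) \<longlongrightarrow> 0) (at_left 0)"
        by (rule tendsto_eventually) (auto simp: eventually_at_filter flat_def)
      show "((\<lambda>y. (flat m y - flat m 0) / (y - 0)) \<longlongrightarrow> 0) (at_right 0)"
        by (rule Lim_transform_eventually[OF flat_tendsto_0[of "m + 1"]])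
           (auto simp: eventually_at_filter flat_def)
    qed
    then show ?thesis using 3 by (simp add: has_field_derivative_iff flat_def)
  qed
qed

definition partial_deriv :: "(real^'n \<Rightarrow> real) \<Rightarrow> 'n \<Rightarrow> real^'n \<Rightarrow> real" where
  "partial_deriv f i x = frechet_derivative f (at x) (axis i 1)"

text \<open>A class of functions that is closed under partial derivatives, since each generating operation is.
  Membership thus yields derivatives of all orders at once.\<close>

inductive smooth :: "(real^'n \<Rightarrow> real) \<Rightarrow> bool" where
  const: "smooth (\<lambda>x. c)"
| coord: "smooth (\<lambda>x. x $ i)"
| add: "smooth f \<Longrightarrow> smooth g \<Longrightarrow> smooth (\<lambda>x. f x + g x)"
| mult: "smooth f \<Longrightarrow> smooth g \<Longrightarrow> smooth (\<lambda>x. f x * g x)"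
| flat: "smooth f \<Longrightarrow> smooth (\<lambda>x. flat m (f x))"
| powr: "smooth f \<Longrightarrow> (\<And>x. f x > 0) \<Longrightarrow> smooth (\<lambda>x. f x powr a)"
| bessel: "smooth f \<Longrightarrow> \<nu> \<ge> 0 \<Longrightarrow> smooth (\<lambda>x. bessel_series \<nu> (f x))"

lemma sum_delta_coord:
  fixes h :: "real^'n"
  shows "(\<Sum>i\<in>UNIV. (if i = j then 1 else 0) * h $ i) = h $ j"
proof -
  have "(\<Sum>i\<in>UNIV. (if i = j then 1 else 0) * h $ i) = (\<Sum>i\<in>UNIV. if i = j then h $ j else 0)"
    by (intro sum.cong) auto
  then show ?thesis by simp
qed

lemma smooth_has_partials:
  assumes "smooth f"
  shows "\<exists>D. (\<forall>i. smooth (D i)) \<and> (\<forall>x. (f has_derivative (\<lambda>h. \<Sum>i\<in>UNIV. D i x * h $ i)) (at x))"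
  using assms
proof induction
  case (const c)
  show ?case by (rule exI[of _ "\<lambda>i x. 0"]) (auto intro: smooth.const)
next
  case (coord j)
  show ?case
  proof (rule exI[of _ "\<lambda>i x. if i = j then 1 else 0"], intro conjI allI)
    fix x :: "real^'a"
    show "((\<lambda>x. x $ j) has_derivative (\<lambda>h. \<Sum>i\<in>UNIV. (if i = j then 1 else 0) * h $ i)) (at x)"
      unfolding sum_delta_coord by (rule bounded_linear_imp_has_derivative[OF bounded_linear_vec_nth])
  qed (auto intro: smooth.const)
next
  case (add f g)
  then obtain D E where D: "\<And>i. smooth (D i)" "\<And>i. smooth (E i)"
    "\<And>x. (f has_derivative (\<lambda>h. \<Sum>i\<in>UNIV. D i x * h $ i)) (at x)"
    "\<And>x. (g has_derivative (\<lambda>h. \<Sum>i\<in>UNIV. E i x * h $ i)) (at x)" by blast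
  show ?case
  proof (rule exI[of _ "\<lambda>i x. D i x + E i x"], intro conjI allI)
    fix x
    show "((\<lambda>x. f x + g x) has_derivative (\<lambda>h. \<Sum>i\<in>UNIV. (D i x + E i x) * h $ i)) (at x)"
      using has_derivative_add[OF D(3,4)] by (simp add: algebra_simps sum.distrib)
  qed (auto intro: smooth.add D)
next
  case (mult f g)
  then obtain D E where D: "\<And>i. smooth (D i)" "\<And>i. smooth (E i)"
    "\<And>x. (f has_derivative (\<lambda>h. \<Sum>i\<in>UNIV. D i x * h $ i)) (at x)"
    "\<And>x. (g has_derivative (\<lambda>h. \<Sum>i\<in>UNIV. E i x * h $ i)) (at x)" by blast
  have s: "smooth (\<lambda>x. f x * E i x + D i x * g x)" for i
    by (intro smooth.intros mult.hyps D)
  show ?case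
  proof (rule exI[of _ "\<lambda>i x. f x * E i x + D i x * g x"], intro conjI allI)
    fix x
    show "((\<lambda>x. f x * g x) has_derivative (\<lambda>h. \<Sum>i\<in>UNIV. (f x * E i x + D i x * g x) * h $ i)) (at x)"
      using has_derivative_mult[OF D(3,4), of x]
      by (simp add: algebra_simps sum.distrib sum_distrib_left sum_distrib_right)
  qed (rule s)
next
  case (flat f m)
  then obtain D where D: "\<And>i. smooth (D i)"
    "\<And>x. (f has_derivative (\<lambda>h. \<Sum>i\<in>UNIV. D i x * h $ i)) (at x)" by blast
  have s: "smooth (\<lambda>x. (flat (m + 2) (f x) + (- real m) * flat (m + 1) (f x)) * D i x)" for i
    by (intro smooth.intros flat.hyps D)
  show ?case
  proof (rule exI[of _ "\<lambda>i x. (flat (m + 2) (f x) + (- real m) * flat (m + 1) (f x)) * D i x"], intro conjI allI)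
    fix x
    show "((\<lambda>x. flat m (f x)) has_derivative (\<lambda>h. \<Sum>i\<in>UNIV. (flat (m + 2) (f x) + (- real m) * flat (m + 1) (f x)) * D i x * h $ i)) (at x)"
      using has_derivative_compose[OF D(2) flat_deriv[of m "f x", unfolded has_field_derivative_def]]
      by (simp add: sum_distrib_left mult.assoc)
  qed (rule s)
next
  case (powr f a)
  then obtain D where D: "\<And>i. smooth (D i)"
    "\<And>x. (f has_derivative (\<lambda>h. \<Sum>i\<in>UNIV. D i x * h $ i)) (at x)" by blast
  have s: "smooth (\<lambda>x. a * f x powr (a - 1) * D i x)" for i
    by (intro smooth.intros powr.hyps D)
  show ?case
  proof (rule exI[of _ "\<lambda>i x. a * f x powr (a - 1) * D i x"], intro conjI allI)
    fix x
    have "((\<lambda>t. t powr a) has_real_derivative a * f x powr (a - 1)) (at (f x))"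
      using powr.hyps(2)[of x] by (rule has_real_derivative_powr)
    from has_derivative_compose[OF D(2) this[unfolded has_field_derivative_def]]
    show "((\<lambda>x. f x powr a) has_derivative (\<lambda>h. \<Sum>i\<in>UNIV. a * f x powr (a - 1) * D i x * h $ i)) (at x)"
      by (simp add: sum_distrib_left mult.assoc)
  qed (rule s)
next
  case (bessel f \<nu>)
  then obtain D where D: "\<And>i. smooth (D i)"
    "\<And>x. (f has_derivative (\<lambda>h. \<Sum>i\<in>UNIV. D i x * h $ i)) (at x)" by blast
  have s: "smooth (\<lambda>x. (- 1 / (\<nu> + 1)) * bessel_series (\<nu> + 1) (f x) * D i x)" for i
    by (intro smooth.intros bessel.hyps D) (use bessel.hyps in auto)
  show ?case
  proof (rule exI[of _ "\<lambda>i x. (- 1 / (\<nu> + 1)) * bessel_series (\<nu> + 1) (f x) * D i x"], intro conjI allI)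
    fix x
    show "((\<lambda>x. bessel_series \<nu> (f x)) has_derivative (\<lambda>h. \<Sum>i\<in>UNIV. (- 1 / (\<nu> + 1)) * bessel_series (\<nu> + 1) (f x) * D i x * h $ i)) (at x)"
      using has_derivative_compose[OF D(2) bessel_series_deriv[OF bessel.hyps(2), of "f x", unfolded has_field_derivative_def]]
      by (simp add: sum_distrib_left mult.assoc sum_negf)
  qed (rule s)
qed

lemma linear_axis_expand:
  fixes f :: "real^'n \<Rightarrow> real"
  assumes "linear f"
  shows "f h = (\<Sum>i\<in>UNIV. f (axis i 1) * h $ i)"
proof -
  have "f h = f (\<Sum>i\<in>UNIV. h $ i *\<^sub>R axis i 1)"
    by (subst basis_expansion[symmetric, of h]) (simp add: scalar_mult_eq_scaleR)
  also have "\<dots> = (\<Sum>i\<in>UNIV. f (axis i 1) * h $ i)"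
    by (simp add: linear_sum[OF assms] linear_cmul[OF assms] mult.commute)
  finally show ?thesis .
qed

lemma has_derivative_partials:
  assumes "f differentiable (at x)"
  shows "(f has_derivative (\<lambda>h. \<Sum>i\<in>UNIV. partial_deriv f i x * h $ i)) (at x)"
proof -
  have "(f has_derivative frechet_derivative f (at x)) (at x)"
    using assms frechet_derivative_works by blast
  moreover have "frechet_derivative f (at x) = (\<lambda>h. \<Sum>i\<in>UNIV. partial_deriv f i x * h $ i)"
    unfolding partial_deriv_def
    by (rule ext, rule linear_axis_expand, rule linear_frechet_derivative[OF assms])
  ultimately show ?thesis by simp
qed

lemma partial_deriv_eq:
  assumes "(f has_derivative (\<lambda>h. \<Sum>i\<in>UNIV. D i * h $ i)) (at x)"
  shows "partial_deriv f i x = D i"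
proof -
  have "frechet_derivative f (at x) = (\<lambda>h. \<Sum>i\<in>UNIV. D i * h $ i)"
    using frechet_derivative_at[OF assms] by simp
  then have "partial_deriv f i x = (\<Sum>j\<in>UNIV. D j * axis i 1 $ j)"
    unfolding partial_deriv_def by simp
  also have "\<dots> = (\<Sum>j\<in>UNIV. if j = i then D i else 0)"
    by (intro sum.cong) (auto simp: axis_def)
  finally show ?thesis by simp
qed

lemma smooth_differentiable: "smooth f \<Longrightarrow> f differentiable (at x)"
  using smooth_has_partials[of f] by (auto simp: differentiable_def)

lemma smooth_partial_deriv:
  assumes "smooth f"
  shows "smooth (partial_deriv f i)"
proof -
  obtain D where D: "\<And>i. smooth (D i)"
    "\<And>x. (f has_derivative (\<lambda>h. \<Sum>i\<in>UNIV. D i x * h $ i)) (at x)"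
    using smooth_has_partials[OF assms] by blast
  have "partial_deriv f i = D i" using partial_deriv_eq[OF D(2)] by blast
  then show ?thesis using D(1) by simp
qed

lemma smooth_k_times_cont_diff: "smooth f \<Longrightarrow> k_times_cont_diff k f"
proof (induction k arbitrary: f)
  case 0
  then show ?case
    by (auto intro!: differentiable_imp_continuous_on simp: differentiable_on_def smooth_differentiable)
next
  case (Suc k)
  have "(\<lambda>x. frechet_derivative f (at x) (axis i 1)) = partial_deriv f i" for i
    by (simp add: partial_deriv_def[abs_def])
  then show ?case
    using Suc.IH[OF smooth_partial_deriv[OF Suc.prems]] smooth_differentiable[OF Suc.prems] by simp
qed

lemma smooth_test_function:
  assumes "smooth f" "compact K" "K \<subseteq> \<Omega>" "\<And>x. x \<notin> K \<Longrightarrow> f x = 0"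
  shows "test_function \<Omega> f"
proof -
  have "{x. f x \<noteq> 0} \<subseteq> K" using assms(4) by auto
  then have "closure {x. f x \<noteq> 0} \<subseteq> K"
    using assms(2) by (simp add: closure_minimal compact_imp_closed)
  moreover from this have "compact (closure {x. f x \<noteq> 0})"
    using assms(2) by (metis closed_closure compact_Int_closed inf.absorb_iff2)
  ultimately show ?thesis
    using assms(3) smooth_k_times_cont_diff[OF assms(1)] unfolding test_function_def by auto
qed

lemma smooth_uminus: "smooth f \<Longrightarrow> smooth (\<lambda>x. - f x)"
  using smooth.mult[OF smooth.const[of "-1"]] by simp

lemma smooth_diff: "smooth f \<Longrightarrow> smooth g \<Longrightarrow> smooth (\<lambda>x. f x - g x)"
  using smooth.add[OF _ smooth_uminus] by simp

lemma smooth_sum: "(\<And>i. i \<in> A \<Longrightarrow> smooth (f i)) \<Longrightarrow> smooth (\<lambda>x. \<Sum>i\<in>A. f i x)"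
  by (induction A rule: infinite_finite_induct) (auto intro: smooth.intros)

lemma smooth_prod: "(\<And>i. i \<in> A \<Longrightarrow> smooth (f i)) \<Longrightarrow> smooth (\<lambda>x. \<Prod>i\<in>A. f i x)"
  by (induction A rule: infinite_finite_induct) (auto intro: smooth.intros)

lemma smooth_norm_squared: "smooth (\<lambda>x::real^'n. (norm x)\<^sup>2)"
proof -
  have "(norm x)\<^sup>2 = (\<Sum>i\<in>UNIV. x $ i * x $ i)" for x :: "real^'n"
    by (simp add: norm_eq_sqrt_inner inner_vec_def sum_nonneg)
  then show ?thesis by (auto intro!: smooth_sum smooth.intros)
qed

lemma test_function_differentiable: "test_function \<Omega> \<phi> \<Longrightarrow> \<phi> differentiable (at x)"
  using k_times_cont_diff.simps(2)[of 0 \<phi>] unfolding test_function_def by simp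

lemma k_times_cont_diff_continuous: "k_times_cont_diff k f \<Longrightarrow> continuous_on UNIV f"
  by (cases k) (auto intro!: differentiable_imp_continuous_on simp: differentiable_on_def)

lemma test_function_continuous: "test_function \<Omega> \<phi> \<Longrightarrow> continuous_on UNIV \<phi>"
  using k_times_cont_diff_continuous[of 0 \<phi>] unfolding test_function_def by simp

lemma test_function_partial_continuous:
  assumes "test_function \<Omega> \<phi>"
  shows "continuous_on UNIV (partial_deriv \<phi> i)"
proof -
  have "k_times_cont_diff (Suc 0) \<phi>" using assms unfolding test_function_def by simp
  then show ?thesis by (simp add: partial_deriv_def[abs_def])
qed

lemma test_function_zero:
  assumes "test_function \<Omega> \<phi>" "x \<notin> \<Omega>"
  shows "\<phi> x = 0"
proof (rule ccontr)
  assume "\<phi> x \<noteq> 0"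
  then have "x \<in> closure {x. \<phi> x \<noteq> 0}" by (intro subsetD[OF closure_subset]) simp
  then show False using assms unfolding test_function_def by auto
qed

lemma test_function_partial_zero:
  assumes "test_function \<Omega> \<phi>" "x \<notin> \<Omega>"
  shows "partial_deriv \<phi> i x = 0"
proof -
  let ?S = "- closure {x. \<phi> x \<noteq> 0}"
  have "x \<in> ?S" using assms unfolding test_function_def by auto
  moreover have "open ?S" by (simp add: open_Compl)
  moreover have "((\<lambda>x. 0) has_derivative (\<lambda>h. 0)) (at x)" by simp
  ultimately have "(\<phi> has_derivative (\<lambda>h. 0)) (at x)"
    using closure_subset[of "{x. \<phi> x \<noteq> 0}"]
    by (intro has_derivative_transform_within_open[of "\<lambda>x. 0" "\<lambda>h. 0" x UNIV ?S \<phi>]) auto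
  then have "(\<phi> has_derivative (\<lambda>h. \<Sum>i\<in>UNIV. 0 * h $ i)) (at x)" by simp
  from partial_deriv_eq[OF this] show ?thesis by simp
qed

section \<open>Square integrable functions\<close>

definition L2 :: "'a measure \<Rightarrow> ('a \<Rightarrow> real) \<Rightarrow> bool" where
  "L2 M f \<longleftrightarrow> f \<in> borel_measurable M \<and> integrable M (\<lambda>x. (f x)\<^sup>2)"

lemma L2_measurable [dest, measurable_dest]: "L2 M f \<Longrightarrow> f \<in> borel_measurable M"
  by (simp add: L2_def)

lemma L2_mult:
  assumes "L2 M f" "L2 M g"
  shows "integrable M (\<lambda>x. f x * g x)"
proof (rule Bochner_Integration.integrable_bound)
  show "integrable M (\<lambda>x. (f x)\<^sup>2 + (g x)\<^sup>2)" using assms by (auto simp: L2_def)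
  show "(\<lambda>x. f x * g x) \<in> borel_measurable M" using assms by (auto simp: L2_def)
  show "AE x in M. norm (f x * g x) \<le> norm ((f x)\<^sup>2 + (g x)\<^sup>2)"
  proof (rule AE_I2)
    fix x
    have "2 * \<bar>f x\<bar> * \<bar>g x\<bar> \<le> \<bar>f x\<bar>\<^sup>2 + \<bar>g x\<bar>\<^sup>2" by (rule sum_squares_bound)
    moreover have "0 \<le> \<bar>f x\<bar> * \<bar>g x\<bar>" by simp
    ultimately have "\<bar>f x * g x\<bar> \<le> (f x)\<^sup>2 + (g x)\<^sup>2"
      unfolding abs_mult power2_abs by linarith
    then show "norm (f x * g x) \<le> norm ((f x)\<^sup>2 + (g x)\<^sup>2)" by simp
  qed
qed

lemma L2_bound:
  assumes "L2 M f" "g \<in> borel_measurable M" "\<And>x. x \<in> space M \<Longrightarrow> \<bar>g x\<bar> \<le> c * \<bar>f x\<bar>"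
  shows "L2 M g"
  unfolding L2_def
proof
  show "integrable M (\<lambda>x. (g x)\<^sup>2)"
  proof (rule Bochner_Integration.integrable_bound)
    show "integrable M (\<lambda>x. c\<^sup>2 * (f x)\<^sup>2)" using assms by (auto simp: L2_def)
    show "AE x in M. norm ((g x)\<^sup>2) \<le> norm (c\<^sup>2 * (f x)\<^sup>2)"
    proof (rule AE_I2)
      fix x assume "x \<in> space M"
      then have "\<bar>g x\<bar>\<^sup>2 \<le> (c * \<bar>f x\<bar>)\<^sup>2" using assms(3) by (intro power_mono) auto
      then show "norm ((g x)\<^sup>2) \<le> norm (c\<^sup>2 * (f x)\<^sup>2)" by (simp add: power_mult_distrib)
    qed
  qed (use assms in measurable)
qed (use assms in simp)

lemma L2_cmult: "L2 M f \<Longrightarrow> L2 M (\<lambda>x. c * f x)"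
  by (rule L2_bound[of M f _ "\<bar>c\<bar>"]) (auto simp: abs_mult)

lemma L2_add:
  assumes "L2 M f" "L2 M g"
  shows "L2 M (\<lambda>x. f x + g x)"
  unfolding L2_def
proof
  have "integrable M (\<lambda>x. (f x)\<^sup>2 + 2 * (f x * g x) + (g x)\<^sup>2)"
    using assms L2_mult[OF assms] by (intro Bochner_Integration.integrable_add) (auto simp: L2_def)
  then show "integrable M (\<lambda>x. (f x + g x)\<^sup>2)"
    by (simp add: power2_sum algebra_simps)
qed (use assms in \<open>auto simp: L2_def\<close>)

lemma L2_diff: "L2 M f \<Longrightarrow> L2 M g \<Longrightarrow> L2 M (\<lambda>x. f x - g x)"
  using L2_add[OF _ L2_cmult[of M g "-1"]] by simp

lemma L2_Cauchy_Schwarz: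
  assumes "L2 M f" "L2 M g"
  shows "(\<integral>x. \<bar>f x * g x\<bar> \<partial>M)\<^sup>2 \<le> (\<integral>x. (f x)\<^sup>2 \<partial>M) * (\<integral>x. (g x)\<^sup>2 \<partial>M)"
proof -
  have [measurable]: "f \<in> borel_measurable M" "g \<in> borel_measurable M" using assms by auto
  have "(\<integral>\<^sup>+x. ennreal \<bar>f x\<bar> * ennreal \<bar>g x\<bar> \<partial>M)\<^sup>2
      \<le> (\<integral>\<^sup>+x. ennreal \<bar>f x\<bar> ^ 2 \<partial>M) * (\<integral>\<^sup>+x. ennreal \<bar>g x\<bar> ^ 2 \<partial>M)"
    by (rule Cauchy_Schwarz_nn_integral) measurable
  also have "(\<integral>\<^sup>+x. ennreal \<bar>f x\<bar> ^ 2 \<partial>M) = ennreal (\<integral>x. (f x)\<^sup>2 \<partial>M)"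
    using assms by (subst nn_integral_eq_integral[symmetric]) (auto simp: L2_def ennreal_power)
  also have "(\<integral>\<^sup>+x. ennreal \<bar>g x\<bar> ^ 2 \<partial>M) = ennreal (\<integral>x. (g x)\<^sup>2 \<partial>M)"
    using assms by (subst nn_integral_eq_integral[symmetric]) (auto simp: L2_def ennreal_power)
  also have "(\<integral>\<^sup>+x. ennreal \<bar>f x\<bar> * ennreal \<bar>g x\<bar> \<partial>M) = ennreal (\<integral>x. \<bar>f x * g x\<bar> \<partial>M)"
    using integrable_abs[OF L2_mult[OF assms]]
    by (subst nn_integral_eq_integral[symmetric]) (auto simp: ennreal_mult abs_mult)
  finally show ?thesis
    by (simp add: ennreal_power ennreal_mult[symmetric])
qed

lemma L2_null_mult:
  assumes "\<And>k. L2 M (f k)" "L2 M g" "(\<lambda>k. \<integral>x. (f k x)\<^sup>2 \<partial>M) \<longlonglongrightarrow> 0"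
  shows "(\<lambda>k. \<integral>x. \<bar>f k x * g x\<bar> \<partial>M) \<longlonglongrightarrow> 0"
proof -
  have "(\<lambda>k. (\<integral>x. (f k x)\<^sup>2 \<partial>M) * (\<integral>x. (g x)\<^sup>2 \<partial>M)) \<longlonglongrightarrow> 0 * (\<integral>x. (g x)\<^sup>2 \<partial>M)"
    by (intro tendsto_intros assms)
  then have lim: "(\<lambda>k. (\<integral>x. (f k x)\<^sup>2 \<partial>M) * (\<integral>x. (g x)\<^sup>2 \<partial>M)) \<longlonglongrightarrow> 0" by simp
  have "(\<lambda>k. (\<integral>x. \<bar>f k x * g x\<bar> \<partial>M)\<^sup>2) \<longlonglongrightarrow> 0"
  proof (rule Lim_null_comparison[OF _ lim], intro always_eventually allI)
    fix k
    show "norm ((\<integral>x. \<bar>f k x * g x\<bar> \<partial>M)\<^sup>2) \<le> (\<integral>x. (f k x)\<^sup>2 \<partial>M) * (\<integral>x. (g x)\<^sup>2 \<partial>M)"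
      using L2_Cauchy_Schwarz[OF assms(1)[of k] assms(2)] by simp
  qed
  then have "(\<lambda>k. sqrt ((\<integral>x. \<bar>f k x * g x\<bar> \<partial>M)\<^sup>2)) \<longlonglongrightarrow> sqrt 0"
    by (rule tendsto_real_sqrt)
  then show ?thesis by simp
qed

lemma tendsto_integral_null_diff:
  assumes "\<And>k. integrable M (f k)" "integrable M g" "(\<lambda>k. \<integral>x. \<bar>f k x - g x\<bar> \<partial>M) \<longlonglongrightarrow> 0"
  shows "(\<lambda>k. \<integral>x. f k x \<partial>M) \<longlonglongrightarrow> (\<integral>x. g x \<partial>M :: real)"
proof (rule LIM_zero_cancel, rule Lim_null_comparison[OF _ assms(3)], intro always_eventually allI)
  fix k
  have "(\<integral>x. f k x \<partial>M) - (\<integral>x. g x \<partial>M) = (\<integral>x. f k x - g x \<partial>M)" using assms by simp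
  then show "norm ((\<integral>x. f k x \<partial>M) - (\<integral>x. g x \<partial>M)) \<le> (\<integral>x. \<bar>f k x - g x\<bar> \<partial>M)"
    using integral_abs_bound[of M "\<lambda>x. f k x - g x"] by simp
qed

lemma L2_inner_tendsto:
  assumes "\<And>k. L2 M (f k)" "L2 M f'" "L2 M g" "(\<lambda>k. \<integral>x. (f k x - f' x)\<^sup>2 \<partial>M) \<longlonglongrightarrow> 0"
  shows "(\<lambda>k. \<integral>x. f k x * g x \<partial>M) \<longlonglongrightarrow> (\<integral>x. f' x * g x \<partial>M)"
proof (rule tendsto_integral_null_diff)
  have "(\<lambda>k. \<integral>x. \<bar>(f k x - f' x) * g x\<bar> \<partial>M) \<longlonglongrightarrow> 0"
    by (rule L2_null_mult) (auto intro: L2_diff assms)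
  then show "(\<lambda>k. \<integral>x. \<bar>f k x * g x - f' x * g x\<bar> \<partial>M) \<longlonglongrightarrow> 0"
    by (simp add: algebra_simps)
qed (auto intro: L2_mult assms)

text \<open>Convergence in \<open>L\<^sup>2\<close> implies that the squares converge in \<open>L\<^sup>1\<close>, from
  \<open>f\<^sup>2 - h\<^sup>2 = (f - h)\<^sup>2 + 2 (f - h) h\<close> and the Cauchy-Schwarz inequality.\<close>

lemma L2_square_tendsto:
  assumes "\<And>k. L2 M (f k)" "L2 M f'" "(\<lambda>k. \<integral>x. (f k x - f' x)\<^sup>2 \<partial>M) \<longlonglongrightarrow> 0"
  shows "(\<lambda>k. \<integral>x. \<bar>(f k x)\<^sup>2 - (f' x)\<^sup>2\<bar> \<partial>M) \<longlonglongrightarrow> 0"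
proof -
  have d: "L2 M (\<lambda>x. f k x - f' x)" for k by (intro L2_diff assms)
  have "(\<lambda>k. \<integral>x. \<bar>(f k x - f' x) * f' x\<bar> \<partial>M) \<longlonglongrightarrow> 0"
    by (rule L2_null_mult[OF d assms(2,3)])
  then have "(\<lambda>k. (\<integral>x. (f k x - f' x)\<^sup>2 \<partial>M) + 2 * (\<integral>x. \<bar>(f k x - f' x) * f' x\<bar> \<partial>M)) \<longlonglongrightarrow> 0 + 2 * 0"
    by (intro tendsto_intros assms)
  then have lim: "(\<lambda>k. (\<integral>x. (f k x - f' x)\<^sup>2 \<partial>M) + 2 * (\<integral>x. \<bar>(f k x - f' x) * f' x\<bar> \<partial>M)) \<longlonglongrightarrow> 0"
    by simp
  show ?thesis
  proof (rule Lim_null_comparison[OF _ lim], intro always_eventually allI)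
    fix k
    have "(\<integral>x. \<bar>(f k x)\<^sup>2 - (f' x)\<^sup>2\<bar> \<partial>M) \<le> (\<integral>x. (f k x - f' x)\<^sup>2 + 2 * \<bar>(f k x - f' x) * f' x\<bar> \<partial>M)"
    proof (rule integral_mono)
      show "integrable M (\<lambda>x. \<bar>(f k x)\<^sup>2 - (f' x)\<^sup>2\<bar>)" using assms by (auto simp: L2_def)
      show "integrable M (\<lambda>x. (f k x - f' x)\<^sup>2 + 2 * \<bar>(f k x - f' x) * f' x\<bar>)"
        using d[of k] L2_mult[OF d assms(2)]
        by (intro Bochner_Integration.integrable_add integrable_mult_right integrable_abs) (auto simp: L2_def)
      fix x
      have "(f k x)\<^sup>2 - (f' x)\<^sup>2 = (f k x - f' x)\<^sup>2 + 2 * ((f k x - f' x) * f' x)"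
        by (simp add: power2_eq_square algebra_simps)
      then show "\<bar>(f k x)\<^sup>2 - (f' x)\<^sup>2\<bar> \<le> (f k x - f' x)\<^sup>2 + 2 * \<bar>(f k x - f' x) * f' x\<bar>"
        using abs_triangle_ineq[of "(f k x - f' x)\<^sup>2" "2 * ((f k x - f' x) * f' x)"] by (simp add: abs_mult)
    qed
    also have "\<dots> = (\<integral>x. (f k x - f' x)\<^sup>2 \<partial>M) + 2 * (\<integral>x. \<bar>(f k x - f' x) * f' x\<bar> \<partial>M)"
      using d[of k] L2_mult[OF d assms(2), of k] by (subst Bochner_Integration.integral_add) (auto simp: L2_def)
    finally show "norm (\<integral>x. \<bar>(f k x)\<^sup>2 - (f' x)\<^sup>2\<bar> \<partial>M) \<le> \<dots>" by simp
  qed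
qed

section \<open>Integration over the disc\<close>

abbreviation disc_measure :: "(real^2) measure" where
  "disc_measure \<equiv> lebesgue_on disc"

lemma finite_disc_measure: "finite_measure disc_measure"
  by (rule finite_measure_lebesgue_on) simp

interpretation disc: finite_measure disc_measure
  by (rule finite_disc_measure)

lemma borel_measurable_disc [measurable (raw)]:
  fixes f :: "real^2 \<Rightarrow> 'b::topological_space"
  assumes "f \<in> borel_measurable borel" shows "f \<in> borel_measurable disc_measure"
  using assms by (intro measurable_restrict_space1 measurable_completion) simp

lemma integral_disc:
  fixes f :: "real^2 \<Rightarrow> real"
  assumes "f \<in> borel_measurable borel"
  shows "integral\<^sup>L disc_measure f = (\<integral>x. indicator disc x * f x \<partial>lborel)"
proof -
  have [measurable]: "f \<in> borel_measurable borel" "disc \<in> sets borel" using assms by simp_all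
  have "(\<lambda>x. indicator disc x *\<^sub>R f x) \<in> borel_measurable lborel"
    unfolding measurable_lborel1 by measurable
  then show ?thesis
    by (subst integral_restrict_space) (auto simp: integral_completion)
qed

lemma integrable_disc:
  fixes f :: "real^2 \<Rightarrow> real"
  assumes "f \<in> borel_measurable borel"
  shows "integrable disc_measure f \<longleftrightarrow> integrable lborel (\<lambda>x. indicator disc x * f x)"
proof -
  have [measurable]: "f \<in> borel_measurable borel" "disc \<in> sets borel" using assms by simp_all
  have "(\<lambda>x. indicator disc x *\<^sub>R f x) \<in> borel_measurable lborel"
    unfolding measurable_lborel1 by measurable
  then show ?thesis
    by (subst integrable_restrict_space) (auto simp: integrable_completion)
qed

lemma L2_integrable_disc: "L2 disc_measure f \<Longrightarrow> integrable disc_measure f"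
  using L2_mult[of disc_measure f "\<lambda>x. 1"] by (simp add: L2_def)

lemma continuous_bounded_disc:
  fixes f :: "real^2 \<Rightarrow> real"
  assumes "continuous_on UNIV f"
  obtains K where "K > 0" "\<And>x. x \<in> disc \<Longrightarrow> \<bar>f x\<bar> \<le> K"
proof -
  have "compact (f ` cball 0 1)"
    using assms by (intro compact_continuous_image) (auto intro: continuous_on_subset)
  then obtain K where "K > 0" "\<forall>y\<in>f ` cball 0 1. norm y \<le> K"
    using compact_imp_bounded bounded_pos by blast
  then show ?thesis using that[of K] by auto
qed

lemma bounded_L2_disc:
  assumes [measurable]: "f \<in> borel_measurable disc_measure" and K: "\<And>x. x \<in> disc \<Longrightarrow> \<bar>f x\<bar> \<le> K"
  shows "L2 disc_measure f"
  unfolding L2_def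
proof
  show "integrable disc_measure (\<lambda>x. (f x)\<^sup>2)"
  proof (rule disc.integrable_const_bound[where B = "K\<^sup>2"])
    show "AE x in disc_measure. norm ((f x)\<^sup>2) \<le> K\<^sup>2"
    proof (rule AE_I2)
      fix x assume "x \<in> space disc_measure"
      then have "\<bar>f x\<bar> \<le> K" using K by simp
      then show "norm ((f x)\<^sup>2) \<le> K\<^sup>2"
        using power_mono[of "\<bar>f x\<bar>" K 2] by simp
    qed
  qed measurable
qed simp

lemma continuous_L2_disc:
  assumes "continuous_on UNIV f"
  shows "L2 disc_measure f"
proof -
  obtain K where "\<And>x. x \<in> disc \<Longrightarrow> \<bar>f x\<bar> \<le> K" using continuous_bounded_disc[OF assms] by blast
  moreover have "f \<in> borel_measurable disc_measure"
    by (intro borel_measurable_disc borel_measurable_continuous_onI assms)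
  ultimately show ?thesis by (intro bounded_L2_disc) auto
qed

lemma square_integrable_real: "f square_integrable_on \<Omega> \<longleftrightarrow> L2 (lebesgue_on \<Omega>) f" for f :: "real^'n \<Rightarrow> real"
  by (simp add: square_integrable_on_def L2_def)

lemma norm_squared_2: "(norm (x::real^2))\<^sup>2 = (x $ 1)\<^sup>2 + (x $ 2)\<^sup>2"
  by (simp add: norm_eq_sqrt_inner inner_vec_def sum_2 power2_eq_square)

lemma Basis_real_2: "(Basis :: (real^2) set) = {axis 1 1, axis 2 1}"
  by (auto simp: Basis_vec_def UNIV_2)

lemma measurable_vec2:
  fixes g :: "'a \<Rightarrow> real^2"
  shows "g \<in> borel_measurable M \<longleftrightarrow> (\<lambda>x. g x $ 1) \<in> borel_measurable M \<and> (\<lambda>x. g x $ 2) \<in> borel_measurable M"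
proof
  assume g: "g \<in> borel_measurable M"
  have "(\<lambda>x. g x \<bullet> axis i 1) \<in> borel_measurable M" for i
    using g by (intro borel_measurable_inner borel_measurable_const)
  then show "(\<lambda>x. g x $ 1) \<in> borel_measurable M \<and> (\<lambda>x. g x $ 2) \<in> borel_measurable M"
    by (simp add: inner_axis)
next
  assume a: "(\<lambda>x. g x $ 1) \<in> borel_measurable M \<and> (\<lambda>x. g x $ 2) \<in> borel_measurable M"
  have "\<forall>b\<in>Basis. (\<lambda>x. g x \<bullet> b) \<in> borel_measurable M"
  proof
    fix b :: "real^2" assume "b \<in> Basis"
    then consider "b = axis 1 1" | "b = axis 2 1" by (auto simp: Basis_real_2)
    then show "(\<lambda>x. g x \<bullet> b) \<in> borel_measurable M"
      using a by cases (simp_all add: inner_axis)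
  qed
  then show "g \<in> borel_measurable M" by (subst borel_measurable_euclidean_space) 
qed

lemma square_integrable_vec2:
  fixes g :: "real^2 \<Rightarrow> real^2"
  shows "g square_integrable_on \<Omega> \<longleftrightarrow> (\<forall>i. L2 (lebesgue_on \<Omega>) (\<lambda>x. g x $ i))"
proof
  assume g: "g square_integrable_on \<Omega>"
  have "L2 (lebesgue_on \<Omega>) (\<lambda>x. g x $ i)" for i
  proof -
    have m: "(\<lambda>x. g x $ i) \<in> borel_measurable (lebesgue_on \<Omega>)"
      using g measurable_vec2[of g "lebesgue_on \<Omega>"] exhaust_2[of i] unfolding square_integrable_on_def by auto
    have "L2 (lebesgue_on \<Omega>) (\<lambda>x. norm (g x))"
      using g by (auto simp: L2_def square_integrable_on_def)
    from L2_bound[OF this m, of 1] show ?thesis by (simp add: component_le_norm_cart)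
  qed
  then show "\<forall>i. L2 (lebesgue_on \<Omega>) (\<lambda>x. g x $ i)" by blast
next
  assume "\<forall>i. L2 (lebesgue_on \<Omega>) (\<lambda>x. g x $ i)"
  then show "g square_integrable_on \<Omega>"
    unfolding square_integrable_on_def by (auto simp: L2_def norm_squared_2 measurable_vec2)
qed

section \<open>Weak gradients\<close>

lemma has_weak_gradient_iff:
  "has_weak_gradient disc u g \<longleftrightarrow>
     (\<forall>i. L2 disc_measure (\<lambda>x. g x $ i)) \<and>
     (\<forall>\<phi> i. test_function disc \<phi> \<longrightarrow>
       (\<integral>x. u x * partial_deriv \<phi> i x \<partial>disc_measure) = - (\<integral>x. g x $ i * \<phi> x \<partial>disc_measure))"
  by (simp add: has_weak_gradient_def square_integrable_vec2 partial_deriv_def)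

lemma has_weak_gradient_L2: "has_weak_gradient disc u g \<Longrightarrow> L2 disc_measure (\<lambda>x. g x $ i)"
  by (simp add: has_weak_gradient_iff)

lemma test_function_L2: "test_function disc \<phi> \<Longrightarrow> L2 disc_measure \<phi>"
  by (intro continuous_L2_disc test_function_continuous)

lemma test_function_partial_L2: "test_function disc \<phi> \<Longrightarrow> L2 disc_measure (partial_deriv \<phi> i)"
  by (intro continuous_L2_disc test_function_partial_continuous)

lemma has_weak_gradient_linear:
  assumes "L2 disc_measure u" "L2 disc_measure v" "has_weak_gradient disc u g" "has_weak_gradient disc v h"
  shows "has_weak_gradient disc (\<lambda>x. a * u x + b * v x) (\<lambda>x. a *\<^sub>R g x + b *\<^sub>R h x)"
  unfolding has_weak_gradient_iff
proof (intro conjI allI impI)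
  fix i show "L2 disc_measure (\<lambda>x. (a *\<^sub>R g x + b *\<^sub>R h x) $ i)"
    using assms(3,4) by (auto intro!: L2_add L2_cmult simp: has_weak_gradient_iff)
next
  fix \<phi> i assume \<phi>: "test_function disc \<phi>"
  have g: "L2 disc_measure (\<lambda>x. g x $ i)" "L2 disc_measure (\<lambda>x. h x $ i)"
    using assms(3,4) by (auto simp: has_weak_gradient_iff)
  note i = L2_mult[OF assms(1) test_function_partial_L2[OF \<phi>, of i]]
    L2_mult[OF assms(2) test_function_partial_L2[OF \<phi>, of i]]
    L2_mult[OF g(1) test_function_L2[OF \<phi>]] L2_mult[OF g(2) test_function_L2[OF \<phi>]]
  have "(\<integral>x. (a * u x + b * v x) * partial_deriv \<phi> i x \<partial>disc_measure)
    = a * (\<integral>x. u x * partial_deriv \<phi> i x \<partial>disc_measure) + b * (\<integral>x. v x * partial_deriv \<phi> i x \<partial>disc_measure)"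
    using i by (simp add: algebra_simps)
  also have "\<dots> = - (a * (\<integral>x. g x $ i * \<phi> x \<partial>disc_measure) + b * (\<integral>x. h x $ i * \<phi> x \<partial>disc_measure))"
    using assms(3,4) \<phi> by (simp add: has_weak_gradient_iff)
  also have "\<dots> = - (\<integral>x. (a *\<^sub>R g x + b *\<^sub>R h x) $ i * \<phi> x \<partial>disc_measure)"
    using i by (simp add: algebra_simps)
  finally show "(\<integral>x. (a * u x + b * v x) * partial_deriv \<phi> i x \<partial>disc_measure) = \<dots>" .
qed

text \<open>The difference quotients in direction \<open>i\<close> have integral zero by translation invariance, and they
  converge dominatedly to the partial derivative.\<close>

lemma integral_partial_deriv_zero:
  fixes F :: "real^'n \<Rightarrow> real"
  assumes diff: "\<And>x. F differentiable (at x)" and cont: "continuous_on UNIV (partial_deriv F i)"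
    and zero: "\<And>x. x \<notin> ball 0 R \<Longrightarrow> F x = 0"
  shows "(\<integral>x. partial_deriv F i x \<partial>lborel) = 0"
proof -
  define e :: "real^'n" where "e = axis i 1"
  define D where "D = partial_deriv F i"
  have ne: "norm e = 1" by (simp add: e_def)
  have contF: "continuous_on UNIV F"
    using diff by (intro differentiable_imp_continuous_on) (simp add: differentiable_on_def)
  have line: "((\<lambda>s. F (x + s *\<^sub>R e)) has_real_derivative D (x + s *\<^sub>R e)) (at s)" for x s
  proof -
    have 1: "((\<lambda>s. x + s *\<^sub>R e) has_derivative (\<lambda>h. h *\<^sub>R e)) (at s)"
      by (auto intro!: derivative_eq_intros)
    have "((\<lambda>s. F (x + s *\<^sub>R e)) has_derivative (\<lambda>h. \<Sum>j\<in>UNIV. partial_deriv F j (x + s *\<^sub>R e) * (h *\<^sub>R e) $ j)) (at s)"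
      by (rule has_derivative_compose[OF 1 has_derivative_partials[OF diff]])
    moreover have "(\<Sum>j\<in>UNIV. partial_deriv F j (x + s *\<^sub>R e) * (h *\<^sub>R e) $ j) = D (x + s *\<^sub>R e) * h" for h
    proof -
      have "(\<Sum>j\<in>UNIV. partial_deriv F j (x + s *\<^sub>R e) * (h *\<^sub>R e) $ j) = (\<Sum>j\<in>UNIV. if j = i then D (x + s *\<^sub>R e) * h else 0)"
        by (intro sum.cong) (auto simp: e_def axis_def D_def)
      then show ?thesis by simp
    qed
    ultimately show ?thesis by (simp add: has_field_derivative_def mult_commute_abs)
  qed
  have contD: "continuous_on UNIV D" using cont by (simp add: D_def)
  have Dzero: "D x = 0" if "norm x > R" for x
  proof -
    have "open {x::real^'n. R < norm x}" by (intro open_Collect_less continuous_intros)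
    then have "(F has_derivative (\<lambda>h. 0)) (at x)"
      using that zero by (intro has_derivative_transform_within_open[of "\<lambda>x. 0" "\<lambda>h. 0" x UNIV "{x. R < norm x}" F]) auto
    then have "(F has_derivative (\<lambda>h. \<Sum>j\<in>UNIV. 0 * h $ j)) (at x)" by simp
    from partial_deriv_eq[OF this] show ?thesis by (simp add: D_def)
  qed
  have "compact (D ` cball 0 R)"
    using contD by (intro compact_continuous_image) (auto intro: continuous_on_subset)
  then obtain K where K: "K > 0" "\<forall>y\<in>D ` cball 0 R. norm y \<le> K"
    using compact_imp_bounded bounded_pos by blast
  have DK: "\<bar>D x\<bar> \<le> K" for x
    using K Dzero[of x] by (cases "norm x \<le> R") auto
  define h where "h k = inverse (real (Suc k))" for k
  have h: "0 < h k" "h k \<le> 1" for k by (auto simp: h_def field_simps)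
  define q where "q k x = (F (x + h k *\<^sub>R e) - F x) / h k" for k x
  have [measurable]: "F \<in> borel_measurable borel" "D \<in> borel_measurable borel"
    using contF contD by (auto intro: borel_measurable_continuous_onI)
  have intF: "integrable lborel F"
  proof -
    have "integrable lborel (\<lambda>x. indicator (cball 0 R) x *\<^sub>R F x)"
      by (rule borel_integrable_compact) (auto intro: continuous_on_subset[OF contF])
    moreover have "(\<lambda>x. indicator (cball 0 R) x *\<^sub>R F x) = F"
      using zero by (auto simp: indicator_def fun_eq_iff not_le)
    ultimately show ?thesis by simp
  qed
  have shift: "integrable lborel (\<lambda>x. F (x + c))" "(\<integral>x. F (x + c) \<partial>lborel) = (\<integral>x. F x \<partial>lborel)" for c
  proof -
    have d: "lborel = distr lborel borel (\<lambda>x. x + c)"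
    proof -
      have "(\<lambda>x. x + c) = (+) c" by (rule ext) (rule add.commute)
      then show ?thesis using lborel_distr_plus[of c] by simp
    qed
    show "integrable lborel (\<lambda>x. F (x + c))"
      using intF by (subst (asm) d, subst (asm) integrable_distr_eq) auto
    show "(\<integral>x. F (x + c) \<partial>lborel) = (\<integral>x. F x \<partial>lborel)"
      by (subst (2) d, subst integral_distr) auto
  qed
  have q0: "(\<integral>x. q k x \<partial>lborel) = 0" for k
    unfolding q_def using shift[of "h k *\<^sub>R e"] intF by simp
  have "(\<lambda>k. \<integral>x. q k x \<partial>lborel) \<longlonglongrightarrow> (\<integral>x. D x \<partial>lborel)"
  proof (rule integral_dominated_convergence)
    show "integrable lborel (\<lambda>x::real^'n. K * indicator (cball 0 (R + 1)) x :: real)"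
      using emeasure_bounded_finite[OF bounded_cball[of "0 :: real^'n" "R + 1"]]
      by (intro integrable_mult_right integrable_real_indicator) auto
    show "AE x in lborel. (\<lambda>k. q k x) \<longlonglongrightarrow> D x"
    proof (rule AE_I2)
      fix x
      have "((\<lambda>s. (F (x + s *\<^sub>R e) - F x) / s) \<longlongrightarrow> D x) (at 0)"
        using line[of x 0] by (simp add: has_field_derivative_iff)
      moreover have "filterlim h (at 0) sequentially"
        using LIMSEQ_inverse_real_of_nat h unfolding h_def filterlim_at
        by (auto intro!: always_eventually)
      ultimately show "(\<lambda>k. q k x) \<longlonglongrightarrow> D x"
        unfolding q_def by (rule filterlim_compose)
    qed
    show "AE x in lborel. norm (q k x) \<le> K * indicator (cball 0 (R + 1)) x" for k
    proof (rule AE_I2)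
      fix x
      obtain z where z: "0 < z" "z < h k" "F (x + h k *\<^sub>R e) - F (x + 0 *\<^sub>R e) = (h k - 0) * D (x + z *\<^sub>R e)"
        using MVT2[of 0 "h k" "\<lambda>s. F (x + s *\<^sub>R e)" "\<lambda>s. D (x + s *\<^sub>R e)"] h line by blast
      then have q: "q k x = D (x + z *\<^sub>R e)" using h[of k] by (simp add: q_def)
      show "norm (q k x) \<le> K * indicator (cball 0 (R + 1)) x"
      proof (cases "norm x \<le> R + 1")
        case True then show ?thesis using q DK by simp
      next
        case False
        have "norm x \<le> norm (x + z *\<^sub>R e) + norm (z *\<^sub>R e)"
          using norm_triangle_ineq4[of "x + z *\<^sub>R e" "z *\<^sub>R e"] by simp
        then have "norm (x + z *\<^sub>R e) > R" using False z h[of k] ne by simp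
        then show ?thesis using q Dzero False by simp
      qed
    qed
  qed (auto simp: q_def)
  then show ?thesis using q0 by (simp add: LIMSEQ_const_iff D_def)
qed

lemma partial_deriv_mult:
  assumes "f differentiable (at x)" "g differentiable (at x)"
  shows "partial_deriv (\<lambda>x. f x * g x) i x = f x * partial_deriv g i x + partial_deriv f i x * g x"
proof (rule partial_deriv_eq)
  show "((\<lambda>x. f x * g x) has_derivative
      (\<lambda>h. \<Sum>i\<in>UNIV. (f x * partial_deriv g i x + partial_deriv f i x * g x) * h $ i)) (at x)"
    using has_derivative_mult[OF assms[THEN has_derivative_partials]]
    by (simp add: algebra_simps sum.distrib sum_distrib_left sum_distrib_right)
qed

text \<open>The product rule together with the vanishing integral of the derivative of \<open>v \<psi>\<close>, which has
  compact support.\<close>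

lemma integration_by_parts_disc:
  assumes v: "\<And>x. v differentiable (at x)" "\<And>i. continuous_on UNIV (partial_deriv v i)"
    and \<psi>: "test_function disc \<psi>"
  shows "(\<integral>x. v x * partial_deriv \<psi> i x \<partial>disc_measure) = - (\<integral>x. partial_deriv v i x * \<psi> x \<partial>disc_measure)"
proof -
  have cv: "continuous_on UNIV v"
    using v(1) by (intro differentiable_imp_continuous_on) (simp add: differentiable_on_def)
  note c = cv v(2)[of i] test_function_continuous[OF \<psi>] test_function_partial_continuous[OF \<psi>, of i]
  have p: "partial_deriv (\<lambda>x. v x * \<psi> x) i = (\<lambda>x. v x * partial_deriv \<psi> i x + partial_deriv v i x * \<psi> x)"
    by (rule ext, rule partial_deriv_mult[OF v(1) test_function_differentiable[OF \<psi>]])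
  have "(\<integral>x. partial_deriv (\<lambda>x. v x * \<psi> x) i x \<partial>lborel) = 0"
  proof (rule integral_partial_deriv_zero[where R = 1])
    show "(\<lambda>x. v x * \<psi> x) differentiable at x" for x
      using v(1) test_function_differentiable[OF \<psi>] by (rule differentiable_mult)
    show "continuous_on UNIV (partial_deriv (\<lambda>x. v x * \<psi> x) i)"
      unfolding p by (intro continuous_intros c)
    show "v x * \<psi> x = 0" if "x \<notin> ball 0 1" for x using test_function_zero[OF \<psi> that] by simp
  qed
  also have "(\<integral>x. partial_deriv (\<lambda>x. v x * \<psi> x) i x \<partial>lborel)
      = (\<integral>x. indicator disc x * (v x * partial_deriv \<psi> i x + partial_deriv v i x * \<psi> x) \<partial>lborel)"
    unfolding p using test_function_zero[OF \<psi>] test_function_partial_zero[OF \<psi>]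
    by (intro Bochner_Integration.integral_cong) (auto simp: indicator_def)
  also have "\<dots> = (\<integral>x. v x * partial_deriv \<psi> i x + partial_deriv v i x * \<psi> x \<partial>disc_measure)"
    by (rule integral_disc[symmetric]) (intro borel_measurable_continuous_onI continuous_intros c)
  also have "\<dots> = (\<integral>x. v x * partial_deriv \<psi> i x \<partial>disc_measure) + (\<integral>x. partial_deriv v i x * \<psi> x \<partial>disc_measure)"
    by (intro Bochner_Integration.integral_add L2_mult continuous_L2_disc c)
  finally show ?thesis by simp
qed

definition gradient :: "(real^'n \<Rightarrow> real) \<Rightarrow> real^'n \<Rightarrow> real^'n" where
  "gradient f x = (\<chi> i. partial_deriv f i x)"

lemma gradient_nth [simp]: "gradient f x $ i = partial_deriv f i x"
  by (simp add: gradient_def)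

lemma test_function_weak_gradient:
  assumes "test_function disc \<phi>"
  shows "has_weak_gradient disc \<phi> (gradient \<phi>)"
  unfolding has_weak_gradient_iff
  using test_function_partial_L2[OF assms] test_function_partial_continuous[OF assms]
    integration_by_parts_disc[OF test_function_differentiable[OF assms]] by simp

lemma AE_disc: "(AE x in disc_measure. P x) \<longleftrightarrow> (AE x in lborel. x \<in> disc \<longrightarrow> P x)"
  by (subst AE_restrict_space_iff) (auto simp: AE_completion_iff)

section \<open>Uniqueness of the weak gradient\<close>

lemma borel_representative:
  fixes h :: "real^2 \<Rightarrow> real"
  assumes "h \<in> borel_measurable disc_measure"
  obtains g where "g \<in> borel_measurable borel" "AE x in disc_measure. h x = g x"
proof -
  have "(\<lambda>x. indicator disc x *\<^sub>R h x) \<in> borel_measurable lebesgue"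
    using assms by (subst (asm) borel_measurable_restrict_space_iff) auto
  from completion_ex_borel_measurable_real[OF this]
  obtain g where g: "g \<in> borel_measurable lborel" "AE x in lborel. indicator disc x *\<^sub>R h x = g x"
    by blast
  show ?thesis
  proof (rule that[of g])
    show "g \<in> borel_measurable borel" using g(1) by simp
    show "AE x in disc_measure. h x = g x"
      unfolding AE_disc using g(2) by eventually_elim (auto simp: indicator_def)
  qed
qed

lemma flat_0_bounds: "0 \<le> flat 0 t" "flat 0 t \<le> 1"
  by (auto simp: flat_def)

lemma flat_0_at_top: "(flat 0 \<longlongrightarrow> 1) at_top"
proof -
  have "((\<lambda>t::real. exp (- inverse t)) \<longlongrightarrow> exp (- 0)) at_top"
    by (intro tendsto_intros tendsto_inverse_0_at_top filterlim_ident)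
  then have "((\<lambda>t::real. exp (- inverse t)) \<longlongrightarrow> 1) at_top" by simp
  then show ?thesis
    by (rule Lim_transform_eventually)
       (use eventually_gt_at_top[of 0] in \<open>auto simp: flat_def divide_inverse elim!: eventually_mono\<close>)
qed

lemma flat_0_scaled_tendsto:
  assumes "d \<ge> 0"
  shows "(\<lambda>n. flat 0 (real (Suc n) * c - d)) \<longlonglongrightarrow> (if c > 0 then 1 else 0)"
proof (cases "c > 0")
  case True
  have "filterlim (\<lambda>n. - d + c * real (Suc n)) at_top sequentially"
    by (intro filterlim_tendsto_add_at_top[OF tendsto_const]
        filterlim_tendsto_pos_mult_at_top[OF tendsto_const True]
        filterlim_compose[OF filterlim_real_sequentially filterlim_Suc])
  from filterlim_compose[OF flat_0_at_top this] show ?thesis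
    using True by (simp add: algebra_simps)
next
  case False
  have "real (Suc n) * c - d \<le> 0" for n
    using False assms mult_nonneg_nonpos[of "real (Suc n)" c] by simp
  then have "flat 0 (real (Suc n) * c - d) = 0" for n
    by (simp add: flat_def not_less)
  then show ?thesis using False by simp
qed

text \<open>The indicator function of a box is, inside the disc, a pointwise bounded limit of test functions.\<close>

lemma integral_box_zero:
  assumes h: "L2 disc_measure h"
    and zero: "\<And>\<phi>. test_function disc \<phi> \<Longrightarrow> (\<integral>x. h x * \<phi> x \<partial>disc_measure) = 0"
  shows "(\<integral>x. h x * indicator (box a b) x \<partial>disc_measure) = 0"
proof -
  define bump where "bump n x = flat 0 (real (Suc n) * (1 - (norm x)\<^sup>2) - 1) *
    (\<Prod>i\<in>UNIV. flat 0 (real (Suc n) * (x $ i - a $ i) - 0) * flat 0 (real (Suc n) * (b $ i - x $ i) - 0))"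
    for n and x :: "real^2"
  have smooth: "smooth (bump n)" for n
    unfolding bump_def
    by (intro smooth.mult smooth.flat smooth_diff smooth.const smooth_norm_squared smooth_prod smooth.coord)
  have test: "test_function disc (bump n)" for n
  proof (rule smooth_test_function[OF smooth, of "cball 0 (sqrt (1 - 1 / real (Suc n)))"])
    have "sqrt (1 - 1 / real (Suc n)) < 1" by (subst real_sqrt_lt_1_iff) simp
    then show "cball 0 (sqrt (1 - 1 / real (Suc n))) \<subseteq> disc"
      by (simp only: cball_subset_ball_iff) simp
    fix x :: "real^2" assume "x \<notin> cball 0 (sqrt (1 - 1 / real (Suc n)))"
    then have "sqrt (1 - 1 / real (Suc n)) < norm x" by simp
    then have "(sqrt (1 - 1 / real (Suc n)))\<^sup>2 < (norm x)\<^sup>2" by (intro power_strict_mono) auto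
    then have "1 - 1 / real (Suc n) < (norm x)\<^sup>2" by simp
    then have "real (Suc n) * (1 - (norm x)\<^sup>2) < real (Suc n) * (1 / real (Suc n))"
      by (intro mult_strict_left_mono) auto
    then have "real (Suc n) * (1 - (norm x)\<^sup>2) - 1 \<le> 0" by simp
    then show "bump n x = 0" unfolding bump_def by (simp only: flat_def) simp
  qed simp
  have le1: "\<bar>bump n x\<bar> \<le> 1" for n x
  proof -
    have "0 \<le> (\<Prod>i\<in>UNIV. flat 0 (real (Suc n) * (x $ i - a $ i) - 0) * flat 0 (real (Suc n) * (b $ i - x $ i) - 0))"
      by (intro prod_nonneg mult_nonneg_nonneg ballI flat_0_bounds)
    moreover have "(\<Prod>i\<in>UNIV. flat 0 (real (Suc n) * (x $ i - a $ i) - 0) * flat 0 (real (Suc n) * (b $ i - x $ i) - 0)) \<le> 1"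
      by (intro prod_le_1 conjI mult_nonneg_nonneg mult_le_one flat_0_bounds)
    ultimately show ?thesis
      unfolding bump_def abs_mult using flat_0_bounds by (intro mult_le_one) (auto simp del: of_nat_Suc)
  qed
  have lim: "(\<lambda>n. bump n x) \<longlonglongrightarrow> indicator (box a b) x" if "x \<in> disc" for x
  proof -
    have n1: "(norm x)\<^sup>2 < 1" using that by (simp add: power_less_one_iff abs_square_less_1)
    have "(\<lambda>n. bump n x) \<longlonglongrightarrow> (if 1 - (norm x)\<^sup>2 > 0 then 1 else 0) *
      (\<Prod>i\<in>UNIV. (if x $ i - a $ i > 0 then 1 else 0) * (if b $ i - x $ i > 0 then 1 else 0))"
      unfolding bump_def by (intro tendsto_mult tendsto_prod flat_0_scaled_tendsto) auto
    also have "(\<Prod>i\<in>UNIV. (if x $ i - a $ i > 0 then 1 else 0) * (if b $ i - x $ i > 0 then 1 else 0)) = (indicator (box a b) x :: real)"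
      by (auto simp: indicator_def mem_box_cart forall_2 UNIV_2)
    finally show ?thesis using n1 by simp
  qed
  have "(\<lambda>n. \<integral>x. h x * bump n x \<partial>disc_measure) \<longlonglongrightarrow> (\<integral>x. h x * indicator (box a b) x \<partial>disc_measure)"
  proof (rule integral_dominated_convergence)
    show "integrable disc_measure (\<lambda>x. \<bar>h x\<bar>)" using L2_integrable_disc[OF h] by simp
    show "AE x in disc_measure. (\<lambda>n. h x * bump n x) \<longlonglongrightarrow> h x * indicator (box a b) x"
      using lim by (intro AE_I2 tendsto_intros) auto
    show "AE x in disc_measure. norm (h x * bump n x) \<le> \<bar>h x\<bar>" for n
      using le1 by (intro AE_I2) (simp add: abs_mult mult_left_le)
    show "(\<lambda>x. h x * bump n x) \<in> borel_measurable disc_measure" for n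
      using L2_mult[OF h test_function_L2[OF test]] by auto
    have "(indicator (box a b) :: real^2 \<Rightarrow> real) \<in> borel_measurable disc_measure"
      by (intro borel_measurable_disc borel_measurable_indicator) simp
    then show "(\<lambda>x. h x * indicator (box a b) x) \<in> borel_measurable disc_measure"
      using h by auto
  qed
  then show ?thesis using zero[OF test] by (simp add: LIMSEQ_const_iff)
qed

text \<open>Boxes form a generator of the Borel sets that is stable under intersection.\<close>

lemma integral_borel_zero:
  assumes h: "L2 disc_measure h"
    and zero: "\<And>\<phi>. test_function disc \<phi> \<Longrightarrow> (\<integral>x. h x * \<phi> x \<partial>disc_measure) = 0"
    and A: "A \<in> sets borel"
  shows "(\<integral>x. h x * indicator A x \<partial>disc_measure) = 0"
proof -
  note box0 = integral_box_zero[OF h zero]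
  note ih = L2_integrable_disc[OF h]
  have mI: "(indicator B :: real^2 \<Rightarrow> real) \<in> borel_measurable disc_measure" if "B \<in> sets borel" for B
    by (intro borel_measurable_disc borel_measurable_indicator that)
  have iI: "integrable disc_measure (\<lambda>x. h x * indicator B x)" if "B \<in> sets borel" for B
    by (rule L2_mult[OF h bounded_L2_disc[of "indicator B" 1, OF mI[OF that]]]) (auto simp: indicator_def)
  define G where "G = range (\<lambda>(a, b). box a b :: (real^2) set)"
  have b: "sets borel = sigma_sets UNIV G"
    unfolding G_def borel_eq_box by (rule sets_measure_of) simp
  have st: "Int_stable G"
    unfolding Int_stable_def G_def by (auto simp: box_Int_box)
  have A': "A \<in> sigma_sets UNIV G" using A b by simp
  have "G \<subseteq> Pow UNIV" by simp
  from st this A' show ?thesis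
  proof (induction rule: sigma_sets_induct_disjoint)
    case (basic B)
    then show ?case using box0 by (auto simp: G_def)
  next
    case empty
    show ?case by simp
  next
    case (compl B)
    have B: "B \<in> sets borel" using compl b by simp
    have "(\<integral>x. h x \<partial>disc_measure) = (\<integral>x. h x * indicator (box (vector [-1, -1]) (vector [1, 1])) x \<partial>disc_measure)"
    proof (rule Bochner_Integration.integral_cong)
      fix x assume "x \<in> space disc_measure"
      then have "norm x < 1" by simp
      then have "\<bar>x $ i\<bar> < 1" for i using component_le_norm_cart[of x i] by simp
      then have "x \<in> box (vector [-1, -1]) (vector [1, 1])"
        by (auto simp: mem_box_cart forall_2 abs_less_iff)
      then show "h x = h x * indicator (box (vector [-1, -1]) (vector [1, 1])) x" by simp
    qed simp
    then have "(\<integral>x. h x \<partial>disc_measure) = 0" using box0 by simp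
    moreover have "(\<integral>x. h x * indicator (UNIV - B) x \<partial>disc_measure)
       = (\<integral>x. h x - h x * indicator B x \<partial>disc_measure)"
      by (intro Bochner_Integration.integral_cong) (auto simp: indicator_def)
    ultimately show ?case using compl ih iI[OF B] by simp
  next
    case (union B)
    have B: "B i \<in> sets borel" for i using union b by auto
    have "(\<lambda>n. \<integral>x. h x * indicator (\<Union>i<n. B i) x \<partial>disc_measure) \<longlonglongrightarrow> (\<integral>x. h x * indicator (\<Union>i. B i) x \<partial>disc_measure)"
    proof (rule integral_dominated_convergence)
      show "integrable disc_measure (\<lambda>x. \<bar>h x\<bar>)" using ih by simp
      show "AE x in disc_measure. (\<lambda>n. h x * indicator (\<Union>i<n. B i) x) \<longlonglongrightarrow> h x * indicator (\<Union>i. B i) x"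
        by (intro AE_I2 tendsto_intros LIMSEQ_indicator_UN)
      show "AE x in disc_measure. norm (h x * indicator (\<Union>i<n. B i) x) \<le> \<bar>h x\<bar>" for n
        by (intro AE_I2) (auto simp: indicator_def)
    qed (use iI B in auto)
    moreover have "(\<integral>x. h x * indicator (\<Union>i<n. B i) x \<partial>disc_measure) = 0" for n
    proof -
      have "disjoint_family_on B {..<n}" using union(1) by (auto simp: disjoint_family_on_def)
      then have "(\<integral>x. h x * indicator (\<Union>i<n. B i) x \<partial>disc_measure) = (\<integral>x. (\<Sum>i<n. h x * indicator (B i) x) \<partial>disc_measure)"
        by (simp add: indicator_UN_disjoint sum_distrib_left)
      also have "\<dots> = (\<Sum>i<n. \<integral>x. h x * indicator (B i) x \<partial>disc_measure)"
        by (intro Bochner_Integration.integral_sum iI B)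
      finally show ?thesis using union by simp
    qed
    ultimately show ?case by (simp add: LIMSEQ_const_iff)
  qed
qed

text \<open>The fundamental lemma of the calculus of variations.\<close>

lemma test_functions_separate:
  assumes h: "L2 disc_measure h"
    and zero: "\<And>\<phi>. test_function disc \<phi> \<Longrightarrow> (\<integral>x. h x * \<phi> x \<partial>disc_measure) = 0"
  shows "AE x in disc_measure. h x = 0"
proof -
  obtain g where g[measurable]: "g \<in> borel_measurable borel" and hg: "AE x in disc_measure. h x = g x"
    using borel_representative[of h] h by auto
  have [measurable]: "disc \<in> sets borel" by simp
  have hm: "h \<in> borel_measurable disc_measure" using h by auto
  have "integrable disc_measure g"
    using L2_integrable_disc[OF h] hg by (subst (asm) integrable_cong_AE) (auto intro: hm)
  then have ig: "integrable lborel (\<lambda>x. indicator disc x * g x)" by (simp add: integrable_disc)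
  have "AE x in lborel. indicator disc x * g x = 0"
  proof (rule density_unique_real[OF ig])
    fix A :: "(real^2) set" assume "A \<in> sets lborel"
    then have A[measurable]: "A \<in> sets borel" by simp
    have "0 = (\<integral>x. h x * indicator A x \<partial>disc_measure)"
      using integral_borel_zero[OF h zero A] by simp
    also have "\<dots> = (\<integral>x. g x * indicator A x \<partial>disc_measure)"
    proof (rule integral_cong_AE)
      show "(\<lambda>x. h x * indicator A x) \<in> borel_measurable disc_measure"
        by (intro borel_measurable_times hm borel_measurable_disc borel_measurable_indicator A)
      show "(\<lambda>x. g x * indicator A x) \<in> borel_measurable disc_measure"
        by (intro borel_measurable_disc) measurable
      show "AE x in disc_measure. h x * indicator A x = g x * indicator A x"
        using hg by eventually_elim simp
    qed
    also have "\<dots> = (\<integral>x. indicator disc x * (g x * indicator A x) \<partial>lborel)"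
      by (rule integral_disc) measurable
    finally show "(\<integral>x\<in>A. indicator disc x * g x \<partial>lborel) = (\<integral>x\<in>A. 0 \<partial>lborel)"
      by (simp add: set_lebesgue_integral_def mult_ac)
  qed simp
  then have "AE x in disc_measure. g x = 0"
    unfolding AE_disc by eventually_elim (auto simp: indicator_def)
  then show ?thesis using hg by eventually_elim simp
qed

lemma weak_gradient_unique:
  assumes "has_weak_gradient disc u g" "has_weak_gradient disc u h"
  shows "AE x in disc_measure. g x = h x"
proof -
  have "AE x in disc_measure. g x $ i - h x $ i = 0" for i
  proof (rule test_functions_separate)
    show "L2 disc_measure (\<lambda>x. g x $ i - h x $ i)"
      by (intro L2_diff has_weak_gradient_L2[OF assms(1)] has_weak_gradient_L2[OF assms(2)])
    fix \<phi> assume \<phi>: "test_function disc \<phi>"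
    have "(\<integral>x. g x $ i * \<phi> x \<partial>disc_measure) = (\<integral>x. h x $ i * \<phi> x \<partial>disc_measure)"
    proof -
      have "- (\<integral>x. g x $ i * \<phi> x \<partial>disc_measure) = - (\<integral>x. h x $ i * \<phi> x \<partial>disc_measure)"
        using assms \<phi> unfolding has_weak_gradient_iff by simp
      then show ?thesis by simp
    qed
    moreover have "integrable disc_measure (\<lambda>x. g x $ i * \<phi> x)" "integrable disc_measure (\<lambda>x. h x $ i * \<phi> x)"
      by (intro L2_mult has_weak_gradient_L2[OF assms(1)] has_weak_gradient_L2[OF assms(2)] test_function_L2[OF \<phi>])+
    ultimately show "(\<integral>x. (g x $ i - h x $ i) * \<phi> x \<partial>disc_measure) = 0"
      by (simp add: left_diff_distrib)
  qed
  from this[of 1] this[of 2] show ?thesis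
    by eventually_elim (simp add: vec_eq_iff forall_2)
qed

lemma weak_gradient_works:
  assumes "has_weak_gradient disc u g"
  shows "has_weak_gradient disc u (weak_gradient disc u)"
    and "AE x in disc_measure. weak_gradient disc u x = g x"
proof -
  show "has_weak_gradient disc u (weak_gradient disc u)"
    unfolding weak_gradient_def by (rule someI[where P = "has_weak_gradient disc u", OF assms])
  from weak_gradient_unique[OF this assms] show "AE x in disc_measure. weak_gradient disc u x = g x" .
qed

lemma has_weak_gradient_measurable:
  "has_weak_gradient disc u g \<Longrightarrow> g \<in> borel_measurable disc_measure"
  by (simp add: has_weak_gradient_def square_integrable_on_def)

section \<open>Approximation and the chain rule\<close>

lemma H1_0_L2: "u \<in> H1_0 disc \<Longrightarrow> L2 disc_measure u"
  by (simp add: H1_0_def H1_def square_integrable_real)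

lemma H1_0_approximation:
  assumes u: "u \<in> H1_0 disc" and g: "has_weak_gradient disc u g"
  obtains \<phi> where "\<And>k. test_function disc (\<phi> k)"
    "(\<lambda>k. \<integral>x. (\<phi> k x - u x)\<^sup>2 \<partial>disc_measure) \<longlonglongrightarrow> 0"
    "\<And>i. (\<lambda>k. \<integral>x. (partial_deriv (\<phi> k) i x - g x $ i)\<^sup>2 \<partial>disc_measure) \<longlonglongrightarrow> 0"
proof -
  have "\<exists>\<phi>. test_function disc \<phi> \<and> H1_norm disc (\<lambda>x. u x - \<phi> x) < inverse (real (Suc k))" for k
    using u unfolding H1_0_def by simp
  then obtain \<phi> where \<phi>: "\<And>k. test_function disc (\<phi> k)"
    and small: "\<And>k. H1_norm disc (\<lambda>x. u x - \<phi> k x) < inverse (real (Suc k))" by metis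
  define e where "e k = (inverse (real (Suc k)))\<^sup>2" for k
  have e0: "e \<longlonglongrightarrow> 0"
    using tendsto_power[OF LIMSEQ_inverse_real_of_nat, of 2] by (simp add: e_def[abs_def])
  have w: "has_weak_gradient disc (\<lambda>x. u x - \<phi> k x) (\<lambda>x. g x - gradient (\<phi> k) x)" for k
    using has_weak_gradient_linear[OF H1_0_L2[OF u] test_function_L2[OF \<phi>] g test_function_weak_gradient[OF \<phi>], of 1 "-1"]
    by simp
  have both: "(\<integral>x. (u x - \<phi> k x)\<^sup>2 \<partial>disc_measure) + (\<integral>x. (norm (g x - gradient (\<phi> k) x))\<^sup>2 \<partial>disc_measure) < e k" for k
  proof -
    have "(\<integral>x. (norm (weak_gradient disc (\<lambda>x. u x - \<phi> k x) x))\<^sup>2 \<partial>disc_measure)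
        = (\<integral>x. (norm (g x - gradient (\<phi> k) x))\<^sup>2 \<partial>disc_measure)"
    proof (rule integral_cong_AE)
      have "weak_gradient disc (\<lambda>x. u x - \<phi> k x) \<in> borel_measurable disc_measure"
        by (rule has_weak_gradient_measurable[OF weak_gradient_works(1)[OF w]])
      then show "(\<lambda>x. (norm (weak_gradient disc (\<lambda>x. u x - \<phi> k x) x))\<^sup>2) \<in> borel_measurable disc_measure"
        by measurable
      have "(\<lambda>x. g x - gradient (\<phi> k) x) \<in> borel_measurable disc_measure"
        by (rule has_weak_gradient_measurable[OF w])
      then show "(\<lambda>x. (norm (g x - gradient (\<phi> k) x))\<^sup>2) \<in> borel_measurable disc_measure"
        by measurable
      show "AE x in disc_measure. (norm (weak_gradient disc (\<lambda>x. u x - \<phi> k x) x))\<^sup>2 = (norm (g x - gradient (\<phi> k) x))\<^sup>2"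
        using weak_gradient_works(2)[OF w[of k]] by eventually_elim simp
    qed
    then have "H1_norm disc (\<lambda>x. u x - \<phi> k x) = sqrt ((\<integral>x. (u x - \<phi> k x)\<^sup>2 \<partial>disc_measure) + (\<integral>x. (norm (g x - gradient (\<phi> k) x))\<^sup>2 \<partial>disc_measure))" (is "_ = sqrt ?S")
      unfolding H1_norm_def by simp
    then have "sqrt ?S < inverse (real (Suc k))" using small[of k] by simp
    moreover have "?S \<ge> 0" by (intro add_nonneg_nonneg) simp_all
    ultimately have "(sqrt ?S)\<^sup>2 < (inverse (real (Suc k)))\<^sup>2" by (intro power_strict_mono) auto
    then show ?thesis using \<open>?S \<ge> 0\<close> by (simp add: e_def)
  qed
  show ?thesis
  proof (rule that[of \<phi>, OF \<phi>])
    have "(\<integral>x. (\<phi> k x - u x)\<^sup>2 \<partial>disc_measure) \<le> e k" for k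
    proof -
      have "(\<integral>x. (\<phi> k x - u x)\<^sup>2 \<partial>disc_measure) = (\<integral>x. (u x - \<phi> k x)\<^sup>2 \<partial>disc_measure)"
        by (simp add: power2_commute)
      moreover have "0 \<le> (\<integral>x. (norm (g x - gradient (\<phi> k) x))\<^sup>2 \<partial>disc_measure)" by simp
      ultimately show ?thesis using both[of k] by linarith
    qed
    then show "(\<lambda>k. \<integral>x. (\<phi> k x - u x)\<^sup>2 \<partial>disc_measure) \<longlonglongrightarrow> 0"
      by (intro Lim_null_comparison[OF _ e0]) auto
    fix i
    have "(\<integral>x. (partial_deriv (\<phi> k) i x - g x $ i)\<^sup>2 \<partial>disc_measure) \<le> e k" for k
    proof -
      have L: "L2 disc_measure (\<lambda>x. (g x - gradient (\<phi> k) x) $ i)" for i by (rule has_weak_gradient_L2[OF w])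
      have "(\<integral>x. (partial_deriv (\<phi> k) i x - g x $ i)\<^sup>2 \<partial>disc_measure) = (\<integral>x. ((g x - gradient (\<phi> k) x) $ i)\<^sup>2 \<partial>disc_measure)"
        by (simp add: power2_commute)
      also have "\<dots> \<le> (\<integral>x. (norm (g x - gradient (\<phi> k) x))\<^sup>2 \<partial>disc_measure)"
      proof (rule integral_mono)
        show "integrable disc_measure (\<lambda>x. ((g x - gradient (\<phi> k) x) $ i)\<^sup>2)" using L[of i] unfolding L2_def by simp
        show "integrable disc_measure (\<lambda>x. (norm (g x - gradient (\<phi> k) x))\<^sup>2)"
          using w unfolding has_weak_gradient_def square_integrable_on_def by simp
        fix x
        have "\<bar>(g x - gradient (\<phi> k) x) $ i\<bar>\<^sup>2 \<le> (norm (g x - gradient (\<phi> k) x))\<^sup>2"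
          by (intro power_mono component_le_norm_cart) simp
        then show "((g x - gradient (\<phi> k) x) $ i)\<^sup>2 \<le> (norm (g x - gradient (\<phi> k) x))\<^sup>2"
          by (simp only: power2_abs)
      qed
      moreover have "0 \<le> (\<integral>x. (u x - \<phi> k x)\<^sup>2 \<partial>disc_measure)" by simp
      ultimately show ?thesis using both[of k] by linarith
    qed
    then show "(\<lambda>k. \<integral>x. (partial_deriv (\<phi> k) i x - g x $ i)\<^sup>2 \<partial>disc_measure) \<longlonglongrightarrow> 0"
      by (intro Lim_null_comparison[OF _ e0]) auto
  qed
qed

text \<open>The identity is classical for test functions; along an approximating sequence the left side converges
  in \<open>L\<^sup>2\<close> because \<open>F\<close> is Lipschitz, the right side in \<open>L\<^sup>1\<close> because \<open>F'\<close> is bounded and Lipschitz.\<close>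

lemma weak_chain_rule:
  fixes F F' :: "real \<Rightarrow> real"
  assumes u: "u \<in> H1_0 disc" and g: "has_weak_gradient disc u g"
    and F: "\<And>t. (F has_real_derivative F' t) (at t)" "F 0 = 0"
    and A: "\<And>t. \<bar>F' t\<bar> \<le> A" and L: "\<And>s t. \<bar>F' s - F' t\<bar> \<le> L * \<bar>s - t\<bar>"
  shows "has_weak_gradient disc (\<lambda>x. F (u x)) (\<lambda>x. F' (u x) *\<^sub>R g x)"
  unfolding has_weak_gradient_iff
proof (intro conjI allI impI)
  have A0: "A \<ge> 0" using A[of 0] by linarith
  have L0: "L \<ge> 0" using L[of 1 0] by auto
  have lip: "\<bar>F s - F t\<bar> \<le> A * \<bar>s - t\<bar>" for s t
    using field_differentiable_bound[of UNIV F F' A s t] F(1) A by (auto simp: has_field_derivative_at_within)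
  have "continuous_on UNIV F" using F(1) by (auto intro!: DERIV_continuous_on)
  then have [measurable]: "F \<in> borel_measurable borel" by (rule borel_measurable_continuous_onI)
  have contF': "continuous_on UNIV F'"
    unfolding continuous_on_iff
  proof (intro ballI allI impI)
    fix x e :: real assume "e > 0"
    have "dist (F' y) (F' x) < e" if "dist y x < e / (L + 1)" for y
    proof -
      have "(L + 1) * \<bar>y - x\<bar> < e" using that L0 by (simp add: dist_real_def field_simps)
      then show ?thesis using L[of y x] by (simp add: dist_real_def algebra_simps)
    qed
    then show "\<exists>d>0. \<forall>y\<in>UNIV. dist y x < d \<longrightarrow> dist (F' y) (F' x) < e"
      using \<open>e > 0\<close> L0 by (intro exI[of _ "e / (L + 1)"]) auto
  qed
  then have [measurable]: "F' \<in> borel_measurable borel" by (rule borel_measurable_continuous_onI)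
  have uL: "L2 disc_measure u" by (rule H1_0_L2[OF u])
  have um[measurable]: "u \<in> borel_measurable disc_measure" using uL by auto
  have gL: "L2 disc_measure (\<lambda>x. g x $ i)" for i by (rule has_weak_gradient_L2[OF g])
  have gm[measurable]: "(\<lambda>x. g x $ i) \<in> borel_measurable disc_measure" for i using gL by auto
  have F'm: "(\<lambda>x. F' (u x) * g x $ i) \<in> borel_measurable disc_measure" for i by measurable
  have F'g: "L2 disc_measure (\<lambda>x. F' (u x) * g x $ i)" for i
    by (rule L2_bound[OF gL[of i] F'm, where c = A]) (auto simp: abs_mult intro!: mult_right_mono A)
  then show "L2 disc_measure (\<lambda>x. (F' (u x) *\<^sub>R g x) $ i)" for i by simp
  have FuL: "L2 disc_measure (\<lambda>x. F (u x))"
    using lip[of _ 0] F(2) by (intro L2_bound[OF uL, of _ A]) auto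
  fix \<psi> i assume \<psi>: "test_function disc \<psi>"
  obtain \<phi> where \<phi>: "\<And>k. test_function disc (\<phi> k)"
    and \<phi>u: "(\<lambda>k. \<integral>x. (\<phi> k x - u x)\<^sup>2 \<partial>disc_measure) \<longlonglongrightarrow> 0"
    and \<phi>g: "\<And>i. (\<lambda>k. \<integral>x. (partial_deriv (\<phi> k) i x - g x $ i)\<^sup>2 \<partial>disc_measure) \<longlonglongrightarrow> 0"
    by (rule H1_0_approximation[OF u g], rule that)
  note \<phi>L = test_function_L2[OF \<phi>] and d\<phi>L = test_function_partial_L2[OF \<phi>]
  have p\<phi>: "partial_deriv (\<lambda>x. F (\<phi> k x)) j x = F' (\<phi> k x) * partial_deriv (\<phi> k) j x"
    and dF\<phi>: "(\<lambda>x. F (\<phi> k x)) differentiable at x" for k j x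
  proof -
    have "((\<lambda>x. F (\<phi> k x)) has_derivative (\<lambda>h. F' (\<phi> k x) * (\<Sum>i\<in>UNIV. partial_deriv (\<phi> k) i x * h $ i))) (at x)"
      using has_derivative_compose[OF has_derivative_partials[OF test_function_differentiable[OF \<phi>]]
        F(1)[of "\<phi> k x", unfolded has_field_derivative_def]] .
    then have d: "((\<lambda>x. F (\<phi> k x)) has_derivative (\<lambda>h. \<Sum>i\<in>UNIV. F' (\<phi> k x) * partial_deriv (\<phi> k) i x * h $ i)) (at x)"
      by (simp add: sum_distrib_left mult.assoc)
    show "partial_deriv (\<lambda>x. F (\<phi> k x)) j x = F' (\<phi> k x) * partial_deriv (\<phi> k) j x"
      by (rule partial_deriv_eq[OF d])
    show "(\<lambda>x. F (\<phi> k x)) differentiable at x" using d by (auto simp: differentiable_def)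
  qed
  have c\<phi>: "continuous_on UNIV (\<lambda>x. F' (\<phi> k x))" for k
    using continuous_on_compose2[OF contF' test_function_continuous[OF \<phi>]] by simp
  have cF\<phi>: "continuous_on UNIV (\<lambda>x. F (\<phi> k x))" for k
    using continuous_on_compose2[OF \<open>continuous_on UNIV F\<close> test_function_continuous[OF \<phi>]] by simp
  have ibp: "(\<integral>x. F (\<phi> k x) * partial_deriv \<psi> i x \<partial>disc_measure)
      = - (\<integral>x. F' (\<phi> k x) * partial_deriv (\<phi> k) i x * \<psi> x \<partial>disc_measure)" for k
  proof -
    have "continuous_on UNIV (partial_deriv (\<lambda>x. F (\<phi> k x)) j)" for j
      unfolding p\<phi>[abs_def] by (intro continuous_intros c\<phi> test_function_partial_continuous[OF \<phi>])
    from integration_by_parts_disc[OF dF\<phi> this \<psi>] show ?thesis by (simp add: p\<phi>)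
  qed
  have lim1: "(\<lambda>k. \<integral>x. F (\<phi> k x) * partial_deriv \<psi> i x \<partial>disc_measure) \<longlonglongrightarrow> (\<integral>x. F (u x) * partial_deriv \<psi> i x \<partial>disc_measure)"
  proof (rule L2_inner_tendsto)
    show "L2 disc_measure (\<lambda>x. F (\<phi> k x))" for k by (rule continuous_L2_disc[OF cF\<phi>])
    show "L2 disc_measure (\<lambda>x. F (u x))" by (rule FuL)
    show "L2 disc_measure (partial_deriv \<psi> i)" by (rule test_function_partial_L2[OF \<psi>])
    have "(\<lambda>k. A\<^sup>2 * (\<integral>x. (\<phi> k x - u x)\<^sup>2 \<partial>disc_measure)) \<longlonglongrightarrow> A\<^sup>2 * 0" by (intro tendsto_intros \<phi>u)
    then have lim: "(\<lambda>k. A\<^sup>2 * (\<integral>x. (\<phi> k x - u x)\<^sup>2 \<partial>disc_measure)) \<longlonglongrightarrow> 0" by simp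
    show "(\<lambda>k. \<integral>x. (F (\<phi> k x) - F (u x))\<^sup>2 \<partial>disc_measure) \<longlonglongrightarrow> 0"
    proof (rule Lim_null_comparison[OF _ lim], intro always_eventually allI)
      fix k
      have "(\<integral>x. (F (\<phi> k x) - F (u x))\<^sup>2 \<partial>disc_measure) \<le> (\<integral>x. A\<^sup>2 * (\<phi> k x - u x)\<^sup>2 \<partial>disc_measure)"
      proof (rule integral_mono)
        show "integrable disc_measure (\<lambda>x. (F (\<phi> k x) - F (u x))\<^sup>2)"
          using L2_diff[OF continuous_L2_disc[OF cF\<phi>] FuL] unfolding L2_def by simp
        show "integrable disc_measure (\<lambda>x. A\<^sup>2 * (\<phi> k x - u x)\<^sup>2)"
          using L2_diff[OF \<phi>L uL] unfolding L2_def by simp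
        fix x
        have "\<bar>F (\<phi> k x) - F (u x)\<bar>\<^sup>2 \<le> (A * \<bar>\<phi> k x - u x\<bar>)\<^sup>2" by (intro power_mono lip) simp
        then show "(F (\<phi> k x) - F (u x))\<^sup>2 \<le> A\<^sup>2 * (\<phi> k x - u x)\<^sup>2" by (simp add: power_mult_distrib)
      qed
      then show "norm (\<integral>x. (F (\<phi> k x) - F (u x))\<^sup>2 \<partial>disc_measure) \<le> A\<^sup>2 * (\<integral>x. (\<phi> k x - u x)\<^sup>2 \<partial>disc_measure)" by simp
    qed
  qed
  obtain K where K: "K > 0" "\<And>x. x \<in> disc \<Longrightarrow> \<bar>\<psi> x\<bar> \<le> K"
    using continuous_bounded_disc[OF test_function_continuous[OF \<psi>]] by blast
  have ad: "L2 disc_measure (\<lambda>x. partial_deriv (\<phi> k) i x - g x $ i)" for k by (intro L2_diff d\<phi>L gL)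
  have a0: "(\<lambda>k. \<integral>x. \<bar>(partial_deriv (\<phi> k) i x - g x $ i) * 1\<bar> \<partial>disc_measure) \<longlonglongrightarrow> 0"
    by (rule L2_null_mult[OF ad _ \<phi>g]) (simp add: L2_def)
  have bd: "L2 disc_measure (\<lambda>x. \<phi> k x - u x)" for k by (intro L2_diff \<phi>L uL)
  have b0: "(\<lambda>k. \<integral>x. \<bar>(\<phi> k x - u x) * g x $ i\<bar> \<partial>disc_measure) \<longlonglongrightarrow> 0"
    by (rule L2_null_mult[OF bd gL \<phi>u])
  have cL: "L2 disc_measure (\<lambda>x. F' (\<phi> k x) * partial_deriv (\<phi> k) i x)" for k
    by (intro continuous_L2_disc continuous_intros c\<phi> test_function_partial_continuous[OF \<phi>])
  have lim2: "(\<lambda>k. \<integral>x. F' (\<phi> k x) * partial_deriv (\<phi> k) i x * \<psi> x \<partial>disc_measure) \<longlonglongrightarrow> (\<integral>x. F' (u x) * g x $ i * \<psi> x \<partial>disc_measure)"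
  proof (rule tendsto_integral_null_diff)
    have "(\<lambda>k. A * K * (\<integral>x. \<bar>(partial_deriv (\<phi> k) i x - g x $ i) * 1\<bar> \<partial>disc_measure)
        + L * K * (\<integral>x. \<bar>(\<phi> k x - u x) * g x $ i\<bar> \<partial>disc_measure)) \<longlonglongrightarrow> A * K * 0 + L * K * 0"
      by (intro tendsto_intros a0 b0)
    then have lim: "(\<lambda>k. A * K * (\<integral>x. \<bar>(partial_deriv (\<phi> k) i x - g x $ i) * 1\<bar> \<partial>disc_measure)
        + L * K * (\<integral>x. \<bar>(\<phi> k x - u x) * g x $ i\<bar> \<partial>disc_measure)) \<longlonglongrightarrow> 0" by simp
    show i1: "integrable disc_measure (\<lambda>x. F' (\<phi> k x) * partial_deriv (\<phi> k) i x * \<psi> x)" for k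
      by (intro L2_mult cL test_function_L2[OF \<psi>])
    show i2: "integrable disc_measure (\<lambda>x. F' (u x) * g x $ i * \<psi> x)"
      by (intro L2_mult F'g test_function_L2[OF \<psi>])
    show "(\<lambda>k. \<integral>x. \<bar>F' (\<phi> k x) * partial_deriv (\<phi> k) i x * \<psi> x - F' (u x) * g x $ i * \<psi> x\<bar> \<partial>disc_measure) \<longlonglongrightarrow> 0"
    proof (rule Lim_null_comparison[OF _ lim], intro always_eventually allI)
      fix k
      have ia: "integrable disc_measure (\<lambda>x. \<bar>(partial_deriv (\<phi> k) i x - g x $ i) * 1\<bar>)"
        using L2_integrable_disc[OF ad[of k]] by simp
      have ib: "integrable disc_measure (\<lambda>x. \<bar>(\<phi> k x - u x) * g x $ i\<bar>)"
        using L2_mult[OF bd[of k] gL[of i]] by (rule integrable_abs)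
      have "(\<integral>x. \<bar>F' (\<phi> k x) * partial_deriv (\<phi> k) i x * \<psi> x - F' (u x) * g x $ i * \<psi> x\<bar> \<partial>disc_measure)
         \<le> (\<integral>x. A * K * \<bar>(partial_deriv (\<phi> k) i x - g x $ i) * 1\<bar> + L * K * \<bar>(\<phi> k x - u x) * g x $ i\<bar> \<partial>disc_measure)"
      proof (rule integral_mono)
        show "integrable disc_measure (\<lambda>x. \<bar>F' (\<phi> k x) * partial_deriv (\<phi> k) i x * \<psi> x - F' (u x) * g x $ i * \<psi> x\<bar>)"
          by (intro integrable_abs Bochner_Integration.integrable_diff i1 i2)
        show "integrable disc_measure (\<lambda>x. A * K * \<bar>(partial_deriv (\<phi> k) i x - g x $ i) * 1\<bar> + L * K * \<bar>(\<phi> k x - u x) * g x $ i\<bar>)"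
          by (intro Bochner_Integration.integrable_add integrable_mult_right ia ib)
        fix x assume "x \<in> space disc_measure"
        then have x: "x \<in> disc" by simp
        let ?d = "partial_deriv (\<phi> k) i x"
        have "F' (\<phi> k x) * ?d * \<psi> x - F' (u x) * g x $ i * \<psi> x
           = F' (\<phi> k x) * \<psi> x * (?d - g x $ i) + (F' (\<phi> k x) - F' (u x)) * \<psi> x * g x $ i"
          by (simp add: algebra_simps)
        also have "\<bar>\<dots>\<bar> \<le> \<bar>F' (\<phi> k x)\<bar> * \<bar>\<psi> x\<bar> * \<bar>?d - g x $ i\<bar> + \<bar>F' (\<phi> k x) - F' (u x)\<bar> * \<bar>\<psi> x\<bar> * \<bar>g x $ i\<bar>"
          by (rule order_trans[OF abs_triangle_ineq]) (simp add: abs_mult)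
        also have "\<dots> \<le> A * K * \<bar>?d - g x $ i\<bar> + (L * \<bar>\<phi> k x - u x\<bar>) * K * \<bar>g x $ i\<bar>"
          using A0 L0 K by (intro add_mono mult_right_mono mult_mono A K(2)[OF x] L) auto
        finally show "\<bar>F' (\<phi> k x) * ?d * \<psi> x - F' (u x) * g x $ i * \<psi> x\<bar> \<le> A * K * \<bar>(?d - g x $ i) * 1\<bar> + L * K * \<bar>(\<phi> k x - u x) * g x $ i\<bar>"
          by (simp add: abs_mult mult_ac)
      qed
      also have "\<dots> = A * K * (\<integral>x. \<bar>(partial_deriv (\<phi> k) i x - g x $ i) * 1\<bar> \<partial>disc_measure)
        + L * K * (\<integral>x. \<bar>(\<phi> k x - u x) * g x $ i\<bar> \<partial>disc_measure)"
        using ia ib by simp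
      finally show "norm (\<integral>x. \<bar>F' (\<phi> k x) * partial_deriv (\<phi> k) i x * \<psi> x - F' (u x) * g x $ i * \<psi> x\<bar> \<partial>disc_measure) \<le> \<dots>"
        by simp
    qed
  qed
  have "(\<lambda>k. - (\<integral>x. F' (\<phi> k x) * partial_deriv (\<phi> k) i x * \<psi> x \<partial>disc_measure)) \<longlonglongrightarrow> (\<integral>x. F (u x) * partial_deriv \<psi> i x \<partial>disc_measure)"
    using lim1 unfolding ibp .
  from LIMSEQ_unique[OF this tendsto_minus[OF lim2]]
  show "(\<integral>x. F (u x) * partial_deriv \<psi> i x \<partial>disc_measure) = - (\<integral>x. (F' (u x) *\<^sub>R g x) $ i * \<psi> x \<partial>disc_measure)"
    by simp
qed

section \<open>Polar coordinates\<close>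

definition cartesian :: "real \<times> real \<Rightarrow> real^2" where
  "cartesian p = vector [fst p, snd p]"

lemma cartesian_nth [simp]: "cartesian p $ 1 = fst p" "cartesian p $ 2 = snd p"
  by (simp_all add: cartesian_def)

lemma continuous_on_vec2:
  fixes f :: "'a::topological_space \<Rightarrow> real^2"
  assumes "continuous_on S (\<lambda>x. f x $ 1)" "continuous_on S (\<lambda>x. f x $ 2)"
  shows "continuous_on S f"
proof -
  have "continuous_on S (\<lambda>x. \<chi> i. f x $ i)"
  proof (rule continuous_on_vec_lambda)
    fix i :: 2
    show "continuous_on S (\<lambda>x. f x $ i)"
      using exhaust_2[of i] assms by auto
  qed
  then show ?thesis by simp
qed

lemma continuous_cartesian: "continuous_on UNIV cartesian"
  by (rule continuous_on_vec2) (auto intro!: continuous_intros)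

lemma measurable_cartesian [measurable]: "cartesian \<in> borel_measurable borel"
  using continuous_cartesian by (rule borel_measurable_continuous_onI)

lemma measurable_cartesian' [measurable]: "cartesian \<in> borel_measurable (borel \<Otimes>\<^sub>M borel)"
  using measurable_cartesian by (simp add: borel_prod)

lemma measurable_cartesian_compose [measurable (raw)]:
  "f \<in> M \<rightarrow>\<^sub>M borel \<Otimes>\<^sub>M borel \<Longrightarrow> (\<lambda>x. cartesian (f x)) \<in> borel_measurable M"
  by (rule measurable_compose[OF _ measurable_cartesian'])

text \<open>The plane as a type of vectors and the product of two lines carry the same Lebesgue measure.\<close>

lemma lborel_real_2: "lborel = distr (lborel \<Otimes>\<^sub>M lborel) borel cartesian"
proof (rule lborel_eqI)
  fix l u :: "real^2"
  assume lu: "\<And>b. b \<in> Basis \<Longrightarrow> l \<bullet> b \<le> u \<bullet> b"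
  have le: "l $ 1 \<le> u $ 1" "l $ 2 \<le> u $ 2"
    using lu[of "axis 1 1"] lu[of "axis 2 1"] by (auto simp: Basis_real_2 inner_axis)
  have "cartesian -` box l u = {l $ 1 <..< u $ 1} \<times> {l $ 2 <..< u $ 2}"
    by (auto simp: mem_box_cart forall_2)
  then have "emeasure (distr (lborel \<Otimes>\<^sub>M lborel) borel cartesian) (box l u)
      = emeasure (lborel \<Otimes>\<^sub>M lborel) ({l $ 1 <..< u $ 1} \<times> {l $ 2 <..< u $ 2})"
    by (subst emeasure_distr) (simp_all add: space_pair_measure lborel_prod)
  also have "\<dots> = ennreal (u $ 1 - l $ 1) * ennreal (u $ 2 - l $ 2)"
    using le by (subst lborel.emeasure_pair_measure_Times) auto
  also have "\<dots> = ennreal (\<Prod>b\<in>Basis. (u - l) \<bullet> b)"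
  proof -
    have "axis (1::2) (1::real) \<noteq> axis 2 1" by (simp add: axis_eq_axis)
    then show ?thesis
      using le by (simp add: Basis_real_2 inner_axis flip: ennreal_mult)
  qed
  finally show "emeasure (distr (lborel \<Otimes>\<^sub>M lborel) borel cartesian) (box l u) = ennreal (\<Prod>b\<in>Basis. (u - l) \<bullet> b)" .
qed simp

text \<open>The area element \<open>r dr d\<theta>\<close> is split so that the angular factor is a probability measure: angular
  integrals are means, and Jensen's inequality holds for them without constants.\<close>

definition radial_measure :: "real measure" where
  "radial_measure = density lborel (\<lambda>r. ennreal (2 * pi * r) * indicator {0<..<1} r)"

definition angular_measure :: "real measure" where
  "angular_measure = density lborel (\<lambda>\<theta>. ennreal (1 / (2 * pi)) * indicator {- pi<..<pi} \<theta>)"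

lemma sets_radial_measure [simp, measurable_cong]: "sets radial_measure = sets borel"
  by (simp add: radial_measure_def)

lemma sets_angular_measure [simp, measurable_cong]: "sets angular_measure = sets borel"
  by (simp add: angular_measure_def)

lemma space_radial_measure [simp]: "space radial_measure = UNIV"
  by (simp add: radial_measure_def)

lemma space_angular_measure [simp]: "space angular_measure = UNIV"
  by (simp add: angular_measure_def)

lemma emeasure_angular_measure: "emeasure angular_measure UNIV = 1"
proof -
  have "emeasure angular_measure UNIV = ennreal (1 / (2 * pi)) * ennreal (2 * pi)"
    by (simp add: angular_measure_def emeasure_density nn_integral_cmult_indicator)
  also have "\<dots> = 1" by (simp add: ennreal_mult'[symmetric])
  finally show ?thesis .
qed

lemma finite_radial_measure: "finite_measure radial_measure"
proof
  have "emeasure radial_measure UNIV = (\<integral>\<^sup>+ r. ennreal (2 * pi * r) * indicator {0<..<1} r \<partial>lborel)"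
    by (simp add: radial_measure_def emeasure_density)
  also have "\<dots> \<le> (\<integral>\<^sup>+ r. ennreal (2 * pi) * indicator {0<..<1::real} r \<partial>lborel)"
    by (intro nn_integral_mono) (auto simp: indicator_def intro!: ennreal_leI)
  also have "\<dots> < \<infinity>"
    by (simp add: nn_integral_cmult_indicator ennreal_mult_less_top)
  finally show "emeasure radial_measure (space radial_measure) \<noteq> \<infinity>" by simp
qed

interpretation radial: finite_measure radial_measure by (rule finite_radial_measure)

interpretation angular: finite_measure angular_measure
  by standard (simp add: emeasure_angular_measure)

interpretation polar: pair_sigma_finite radial_measure angular_measure ..

lemma polar_nth [simp]: "polar r \<theta> $ 1 = r * cos \<theta>" "polar r \<theta> $ 2 = r * sin \<theta>"
  by (simp_all add: polar_def)

lemma continuous_polar: "continuous_on UNIV (\<lambda>(r, \<theta>). polar r \<theta>)"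
  by (rule continuous_on_vec2) (auto intro!: continuous_intros simp: split_beta)

lemma measurable_polar [measurable]:
  "(\<lambda>(r, \<theta>). polar r \<theta>) \<in> borel_measurable (borel \<Otimes>\<^sub>M borel)"
  using borel_measurable_continuous_onI[OF continuous_polar] by (simp add: borel_prod)

lemma measurable_polar' [measurable (raw)]:
  assumes [measurable]: "f \<in> borel_measurable M" "g \<in> borel_measurable M"
  shows "(\<lambda>x. polar (f x) (g x)) \<in> borel_measurable M"
proof -
  have "(\<lambda>x. (f x, g x)) \<in> M \<rightarrow>\<^sub>M borel \<Otimes>\<^sub>M borel" by measurable
  from measurable_compose[OF this measurable_polar] show ?thesis by simp
qed

lemma norm_vec2: "norm (x :: real^2) = sqrt ((x $ 1)\<^sup>2 + (x $ 2)\<^sup>2)"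
  by (simp add: norm_eq_sqrt_inner inner_vec_def sum_2 power2_eq_square)

lemma norm_polar [simp]: "norm (polar r \<theta>) = \<bar>r\<bar>"
proof -
  have "(r * cos \<theta>)\<^sup>2 + (r * sin \<theta>)\<^sup>2 = r\<^sup>2 * ((cos \<theta>)\<^sup>2 + (sin \<theta>)\<^sup>2)"
    by (simp only: power_mult_distrib distrib_left)
  then show ?thesis by (simp add: norm_vec2)
qed

lemma polar_inj:
  assumes "polar r \<theta> = polar r' \<theta>'" "0 < r" "0 < r'" "\<bar>\<theta> - \<theta>'\<bar> < 2 * pi"
  shows "r = r'" "\<theta> = \<theta>'"
proof -
  have "norm (polar r \<theta>) = norm (polar r' \<theta>')" by (rule arg_cong[OF assms(1)])
  then show r: "r = r'" using assms(2,3) unfolding norm_polar by simp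
  have "polar r \<theta> $ 1 = polar r' \<theta>' $ 1" "polar r \<theta> $ 2 = polar r' \<theta>' $ 2"
    using assms(1) by simp_all
  then have "cos \<theta> = cos \<theta>'" "sin \<theta> = sin \<theta>'" using assms r by simp_all
  then obtain n :: int where n: "\<theta> = \<theta>' + 2 * pi * n"
    using sin_cos_eq_iff[of \<theta> \<theta>'] by auto
  then have "\<bar>2 * pi * n\<bar> < 2 * pi * 1" using assms(4) by simp
  then have "\<bar>real_of_int n\<bar> < 1" by (simp add: abs_mult)
  then have "n = 0" by linarith
  then show "\<theta> = \<theta>'" using n by simp
qed

lemma polar_surj:
  fixes x :: "real^2"
  assumes "\<not> (x $ 2 = 0 \<and> x $ 1 \<le> 0)"
  obtains \<theta> where "- pi < \<theta>" "\<theta> < pi" "x = polar (norm x) \<theta>"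
proof -
  define z where "z = Complex (x $ 1) (x $ 2)"
  have "z \<noteq> 0" using assms by (auto simp: z_def complex_eq_iff)
  have n: "cmod z = norm x" by (simp add: z_def cmod_def norm_vec2)
  have z: "z = rcis (norm x) (Arg z)" using rcis_cmod_Arg[of z] n by simp
  have "x $ 1 = norm x * cos (Arg z)" "x $ 2 = norm x * sin (Arg z)"
    using arg_cong[OF z, of Re] arg_cong[OF z, of Im] by (simp_all add: z_def)
  then have x: "x = polar (norm x) (Arg z)"
    by (simp add: vec_eq_iff forall_2)
  have "Arg z \<noteq> pi"
  proof
    assume "Arg z = pi"
    then have "x $ 1 = - norm x" "x $ 2 = 0"
      using \<open>x $ 1 = _\<close> \<open>x $ 2 = _\<close> by simp_all
    then show False using assms by simp
  qed
  moreover have "- pi < Arg z" "Arg z \<le> pi" using Arg_bounded by auto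
  ultimately show ?thesis using that[of "Arg z"] x by simp
qed

definition strip :: "(real^2) set" where
  "strip = {x. 0 < x $ 1 \<and> x $ 1 < 1 \<and> - pi < x $ 2 \<and> x $ 2 < pi}"

lemma strip_eq: "strip = box (vector [0, - pi]) (vector [1, pi])"
  by (auto simp: strip_def mem_box_cart forall_2)

lemma has_derivative_polar:
  "((\<lambda>x::real^2. polar (x $ 1) (x $ 2)) has_derivative
     (\<lambda>h. vector [cos (x $ 2) * h $ 1 - x $ 1 * sin (x $ 2) * h $ 2,
                  sin (x $ 2) * h $ 1 + x $ 1 * cos (x $ 2) * h $ 2])) (at x within S)"
proof (rule has_derivative_componentwise_within[THEN iffD2], intro ballI)
  fix b :: "real^2" assume b: "b \<in> Basis"
  have c: "((\<lambda>x::real^2. x $ i) has_derivative (\<lambda>h. h $ i)) (at x within S)" for i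
    by (simp add: bounded_linear_vec_nth bounded_linear_imp_has_derivative)
  have 1: "((\<lambda>x::real^2. x $ 1 * cos (x $ 2)) has_derivative
      (\<lambda>h. cos (x $ 2) * h $ 1 - x $ 1 * sin (x $ 2) * h $ 2)) (at x within S)"
    by (rule derivative_eq_intros c refl)+ (auto simp: algebra_simps)
  have 2: "((\<lambda>x::real^2. x $ 1 * sin (x $ 2)) has_derivative
      (\<lambda>h. sin (x $ 2) * h $ 1 + x $ 1 * cos (x $ 2) * h $ 2)) (at x within S)"
    by (rule derivative_eq_intros c refl)+ (auto simp: algebra_simps)
  consider "b = axis 1 1" | "b = axis 2 1" using b by (auto simp: Basis_real_2)
  then show "((\<lambda>x::real^2. polar (x $ 1) (x $ 2) \<bullet> b) has_derivative
     (\<lambda>h. vector [cos (x $ 2) * h $ 1 - x $ 1 * sin (x $ 2) * h $ 2,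
                  sin (x $ 2) * h $ 1 + x $ 1 * cos (x $ 2) * h $ 2] \<bullet> b)) (at x within S)"
    by cases (use 1 2 in \<open>simp_all add: inner_axis\<close>)
qed

text \<open>The change of variables formula for the polar map on the rectangle \<open>strip\<close>; the image misses
  only a segment, which is a null set.\<close>

lemma emeasure_polar_image:
  assumes A: "A \<in> sets borel"
  shows "emeasure lborel (A \<inter> disc)
    = (\<integral>\<^sup>+ x. ennreal (x $ 1) * indicator (strip \<inter> (\<lambda>x. polar (x $ 1) (x $ 2)) -` A) x \<partial>lborel)"
proof -
  let ?P = "\<lambda>x::real^2. polar (x $ 1) (x $ 2)"
  define S where "S = strip \<inter> ?P -` A"
  have contP: "continuous_on UNIV ?P"
    by (rule continuous_on_vec2) (auto intro!: continuous_intros)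
  then have [measurable]: "?P \<in> borel_measurable borel"
    by (rule borel_measurable_continuous_onI)
  have strip[measurable]: "strip \<in> sets borel" by (simp add: strip_eq)
  have S[measurable]: "S \<in> sets borel"
    unfolding S_def using A measurable_sets[of ?P borel borel A] by auto
  have Sl: "S \<in> sets lebesgue" using S by auto
  define P' where "P' x h = (vector [cos (x $ 2) * h $ 1 - x $ 1 * sin (x $ 2) * h $ 2,
                  sin (x $ 2) * h $ 1 + x $ 1 * cos (x $ 2) * h $ 2] :: real^2)" for x h :: "real^2"
  have det: "\<bar>det (matrix (P' x))\<bar> = x $ 1" if "x \<in> S" for x
  proof -
    have "det (matrix (P' x)) = x $ 1 * (cos (x $ 2) * cos (x $ 2)) + x $ 1 * (sin (x $ 2) * sin (x $ 2))"
      by (simp add: det_2 matrix_def P'_def axis_def algebra_simps)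
    also have "\<dots> = x $ 1" by (simp only: distrib_left[symmetric] sin_cos_squared_add3 mult_1_right)
    finally have "det (matrix (P' x)) = x $ 1" .
    then show ?thesis using that by (simp add: S_def strip_def)
  qed
  have inj: "inj_on ?P S"
  proof (rule inj_onI)
    fix x y assume xy: "x \<in> S" "y \<in> S" "?P x = ?P y"
    then have "x $ 1 = y $ 1" "x $ 2 = y $ 2"
      using polar_inj[of "x $ 1" "x $ 2" "y $ 1" "y $ 2"] by (auto simp: S_def strip_def)
    then show "x = y" by (simp add: vec_eq_iff forall_2)
  qed
  have Slm: "S \<in> lmeasurable"
    by (rule fmeasurableI2[of strip]) (auto simp: S_def strip_eq Sl[unfolded S_def strip_eq])
  have int: "integrable lborel (\<lambda>x. x $ 1 * indicator S x)"
  proof (rule Bochner_Integration.integrable_bound)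
    show "integrable lborel (\<lambda>x::real^2. indicator strip x :: real)"
      using emeasure_lborel_box_finite[of "vector [0, - pi] :: real^2" "vector [1, pi]"]
      by (intro integrable_real_indicator) (auto simp: strip_eq)
    show "AE x in lborel. norm (x $ 1 * indicator S x :: real) \<le> norm (indicator strip x :: real)"
      by (auto simp: S_def strip_def indicator_def)
  qed measurable
  have hk: "((\<lambda>x. x $ 1 * indicator S x) has_integral (\<integral>x. x $ 1 * indicator S x \<partial>lborel)) UNIV"
    by (rule has_integral_integral_lborel[OF int])
  then have "((\<lambda>x. if x \<in> S then x $ 1 else 0) has_integral (\<integral>x. x $ 1 * indicator S x \<partial>lborel)) UNIV"
    by (rule has_integral_eq[rotated]) (auto simp: indicator_def)
  then have "((\<lambda>x. x $ 1) has_integral (\<integral>x. x $ 1 * indicator S x \<partial>lborel)) S"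
    by (simp add: has_integral_restrict_UNIV)
  then have hd: "((\<lambda>x. \<bar>det (matrix (P' x))\<bar>) has_integral (\<integral>x. x $ 1 * indicator S x \<partial>lborel)) S"
    by (rule has_integral_eq[rotated]) (simp add: det)
  have der: "(?P has_derivative P' x) (at x within S)" for x
    using has_derivative_polar[of x S] unfolding P'_def .
  have m: "measure lebesgue (?P ` S) = (\<integral>x. x $ 1 * indicator S x \<partial>lborel)"
    using measure_differentiable_image_eq[OF Sl der inj] hd
    by (simp add: has_integral_integrable integral_unique)
  have "?P ` S \<in> lmeasurable"
    by (rule measurable_differentiable_image[OF Sl der has_integral_integrable[OF hd]])
  then have "emeasure lebesgue (?P ` S) = ennreal (\<integral>x. x $ 1 * indicator S x \<partial>lborel)"
    unfolding m[symmetric] by (intro emeasure_eq_ennreal_measure fmeasurableD2)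
  also have "\<dots> = (\<integral>\<^sup>+ x. ennreal (x $ 1 * indicator S x) \<partial>lborel)"
    by (rule nn_integral_eq_integral[OF int, symmetric]) (auto simp: S_def strip_def indicator_def)
  also have "\<dots> = (\<integral>\<^sup>+ x. ennreal (x $ 1) * indicator S x \<partial>lborel)"
    by (intro nn_integral_cong) (auto simp: indicator_def)
  finally have e: "emeasure lebesgue (?P ` S) = (\<integral>\<^sup>+ x. ennreal (x $ 1) * indicator S x \<partial>lborel)" .
  define L where "L = {x::real^2. x $ 2 = 0}"
  have L: "L \<in> null_sets lebesgue"
  proof -
    have "negligible {x::real^2. axis 2 1 \<bullet> x = 0}"
      by (rule negligible_hyperplane) (simp add: axis_eq_0_iff)
    then show ?thesis by (simp add: L_def inner_axis' negligible_iff_null_sets)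
  qed
  have img: "?P ` S \<union> (A \<inter> disc \<inter> L) = A \<inter> disc"
  proof (intro equalityI subsetI)
    fix y assume "y \<in> ?P ` S \<union> (A \<inter> disc \<inter> L)"
    then show "y \<in> A \<inter> disc" by (auto simp: S_def strip_def)
  next
    fix y assume y: "y \<in> A \<inter> disc"
    show "y \<in> ?P ` S \<union> (A \<inter> disc \<inter> L)"
    proof (cases "y \<in> L")
      case False
      then obtain \<theta> where t: "- pi < \<theta>" "\<theta> < pi" "y = polar (norm y) \<theta>"
        using polar_surj[of y] by (auto simp: L_def)
      have "y \<noteq> 0" using False by (auto simp: L_def)
      have P: "y = ?P (vector [norm y, \<theta>])" using t by simp
      have "vector [norm y, \<theta>] \<in> strip"
        using t(1,2) y \<open>y \<noteq> 0\<close> by (simp add: strip_def)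
      moreover have "?P (vector [norm y, \<theta>]) \<in> A" using y P by simp
      ultimately have "vector [norm y, \<theta>] \<in> S" by (simp add: S_def)
      then have "?P (vector [norm y, \<theta>]) \<in> ?P ` S" by (rule imageI)
      then show ?thesis using P by simp
    qed (use y in auto)
  qed
  have "A \<inter> disc \<inter> L \<in> null_sets lebesgue"
    by (rule null_sets_completion_subset[OF _ L]) auto
  then have "emeasure lebesgue (?P ` S \<union> (A \<inter> disc \<inter> L)) = emeasure lebesgue (?P ` S)"
    using \<open>?P ` S \<in> lmeasurable\<close> by (intro emeasure_Un_null_set) auto
  then have "emeasure lebesgue (A \<inter> disc) = emeasure lebesgue (?P ` S)" using img by simp
  then show ?thesis using e A by (simp add: S_def)
qed

lemma lborel_disc_polar:
  "density lborel (indicator disc)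
     = distr (radial_measure \<Otimes>\<^sub>M angular_measure) borel (\<lambda>(r, \<theta>). polar r \<theta>)" (is "?L = ?R")
proof (rule measure_eqI)
  show "sets ?L = sets ?R" by simp
  fix A assume "A \<in> sets ?L"
  then have A[measurable]: "A \<in> sets borel" by simp
  have [measurable]: "strip \<in> sets borel" by (simp add: strip_eq)
  have disc[measurable]: "disc \<in> sets borel" by simp
  have "emeasure ?L A = emeasure lborel (A \<inter> disc)"
    by (simp add: emeasure_density Int_commute flip: indicator_inter_arith)
  also have "\<dots> = (\<integral>\<^sup>+ x. ennreal (x $ 1) * indicator (strip \<inter> (\<lambda>x. polar (x $ 1) (x $ 2)) -` A) x \<partial>lborel)"
    by (rule emeasure_polar_image[OF A])
  also have "\<dots> = (\<integral>\<^sup>+ x. ennreal (x $ 1) * indicator strip x * indicator A (polar (x $ 1) (x $ 2)) \<partial>lborel)"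
    by (intro nn_integral_cong) (auto simp: indicator_def)
  also have "\<dots> = (\<integral>\<^sup>+ p. ennreal (fst p) * indicator strip (cartesian p) * indicator A (polar (fst p) (snd p)) \<partial>(lborel \<Otimes>\<^sub>M lborel))"
    by (subst lborel_real_2, subst nn_integral_distr) (auto simp: lborel_prod)
  also have "\<dots> = (\<integral>\<^sup>+ r. \<integral>\<^sup>+ \<theta>. ennreal r * indicator strip (cartesian (r, \<theta>)) * indicator A (polar r \<theta>) \<partial>lborel \<partial>lborel)"
    by (subst lborel.nn_integral_fst[symmetric]) auto
  also have "\<dots> = (\<integral>\<^sup>+ r. \<integral>\<^sup>+ \<theta>. (ennreal (2 * pi * r) * indicator {0<..<1} r) * (ennreal (1 / (2 * pi)) * indicator {- pi<..<pi} \<theta> * indicator A (polar r \<theta>)) \<partial>lborel \<partial>lborel)"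
  proof (intro nn_integral_cong)
    fix r \<theta> :: real
    have "ennreal r = ennreal (2 * pi * r) * ennreal (1 / (2 * pi))"
      by (simp add: ennreal_mult''[symmetric])
    then show "ennreal r * indicator strip (cartesian (r, \<theta>)) * indicator A (polar r \<theta>)
      = (ennreal (2 * pi * r) * indicator {0<..<1} r) * (ennreal (1 / (2 * pi)) * indicator {- pi<..<pi} \<theta> * indicator A (polar r \<theta>))"
      by (auto simp: indicator_def strip_def)
  qed
  also have "\<dots> = (\<integral>\<^sup>+ r. (ennreal (2 * pi * r) * indicator {0<..<1} r) * (\<integral>\<^sup>+ \<theta>. indicator A (polar r \<theta>) \<partial>angular_measure) \<partial>lborel)"
    by (intro nn_integral_cong) (simp add: nn_integral_cmult angular_measure_def nn_integral_density)
  also have "\<dots> = (\<integral>\<^sup>+ r. \<integral>\<^sup>+ \<theta>. indicator A (polar r \<theta>) \<partial>angular_measure \<partial>radial_measure)"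
    unfolding radial_measure_def
    by (subst nn_integral_density) (auto intro!: angular.borel_measurable_nn_integral)
  also have "\<dots> = (\<integral>\<^sup>+ p. indicator A (polar (fst p) (snd p)) \<partial>(radial_measure \<Otimes>\<^sub>M angular_measure))"
    by (subst angular.nn_integral_fst[symmetric]) auto
  also have "\<dots> = (\<integral>\<^sup>+ p. indicator ((\<lambda>(r, \<theta>). polar r \<theta>) -` A \<inter> space (radial_measure \<Otimes>\<^sub>M angular_measure)) p
      \<partial>(radial_measure \<Otimes>\<^sub>M angular_measure))"
    by (intro nn_integral_cong) (auto simp: indicator_def space_pair_measure)
  also have "\<dots> = emeasure (radial_measure \<Otimes>\<^sub>M angular_measure)
      ((\<lambda>(r, \<theta>). polar r \<theta>) -` A \<inter> space (radial_measure \<Otimes>\<^sub>M angular_measure))"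
    by (intro nn_integral_indicator measurable_sets[OF _ A]) measurable
  also have "\<dots> = emeasure ?R A"
    by (intro emeasure_distr[symmetric] A) measurable
  finally show "emeasure ?L A = emeasure ?R A" .
qed

section \<open>Two inequalities for radial functions\<close>

lemma max_0_square_deriv:
  "((\<lambda>y::real. (max y 0)\<^sup>2) has_real_derivative 2 * max t 0) (at t)"
proof -
  consider "t > 0" | "t < 0" | "t = 0" by linarith
  then show ?thesis
  proof cases
    case 1
    have "((\<lambda>y. y\<^sup>2) has_real_derivative 2 * t) (at t)" by (auto intro!: derivative_eq_intros)
    then have "((\<lambda>y::real. (max y 0)\<^sup>2) has_real_derivative 2 * t) (at t)"
      by (rule has_field_derivative_transform_within_open[where S = "{0<..}"]) (use 1 in auto)
    then show ?thesis using 1 by simp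
  next
    case 2
    have "((\<lambda>y::real. 0) has_real_derivative 0) (at t)" by simp
    then have "((\<lambda>y::real. (max y 0)\<^sup>2) has_real_derivative 0) (at t)"
      by (rule has_field_derivative_transform_within_open[where S = "{..<0}"]) (use 2 in auto)
    then show ?thesis using 2 by simp
  next
    case 3
    have id0: "((\<lambda>y::real. \<bar>y\<bar>) \<longlongrightarrow> 0) (at 0)" by (rule tendsto_eq_intros refl | simp)+
    have "((\<lambda>y::real. ((max y 0)\<^sup>2 - (max 0 0)\<^sup>2) / (y - 0)) \<longlongrightarrow> 0) (at 0)"
    proof (rule Lim_null_comparison[OF _ id0], intro always_eventually allI)
      fix y :: real
      show "norm (((max y 0)\<^sup>2 - (max 0 0)\<^sup>2) / (y - 0)) \<le> \<bar>y\<bar>"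
        by (auto simp: max_def power2_eq_square)
    qed
    then show ?thesis using 3 by (simp add: has_field_derivative_iff)
  qed
qed

lemma radial_measure_AE: "AE r in radial_measure. 0 < r \<and> r < 1"
  unfolding radial_measure_def by (subst AE_density) (auto simp: indicator_def)

text \<open>For bounded functions the measure \<open>radial_measure\<close> is reduced to an ordinary integral, to
  which the fundamental theorem of calculus applies.\<close>

lemma radial_integral:
  fixes f :: "real \<Rightarrow> real"
  assumes [measurable]: "f \<in> borel_measurable borel" and K: "\<And>r. 0 \<le> r \<Longrightarrow> r \<le> 1 \<Longrightarrow> \<bar>f r\<bar> \<le> K"
  shows "integrable radial_measure f"
    and "((\<lambda>r. r * f r) has_integral (\<integral>r. f r \<partial>radial_measure) / (2 * pi)) {0..1}"
proof -
  show i: "integrable radial_measure f"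
  proof (rule radial.integrable_const_bound[where B = K])
    show "AE r in radial_measure. norm (f r) \<le> K" using radial_measure_AE by eventually_elim (auto intro!: K)
  qed measurable
  have d: "radial_measure = density lborel (\<lambda>r. ennreal (2 * pi * (r * indicator {0<..<1} r)))"
    unfolding radial_measure_def by (intro density_cong) (auto simp: indicator_def)
  have nn: "AE r in lborel. 0 \<le> 2 * pi * (r * indicator {0<..<1} r :: real)"
    by (intro AE_I2) (auto simp: indicator_def)
  have i2: "integrable lborel (\<lambda>r. 2 * pi * (r * indicator {0<..<1} r) * f r)"
  proof -
    have "integrable (density lborel (\<lambda>r. ennreal (2 * pi * (r * indicator {0<..<1} r)))) f
        \<longleftrightarrow> integrable lborel (\<lambda>r. (2 * pi * (r * indicator {0<..<1} r)) *\<^sub>R f r)"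
      by (rule integrable_density[OF _ _ nn]) measurable
    then show ?thesis using i unfolding d by simp
  qed
  have e2: "(\<integral>r. f r \<partial>radial_measure) = (\<integral>r. 2 * pi * (r * indicator {0<..<1} r) * f r \<partial>lborel)"
  proof -
    have "(\<integral>r. f r \<partial>density lborel (\<lambda>r. ennreal (2 * pi * (r * indicator {0<..<1} r))))
        = (\<integral>r. (2 * pi * (r * indicator {0<..<1} r)) *\<^sub>R f r \<partial>lborel)"
      by (rule integral_density[OF _ _ nn]) measurable
    then show ?thesis unfolding d by simp
  qed
  have ae: "AE r in lborel. 2 * pi * (r * indicator {0<..<1} r) * f r = 2 * pi * (indicator {0..1} r * (r * f r))"
    using AE_lborel_singleton[of "1::real"] by eventually_elim (auto simp: indicator_def)
  have i3: "integrable lborel (\<lambda>r. 2 * pi * (indicator {0..1} r * (r * f r)))"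
  proof -
    have "integrable lborel (\<lambda>r. 2 * pi * (r * indicator {0<..<1} r) * f r)
        \<longleftrightarrow> integrable lborel (\<lambda>r. 2 * pi * (indicator {0..1} r * (r * f r)))"
      by (rule integrable_cong_AE[OF _ _ ae]) measurable
    then show ?thesis using i2 by blast
  qed
  have i4: "integrable lborel (\<lambda>r. indicator {0..1} r * (r * f r))"
    using integrable_mult_right[of "1 / (2 * pi)", OF i3] by simp
  have "(\<integral>r. f r \<partial>radial_measure) = (\<integral>r. 2 * pi * (indicator {0..1} r * (r * f r)) \<partial>lborel)"
    unfolding e2
  proof (rule integral_cong_AE)
    show "AE r in lborel. 2 * pi * (r * indicator {0<..<1} r) * f r = 2 * pi * (indicator {0..1} r * (r * f r))"
      by (rule ae)
  qed measurable
  then have e3: "(\<integral>r. f r \<partial>radial_measure) / (2 * pi) = (\<integral>r. indicator {0..1} r * (r * f r) \<partial>lborel)" by simp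
  have "((\<lambda>r. indicator {0..1} r * (r * f r)) has_integral (\<integral>r. f r \<partial>radial_measure) / (2 * pi)) UNIV"
    unfolding e3 by (rule has_integral_integral_lborel[OF i4])
  then have "((\<lambda>r. if r \<in> {0..1} then r * f r else 0) has_integral (\<integral>r. f r \<partial>radial_measure) / (2 * pi)) UNIV"
    by (rule has_integral_eq[rotated]) (auto simp: indicator_def)
  then show "((\<lambda>r. r * f r) has_integral (\<integral>r. f r \<partial>radial_measure) / (2 * pi)) {0..1}"
    by (simp only: has_integral_restrict_UNIV)
qed

text \<open>At a simple zero of \<open>\<psi>\<close> the numerator vanishes to second order and the denominator to first order.\<close>

lemma tendsto_square_quotient:
  fixes F \<psi> p :: "real \<Rightarrow> real"
  assumes F: "(F has_real_derivative d) (at a)" and \<psi>: "(\<psi> has_real_derivative e) (at a)"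
    and e: "e \<noteq> 0" and \<psi>0: "\<psi> a = 0" and p: "\<And>r. \<bar>p r\<bar> \<le> \<bar>F r - F a\<bar>"
  shows "((\<lambda>r. (p r)\<^sup>2 / \<psi> r) \<longlongrightarrow> 0) (at a)"
proof -
  have Fa: "((\<lambda>r. F r - F a) \<longlongrightarrow> F a - F a) (at a)"
    using DERIV_isCont[OF F] by (intro tendsto_intros) (simp add: isCont_def)
  have "((\<lambda>r. (F r - F a) / (r - a) * (F r - F a) / ((\<psi> r - \<psi> a) / (r - a))) \<longlongrightarrow> d * (F a - F a) / e) (at a)"
    using F \<psi> unfolding has_field_derivative_iff by (intro tendsto_intros Fa e)
  then have l: "((\<lambda>r. \<bar>(F r - F a) / (r - a) * (F r - F a) / ((\<psi> r - \<psi> a) / (r - a))\<bar>) \<longlongrightarrow> 0) (at a)"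
    using tendsto_rabs by fastforce
  show ?thesis
  proof (rule Lim_null_comparison[OF _ l], unfold eventually_at_filter, intro always_eventually allI impI)
    fix r assume "r \<noteq> a"
    then have "(F r - F a) / (r - a) * (F r - F a) / ((\<psi> r - \<psi> a) / (r - a)) = (F r - F a)\<^sup>2 / \<psi> r"
      by (simp add: \<psi>0 power2_eq_square)
    moreover have "(p r)\<^sup>2 \<le> (F r - F a)\<^sup>2" using p[of r] by (simp add: abs_le_square_iff)
    ultimately show "norm ((p r)\<^sup>2 / \<psi> r) \<le> \<bar>(F r - F a) / (r - a) * (F r - F a) / ((\<psi> r - \<psi> a) / (r - a))\<bar>"
      by (simp add: divide_right_mono abs_divide)
  qed
qed

lemma bounded_on_unit_interval:
  fixes f :: "real \<Rightarrow> real"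
  assumes "continuous_on UNIV f"
  obtains K where "K > 0" "\<And>r. 0 \<le> r \<Longrightarrow> r \<le> 1 \<Longrightarrow> \<bar>f r\<bar> \<le> K"
proof -
  have "compact (f ` {0..1})"
    using assms by (intro compact_continuous_image) (auto intro: continuous_on_subset)
  then obtain K where "K > 0" "\<forall>y\<in>f ` {0..1}. norm y \<le> K"
    using compact_imp_bounded bounded_pos by blast
  then show ?thesis using that[of K] by auto
qed

text \<open>Picone's identity. With \<open>Q = r \<psi>'\<close> the derivative of \<open>p\<^sup>2 Q / \<psi>\<close>, where \<open>p\<close> is the positive part of
  \<open>F\<close>, equals \<open>r (p')\<^sup>2 - \<Lambda> r\<^bsup>1+\<alpha>\<^esup> p\<^sup>2 - r (p' - p \<psi>' / \<psi>)\<^sup>2\<close>. Its integral is zero: the quotient extends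
  continuously by 0 to the two zeros of \<open>\<psi>\<close>, as \<open>p\<close> vanishes there. Dropping the square gives the
  inequality.\<close>

lemma radial_picone:
  fixes F D :: "real \<Rightarrow> real" and \<alpha> \<kappa> r0 :: real
  defines "\<gamma> \<equiv> (2 + \<alpha>) / 2"
  defines "\<psi> \<equiv> \<lambda>r. bessel_series 0 (\<kappa>\<^sup>2 / 4 * r powr (2 * \<gamma>))"
  assumes \<alpha>: "\<alpha> \<ge> 0" and \<kappa>: "\<kappa> > 0" and r0: "0 < r0" "r0 < 1"
    and zeros: "\<And>r. 0 \<le> r \<Longrightarrow> r \<le> 1 \<Longrightarrow> \<psi> r = 0 \<longleftrightarrow> r = r0 \<or> r = 1"
    and F: "\<And>r. (F has_real_derivative D r) (at r)" and D: "continuous_on UNIV D"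
    and F1: "F 1 = 0" and Fr0: "F r0 \<le> 0"
  shows "(\<gamma> * \<kappa>)\<^sup>2 * (\<integral>r. r powr \<alpha> * (max (F r) 0)\<^sup>2 \<partial>radial_measure)
     \<le> (\<integral>r. (if F r > 0 then D r else 0)\<^sup>2 \<partial>radial_measure)"
proof -
  define lam where "lam = (\<gamma> * \<kappa>)\<^sup>2"
  define p where "p r = max (F r) 0" for r
  define t where "t r = \<kappa>\<^sup>2 / 4 * r powr (2 * \<gamma>)" for r
  define Q where "Q r = 2 * \<gamma> * (t r * bessel_series' 0 (t r))" for r
  have \<gamma>: "\<gamma> \<ge> 1" using \<alpha> by (simp add: \<gamma>_def)
  have contF: "continuous_on UNIV F" using F by (intro DERIV_continuous_on) (auto intro: has_field_derivative_at_within)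
  have Fm[measurable]: "F \<in> borel_measurable borel" and Dm[measurable]: "D \<in> borel_measurable borel"
    using contF D by (auto intro: borel_measurable_continuous_onI)
  have t': "(t has_real_derivative 2 * \<gamma> * t r / r) (at r)" if "r > 0" for r
  proof -
    have "(t has_real_derivative \<kappa>\<^sup>2 / 4 * (2 * \<gamma> * r powr (2 * \<gamma> - 1))) (at r)"
      unfolding t_def by (intro DERIV_cmult has_real_derivative_powr that)
    then show ?thesis using that by (simp add: t_def powr_diff)
  qed
  have \<psi>': "(\<psi> has_real_derivative Q r / r) (at r)" if "r > 0" for r
  proof -
    have "((\<lambda>r. bessel_series 0 (t r)) has_real_derivative bessel_series' 0 (t r) * (2 * \<gamma> * t r / r)) (at r)"
      by (rule bessel_series_has_deriv[OF _ t'[OF that]]) simp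
    moreover have "\<psi> = (\<lambda>r. bessel_series 0 (t r))" by (simp add: \<psi>_def t_def)
    ultimately show ?thesis by (simp add: Q_def mult_ac)
  qed
  have Q': "(Q has_real_derivative - lam * r powr (1 + \<alpha>) * \<psi> r) (at r)" if "r > 0" for r
  proof -
    have "((\<lambda>s. s * bessel_series' 0 s) has_real_derivative - bessel_series 0 (t r)) (at (t r))"
      using bessel_ode[of 0 "t r" UNIV] by simp
    from DERIV_cmult[OF DERIV_chain2[OF this t'[OF that]], of "2 * \<gamma>"]
    have "(Q has_real_derivative 2 * \<gamma> * (- bessel_series 0 (t r) * (2 * \<gamma> * t r / r))) (at r)"
      by (simp add: Q_def[abs_def])
    moreover have "r powr (1 + \<alpha>) = r powr (2 * \<gamma>) / r"
    proof -
      have "2 * \<gamma> = (1 + \<alpha>) + 1" by (simp add: \<gamma>_def)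
      then have "r powr (2 * \<gamma>) = r powr (1 + \<alpha>) * r powr 1" by (simp only: powr_add)
      then show ?thesis using that by simp
    qed
    ultimately show ?thesis
      using that by (simp add: \<psi>_def t_def[symmetric] lam_def power2_eq_square) (simp add: t_def power2_eq_square field_simps)
  qed
  have contt: "continuous_on {0..1} t"
    unfolding t_def using \<gamma> by (intro continuous_intros continuous_on_powr') auto
  have cont\<psi>: "continuous_on {0..1} \<psi>"
    unfolding \<psi>_def t_def[symmetric] by (intro continuous_intros contt) simp
  have contQ: "continuous_on {0..1} Q"
    unfolding Q_def by (intro continuous_intros contt) simp
  have contp: "continuous_on S p" for S
    unfolding p_def by (intro continuous_intros continuous_on_subset[OF contF]) simp
  have p2': "((\<lambda>r. (p r)\<^sup>2) has_real_derivative 2 * p r * D r) (at r)" for r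
    using DERIV_chain2[OF max_0_square_deriv F[of r]] by (simp add: p_def)
  define H where "H r = (p r)\<^sup>2 / \<psi> r * Q r" for r
  have Hlim: "(H \<longlongrightarrow> H a) (at a within {0..1})" if a: "a = r0 \<or> a = 1" for a
  proof -
    have a01: "0 < a" "a \<le> 1" using a r0 by auto
    have \<psi>a: "\<psi> a = 0" using zeros a r0 by auto
    have ta: "t a > 0" using a01 \<kappa> by (simp add: t_def)
    have "bessel_series' 0 (t a) \<noteq> 0"
      using \<psi>a by (intro bessel_series_simple_zeros ta) (auto simp: \<psi>_def t_def)
    then have Qa: "Q a / a \<noteq> 0" using ta \<gamma> a01 by (simp add: Q_def)
    have Fa: "F a \<le> 0" using a F1 Fr0 by auto
    have "((\<lambda>r. (p r)\<^sup>2 / \<psi> r) \<longlongrightarrow> 0) (at a)"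
      by (rule tendsto_square_quotient[OF F \<psi>'[OF a01(1)] Qa \<psi>a]) (use Fa in \<open>auto simp: p_def max_def\<close>)
    then have "((\<lambda>r. (p r)\<^sup>2 / \<psi> r) \<longlongrightarrow> 0) (at a within {0..1})"
      by (rule tendsto_within_subset) simp
    moreover have "(Q \<longlongrightarrow> Q a) (at a within {0..1})"
      using contQ a01 by (auto simp: continuous_on)
    ultimately have "(H \<longlongrightarrow> 0 * Q a) (at a within {0..1})"
      unfolding H_def by (rule tendsto_mult)
    then show ?thesis using \<psi>a by (simp add: H_def)
  qed
  have contH: "continuous_on {0..1} H"
    unfolding continuous_on
  proof
    fix a :: real assume a: "a \<in> {0..1}"
    show "(H \<longlongrightarrow> H a) (at a within {0..1})"
    proof (cases "a = r0 \<or> a = 1")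
      case False
      then have "\<psi> a \<noteq> 0" using zeros a by auto
      moreover have "(\<psi> \<longlongrightarrow> \<psi> a) (at a within {0..1})" "(Q \<longlongrightarrow> Q a) (at a within {0..1})" "(p \<longlongrightarrow> p a) (at a within {0..1})"
        using cont\<psi> contQ contp[of "{0..1}"] a by (auto simp: continuous_on)
      ultimately show ?thesis unfolding H_def by (intro tendsto_intros)
    qed (rule Hlim)
  qed
  define h where "h r = (2 * p r * D r * \<psi> r - (p r)\<^sup>2 * (Q r / r)) / (\<psi> r * \<psi> r) * Q r + (- lam * r powr (1 + \<alpha>) * \<psi> r) * ((p r)\<^sup>2 / \<psi> r)" for r
  have H': "(H has_vector_derivative h r) (at r)" if "r \<in> {0<..<1} - {r0}" for r
  proof -
    have r: "r > 0" "\<psi> r \<noteq> 0" using that zeros by auto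
    have "(H has_real_derivative h r) (at r)"
      unfolding H_def h_def by (intro DERIV_mult DERIV_divide p2' \<psi>' Q' r)
    then show ?thesis by (simp add: has_real_derivative_iff_has_vector_derivative)
  qed
  have "(h has_integral (H 1 - H 0)) {0..1}"
    by (rule fundamental_theorem_of_calculus_interior_strong[of "{r0}"]) (use contH H' in auto)
  moreover have "H 1 = 0" using zeros[of 1] by (simp add: H_def)
  moreover have "H 0 = 0" by (simp add: H_def Q_def t_def)
  ultimately have hint: "(h has_integral 0) {0..1}" by simp
  define g where "g r = (if F r > 0 then D r else 0)" for r
  have gm[measurable]: "g \<in> borel_measurable borel" unfolding g_def by measurable
  have pm[measurable]: "p \<in> borel_measurable borel" unfolding p_def by measurable
  obtain K where K: "\<And>r. 0 \<le> r \<Longrightarrow> r \<le> 1 \<Longrightarrow> \<bar>D r\<bar> \<le> K" using bounded_on_unit_interval[OF D] by blast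
  obtain K' where K': "\<And>r. 0 \<le> r \<Longrightarrow> r \<le> 1 \<Longrightarrow> \<bar>F r\<bar> \<le> K'" using bounded_on_unit_interval[OF contF] by blast
  have Kb: "\<bar>(g r)\<^sup>2\<bar> \<le> K\<^sup>2" if "0 \<le> r" "r \<le> 1" for r
    using power_mono[of "\<bar>D r\<bar>" K 2] K[OF that] by (simp add: g_def)
  have K'b: "\<bar>r powr \<alpha> * (p r)\<^sup>2\<bar> \<le> K'\<^sup>2" if "0 \<le> r" "r \<le> 1" for r
  proof -
    have "\<bar>p r\<bar> \<le> K'" using K'[OF that] by (auto simp: p_def max_def)
    then have "(p r)\<^sup>2 \<le> K'\<^sup>2" using power_mono[of "\<bar>p r\<bar>" K' 2] by simp
    moreover have "r powr \<alpha> \<le> 1" using that \<alpha> by (simp add: powr_le1)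
    ultimately have "r powr \<alpha> * (p r)\<^sup>2 \<le> 1 * K'\<^sup>2" by (intro mult_mono) auto
    then show ?thesis by (simp add: abs_mult)
  qed
  define I where "I = (\<integral>r. (g r)\<^sup>2 \<partial>radial_measure)"
  define J where "J = (\<integral>r. r powr \<alpha> * (p r)\<^sup>2 \<partial>radial_measure)"
  have i1: "((\<lambda>r. r * (g r)\<^sup>2) has_integral I / (2 * pi)) {0..1}"
    unfolding I_def by (rule radial_integral(2)[where K = "K\<^sup>2", OF _ Kb]) auto
  have i2: "((\<lambda>r. r * (r powr \<alpha> * (p r)\<^sup>2)) has_integral J / (2 * pi)) {0..1}"
    unfolding J_def by (rule radial_integral(2)[where K = "K'\<^sup>2", OF _ K'b]) auto
  define k where "k r = r * (g r)\<^sup>2 - lam * (r * (r powr \<alpha> * (p r)\<^sup>2))" for r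
  have kint: "(k has_integral I / (2 * pi) - lam * (J / (2 * pi))) {0..1}"
    unfolding k_def by (intro has_integral_diff has_integral_mult_right i1 i2)
  have "h r \<le> k r" if "r \<in> {0..1} - {0, r0, 1}" for r
  proof (cases "F r > 0")
    case False
    then have "p r = 0" "g r = 0" by (auto simp: p_def g_def)
    then show ?thesis by (simp add: h_def k_def)
  next
    case True
    have r: "r > 0" "\<psi> r \<noteq> 0" using that zeros by auto
    have pg: "p r = F r" "g r = D r" using True by (auto simp: p_def g_def)
    have e: "r powr (1 + \<alpha>) = r * r powr \<alpha>" using r by (simp add: powr_add)
    \<comment> \<open>the square in Picone's identity\<close>
    have "k r - h r = r * (D r - F r * Q r / (r * \<psi> r))\<^sup>2"
      unfolding k_def h_def pg e using r by (simp add: field_simps power2_eq_square)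
    moreover have "\<dots> \<ge> 0" using r by simp
    ultimately show ?thesis by linarith
  qed
  then have le: "(if r \<in> {0, r0, 1} then k r else h r) \<le> k r" if "r \<in> {0..1}" for r using that by auto
  have "((\<lambda>r. if r \<in> {0, r0, 1} then k r else h r) has_integral 0) {0..1}"
    by (rule has_integral_spike_finite[OF _ _ hint, of "{0, r0, 1}"]) auto
  from has_integral_le[OF this kint] le have "0 \<le> I / (2 * pi) - lam * (J / (2 * pi))" by auto
  then have "lam * J \<le> I" by (simp add: field_simps)
  then show ?thesis by (simp add: lam_def I_def J_def g_def p_def)
qed

text \<open>A Ladyzhenskaya inequality. Let \<open>I\<close>, \<open>Q\<close> and \<open>A\<close> be the integrals of \<open>|p p'|\<close>, \<open>p\<^sup>2\<close> and \<open>(p')\<^sup>2\<close> with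
  weight \<open>r\<close>, where \<open>p\<close> is the positive part of \<open>F\<close>. Since \<open>p\<close> vanishes at 1, integrating the derivatives of \<open>p\<^sup>2\<close>
  and of \<open>r p\<^sup>2\<close> bounds \<open>r p\<^sup>2\<close> and \<open>\<integral>p\<^sup>2 dr\<close> by \<open>2 I\<close>, so that \<open>Q \<le> 2 I\<close> and the integral of \<open>r p\<^sup>4\<close> is at most
  \<open>4 I\<^sup>2\<close>. Together with \<open>I\<^sup>2 \<le> Q A\<close> this yields \<open>I \<le> 2 A\<close>.\<close>

lemma radial_ladyzhenskaya:
  fixes F D :: "real \<Rightarrow> real"
  assumes F: "\<And>r. (F has_real_derivative D r) (at r)" and D: "continuous_on UNIV D"
    and F1: "F 1 = 0"
  shows "(\<integral>r. (max (F r) 0) ^ 4 \<partial>radial_measure)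
     \<le> 16 * (\<integral>r. (if F r > 0 then D r else 0)\<^sup>2 \<partial>radial_measure)\<^sup>2"
proof -
  define p where "p r = max (F r) 0" for r
  define g where "g r = (if F r > 0 then D r else 0)" for r
  have contF: "continuous_on UNIV F" using F by (intro DERIV_continuous_on) (auto intro: has_field_derivative_at_within)
  have Fm[measurable]: "F \<in> borel_measurable borel" and Dm[measurable]: "D \<in> borel_measurable borel"
    using contF D by (auto intro: borel_measurable_continuous_onI)
  have gm[measurable]: "g \<in> borel_measurable borel" unfolding g_def by measurable
  have pm[measurable]: "p \<in> borel_measurable borel" unfolding p_def by measurable
  have contp: "continuous_on S p" for S
    unfolding p_def by (intro continuous_intros continuous_on_subset[OF contF]) simp
  have contD: "continuous_on S D" for S by (rule continuous_on_subset[OF D]) simp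
  have p0: "p r \<ge> 0" for r by (simp add: p_def)
  have p2': "((\<lambda>r. (p r)\<^sup>2) has_real_derivative 2 * p r * D r) (at r)" for r
    using DERIV_chain2[OF max_0_square_deriv F[of r]] by (simp add: p_def)
  have pg: "p r * g r = p r * D r" for r by (simp add: p_def g_def)
  obtain K where K: "K > 0" "\<And>r. 0 \<le> r \<Longrightarrow> r \<le> 1 \<Longrightarrow> \<bar>D r\<bar> \<le> K" using bounded_on_unit_interval[OF D] by blast
  obtain L where L: "L > 0" "\<And>r. 0 \<le> r \<Longrightarrow> r \<le> 1 \<Longrightarrow> \<bar>F r\<bar> \<le> L" using bounded_on_unit_interval[OF contF] by blast
  have gK: "\<bar>g r\<bar> \<le> K" if "0 \<le> r" "r \<le> 1" for r using K(2)[OF that] K(1) by (simp add: g_def)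
  have pL: "\<bar>p r\<bar> \<le> L" if "0 \<le> r" "r \<le> 1" for r using L(2)[OF that] L(1) by (auto simp: p_def max_def)
  have g2: "\<bar>(g r)\<^sup>2\<bar> \<le> K\<^sup>2" if "0 \<le> r" "r \<le> 1" for r
    using power_mono[OF gK[OF that], of 2] by simp
  have p2: "\<bar>(p r)\<^sup>2\<bar> \<le> L\<^sup>2" if "0 \<le> r" "r \<le> 1" for r
    using power_mono[OF pL[OF that], of 2] by simp
  have p4: "\<bar>p r ^ 4\<bar> \<le> L ^ 4" if "0 \<le> r" "r \<le> 1" for r
    using power_mono[OF pL[OF that], of 4] by (simp add: power_abs)
  have pgb: "\<bar>\<bar>p r * g r\<bar>\<bar> \<le> L * K" if "0 \<le> r" "r \<le> 1" for r
    using mult_mono[OF pL[OF that] gK[OF that]] L K by (simp add: abs_mult)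
  define I where "I = (\<integral>r. \<bar>p r * g r\<bar> \<partial>radial_measure) / (2 * pi)"
  define A where "A = (\<integral>r. (g r)\<^sup>2 \<partial>radial_measure) / (2 * pi)"
  define Q where "Q = (\<integral>r. (p r)\<^sup>2 \<partial>radial_measure) / (2 * pi)"
  define Y where "Y = (\<integral>r. p r ^ 4 \<partial>radial_measure) / (2 * pi)"
  have I0: "I \<ge> 0" unfolding I_def by simp
  have A0: "A \<ge> 0" unfolding A_def by simp
  have hI: "((\<lambda>r. r * \<bar>p r * g r\<bar>) has_integral I) {0..1}"
    unfolding I_def by (rule radial_integral(2)[where K = "L * K", OF _ pgb]) auto
  have hQ: "((\<lambda>r. r * (p r)\<^sup>2) has_integral Q) {0..1}"
    unfolding Q_def by (rule radial_integral(2)[where K = "L\<^sup>2", OF _ p2]) auto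
  have hY: "((\<lambda>r. r * p r ^ 4) has_integral Y) {0..1}"
    unfolding Y_def by (rule radial_integral(2)[where K = "L ^ 4", OF _ p4]) auto
  have CS: "I\<^sup>2 \<le> Q * A"
  proof -
    have "L2 radial_measure p" "L2 radial_measure g"
      unfolding L2_def using radial_integral(1)[of "\<lambda>r. (p r)\<^sup>2", OF _ p2] radial_integral(1)[of "\<lambda>r. (g r)\<^sup>2", OF _ g2] by auto
    from L2_Cauchy_Schwarz[OF this] show ?thesis
      by (simp add: I_def Q_def A_def power_divide power2_eq_square divide_right_mono)
  qed
  define P where "P = integral {0..1} (\<lambda>r. (p r)\<^sup>2)"
  have pint: "(\<lambda>r. (p r)\<^sup>2) integrable_on {a..b}" for a b
    by (intro integrable_continuous_real continuous_intros contp)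
  have hP: "((\<lambda>r. (p r)\<^sup>2) has_integral P) {0..1}"
    unfolding P_def by (rule integrable_integral[OF pint])
  have pos1: "r * (p r)\<^sup>2 \<le> 2 * I" if r: "0 \<le> r" "r \<le> 1" for r
  proof -
    have "((\<lambda>s. 2 * p s * D s) has_integral ((p 1)\<^sup>2 - (p r)\<^sup>2)) {r..1}"
      by (intro fundamental_theorem_of_calculus r(2))
         (auto intro: has_field_derivative_at_within p2' simp flip: has_real_derivative_iff_has_vector_derivative)
    then have "((\<lambda>s. r * (- (2 * p s * D s))) has_integral (r * (- ((p 1)\<^sup>2 - (p r)\<^sup>2)))) {r..1}"
      by (intro has_integral_mult_right has_integral_neg)
    moreover have "p 1 = 0" by (simp add: p_def F1)
    ultimately have a: "((\<lambda>s. r * (- (2 * p s * D s))) has_integral (r * (p r)\<^sup>2)) {r..1}" by simp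
    have s: "(\<lambda>s. 2 * (s * \<bar>p s * g s\<bar>)) integrable_on {0..1}"
      using has_integral_mult_right[OF hI, of 2] by (rule has_integral_integrable)
    have b: "(\<lambda>s. 2 * (s * \<bar>p s * g s\<bar>)) integrable_on {r..1}"
      by (rule integrable_on_subinterval[OF s]) (use r in auto)
    have "r * (p r)\<^sup>2 \<le> integral {r..1} (\<lambda>s. 2 * (s * \<bar>p s * g s\<bar>))"
    proof (rule has_integral_le[OF a integrable_integral[OF b]])
      fix x assume x: "x \<in> {r..1}"
      have "r * (- (2 * p x * D x)) \<le> r * (2 * \<bar>p x * g x\<bar>)"
      proof (rule mult_left_mono[OF _ r(1)])
        have "- (p x * D x) \<le> \<bar>p x * g x\<bar>" using abs_ge_minus_self[of "p x * g x"] unfolding pg .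
        then show "- (2 * p x * D x) \<le> 2 * \<bar>p x * g x\<bar>" by linarith
      qed
      also have "\<dots> \<le> x * (2 * \<bar>p x * g x\<bar>)" using x by (intro mult_right_mono) auto
      finally show "r * (- (2 * p x * D x)) \<le> 2 * (x * \<bar>p x * g x\<bar>)" by simp
    qed
    also have "\<dots> \<le> integral {0..1} (\<lambda>s. 2 * (s * \<bar>p s * g s\<bar>))"
      by (rule integral_subset_le[OF _ b s]) (use r in auto)
    also have "\<dots> = 2 * I" using has_integral_mult_right[OF hI, of 2] by (rule integral_unique)
    finally show ?thesis .
  qed
  have P2I: "P \<le> 2 * I"
  proof -
    have d: "((\<lambda>r. r * (p r)\<^sup>2) has_real_derivative r * (2 * p r * D r) + (p r)\<^sup>2) (at r)" for r
      using DERIV_mult'[OF DERIV_ident p2'[of r]] by simp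
    have "((\<lambda>r. r * (2 * p r * D r) + (p r)\<^sup>2) has_integral (1 * (p 1)\<^sup>2 - 0 * (p 0)\<^sup>2)) {0..1}"
      by (intro fundamental_theorem_of_calculus)
         (auto intro: has_field_derivative_at_within d simp flip: has_real_derivative_iff_has_vector_derivative)
    moreover have "p 1 = 0" by (simp add: p_def F1)
    ultimately have a: "((\<lambda>r. r * (2 * p r * D r) + (p r)\<^sup>2) has_integral 0) {0..1}" by simp
    have "0 \<ge> P - 2 * I"
    proof (rule has_integral_le[OF _ a])
      show "((\<lambda>r. (p r)\<^sup>2 - 2 * (r * \<bar>p r * g r\<bar>)) has_integral (P - 2 * I)) {0..1}"
        by (intro has_integral_diff has_integral_mult_right hP hI)
      fix r :: real assume r: "r \<in> {0..1}"
      have "r * (- (p r * g r)) \<le> r * \<bar>p r * g r\<bar>"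
        by (rule mult_left_mono[OF abs_ge_minus_self]) (use r in simp)
      then have "- (r * (p r * g r)) \<le> r * \<bar>p r * g r\<bar>" by (simp only: mult_minus_right)
      moreover have "r * (2 * p r * D r) = 2 * (r * (p r * g r))" unfolding pg by (simp only: mult_ac)
      ultimately show "(p r)\<^sup>2 - 2 * (r * \<bar>p r * g r\<bar>) \<le> r * (2 * p r * D r) + (p r)\<^sup>2" by linarith
    qed
    then show ?thesis by simp
  qed
  have "Q \<le> P"
    by (rule has_integral_le[OF hQ hP]) (auto intro!: mult_left_le_one_le)
  then have "Q \<le> 2 * I" using P2I by simp
  then have "I * I \<le> (2 * A) * I"
    using CS mult_right_mono[of Q "2 * I" A] A0 by (simp add: power2_eq_square mult_ac)
  then have IA: "I \<le> 2 * A" using I0 A0 by (cases "I = 0") (auto simp: mult_le_cancel_right)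
  have "Y \<le> (2 * I) * P"
  proof (rule has_integral_le[OF hY has_integral_mult_right[OF hP]])
    fix r :: real assume r: "r \<in> {0..1}"
    have "r * (p r)\<^sup>2 * (p r)\<^sup>2 \<le> 2 * I * (p r)\<^sup>2"
      using r by (intro mult_right_mono pos1) auto
    then show "r * p r ^ 4 \<le> 2 * I * (p r)\<^sup>2" by (simp add: power4_eq_xxxx power2_eq_square mult_ac)
  qed
  also have "\<dots> \<le> (2 * I) * (2 * I)" using P2I I0 by (intro mult_left_mono) auto
  also have "\<dots> \<le> (2 * (2 * A)) * (2 * (2 * A))" using IA I0 A0 by (intro mult_mono) auto
  finally have YA: "Y \<le> 16 * A\<^sup>2" by (simp add: power2_eq_square)
  define a where "a = (\<integral>r. (g r)\<^sup>2 \<partial>radial_measure)"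
  have "(\<integral>r. p r ^ 4 \<partial>radial_measure) = 2 * pi * Y" by (simp add: Y_def)
  also have "\<dots> \<le> 2 * pi * (16 * A\<^sup>2)" using YA by (intro mult_left_mono) auto
  also have "\<dots> = 16 * a\<^sup>2 / (2 * pi)" by (simp add: A_def a_def power_divide power2_eq_square)
  also have "\<dots> \<le> 16 * a\<^sup>2 / 1" using pi_gt3 by (intro divide_left_mono) auto
  finally show ?thesis by (simp add: p_def g_def a_def)
qed

section \<open>Limits of radial functions\<close>

lemma abs_max_0_diff_le: "\<bar>max s 0 - max t 0\<bar> \<le> \<bar>s - t\<bar>" for s t :: real
  by (auto simp: max_def)

lemma L2_AE_subseq:
  assumes "\<And>k. L2 M (f k)" "(\<lambda>k. \<integral>x. (f k x)\<^sup>2 \<partial>M) \<longlonglongrightarrow> 0"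
  obtains s where "strict_mono (s :: nat \<Rightarrow> nat)" "AE x in M. (\<lambda>k. f (s k) x) \<longlonglongrightarrow> 0"
proof -
  have "integrable M (\<lambda>x. (f k x)\<^sup>2)" for k using assms(1)[of k] by (simp add: L2_def)
  moreover have "(\<lambda>k. \<integral>x. norm ((f k x)\<^sup>2) \<partial>M) \<longlonglongrightarrow> 0" using assms(2) by simp
  ultimately have "\<exists>s::nat\<Rightarrow>nat. strict_mono s \<and> (AE x in M. (\<lambda>k. (f (s k) x)\<^sup>2) \<longlonglongrightarrow> 0)"
    by (rule tendsto_L1_AE_subseq)
  then obtain s :: "nat \<Rightarrow> nat" where s: "strict_mono s" "AE x in M. (\<lambda>k. (f (s k) x)\<^sup>2) \<longlonglongrightarrow> 0" by auto
  have "AE x in M. (\<lambda>k. f (s k) x) \<longlonglongrightarrow> 0"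
    using s(2)
  proof eventually_elim
    case (elim x)
    from tendsto_real_sqrt[OF this] have "(\<lambda>k. \<bar>f (s k) x\<bar>) \<longlonglongrightarrow> 0" by simp
    then show ?case by (rule tendsto_rabs_zero_cancel)
  qed
  with s(1) show ?thesis by (rule that)
qed

text \<open>Where \<open>U\<close> vanishes, the sign of \<open>F k\<close> is not controlled. The bound in the limit therefore involves
  \<open>U \<ge> 0\<close> instead of \<open>U > 0\<close>; the difference disappears later, because a weak gradient vanishes almost
  everywhere on the zeros of the function.\<close>

lemma truncated_limit:
  fixes F D :: "nat \<Rightarrow> real \<Rightarrow> real"
  assumes FL: "\<And>k. L2 M (F k)" and DL: "\<And>k. L2 M (D k)" and UL: "L2 M U" and GL: "L2 M G"
    and FU: "(\<lambda>k. \<integral>r. (F k r - U r)\<^sup>2 \<partial>M) \<longlonglongrightarrow> 0" and DG: "(\<lambda>k. \<integral>r. (D k r - G r)\<^sup>2 \<partial>M) \<longlonglongrightarrow> 0"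
  obtains s e where "strict_mono (s :: nat \<Rightarrow> nat)" "e \<longlonglongrightarrow> (0::real)"
    "AE r in M. (\<lambda>k. F (s k) r) \<longlonglongrightarrow> U r"
    "\<And>k. (\<integral>r. (if F (s k) r > 0 then D (s k) r else 0)\<^sup>2 \<partial>M) \<le> (\<integral>r. (if U r \<ge> 0 then G r else 0)\<^sup>2 \<partial>M) + e k"
proof -
  have [measurable]: "F k \<in> borel_measurable M" "D k \<in> borel_measurable M" "U \<in> borel_measurable M" "G \<in> borel_measurable M" for k
    using FL DL UL GL by auto
  have G2: "integrable M (\<lambda>r. (G r)\<^sup>2)" using GL by (simp add: L2_def)
  have D2: "integrable M (\<lambda>r. (D k r)\<^sup>2)" for k using DL[of k] by (simp add: L2_def)
  have FUL: "L2 M (\<lambda>r. F k r - U r)" for k by (intro L2_diff FL UL)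
  obtain s where s: "strict_mono (s :: nat \<Rightarrow> nat)" "AE r in M. (\<lambda>k. F (s k) r - U r) \<longlonglongrightarrow> 0"
    by (rule L2_AE_subseq[OF FUL FU], rule that)
  have conv: "AE r in M. (\<lambda>k. F (s k) r) \<longlonglongrightarrow> U r"
    using s(2) by eventually_elim (rule LIM_zero_cancel)
  define q where "q k r = (if F (s k) r > 0 \<and> U r < 0 then (G r)\<^sup>2 else 0)" for k r
  have qm[measurable]: "q k \<in> borel_measurable M" for k unfolding q_def by measurable
  have qle: "\<bar>q k r\<bar> \<le> (G r)\<^sup>2" for k r by (simp add: q_def)
  have qi: "integrable M (q k)" for k
    by (rule Bochner_Integration.integrable_bound[OF G2]) (auto intro!: AE_I2 qle)
  have q0: "(\<lambda>k. \<integral>r. q k r \<partial>M) \<longlonglongrightarrow> (\<integral>r. 0 \<partial>M)"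
  proof (rule integral_dominated_convergence[OF _ _ G2])
    show "AE r in M. (\<lambda>k. q k r) \<longlonglongrightarrow> 0"
      using conv
    proof eventually_elim
      case (elim r)
      show ?case
      proof (cases "U r < 0")
        case True
        then have "\<forall>\<^sub>F k in sequentially. F (s k) r < 0" using order_tendstoD(2)[OF elim] by simp
        then have "\<forall>\<^sub>F k in sequentially. q k r = 0" by eventually_elim (simp add: q_def)
        then show ?thesis by (rule tendsto_eventually)
      qed (simp add: q_def)
    qed
    show "AE r in M. norm (q k r) \<le> (G r)\<^sup>2" for k using qle by (intro AE_I2) simp
  qed measurable
  define e where "e k = (\<integral>r. \<bar>(D (s k) r)\<^sup>2 - (G r)\<^sup>2\<bar> \<partial>M) + (\<integral>r. q k r \<partial>M)" for k
  have "(\<lambda>k. \<integral>r. \<bar>(D (s k) r)\<^sup>2 - (G r)\<^sup>2\<bar> \<partial>M) \<longlonglongrightarrow> 0"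
    using LIMSEQ_subseq_LIMSEQ[OF L2_square_tendsto[OF DL GL DG] s(1)] by (simp add: comp_def)
  from tendsto_add[OF this q0] have e: "e \<longlonglongrightarrow> 0" by (simp add: e_def[abs_def])
  show ?thesis
  proof (rule that[OF s(1) e conv])
    fix k
    have i: "integrable M (\<lambda>r. (if U r \<ge> 0 then G r else 0)\<^sup>2)"
      by (rule Bochner_Integration.integrable_bound[OF G2]) auto
    have j: "integrable M (\<lambda>r. (if F (s k) r > 0 then D (s k) r else 0)\<^sup>2)"
      by (rule Bochner_Integration.integrable_bound[OF D2[of "s k"]]) auto
    have d: "integrable M (\<lambda>r. \<bar>(D (s k) r)\<^sup>2 - (G r)\<^sup>2\<bar>)" using D2 G2 by (intro integrable_abs Bochner_Integration.integrable_diff)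
    have "(\<integral>r. (if F (s k) r > 0 then D (s k) r else 0)\<^sup>2 \<partial>M)
        \<le> (\<integral>r. (if U r \<ge> 0 then G r else 0)\<^sup>2 + (\<bar>(D (s k) r)\<^sup>2 - (G r)\<^sup>2\<bar> + q k r) \<partial>M)"
    proof (rule integral_mono[OF j])
      show "integrable M (\<lambda>r. (if U r \<ge> 0 then G r else 0)\<^sup>2 + (\<bar>(D (s k) r)\<^sup>2 - (G r)\<^sup>2\<bar> + q k r))"
        by (intro Bochner_Integration.integrable_add i d qi)
    qed (auto simp: q_def)
    also have "\<dots> = (\<integral>r. (if U r \<ge> 0 then G r else 0)\<^sup>2 \<partial>M) + e k"
      using i d qi by (simp add: e_def)
    finally show "(\<integral>r. (if F (s k) r > 0 then D (s k) r else 0)\<^sup>2 \<partial>M) \<le> (\<integral>r. (if U r \<ge> 0 then G r else 0)\<^sup>2 \<partial>M) + e k" .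
  qed
qed

lemma continuous_L2_radial:
  assumes "continuous_on UNIV f"
  shows "L2 radial_measure f"
proof -
  obtain K where K: "\<And>r. 0 \<le> r \<Longrightarrow> r \<le> 1 \<Longrightarrow> \<bar>f r\<bar> \<le> K" using bounded_on_unit_interval[OF assms] by blast
  have [measurable]: "f \<in> borel_measurable borel" by (rule borel_measurable_continuous_onI[OF assms])
  have "\<bar>(f r)\<^sup>2\<bar> \<le> K\<^sup>2" if "0 \<le> r" "r \<le> 1" for r using power_mono[OF K[OF that], of 2] by simp
  from radial_integral(1)[of "\<lambda>r. (f r)\<^sup>2", OF _ this] show ?thesis
    unfolding L2_def by simp
qed

text \<open>The situation of the angular means of test functions that approximate a radial function: \<open>U\<close> is its
  profile and \<open>G\<close> the mean of the radial component of its weak gradient.\<close>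

locale radial_sequence =
  fixes F D :: "nat \<Rightarrow> real \<Rightarrow> real" and U G :: "real \<Rightarrow> real"
  assumes deriv: "\<And>k r. (F k has_real_derivative D k r) (at r)"
    and contD: "\<And>k. continuous_on UNIV (D k)" and F1: "\<And>k. F k 1 = 0"
    and UL: "L2 radial_measure U" and GL: "L2 radial_measure G"
    and FU: "(\<lambda>k. \<integral>r. (F k r - U r)\<^sup>2 \<partial>radial_measure) \<longlonglongrightarrow> 0"
    and DG: "(\<lambda>k. \<integral>r. (D k r - G r)\<^sup>2 \<partial>radial_measure) \<longlonglongrightarrow> 0"
begin

lemma contF: "continuous_on UNIV (F k)"
  using deriv by (intro DERIV_continuous_on) (auto intro: has_field_derivative_at_within)

text \<open>Fatou's lemma along an almost everywhere convergent subsequence.\<close>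

lemma limit_ladyzhenskaya:
  "integrable radial_measure (\<lambda>r. (max (U r) 0) ^ 4)"
  "(\<integral>r. (max (U r) 0) ^ 4 \<partial>radial_measure) \<le> 16 * (\<integral>r. (if U r \<ge> 0 then G r else 0)\<^sup>2 \<partial>radial_measure)\<^sup>2"
proof -
  define B where "B = (\<integral>r. (if U r \<ge> 0 then G r else 0)\<^sup>2 \<partial>radial_measure)"
  obtain s e where s: "strict_mono (s :: nat \<Rightarrow> nat)" "e \<longlonglongrightarrow> (0::real)"
    "AE r in radial_measure. (\<lambda>k. F (s k) r) \<longlonglongrightarrow> U r"
    and b': "\<And>k. (\<integral>r. (if F (s k) r > 0 then D (s k) r else 0)\<^sup>2 \<partial>radial_measure)
        \<le> (\<integral>r. (if U r \<ge> 0 then G r else 0)\<^sup>2 \<partial>radial_measure) + e k"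
    by (rule truncated_limit[OF continuous_L2_radial[OF contF] continuous_L2_radial[OF contD] UL GL FU DG], rule that)
  note b = b'[folded B_def]
  have [measurable]: "U \<in> borel_measurable radial_measure" using UL by auto
  have Fm[measurable]: "F k \<in> borel_measurable borel" for k by (rule borel_measurable_continuous_onI[OF contF])
  have bnd: "(\<integral>r. (max (F (s k) r) 0) ^ 4 \<partial>radial_measure) \<le> 16 * (B + e k)\<^sup>2" for k
  proof -
    have "(\<integral>r. (max (F (s k) r) 0) ^ 4 \<partial>radial_measure) \<le> 16 * (\<integral>r. (if F (s k) r > 0 then D (s k) r else 0)\<^sup>2 \<partial>radial_measure)\<^sup>2"
      by (rule radial_ladyzhenskaya[OF deriv contD F1])
    also have "\<dots> \<le> 16 * (B + e k)\<^sup>2"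
      by (intro mult_left_mono power_mono b) auto
    finally show ?thesis .
  qed
  have int4: "integrable radial_measure (\<lambda>r. (max (F k r) 0) ^ 4)" for k
  proof -
    obtain K where K: "\<And>r. 0 \<le> r \<Longrightarrow> r \<le> 1 \<Longrightarrow> \<bar>F k r\<bar> \<le> K" using bounded_on_unit_interval[OF contF] by blast
    have "\<bar>(max (F k r) 0) ^ 4\<bar> \<le> K ^ 4" if "0 \<le> r" "r \<le> 1" for r
    proof -
      have "\<bar>max (F k r) 0\<bar> \<le> K" using K[OF that] by auto
      from power_mono[OF this, of 4] show ?thesis by (simp add: power_abs)
    qed
    then show ?thesis by (intro radial_integral(1)) auto
  qed
  have eq: "(\<integral>\<^sup>+ r. ennreal ((max (F (s k) r) 0) ^ 4) \<partial>radial_measure) = ennreal (\<integral>r. (max (F (s k) r) 0) ^ 4 \<partial>radial_measure)" for k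
    by (rule nn_integral_eq_integral[OF int4]) simp
  have "(\<integral>\<^sup>+ r. ennreal ((max (U r) 0) ^ 4) \<partial>radial_measure) = (\<integral>\<^sup>+ r. liminf (\<lambda>k. ennreal ((max (F (s k) r) 0) ^ 4)) \<partial>radial_measure)"
  proof (rule nn_integral_cong_AE)
    show "AE r in radial_measure. ennreal ((max (U r) 0) ^ 4) = liminf (\<lambda>k. ennreal ((max (F (s k) r) 0) ^ 4))"
      using s(3)
    proof eventually_elim
      case (elim r)
      then have "(\<lambda>k. ennreal ((max (F (s k) r) 0) ^ 4)) \<longlonglongrightarrow> ennreal ((max (U r) 0) ^ 4)"
        by (intro tendsto_ennrealI tendsto_power tendsto_max tendsto_const)
      from lim_imp_Liminf[OF trivial_limit_sequentially this] show ?case by simp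
    qed
  qed
  also have "\<dots> \<le> liminf (\<lambda>k. \<integral>\<^sup>+ r. ennreal ((max (F (s k) r) 0) ^ 4) \<partial>radial_measure)"
    by (rule nn_integral_liminf) measurable
  also have "\<dots> \<le> liminf (\<lambda>k. ennreal (16 * (B + e k)\<^sup>2))"
    unfolding eq by (intro Liminf_mono always_eventually allI ennreal_leI bnd)
  also have "\<dots> = ennreal (16 * B\<^sup>2)"
  proof (rule lim_imp_Liminf[OF trivial_limit_sequentially])
    have "(\<lambda>k. ennreal (16 * (B + e k)\<^sup>2)) \<longlonglongrightarrow> ennreal (16 * (B + 0)\<^sup>2)"
      by (intro tendsto_ennrealI tendsto_intros s(2))
    then show "(\<lambda>k. ennreal (16 * (B + e k)\<^sup>2)) \<longlonglongrightarrow> ennreal (16 * B\<^sup>2)" by simp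
  qed
  finally have le: "(\<integral>\<^sup>+ r. ennreal ((max (U r) 0) ^ 4) \<partial>radial_measure) \<le> ennreal (16 * B\<^sup>2)" .
  show i: "integrable radial_measure (\<lambda>r. (max (U r) 0) ^ 4)"
  proof (rule integrableI_nonneg)
    show "(\<integral>\<^sup>+ r. ennreal ((max (U r) 0) ^ 4) \<partial>radial_measure) < \<infinity>"
      using le by (rule le_less_trans) simp
  qed auto
  have "ennreal (\<integral>r. (max (U r) 0) ^ 4 \<partial>radial_measure) \<le> ennreal (16 * B\<^sup>2)"
    using le by (subst nn_integral_eq_integral[OF i, symmetric]) auto
  then show "(\<integral>r. (max (U r) 0) ^ 4 \<partial>radial_measure) \<le> 16 * (\<integral>r. (if U r \<ge> 0 then G r else 0)\<^sup>2 \<partial>radial_measure)\<^sup>2"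
    by (simp add: B_def)
qed

text \<open>The weighted \<open>L\<^sup>2\<close> norms converge, and the Dirichlet integrals exceed the one of the limit by a null
  sequence at most.\<close>

lemma limit_picone:
  fixes \<alpha> \<kappa> r0 :: real
  assumes \<alpha>: "\<alpha> \<ge> 0" and \<kappa>: "\<kappa> > 0" and r0: "0 < r0" "r0 < 1"
    and zeros: "\<And>r. 0 \<le> r \<Longrightarrow> r \<le> 1 \<Longrightarrow>
        bessel_series 0 (\<kappa>\<^sup>2 / 4 * r powr (2 * ((2 + \<alpha>) / 2))) = 0 \<longleftrightarrow> r = r0 \<or> r = 1"
    and neg: "\<And>k. F k r0 \<le> 0"
  shows "((2 + \<alpha>) / 2 * \<kappa>)\<^sup>2 * (\<integral>r. r powr \<alpha> * (max (U r) 0)\<^sup>2 \<partial>radial_measure)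
     \<le> (\<integral>r. (if U r \<ge> 0 then G r else 0)\<^sup>2 \<partial>radial_measure)"
proof -
  define lam where "lam = ((2 + \<alpha>) / 2 * \<kappa>)\<^sup>2"
  define B where "B = (\<integral>r. (if U r \<ge> 0 then G r else 0)\<^sup>2 \<partial>radial_measure)"
  have FL: "L2 radial_measure (F k)" for k by (rule continuous_L2_radial[OF contF])
  obtain s e where s: "strict_mono (s :: nat \<Rightarrow> nat)" "e \<longlonglongrightarrow> (0::real)"
    "AE r in radial_measure. (\<lambda>k. F (s k) r) \<longlonglongrightarrow> U r"
    and b': "\<And>k. (\<integral>r. (if F (s k) r > 0 then D (s k) r else 0)\<^sup>2 \<partial>radial_measure)
        \<le> (\<integral>r. (if U r \<ge> 0 then G r else 0)\<^sup>2 \<partial>radial_measure) + e k"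
    by (rule truncated_limit[OF FL continuous_L2_radial[OF contD] UL GL FU DG], rule that)
  note b = b'[folded B_def]
  define f where "f k r = r powr \<alpha> * (max (F (s k) r) 0)\<^sup>2" for k r
  define f' where "f' r = r powr \<alpha> * (max (U r) 0)\<^sup>2" for r
  have [measurable]: "U \<in> borel_measurable radial_measure" using UL by auto
  have Fm[measurable]: "F k \<in> borel_measurable borel" for k by (rule borel_measurable_continuous_onI[OF contF])
  have w: "AE r in radial_measure. 0 \<le> r powr \<alpha> \<and> r powr \<alpha> \<le> 1"
    using radial_measure_AE by eventually_elim (use \<alpha> in \<open>auto intro: powr_le1\<close>)
  have p1: "L2 radial_measure (\<lambda>r. max (F (s k) r) 0)" for k
    by (rule L2_bound[OF FL[of "s k"], where c = 1]) (auto simp: max_def)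
  have p2: "L2 radial_measure (\<lambda>r. max (U r) 0)"
    by (rule L2_bound[OF UL, where c = 1]) (auto simp: max_def)
  have fi: "integrable radial_measure (f k)" for k
  proof (rule Bochner_Integration.integrable_bound[of _ "\<lambda>r. (max (F (s k) r) 0)\<^sup>2"])
    show "integrable radial_measure (\<lambda>r. (max (F (s k) r) 0)\<^sup>2)" using p1 by (simp add: L2_def)
    show "AE r in radial_measure. norm (f k r) \<le> norm ((max (F (s k) r) 0)\<^sup>2)"
      using w by eventually_elim (auto simp: f_def abs_mult intro!: mult_left_le_one_le)
    show "f k \<in> borel_measurable radial_measure" unfolding f_def[abs_def] by measurable
  qed
  have fi': "integrable radial_measure f'"
  proof (rule Bochner_Integration.integrable_bound[of _ "\<lambda>r. (max (U r) 0)\<^sup>2"])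
    show "integrable radial_measure (\<lambda>r. (max (U r) 0)\<^sup>2)" using p2 by (simp add: L2_def)
    show "AE r in radial_measure. norm (f' r) \<le> norm ((max (U r) 0)\<^sup>2)"
      using w by eventually_elim (auto simp: f'_def abs_mult intro!: mult_left_le_one_le)
    show "f' \<in> borel_measurable radial_measure" unfolding f'_def[abs_def] by measurable
  qed
  have FUs: "(\<lambda>k. \<integral>r. (F (s k) r - U r)\<^sup>2 \<partial>radial_measure) \<longlonglongrightarrow> 0"
    using LIMSEQ_subseq_LIMSEQ[OF FU s(1)] by (simp add: comp_def)
  have "(\<lambda>k. \<integral>r. (max (F (s k) r) 0 - max (U r) 0)\<^sup>2 \<partial>radial_measure) \<longlonglongrightarrow> 0"
  proof (rule Lim_null_comparison[OF _ FUs], intro always_eventually allI)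
    fix k
    have "(\<integral>r. (max (F (s k) r) 0 - max (U r) 0)\<^sup>2 \<partial>radial_measure) \<le> (\<integral>r. (F (s k) r - U r)\<^sup>2 \<partial>radial_measure)"
    proof (rule integral_mono)
      show "integrable radial_measure (\<lambda>r. (max (F (s k) r) 0 - max (U r) 0)\<^sup>2)" using L2_diff[OF p1 p2] by (simp add: L2_def)
      show "integrable radial_measure (\<lambda>r. (F (s k) r - U r)\<^sup>2)" using L2_diff[OF FL UL] by (simp add: L2_def)
      show "(max (F (s k) r) 0 - max (U r) 0)\<^sup>2 \<le> (F (s k) r - U r)\<^sup>2" for r
        using abs_max_0_diff_le by (simp add: abs_le_square_iff[symmetric])
    qed
    then show "norm (\<integral>r. (max (F (s k) r) 0 - max (U r) 0)\<^sup>2 \<partial>radial_measure) \<le> (\<integral>r. (F (s k) r - U r)\<^sup>2 \<partial>radial_measure)" by simp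
  qed
  from L2_square_tendsto[OF p1 p2 this]
  have sq: "(\<lambda>k. \<integral>r. \<bar>(max (F (s k) r) 0)\<^sup>2 - (max (U r) 0)\<^sup>2\<bar> \<partial>radial_measure) \<longlonglongrightarrow> 0" .
  have "(\<lambda>k. \<integral>r. \<bar>f k r - f' r\<bar> \<partial>radial_measure) \<longlonglongrightarrow> 0"
  proof (rule Lim_null_comparison[OF _ sq], intro always_eventually allI)
    fix k
    have "(\<integral>r. \<bar>f k r - f' r\<bar> \<partial>radial_measure) \<le> (\<integral>r. \<bar>(max (F (s k) r) 0)\<^sup>2 - (max (U r) 0)\<^sup>2\<bar> \<partial>radial_measure)"
    proof (rule integral_mono_AE)
      show "integrable radial_measure (\<lambda>r. \<bar>f k r - f' r\<bar>)" by (intro integrable_abs Bochner_Integration.integrable_diff fi fi')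
      show "integrable radial_measure (\<lambda>r. \<bar>(max (F (s k) r) 0)\<^sup>2 - (max (U r) 0)\<^sup>2\<bar>)"
        using p1 p2 by (intro integrable_abs Bochner_Integration.integrable_diff) (auto simp: L2_def)
      show "AE r in radial_measure. \<bar>f k r - f' r\<bar> \<le> \<bar>(max (F (s k) r) 0)\<^sup>2 - (max (U r) 0)\<^sup>2\<bar>"
        using w
      proof eventually_elim
        case (elim r)
        have "\<bar>f k r - f' r\<bar> = r powr \<alpha> * \<bar>(max (F (s k) r) 0)\<^sup>2 - (max (U r) 0)\<^sup>2\<bar>"
          unfolding f_def f'_def by (simp add: abs_mult flip: right_diff_distrib)
        also have "\<dots> \<le> \<bar>(max (F (s k) r) 0)\<^sup>2 - (max (U r) 0)\<^sup>2\<bar>" using elim by (intro mult_left_le_one_le) auto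
        finally show ?case .
      qed
    qed
    then show "norm (\<integral>r. \<bar>f k r - f' r\<bar> \<partial>radial_measure) \<le> (\<integral>r. \<bar>(max (F (s k) r) 0)\<^sup>2 - (max (U r) 0)\<^sup>2\<bar> \<partial>radial_measure)" by simp
  qed
  from tendsto_integral_null_diff[OF fi fi' this]
  have "(\<lambda>k. lam * (\<integral>r. f k r \<partial>radial_measure)) \<longlonglongrightarrow> lam * (\<integral>r. f' r \<partial>radial_measure)"
    by (intro tendsto_intros)
  moreover have "(\<lambda>k. B + e k) \<longlonglongrightarrow> B + 0" by (intro tendsto_intros s(2))
  moreover have "lam * (\<integral>r. f k r \<partial>radial_measure) \<le> B + e k" for k
    using order_trans[OF radial_picone[OF \<alpha> \<kappa> r0 zeros deriv contD F1 neg, of "s k"] b[of k]]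
    by (simp add: lam_def f_def)
  ultimately have "lam * (\<integral>r. f' r \<partial>radial_measure) \<le> B + 0" by (intro LIMSEQ_le) auto
  then show ?thesis by (simp add: lam_def B_def f'_def)
qed

end

section \<open>Angular means\<close>

lemma disc_polar_integrable:
  assumes [measurable]: "f \<in> borel_measurable borel"
  shows "integrable disc_measure f \<longleftrightarrow> integrable (radial_measure \<Otimes>\<^sub>M angular_measure) (\<lambda>(r, \<theta>). f (polar r \<theta>) :: real)"
proof -
  have [measurable]: "disc \<in> sets borel" by simp
  have "integrable disc_measure f \<longleftrightarrow> integrable lborel (\<lambda>x. indicator disc x * f x)"
    by (rule integrable_disc) measurable
  also have "\<dots> \<longleftrightarrow> integrable (density lborel (\<lambda>x. ennreal (indicator disc x))) f"
    by (subst integrable_density) auto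
  also have "\<dots> \<longleftrightarrow> integrable (distr (radial_measure \<Otimes>\<^sub>M angular_measure) borel (\<lambda>(r, \<theta>). polar r \<theta>)) f"
    by (simp add: lborel_disc_polar[symmetric] ennreal_indicator)
  also have "\<dots> \<longleftrightarrow> integrable (radial_measure \<Otimes>\<^sub>M angular_measure) (\<lambda>(r, \<theta>). f (polar r \<theta>))"
    by (subst integrable_distr_eq) (auto simp: case_prod_unfold)
  finally show ?thesis .
qed

lemma disc_polar_integral:
  assumes [measurable]: "f \<in> borel_measurable borel" and "integrable disc_measure f"
  shows "(\<integral>x. f x \<partial>disc_measure) = (\<integral>r. \<integral>\<theta>. f (polar r \<theta>) \<partial>angular_measure \<partial>radial_measure :: real)"
proof -
  have [measurable]: "disc \<in> sets borel" by simp
  have "(\<integral>x. f x \<partial>disc_measure) = (\<integral>x. indicator disc x * f x \<partial>lborel)"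
    by (rule integral_disc) measurable
  also have "\<dots> = (\<integral>x. f x \<partial>density lborel (\<lambda>x. ennreal (indicator disc x)))"
    by (subst integral_density) auto
  also have "\<dots> = (\<integral>x. f x \<partial>distr (radial_measure \<Otimes>\<^sub>M angular_measure) borel (\<lambda>(r, \<theta>). polar r \<theta>))"
    by (simp add: lborel_disc_polar[symmetric] ennreal_indicator)
  also have "\<dots> = (\<integral>p. (\<lambda>(r, \<theta>). f (polar r \<theta>)) p \<partial>(radial_measure \<Otimes>\<^sub>M angular_measure))"
    by (subst integral_distr) (auto simp: case_prod_unfold)
  also have "\<dots> = (\<integral>r. \<integral>\<theta>. f (polar r \<theta>) \<partial>angular_measure \<partial>radial_measure)"
    using polar.integral_fst'[of "\<lambda>(r, \<theta>). f (polar r \<theta>)"] disc_polar_integrable[of f] assms by simp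
  finally show ?thesis .
qed

lemma disc_polar_AE:
  assumes "AE x in disc_measure. P x"
  shows "AE r in radial_measure. AE \<theta> in angular_measure. P (polar r \<theta>)"
proof -
  have "AE x in density lborel (indicator disc). P x"
  proof -
    have "(indicator disc :: real^2 \<Rightarrow> ennreal) \<in> borel_measurable lborel"
      by (intro borel_measurable_indicator) simp
    from AE_density[OF this, of P] show ?thesis
      using assms unfolding AE_disc by (auto simp: indicator_def elim!: eventually_mono split: if_splits)
  qed
  then have "AE x in distr (radial_measure \<Otimes>\<^sub>M angular_measure) borel (\<lambda>(r, \<theta>). polar r \<theta>). P x"
    unfolding lborel_disc_polar .
  from AE_distrD[OF _ this] have "AE p in radial_measure \<Otimes>\<^sub>M angular_measure. P ((\<lambda>(r, \<theta>). polar r \<theta>) p)"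
    by measurable
  from polar.AE_pair[OF this] show ?thesis by simp
qed

definition angular_mean :: "(real^2 \<Rightarrow> real) \<Rightarrow> real \<Rightarrow> real" where
  "angular_mean h r = (\<integral>\<theta>. h (polar r \<theta>) \<partial>angular_measure)"

lemma angular_measure_UNIV [simp]: "measure angular_measure UNIV = 1"
  by (simp add: measure_def emeasure_angular_measure)

lemma angular_integral_const [simp]: "(\<integral>\<theta>. c \<partial>angular_measure) = (c :: real)"
  by (simp add: angular_measure_UNIV)

lemma measurable_angular_mean [measurable]:
  assumes [measurable]: "h \<in> borel_measurable borel"
  shows "angular_mean h \<in> borel_measurable borel"
  unfolding angular_mean_def by (intro angular.borel_measurable_lebesgue_integral) measurable

lemma angular_mean_AE_L2:
  assumes [measurable]: "h \<in> borel_measurable borel" and h: "L2 disc_measure h"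
  shows "AE r in radial_measure. L2 angular_measure (\<lambda>\<theta>. h (polar r \<theta>))"
proof -
  have "integrable disc_measure (\<lambda>x. (h x)\<^sup>2)" using h by (simp add: L2_def)
  then have "integrable (radial_measure \<Otimes>\<^sub>M angular_measure) (\<lambda>(r, \<theta>). (h (polar r \<theta>))\<^sup>2)"
    by (subst (asm) disc_polar_integrable) auto
  from polar.AE_integrable_fst'[OF this]
  show ?thesis by eventually_elim (simp add: L2_def)
qed

lemma angular_mean_square_le:
  assumes "L2 angular_measure f"
  shows "(\<integral>\<theta>. f \<theta> \<partial>angular_measure)\<^sup>2 \<le> (\<integral>\<theta>. (f \<theta>)\<^sup>2 \<partial>angular_measure)"
proof -
  have one: "L2 angular_measure (\<lambda>\<theta>. 1)" by (simp add: L2_def)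
  have "\<bar>\<integral>\<theta>. f \<theta> \<partial>angular_measure\<bar>\<^sup>2 \<le> (\<integral>\<theta>. \<bar>f \<theta>\<bar> \<partial>angular_measure)\<^sup>2"
    by (intro power_mono integral_abs_bound) simp
  also have "\<dots> \<le> (\<integral>\<theta>. (f \<theta>)\<^sup>2 \<partial>angular_measure)"
    using L2_Cauchy_Schwarz[OF assms one] by simp
  finally show ?thesis by simp
qed

lemma angular_mean_L2:
  assumes [measurable]: "h \<in> borel_measurable borel" and h: "L2 disc_measure h"
  shows "L2 radial_measure (angular_mean h)"
    and "(\<integral>r. (angular_mean h r)\<^sup>2 \<partial>radial_measure) \<le> (\<integral>x. (h x)\<^sup>2 \<partial>disc_measure)"
proof -
  have i: "integrable disc_measure (\<lambda>x. (h x)\<^sup>2)" using h by (simp add: L2_def)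
  then have "integrable (radial_measure \<Otimes>\<^sub>M angular_measure) (\<lambda>(r, \<theta>). (h (polar r \<theta>))\<^sup>2)"
    by (subst (asm) disc_polar_integrable) auto
  from polar.integrable_fst'[OF this]
  have i2: "integrable radial_measure (\<lambda>r. \<integral>\<theta>. (h (polar r \<theta>))\<^sup>2 \<partial>angular_measure)" by simp
  have le: "AE r in radial_measure. (angular_mean h r)\<^sup>2 \<le> (\<integral>\<theta>. (h (polar r \<theta>))\<^sup>2 \<partial>angular_measure)"
    using angular_mean_AE_L2[OF assms] unfolding angular_mean_def by eventually_elim (rule angular_mean_square_le)
  have i3: "integrable radial_measure (\<lambda>r. (angular_mean h r)\<^sup>2)"
    by (rule Bochner_Integration.integrable_bound[OF i2]) (use le in \<open>auto elim!: eventually_mono\<close>)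
  then show "L2 radial_measure (angular_mean h)" by (simp add: L2_def)
  have "(\<integral>r. (angular_mean h r)\<^sup>2 \<partial>radial_measure) \<le> (\<integral>r. \<integral>\<theta>. (h (polar r \<theta>))\<^sup>2 \<partial>angular_measure \<partial>radial_measure)"
    by (rule integral_mono_AE[OF i3 i2 le])
  also have "\<dots> = (\<integral>x. (h x)\<^sup>2 \<partial>disc_measure)"
    by (rule disc_polar_integral[symmetric, OF _ i]) measurable
  finally show "(\<integral>r. (angular_mean h r)\<^sup>2 \<partial>radial_measure) \<le> (\<integral>x. (h x)\<^sup>2 \<partial>disc_measure)" .
qed

text \<open>Jensen's inequality on almost every circle: averaging over angles contracts \<open>L\<^sup>2\<close> distances.\<close>

lemma angular_mean_diff_le:
  assumes [measurable]: "h \<in> borel_measurable borel" "k \<in> borel_measurable borel"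
    and h: "L2 disc_measure h" and k: "L2 disc_measure k"
  shows "(\<integral>r. (angular_mean h r - angular_mean k r)\<^sup>2 \<partial>radial_measure) \<le> (\<integral>x. (h x - k x)\<^sup>2 \<partial>disc_measure)"
proof -
  have "(\<integral>r. (angular_mean h r - angular_mean k r)\<^sup>2 \<partial>radial_measure) = (\<integral>r. (angular_mean (\<lambda>x. h x - k x) r)\<^sup>2 \<partial>radial_measure)"
  proof (rule integral_cong_AE)
    show "AE r in radial_measure. (angular_mean h r - angular_mean k r)\<^sup>2 = (angular_mean (\<lambda>x. h x - k x) r)\<^sup>2"
      using angular_mean_AE_L2[OF assms(1) h] angular_mean_AE_L2[OF assms(2) k]
    proof eventually_elim
      case (elim r)
      have "L2 angular_measure (\<lambda>\<theta>. 1)" by (simp add: L2_def)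
      then have "integrable angular_measure (\<lambda>\<theta>. h (polar r \<theta>))" "integrable angular_measure (\<lambda>\<theta>. k (polar r \<theta>))"
        using L2_mult[OF elim(1), of "\<lambda>\<theta>. 1"] L2_mult[OF elim(2), of "\<lambda>\<theta>. 1"] by simp_all
      then show ?case by (simp add: angular_mean_def)
    qed
  qed measurable
  also have "\<dots> \<le> (\<integral>x. (h x - k x)\<^sup>2 \<partial>disc_measure)"
    by (rule angular_mean_L2(2)) (use L2_diff[OF h k] in auto)
  finally show ?thesis .
qed

section \<open>Positive and negative parts\<close>

lemma flat_pos_mult: "t * flat (Suc m) t = flat m t"
  by (auto simp: flat_def)

lemma flat_3_bounds: "0 \<le> flat 3 s" "flat 3 s \<le> 27"
proof -
  show "0 \<le> flat 3 s" by (simp add: flat_def)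
  show "flat 3 s \<le> 27"
  proof (cases "s > 0")
    case True
    define y where "y = 1 / s"
    have y: "y > 0" "s = 1 / y" using True by (auto simp: y_def)
    have "y / 3 \<le> exp (y / 3)" using exp_ge_add_one_self[of "y / 3"] by linarith
    then have "(y / 3) ^ 3 \<le> exp (y / 3) ^ 3" using y by (intro power_mono) auto
    also have "exp (y / 3) ^ 3 = exp y" by (simp add: exp_of_nat_mult[symmetric])
    finally have "y ^ 3 \<le> 27 * exp y" by (simp add: power_divide)
    moreover have "flat 3 s = y ^ 3 / exp y"
      using True by (simp add: flat_def y_def exp_minus power_divide field_simps)
    ultimately show ?thesis by (simp add: divide_le_eq)
  qed (simp add: flat_def)
qed

text \<open>A smooth approximation of the positive part with bounded and Lipschitz derivative, to which
  the weak chain rule applies.\<close>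

definition ramp :: "real \<Rightarrow> real \<Rightarrow> real" where
  "ramp c t = t * flat 0 (c * t)"

definition ramp' :: "real \<Rightarrow> real \<Rightarrow> real" where
  "ramp' c t = flat 0 (c * t) + flat 1 (c * t)"

lemma ramp_deriv: "(ramp c has_real_derivative ramp' c t) (at t)"
proof -
  have "((\<lambda>t. flat 0 (c * t)) has_real_derivative flat 2 (c * t) * c) (at t)"
    using DERIV_chain2[OF flat_deriv[of 0 "c * t"] DERIV_cmult_Id[of c t]] by (simp add: numeral_2_eq_2)
  from DERIV_mult'[OF DERIV_ident this]
  have "(ramp c has_real_derivative t * (flat 2 (c * t) * c) + flat 0 (c * t)) (at t)"
    by (simp add: ramp_def[abs_def])
  moreover have "t * (flat 2 (c * t) * c) = flat 1 (c * t)"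
    using flat_pos_mult[of "c * t" 1] by (simp add: numeral_2_eq_2 mult_ac)
  ultimately show ?thesis by (simp add: ramp'_def add.commute)
qed

lemma ramp'_bounds: "0 \<le> ramp' c t" "ramp' c t \<le> 1"
proof -
  show "0 \<le> ramp' c t" by (simp add: ramp'_def flat_def)
  show "ramp' c t \<le> 1"
  proof (cases "c * t > 0")
    case True
    define y where "y = 1 / (c * t)"
    have "ramp' c t = (1 + y) / exp y"
      using True by (simp add: ramp'_def flat_def y_def exp_minus field_simps)
    also have "\<dots> \<le> 1" using exp_ge_add_one_self[of y] by simp
    finally show ?thesis .
  qed (simp add: ramp'_def flat_def)
qed

lemma ramp'_lipschitz: "\<bar>ramp' c s - ramp' c t\<bar> \<le> 27 * \<bar>c\<bar> * \<bar>s - t\<bar>"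
proof -
  have d: "(ramp' c has_real_derivative flat 3 (c * x) * c) (at x)" for x
  proof -
    have f0: "(flat 0 has_real_derivative flat 2 y) (at y)" and f1: "(flat 1 has_real_derivative flat 3 y - flat 2 y) (at y)" for y
      using flat_deriv[of 0 y] flat_deriv[of 1 y] by (simp_all add: numeral_2_eq_2 numeral_3_eq_3)
    have "(ramp' c has_real_derivative flat 2 (c * x) * c + (flat 3 (c * x) - flat 2 (c * x)) * c) (at x)"
      unfolding ramp'_def by (intro DERIV_add DERIV_chain2[OF f0 DERIV_cmult_Id] DERIV_chain2[OF f1 DERIV_cmult_Id])
    then show ?thesis by (simp add: algebra_simps)
  qed
  have "norm (ramp' c s - ramp' c t) \<le> 27 * \<bar>c\<bar> * norm (s - t)"
    by (rule field_differentiable_bound[of UNIV "ramp' c" "\<lambda>x. flat 3 (c * x) * c"])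
       (auto simp: abs_mult flat_3_bounds intro!: mult_right_mono has_field_derivative_at_within d)
  then show ?thesis by simp
qed

lemma ramp_abs_le: "\<bar>ramp c t\<bar> \<le> \<bar>t\<bar>"
  using flat_0_bounds[of "c * t"] by (simp add: ramp_def abs_mult mult_left_le)

lemma ramp_tendsto: "(\<lambda>k. ramp (real (Suc k)) t) \<longlonglongrightarrow> max t 0"
proof -
  have "(\<lambda>k. t * flat 0 (real (Suc k) * t - 0)) \<longlonglongrightarrow> t * (if t > 0 then 1 else 0)"
    by (intro tendsto_intros flat_0_scaled_tendsto) simp
  then show ?thesis by (simp add: ramp_def max_def split: if_splits)
qed

lemma ramp'_tendsto: "(\<lambda>k. ramp' (real (Suc k)) t) \<longlonglongrightarrow> (if t > 0 then 1 else 0)"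
proof -
  have a: "(\<lambda>k. flat 0 (real (Suc k) * t - 0)) \<longlonglongrightarrow> (if t > 0 then 1 else 0)"
    by (rule flat_0_scaled_tendsto) simp
  have "(\<lambda>k. inverse (real (Suc k)) * \<bar>inverse t\<bar>) \<longlonglongrightarrow> 0 * \<bar>inverse t\<bar>"
    by (intro tendsto_intros LIMSEQ_inverse_real_of_nat)
  then have l: "(\<lambda>k. inverse (real (Suc k)) * \<bar>inverse t\<bar>) \<longlonglongrightarrow> 0" by simp
  have b: "(\<lambda>k. flat 1 (real (Suc k) * t)) \<longlonglongrightarrow> 0"
  proof (rule Lim_null_comparison[OF _ l], intro always_eventually allI)
    fix k
    define s where "s = real (Suc k) * t"
    have "norm (flat 1 s) \<le> \<bar>inverse s\<bar>"
    proof (cases "s > 0")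
      case True
      have "flat 1 s = flat 0 s * inverse s" using True by (simp add: flat_def divide_inverse)
      then show ?thesis using flat_0_bounds[of s] by (simp add: abs_mult mult_right_le_one_le mult_left_le_one_le)
    qed (simp add: flat_def)
    then show "norm (flat 1 (real (Suc k) * t)) \<le> inverse (real (Suc k)) * \<bar>inverse t\<bar>"
      by (simp add: s_def abs_mult inverse_mult_distrib)
  qed
  from tendsto_add[OF a b] show ?thesis by (simp add: ramp'_def)
qed

text \<open>The chain rule for \<open>ramp\<close> and dominated convergence. The parameter \<open>\<sigma> = \<plusminus>1\<close> treats the positive and
  the negative part of \<open>u\<close> at once.\<close>

lemma signed_part_weak_gradient:
  assumes u: "u \<in> H1_0 disc" and g: "has_weak_gradient disc u g" and \<sigma>: "\<bar>\<sigma>\<bar> = (1::real)"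
  shows "has_weak_gradient disc (\<lambda>x. max (\<sigma> * u x) 0) (\<lambda>x. if \<sigma> * u x > 0 then \<sigma> *\<^sub>R g x else 0)"
  unfolding has_weak_gradient_iff
proof (intro conjI allI impI)
  have uL: "L2 disc_measure u" by (rule H1_0_L2[OF u])
  have [measurable]: "u \<in> borel_measurable disc_measure" using uL by auto
  have gL: "L2 disc_measure (\<lambda>x. g x $ i)" for i by (rule has_weak_gradient_L2[OF g])
  have [measurable]: "(\<lambda>x. g x $ i) \<in> borel_measurable disc_measure" for i using gL by auto
  have e: "(if \<sigma> * u x > 0 then \<sigma> *\<^sub>R g x else 0) $ i = (if \<sigma> * u x > 0 then \<sigma> * g x $ i else 0)" for x i by simp
  have m: "(\<lambda>x. if \<sigma> * u x > 0 then \<sigma> * g x $ i else 0) \<in> borel_measurable disc_measure" for i by measurable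
  show "L2 disc_measure (\<lambda>x. (if \<sigma> * u x > 0 then \<sigma> *\<^sub>R g x else 0) $ i)" for i
    unfolding e by (rule L2_bound[OF gL[of i] m, where c = 1]) (simp add: abs_mult \<sigma>)
  fix \<psi> i assume \<psi>: "test_function disc \<psi>"
  have \<psi>L: "L2 disc_measure \<psi>" and d\<psi>L: "L2 disc_measure (partial_deriv \<psi> i)"
    by (rule test_function_L2[OF \<psi>], rule test_function_partial_L2[OF \<psi>])
  have [measurable]: "\<psi> \<in> borel_measurable disc_measure" "partial_deriv \<psi> i \<in> borel_measurable disc_measure"
    using \<psi>L d\<psi>L by auto
  define F where "F k t = ramp (real (Suc k)) (\<sigma> * t)" for k t
  define F' where "F' k t = ramp' (real (Suc k)) (\<sigma> * t) * \<sigma>" for k t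
  have F: "(F k has_real_derivative F' k t) (at t)" for k t
    unfolding F_def F'_def by (rule DERIV_chain2[OF ramp_deriv DERIV_cmult_Id])
  have F'1: "\<bar>F' k t\<bar> \<le> 1" for k t
    using ramp'_bounds[of "real (Suc k)" "\<sigma> * t"] by (simp add: F'_def abs_mult \<sigma>)
  have F'L: "\<bar>F' k s - F' k t\<bar> \<le> (27 * real (Suc k)) * \<bar>s - t\<bar>" for k s t
  proof -
    have "\<bar>F' k s - F' k t\<bar> = \<bar>ramp' (real (Suc k)) (\<sigma> * s) - ramp' (real (Suc k)) (\<sigma> * t)\<bar> * \<bar>\<sigma>\<bar>"
      unfolding F'_def by (simp only: left_diff_distrib[symmetric] abs_mult)
    also have "\<dots> \<le> 27 * \<bar>real (Suc k)\<bar> * \<bar>\<sigma> * s - \<sigma> * t\<bar> * \<bar>\<sigma>\<bar>"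
      by (intro mult_right_mono ramp'_lipschitz) simp
    also have "\<bar>\<sigma> * s - \<sigma> * t\<bar> = \<bar>s - t\<bar>" by (simp only: right_diff_distrib[symmetric] abs_mult \<sigma>) simp
    finally show ?thesis by (simp add: \<sigma>)
  qed
  have "has_weak_gradient disc (\<lambda>x. F k (u x)) (\<lambda>x. F' k (u x) *\<^sub>R g x)" for k
    by (rule weak_chain_rule[OF u g F _ F'1 F'L]) (simp add: F_def ramp_def)
  then have eq: "(\<integral>x. F k (u x) * partial_deriv \<psi> i x \<partial>disc_measure) = - (\<integral>x. F' k (u x) * g x $ i * \<psi> x \<partial>disc_measure)" for k
    using \<psi> unfolding has_weak_gradient_iff by simp
  have "continuous_on UNIV (F k)" "continuous_on UNIV (F' k)" for k
  proof -
    show "continuous_on UNIV (F k)"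
      using F by (intro DERIV_continuous_on) (auto intro: has_field_derivative_at_within)
    have cf: "continuous_on UNIV (flat m)" for m
      using flat_deriv by (intro DERIV_continuous_on) (auto intro: has_field_derivative_at_within)
    have c2: "continuous_on UNIV (\<lambda>t. flat m (real (Suc k) * (\<sigma> * t)))" for m
      by (rule continuous_on_compose2[OF cf]) (auto intro!: continuous_intros)
    show "continuous_on UNIV (F' k)"
      unfolding F'_def ramp'_def by (intro continuous_on_mult continuous_on_add c2 continuous_on_const)
  qed
  then have [measurable]: "F k \<in> borel_measurable borel" "F' k \<in> borel_measurable borel" for k
    by (auto intro: borel_measurable_continuous_onI)
  have l1: "(\<lambda>k. \<integral>x. F k (u x) * partial_deriv \<psi> i x \<partial>disc_measure) \<longlonglongrightarrow> (\<integral>x. max (\<sigma> * u x) 0 * partial_deriv \<psi> i x \<partial>disc_measure)"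
  proof (rule integral_dominated_convergence)
    show "integrable disc_measure (\<lambda>x. \<bar>u x * partial_deriv \<psi> i x\<bar>)" by (intro integrable_abs L2_mult uL d\<psi>L)
    show "AE x in disc_measure. (\<lambda>k. F k (u x) * partial_deriv \<psi> i x) \<longlonglongrightarrow> max (\<sigma> * u x) 0 * partial_deriv \<psi> i x"
      unfolding F_def by (intro AE_I2 tendsto_intros ramp_tendsto)
    show "AE x in disc_measure. norm (F k (u x) * partial_deriv \<psi> i x) \<le> \<bar>u x * partial_deriv \<psi> i x\<bar>" for k
    proof (rule AE_I2)
      fix x
      have "\<bar>F k (u x)\<bar> \<le> \<bar>u x\<bar>" using ramp_abs_le[of "real (Suc k)" "\<sigma> * u x"] by (simp add: F_def abs_mult \<sigma>)
      then show "norm (F k (u x) * partial_deriv \<psi> i x) \<le> \<bar>u x * partial_deriv \<psi> i x\<bar>"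
        by (simp add: abs_mult mult_right_mono)
    qed
  qed measurable
  have l2: "(\<lambda>k. \<integral>x. F' k (u x) * g x $ i * \<psi> x \<partial>disc_measure) \<longlonglongrightarrow> (\<integral>x. (if \<sigma> * u x > 0 then \<sigma> * g x $ i else 0) * \<psi> x \<partial>disc_measure)"
  proof (rule integral_dominated_convergence)
    show "integrable disc_measure (\<lambda>x. \<bar>g x $ i * \<psi> x\<bar>)" by (intro integrable_abs L2_mult gL \<psi>L)
    show "AE x in disc_measure. (\<lambda>k. F' k (u x) * g x $ i * \<psi> x) \<longlonglongrightarrow> (if \<sigma> * u x > 0 then \<sigma> * g x $ i else 0) * \<psi> x"
    proof (rule AE_I2)
      fix x
      have "(\<lambda>k. ramp' (real (Suc k)) (\<sigma> * u x) * \<sigma> * g x $ i * \<psi> x) \<longlonglongrightarrow> (if \<sigma> * u x > 0 then 1 else 0) * \<sigma> * g x $ i * \<psi> x"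
        by (intro tendsto_mult tendsto_const ramp'_tendsto)
      moreover have "(if \<sigma> * u x > 0 then 1 else 0) * \<sigma> * g x $ i * \<psi> x = (if \<sigma> * u x > 0 then \<sigma> * g x $ i else 0) * \<psi> x" by simp
      ultimately show "(\<lambda>k. F' k (u x) * g x $ i * \<psi> x) \<longlonglongrightarrow> (if \<sigma> * u x > 0 then \<sigma> * g x $ i else 0) * \<psi> x"
        unfolding F'_def by simp
    qed
    show "AE x in disc_measure. norm (F' k (u x) * g x $ i * \<psi> x) \<le> \<bar>g x $ i * \<psi> x\<bar>" for k
    proof (rule AE_I2)
      fix x
      have "\<bar>F' k (u x)\<bar> * \<bar>g x $ i * \<psi> x\<bar> \<le> 1 * \<bar>g x $ i * \<psi> x\<bar>" by (intro mult_right_mono F'1) simp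
      then show "norm (F' k (u x) * g x $ i * \<psi> x) \<le> \<bar>g x $ i * \<psi> x\<bar>" by (simp add: abs_mult mult.assoc)
    qed
  qed measurable
  have "(\<lambda>k. - (\<integral>x. F' k (u x) * g x $ i * \<psi> x \<partial>disc_measure)) \<longlonglongrightarrow> (\<integral>x. max (\<sigma> * u x) 0 * partial_deriv \<psi> i x \<partial>disc_measure)"
    using l1 unfolding eq .
  from LIMSEQ_unique[OF this tendsto_minus[OF l2]]
  show "(\<integral>x. max (\<sigma> * u x) 0 * partial_deriv \<psi> i x \<partial>disc_measure)
      = - (\<integral>x. (if \<sigma> * u x > 0 then \<sigma> *\<^sub>R g x else 0) $ i * \<psi> x \<partial>disc_measure)"
    unfolding e .
qed

text \<open>The difference of the two parts is \<open>u\<close>, and both of their weak gradients vanish where \<open>u\<close> does; the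
  claim follows from uniqueness.\<close>

lemma weak_gradient_zero_on_zeros:
  assumes u: "u \<in> H1_0 disc" and g: "has_weak_gradient disc u g"
  shows "AE x in disc_measure. u x = 0 \<longrightarrow> g x = 0"
proof -
  have uL: "L2 disc_measure u" by (rule H1_0_L2[OF u])
  have [measurable]: "u \<in> borel_measurable disc_measure" using uL by auto
  have pL: "L2 disc_measure (\<lambda>x. max (\<sigma> * u x) 0)" if "\<bar>\<sigma>\<bar> = 1" for \<sigma>
  proof (rule L2_bound[OF uL, where c = 1])
    fix x
    have "\<bar>\<sigma> * u x\<bar> = \<bar>u x\<bar>" using that by (simp add: abs_mult)
    moreover have "\<bar>max y 0\<bar> \<le> \<bar>y\<bar>" for y :: real by (auto simp: max_def)
    from this[of "\<sigma> * u x"] have "\<bar>max (\<sigma> * u x) 0\<bar> \<le> \<bar>\<sigma> * u x\<bar>" .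
    ultimately show "\<bar>max (\<sigma> * u x) 0\<bar> \<le> 1 * \<bar>u x\<bar>" by linarith
  qed measurable
  note p = signed_part_weak_gradient[OF u g, of 1] signed_part_weak_gradient[OF u g, of "-1"]
  have "has_weak_gradient disc (\<lambda>x. 1 * max (1 * u x) 0 + (-1) * max (-1 * u x) 0)
     (\<lambda>x. 1 *\<^sub>R (if 1 * u x > 0 then 1 *\<^sub>R g x else 0) + (-1) *\<^sub>R (if -1 * u x > 0 then (-1) *\<^sub>R g x else 0))"
    by (rule has_weak_gradient_linear) (use pL[of 1] pL[of "-1"] p in simp_all)
  moreover have "(\<lambda>x. 1 * max (1 * u x) 0 + (-1) * max (-1 * u x) 0) = u" by (auto simp: max_def)
  ultimately have "has_weak_gradient disc u
     (\<lambda>x. 1 *\<^sub>R (if 1 * u x > 0 then 1 *\<^sub>R g x else 0) + (-1) *\<^sub>R (if -1 * u x > 0 then (-1) *\<^sub>R g x else 0))" by simp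
  from weak_gradient_unique[OF g this] show ?thesis by eventually_elim auto
qed

section \<open>Radial elements of the Sobolev space\<close>

lemma angular_integral_continuous:
  fixes f :: "real \<Rightarrow> real"
  assumes cont: "continuous_on UNIV f"
  shows "(\<integral>\<theta>. f \<theta> \<partial>angular_measure) = integral {-pi..pi} f / (2 * pi)"
proof -
  have [measurable]: "f \<in> borel_measurable borel" by (rule borel_measurable_continuous_onI[OF cont])
  have d: "angular_measure = density lborel (\<lambda>\<theta>. ennreal (indicator {-pi<..<pi} \<theta> / (2 * pi)))"
    unfolding angular_measure_def by (intro density_cong) (auto simp: indicator_def)
  have "(\<integral>\<theta>. f \<theta> \<partial>angular_measure) = (\<integral>\<theta>. (indicator {-pi<..<pi} \<theta> / (2 * pi)) *\<^sub>R f \<theta> \<partial>lborel)"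
    unfolding d by (rule integral_density) auto
  also have "\<dots> = (\<integral>\<theta>. (indicator {-pi..pi} \<theta> *\<^sub>R f \<theta>) / (2 * pi) \<partial>lborel)"
  proof (rule integral_cong_AE)
    show "AE \<theta> in lborel. (indicator {-pi<..<pi} \<theta> / (2 * pi)) *\<^sub>R f \<theta> = (indicator {-pi..pi} \<theta> *\<^sub>R f \<theta>) / (2 * pi)"
      using AE_lborel_singleton[of pi] AE_lborel_singleton[of "-pi"]
      by eventually_elim (auto simp: indicator_def)
  qed measurable
  also have "\<dots> = (\<integral>\<theta>. indicator {-pi..pi} \<theta> *\<^sub>R f \<theta> \<partial>lborel) / (2 * pi)" by simp
  also have "(\<integral>\<theta>. indicator {-pi..pi} \<theta> *\<^sub>R f \<theta> \<partial>lborel) = integral {-pi..pi} f"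
  proof -
    have "integrable lborel (\<lambda>\<theta>. indicator {-pi..pi} \<theta> *\<^sub>R f \<theta>)"
      by (rule borel_integrable_compact) (auto intro: continuous_on_subset[OF cont])
    from has_integral_integral_lborel[OF this]
    have "((\<lambda>\<theta>. if \<theta> \<in> {-pi..pi} then f \<theta> else 0) has_integral (\<integral>\<theta>. indicator {-pi..pi} \<theta> *\<^sub>R f \<theta> \<partial>lborel)) UNIV"
      by (rule has_integral_eq[rotated]) (auto simp: indicator_def)
    then have "(f has_integral (\<integral>\<theta>. indicator {-pi..pi} \<theta> *\<^sub>R f \<theta> \<partial>lborel)) {-pi..pi}"
      by (simp only: has_integral_restrict_UNIV)
    then show ?thesis by (rule integral_unique[symmetric])
  qed
  finally show ?thesis .
qed

text \<open>The angular mean of the radial derivative, in Cartesian terms.\<close>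

definition radial_deriv_mean :: "(real^2 \<Rightarrow> real) \<Rightarrow> real \<Rightarrow> real" where
  "radial_deriv_mean \<phi> r =
     (\<integral>\<theta>. partial_deriv \<phi> 1 (polar r \<theta>) * cos \<theta> + partial_deriv \<phi> 2 (polar r \<theta>) * sin \<theta> \<partial>angular_measure)"

lemma continuous_on_polar_compose:
  fixes h :: "real^2 \<Rightarrow> real" and S :: "'a::t2_space set"
  assumes "continuous_on UNIV h" "continuous_on S a" "continuous_on S b"
  shows "continuous_on S (\<lambda>p. h (polar (a p) (b p)))"
proof -
  have "continuous_on S (\<lambda>p. polar (a p) (b p))"
    by (rule continuous_on_vec2)
       (auto intro!: continuous_on_mult continuous_on_cos continuous_on_sin assms(2,3))
  then show ?thesis by (rule continuous_on_compose2[OF assms(1)]) simp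
qed

lemma polar_radial_deriv:
  assumes "\<phi> differentiable (at (polar r \<theta>))"
  shows "((\<lambda>r. \<phi> (polar r \<theta>)) has_real_derivative
     partial_deriv \<phi> 1 (polar r \<theta>) * cos \<theta> + partial_deriv \<phi> 2 (polar r \<theta>) * sin \<theta>) (at r)"
proof -
  have p: "polar h \<theta> = h *\<^sub>R polar 1 \<theta>" for h by (simp add: vec_eq_iff forall_2)
  have "((\<lambda>r. r *\<^sub>R polar 1 \<theta>) has_derivative (\<lambda>h. h *\<^sub>R polar 1 \<theta>)) (at r)"
    by (auto intro!: derivative_eq_intros)
  then have "((\<lambda>r. polar r \<theta>) has_derivative (\<lambda>h. polar h \<theta>)) (at r)"
    by (simp only: p[symmetric])
  from has_derivative_compose[OF this has_derivative_partials[OF assms]]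
  have "((\<lambda>r. \<phi> (polar r \<theta>)) has_derivative
    (\<lambda>h. partial_deriv \<phi> 1 (polar r \<theta>) * (h * cos \<theta>) + partial_deriv \<phi> 2 (polar r \<theta>) * (h * sin \<theta>))) (at r)"
    by (simp add: sum_2)
  moreover have "(\<lambda>h. partial_deriv \<phi> 1 (polar r \<theta>) * (h * cos \<theta>) + partial_deriv \<phi> 2 (polar r \<theta>) * (h * sin \<theta>))
      = (*) (partial_deriv \<phi> 1 (polar r \<theta>) * cos \<theta> + partial_deriv \<phi> 2 (polar r \<theta>) * sin \<theta>)"
    by (rule ext) (simp add: algebra_simps)
  ultimately show ?thesis by (simp only: has_field_derivative_def)
qed

lemma angular_mean_test_function:
  assumes \<phi>: "test_function disc \<phi>"
  shows "(angular_mean \<phi> has_real_derivative radial_deriv_mean \<phi> r) (at r)"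
    and "continuous_on UNIV (radial_deriv_mean \<phi>)"
    and "angular_mean \<phi> 1 = 0"
proof -
  note c = test_function_continuous[OF \<phi>] test_function_partial_continuous[OF \<phi>]
  define fx where "fx r \<theta> = partial_deriv \<phi> 1 (polar r \<theta>) * cos \<theta> + partial_deriv \<phi> 2 (polar r \<theta>) * sin \<theta>" for r \<theta>
  have trig: "continuous_on S (\<lambda>p::real \<times> real. cos (snd p))" "continuous_on S (\<lambda>p::real \<times> real. sin (snd p))" for S
    by (rule continuous_on_cos, rule continuous_on_snd, rule continuous_on_id)
       (rule continuous_on_sin, rule continuous_on_snd, rule continuous_on_id)
  have pc: "continuous_on S (\<lambda>p. partial_deriv \<phi> i (polar (fst p) (snd p)))" for S i
    by (rule continuous_on_polar_compose[OF c(2)]) (rule continuous_on_fst, rule continuous_on_id, rule continuous_on_snd, rule continuous_on_id)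
  have cfx: "continuous_on S (\<lambda>(r, \<theta>). fx r \<theta>)" for S
    unfolding fx_def case_prod_unfold by (rule continuous_on_add; rule continuous_on_mult; rule pc trig)
  have c\<phi>: "continuous_on UNIV (\<lambda>\<theta>. \<phi> (polar r \<theta>))" for r
    by (rule continuous_on_polar_compose[OF c(1) continuous_on_const continuous_on_id])
  have "continuous_on UNIV (\<lambda>\<theta>. fx (fst (r, \<theta>)) (snd (r, \<theta>)))" for r
    by (rule continuous_on_compose2[OF cfx[of UNIV, unfolded case_prod_unfold], of UNIV "\<lambda>\<theta>. (r, \<theta>)"])
       (auto intro!: continuous_on_Pair continuous_on_const continuous_on_id)
  then have cf: "continuous_on UNIV (fx r)" for r by simp
  have 1: "angular_mean \<phi> = (\<lambda>r. integral (cbox (-pi) pi) (\<lambda>\<theta>. \<phi> (polar r \<theta>)) / (2 * pi))"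
    using angular_integral_continuous[OF c\<phi>] by (simp add: angular_mean_def[abs_def])
  have 2: "radial_deriv_mean \<phi> = (\<lambda>r. integral (cbox (-pi) pi) (fx r) / (2 * pi))"
  proof
    fix r
    have "radial_deriv_mean \<phi> r = (\<integral>\<theta>. fx r \<theta> \<partial>angular_measure)"
      by (simp add: radial_deriv_mean_def fx_def)
    then show "radial_deriv_mean \<phi> r = integral (cbox (-pi) pi) (fx r) / (2 * pi)"
      using angular_integral_continuous[OF cf[of r]] by simp
  qed
  have "((\<lambda>r. integral (cbox (-pi) pi) (\<lambda>\<theta>. \<phi> (polar r \<theta>))) has_field_derivative integral (cbox (-pi) pi) (fx r)) (at r within UNIV)"
  proof (rule leibniz_rule_field_derivative)
    show "((\<lambda>r. \<phi> (polar r \<theta>)) has_field_derivative fx r \<theta>) (at r within UNIV)" for r \<theta>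
      using polar_radial_deriv[OF test_function_differentiable[OF \<phi>]] by (simp add: fx_def)
    show "(\<lambda>\<theta>. \<phi> (polar r \<theta>)) integrable_on cbox (-pi) pi" for r
      by (rule integrable_continuous) (rule continuous_on_subset[OF c\<phi>], simp)
  qed (auto intro: cfx)
  from DERIV_cdivide[OF this, of "2 * pi"]
  show "(angular_mean \<phi> has_real_derivative radial_deriv_mean \<phi> r) (at r)" unfolding 1 2 by simp
  have "continuous_on UNIV (\<lambda>r. integral (cbox (-pi) pi) (fx r))"
    by (rule integral_continuous_on_param) (rule cfx)
  then show "continuous_on UNIV (radial_deriv_mean \<phi>)" unfolding 2 by (intro continuous_intros) auto
  have "\<phi> (polar 1 \<theta>) = 0" for \<theta> by (rule test_function_zero[OF \<phi>]) simp
  then show "angular_mean \<phi> 1 = 0" by (simp add: angular_mean_def)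
qed

lemma radial_component_square_le:
  fixes x :: "real^2"
  shows "((x $ 1 * a + x $ 2 * b) / norm x)\<^sup>2 \<le> a\<^sup>2 + b\<^sup>2"
proof (cases "x = 0")
  case False
  have "(x $ 1 * a + x $ 2 * b)\<^sup>2 + (x $ 1 * b - x $ 2 * a)\<^sup>2 = ((x $ 1)\<^sup>2 + (x $ 2)\<^sup>2) * (a\<^sup>2 + b\<^sup>2)"
    by (simp add: power2_eq_square algebra_simps)
  then have "(x $ 1 * a + x $ 2 * b)\<^sup>2 \<le> (norm x)\<^sup>2 * (a\<^sup>2 + b\<^sup>2)"
    using zero_le_power2[of "x $ 1 * b - x $ 2 * a"] unfolding norm_squared_2 by linarith
  then show ?thesis using False by (simp add: power_divide divide_le_eq mult.commute)
qed simp

lemma radial_transfer: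
  assumes f[measurable]: "f \<in> borel_measurable borel" and V[measurable]: "V \<in> borel_measurable borel"
    and ae: "AE r in radial_measure. AE \<theta> in angular_measure. f (polar r \<theta>) = V r"
    and i: "integrable radial_measure V"
  shows "integrable disc_measure f" and "(\<integral>x. f x \<partial>disc_measure) = (\<integral>r. V r \<partial>radial_measure :: real)"
proof -
  have ae2: "AE r in radial_measure. integrable angular_measure (\<lambda>\<theta>. f (polar r \<theta>)) \<and>
      (\<integral>\<theta>. norm (f (polar r \<theta>)) \<partial>angular_measure) = norm (V r) \<and> (\<integral>\<theta>. f (polar r \<theta>) \<partial>angular_measure) = V r"
    using ae
  proof eventually_elim
    case (elim r)
    have "integrable angular_measure (\<lambda>\<theta>. f (polar r \<theta>)) \<longleftrightarrow> integrable angular_measure (\<lambda>\<theta>. V r)"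
      using elim by (intro integrable_cong_AE) auto
    then have "integrable angular_measure (\<lambda>\<theta>. f (polar r \<theta>))" by simp
    moreover have "(\<integral>\<theta>. norm (f (polar r \<theta>)) \<partial>angular_measure) = (\<integral>\<theta>. norm (V r) \<partial>angular_measure)"
      using elim by (intro integral_cong_AE) (auto elim!: eventually_mono)
    moreover have "(\<integral>\<theta>. f (polar r \<theta>) \<partial>angular_measure) = (\<integral>\<theta>. V r \<partial>angular_measure)"
      using elim by (intro integral_cong_AE) auto
    ultimately show ?case by simp
  qed
  have "integrable radial_measure (\<lambda>r. \<integral>\<theta>. norm (f (polar r \<theta>)) \<partial>angular_measure) \<longleftrightarrow> integrable radial_measure (\<lambda>r. norm (V r))"
    using ae2 by (intro integrable_cong_AE) (auto elim!: eventually_mono)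
  then have i1: "integrable radial_measure (\<lambda>r. \<integral>\<theta>. norm (f (polar r \<theta>)) \<partial>angular_measure)"
    using i by (simp only: integrable_norm)
  have "integrable (radial_measure \<Otimes>\<^sub>M angular_measure) (\<lambda>(r, \<theta>). f (polar r \<theta>))"
  proof (rule polar.Fubini_integrable)
    show "(\<lambda>(r, \<theta>). f (polar r \<theta>)) \<in> borel_measurable (radial_measure \<Otimes>\<^sub>M angular_measure)"
      unfolding case_prod_unfold by measurable
    show "integrable radial_measure (\<lambda>x. \<integral>y. norm ((\<lambda>(r, \<theta>). f (polar r \<theta>)) (x, y)) \<partial>angular_measure)"
      using i1 by simp
    show "AE x in radial_measure. integrable angular_measure (\<lambda>y. (\<lambda>(r, \<theta>). f (polar r \<theta>)) (x, y))"
      using ae2 by eventually_elim simp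
  qed
  then show d: "integrable disc_measure f" by (subst disc_polar_integrable) auto
  have "(\<integral>x. f x \<partial>disc_measure) = (\<integral>r. \<integral>\<theta>. f (polar r \<theta>) \<partial>angular_measure \<partial>radial_measure)"
    by (rule disc_polar_integral[OF f d])
  also have "\<dots> = (\<integral>r. V r \<partial>radial_measure)"
    using ae2 by (intro integral_cong_AE) (auto elim!: eventually_mono)
  finally show "(\<integral>x. f x \<partial>disc_measure) = (\<integral>r. V r \<partial>radial_measure)" .
qed

text \<open>The gradient is a parameter, because weak gradients are determined only up to null sets.\<close>

definition part_energy :: "(real^2 \<Rightarrow> real) \<Rightarrow> (real^2 \<Rightarrow> real^2) \<Rightarrow> real \<Rightarrow> real" where
  "part_energy u g \<sigma> = (\<integral>x. (if \<sigma> * u x > 0 then (norm (g x))\<^sup>2 else 0) \<partial>disc_measure)"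

text \<open>Angular means of approximating test functions are profiles to which the one-dimensional inequalities
  apply; they converge to the profile \<open>U\<close> of \<open>u\<close>, and their derivatives to the mean \<open>G\<close> of the radial
  component of the gradient. By the pigeonhole principle infinitely many of them have the same sign at
  \<open>r0\<close>, which determines the part for which Picone's inequality survives in the limit.\<close>

lemma radial_bounds:
  fixes \<alpha> \<kappa> r0 :: real
  assumes u: "u \<in> H1_0 disc" and g: "has_weak_gradient disc u g" and rad: "radial u"
    and \<alpha>: "\<alpha> \<ge> 0" and \<kappa>: "\<kappa> > 0" and r0: "0 < r0" "r0 < 1"
    and zeros: "\<And>r. 0 \<le> r \<Longrightarrow> r \<le> 1 \<Longrightarrow>
        bessel_series 0 (\<kappa>\<^sup>2 / 4 * r powr (2 * ((2 + \<alpha>) / 2))) = 0 \<longleftrightarrow> r = r0 \<or> r = 1"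
  shows "\<exists>\<sigma>. \<bar>\<sigma>\<bar> = 1 \<and>
      ((2 + \<alpha>) / 2 * \<kappa>)\<^sup>2 * (\<integral>x. norm x powr \<alpha> * (max (\<sigma> * u x) 0)\<^sup>2 \<partial>disc_measure) \<le> part_energy u g \<sigma>"
    and "\<And>\<sigma>. \<bar>\<sigma>\<bar> = 1 \<Longrightarrow> integrable disc_measure (\<lambda>x. (max (\<sigma> * u x) 0) ^ 4) \<and>
      (\<integral>x. (max (\<sigma> * u x) 0) ^ 4 \<partial>disc_measure) \<le> 16 * (part_energy u g \<sigma>)\<^sup>2"
proof -
  have uL: "L2 disc_measure u" by (rule H1_0_L2[OF u])
  have um[measurable]: "u \<in> borel_measurable disc_measure" using uL by auto
  have gL: "L2 disc_measure (\<lambda>x. g x $ i)" for i by (rule has_weak_gradient_L2[OF g])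
  have gm[measurable]: "(\<lambda>x. g x $ i) \<in> borel_measurable disc_measure" for i using gL by auto
  obtain u' where u'[measurable]: "u' \<in> borel_measurable borel" and uu': "AE x in disc_measure. u x = u' x"
    by (rule borel_representative[OF um], rule that)
  obtain a where a[measurable]: "a \<in> borel_measurable borel" and ga: "AE x in disc_measure. g x $ 1 = a x"
    by (rule borel_representative[OF gm], rule that)
  obtain b where b[measurable]: "b \<in> borel_measurable borel" and gb: "AE x in disc_measure. g x $ 2 = b x"
    by (rule borel_representative[OF gm], rule that)
  have L2_cong: "L2 disc_measure f \<Longrightarrow> f' \<in> borel_measurable borel \<Longrightarrow> (AE x in disc_measure. f x = f' x) \<Longrightarrow> L2 disc_measure f'" for f f' :: "real^2 \<Rightarrow> real"
  proof -
    assume f: "L2 disc_measure f" and f'[measurable]: "f' \<in> borel_measurable borel" and ff': "AE x in disc_measure. f x = f' x"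
    have [measurable]: "f \<in> borel_measurable disc_measure" using f by auto
    have "integrable disc_measure (\<lambda>x. (f x)\<^sup>2) \<longleftrightarrow> integrable disc_measure (\<lambda>x. (f' x)\<^sup>2)"
      using ff' by (intro integrable_cong_AE) (auto elim!: eventually_mono)
    then show "L2 disc_measure f'" using f by (simp add: L2_def)
  qed
  have u'L: "L2 disc_measure u'" by (rule L2_cong[OF uL u' uu'])
  have aL: "L2 disc_measure a" by (rule L2_cong[OF gL a ga])
  have bL: "L2 disc_measure b" by (rule L2_cong[OF gL b gb])
  define U where "U = angular_mean u'"
  have UL: "L2 radial_measure U" unfolding U_def by (rule angular_mean_L2(1)[OF u' u'L])
  have [measurable]: "U \<in> borel_measurable borel" unfolding U_def by measurable
  obtain f where "AE x in disc_measure. u x = f (norm x)" using rad unfolding radial_def by auto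
  with uu' have "AE x in disc_measure. u' x = f (norm x)" by eventually_elim simp
  from disc_polar_AE[OF this]
  have uU: "AE r in radial_measure. AE \<theta> in angular_measure. u' (polar r \<theta>) = U r"
  proof eventually_elim
    case (elim r)
    have "U r = (\<integral>\<theta>. f \<bar>r\<bar> \<partial>angular_measure)"
      unfolding U_def angular_mean_def using elim by (intro integral_cong_AE) auto
    then show ?case using elim by simp
  qed
  define rg where "rg x = (x $ 1 * a x + x $ 2 * b x) / norm x" for x :: "real^2"
  have nth[measurable]: "(\<lambda>x::real^2. x $ i) \<in> borel_measurable borel" for i
    by (intro borel_measurable_continuous_onI continuous_intros)
  have rgm[measurable]: "rg \<in> borel_measurable borel" unfolding rg_def by measurable
  have radL: "L2 disc_measure (\<lambda>x. (x $ 1 * h x + x $ 2 * k x) / norm x)"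
    if h[measurable]: "h \<in> borel_measurable borel" and k[measurable]: "k \<in> borel_measurable borel" and hk: "L2 disc_measure h" "L2 disc_measure k" for h k
    unfolding L2_def
  proof
    show "integrable disc_measure (\<lambda>x. ((x $ 1 * h x + x $ 2 * k x) / norm x)\<^sup>2)"
    proof (rule Bochner_Integration.integrable_bound)
      show "integrable disc_measure (\<lambda>x. (h x)\<^sup>2 + (k x)\<^sup>2)" using hk by (simp add: L2_def)
      show "AE x in disc_measure. norm (((x $ 1 * h x + x $ 2 * k x) / norm x)\<^sup>2) \<le> norm ((h x)\<^sup>2 + (k x)\<^sup>2)"
        using radial_component_square_le by (intro AE_I2) simp
    qed measurable
  qed measurable
  have rgL: "L2 disc_measure rg" unfolding rg_def by (rule radL[OF a b aL bL])
  define G where "G = angular_mean rg"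
  have GL: "L2 radial_measure G" unfolding G_def by (rule angular_mean_L2(1)[OF rgm rgL])
  have [measurable]: "G \<in> borel_measurable borel" unfolding G_def by measurable
  obtain \<phi> where \<phi>: "\<And>k. test_function disc (\<phi> k)"
    and \<phi>u: "(\<lambda>k. \<integral>x. (\<phi> k x - u x)\<^sup>2 \<partial>disc_measure) \<longlonglongrightarrow> 0"
    and \<phi>g: "\<And>i. (\<lambda>k. \<integral>x. (partial_deriv (\<phi> k) i x - g x $ i)\<^sup>2 \<partial>disc_measure) \<longlonglongrightarrow> 0"
    by (rule H1_0_approximation[OF u g], rule that)
  note \<phi>L = test_function_L2[OF \<phi>] and d\<phi>L = test_function_partial_L2[OF \<phi>]
  have \<phi>m[measurable]: "\<phi> k \<in> borel_measurable borel" for k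
    by (rule borel_measurable_continuous_onI[OF test_function_continuous[OF \<phi>]])
  have d\<phi>m[measurable]: "partial_deriv (\<phi> k) i \<in> borel_measurable borel" for k i
    by (rule borel_measurable_continuous_onI[OF test_function_partial_continuous[OF \<phi>]])
  define F where "F k = angular_mean (\<phi> k)" for k
  define D where "D k = radial_deriv_mean (\<phi> k)" for k
  have FD: "(F k has_real_derivative D k r) (at r)" "continuous_on UNIV (D k)" "F k 1 = 0" for k r
    unfolding F_def D_def by (rule angular_mean_test_function[OF \<phi>])+
  have FU: "(\<lambda>k. \<integral>r. (F k r - U r)\<^sup>2 \<partial>radial_measure) \<longlonglongrightarrow> 0"
  proof (rule Lim_null_comparison[OF _ \<phi>u], intro always_eventually allI)
    fix k
    have "(\<integral>r. (F k r - U r)\<^sup>2 \<partial>radial_measure) \<le> (\<integral>x. (\<phi> k x - u' x)\<^sup>2 \<partial>disc_measure)"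
      unfolding F_def U_def by (rule angular_mean_diff_le[OF \<phi>m u' \<phi>L u'L])
    also have "\<dots> = (\<integral>x. (\<phi> k x - u x)\<^sup>2 \<partial>disc_measure)"
      using uu' by (intro integral_cong_AE) (auto elim!: eventually_mono)
    finally show "norm (\<integral>r. (F k r - U r)\<^sup>2 \<partial>radial_measure) \<le> (\<integral>x. (\<phi> k x - u x)\<^sup>2 \<partial>disc_measure)" by simp
  qed
  define r\<phi> where "r\<phi> k x = (x $ 1 * partial_deriv (\<phi> k) 1 x + x $ 2 * partial_deriv (\<phi> k) 2 x) / norm x" for k and x :: "real^2"
  have r\<phi>m[measurable]: "r\<phi> k \<in> borel_measurable borel" for k unfolding r\<phi>_def by measurable
  have r\<phi>L: "L2 disc_measure (r\<phi> k)" for k unfolding r\<phi>_def by (rule radL[OF d\<phi>m d\<phi>m d\<phi>L d\<phi>L])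
  have Dr: "D k r = angular_mean (r\<phi> k) r" if "r > 0" for k r
    unfolding D_def radial_deriv_mean_def angular_mean_def r\<phi>_def
    by (rule arg_cong[where f = "\<lambda>h. (\<integral>\<theta>. h \<theta> \<partial>angular_measure)"], rule ext) (use that in \<open>simp add: field_simps\<close>)
  have Dm[measurable]: "D k \<in> borel_measurable borel" for k by (rule borel_measurable_continuous_onI[OF FD(2)])
  have "(\<lambda>k. (\<integral>x. (partial_deriv (\<phi> k) 1 x - g x $ 1)\<^sup>2 \<partial>disc_measure) + (\<integral>x. (partial_deriv (\<phi> k) 2 x - g x $ 2)\<^sup>2 \<partial>disc_measure)) \<longlonglongrightarrow> 0 + 0"
    by (intro tendsto_add \<phi>g)
  then have \<phi>g2: "(\<lambda>k. (\<integral>x. (partial_deriv (\<phi> k) 1 x - g x $ 1)\<^sup>2 \<partial>disc_measure) + (\<integral>x. (partial_deriv (\<phi> k) 2 x - g x $ 2)\<^sup>2 \<partial>disc_measure)) \<longlonglongrightarrow> 0" by simp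
  have DG: "(\<lambda>k. \<integral>r. (D k r - G r)\<^sup>2 \<partial>radial_measure) \<longlonglongrightarrow> 0"
  proof (rule Lim_null_comparison[OF _ \<phi>g2], intro always_eventually allI)
    fix k
    have i: "integrable disc_measure (\<lambda>x. (partial_deriv (\<phi> k) i x - g x $ i)\<^sup>2)" for i
      using L2_diff[OF d\<phi>L[of k i] gL[of i]] by (simp add: L2_def)
    have "(\<integral>r. (D k r - G r)\<^sup>2 \<partial>radial_measure) = (\<integral>r. (angular_mean (r\<phi> k) r - angular_mean rg r)\<^sup>2 \<partial>radial_measure)"
    proof (rule integral_cong_AE)
      show "AE r in radial_measure. (D k r - G r)\<^sup>2 = (angular_mean (r\<phi> k) r - angular_mean rg r)\<^sup>2"
        using radial_measure_AE by eventually_elim (simp add: Dr G_def)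
    qed measurable
    also have "\<dots> \<le> (\<integral>x. (r\<phi> k x - rg x)\<^sup>2 \<partial>disc_measure)"
      by (rule angular_mean_diff_le[OF r\<phi>m rgm r\<phi>L rgL])
    also have "\<dots> \<le> (\<integral>x. (partial_deriv (\<phi> k) 1 x - g x $ 1)\<^sup>2 + (partial_deriv (\<phi> k) 2 x - g x $ 2)\<^sup>2 \<partial>disc_measure)"
    proof (rule integral_mono_AE)
      show "integrable disc_measure (\<lambda>x. (r\<phi> k x - rg x)\<^sup>2)" using L2_diff[OF r\<phi>L rgL] by (simp add: L2_def)
      show "integrable disc_measure (\<lambda>x. (partial_deriv (\<phi> k) 1 x - g x $ 1)\<^sup>2 + (partial_deriv (\<phi> k) 2 x - g x $ 2)\<^sup>2)"
        by (intro Bochner_Integration.integrable_add i)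
      show "AE x in disc_measure. (r\<phi> k x - rg x)\<^sup>2 \<le> (partial_deriv (\<phi> k) 1 x - g x $ 1)\<^sup>2 + (partial_deriv (\<phi> k) 2 x - g x $ 2)\<^sup>2"
        using ga gb
      proof eventually_elim
        case (elim x)
        have "r\<phi> k x - rg x = (x $ 1 * (partial_deriv (\<phi> k) 1 x - a x) + x $ 2 * (partial_deriv (\<phi> k) 2 x - b x)) / norm x"
          unfolding r\<phi>_def rg_def by (simp add: diff_divide_distrib[symmetric] algebra_simps)
        then show ?case using radial_component_square_le[of x "partial_deriv (\<phi> k) 1 x - a x" "partial_deriv (\<phi> k) 2 x - b x"] elim by simp
      qed
    qed
    also have "\<dots> = (\<integral>x. (partial_deriv (\<phi> k) 1 x - g x $ 1)\<^sup>2 \<partial>disc_measure) + (\<integral>x. (partial_deriv (\<phi> k) 2 x - g x $ 2)\<^sup>2 \<partial>disc_measure)"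
      by (intro Bochner_Integration.integral_add i)
    finally show "norm (\<integral>r. (D k r - G r)\<^sup>2 \<partial>radial_measure) \<le> \<dots>" by simp
  qed
  have seq: "radial_sequence (\<lambda>k r. \<sigma> * F (s k) r) (\<lambda>k r. \<sigma> * D (s k) r) (\<lambda>r. \<sigma> * U r) (\<lambda>r. \<sigma> * G r)"
    if \<sigma>: "\<bar>\<sigma>\<bar> = 1" and s: "strict_mono s" for \<sigma> s
  proof
    have s2: "\<sigma>\<^sup>2 = 1" using \<sigma> by (metis power2_abs power_one)
    have e: "(\<sigma> * x - \<sigma> * y)\<^sup>2 = (x - y)\<^sup>2" for x y
      using s2 by (simp only: right_diff_distrib[symmetric] power_mult_distrib)
    show "((\<lambda>r. \<sigma> * F (s k) r) has_real_derivative \<sigma> * D (s k) r) (at r)" for k r by (intro DERIV_cmult FD)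
    show "continuous_on UNIV (\<lambda>r. \<sigma> * D (s k) r)" for k by (intro continuous_intros FD)
    show "\<sigma> * F (s k) 1 = 0" for k by (simp add: FD)
    show "L2 radial_measure (\<lambda>r. \<sigma> * U r)" "L2 radial_measure (\<lambda>r. \<sigma> * G r)" by (intro L2_cmult UL GL)+
    show "(\<lambda>k. \<integral>r. (\<sigma> * F (s k) r - \<sigma> * U r)\<^sup>2 \<partial>radial_measure) \<longlonglongrightarrow> 0"
      unfolding e using LIMSEQ_subseq_LIMSEQ[OF FU s] by (simp add: comp_def)
    show "(\<lambda>k. \<integral>r. (\<sigma> * D (s k) r - \<sigma> * G r)\<^sup>2 \<partial>radial_measure) \<longlonglongrightarrow> 0"
      unfolding e using LIMSEQ_subseq_LIMSEQ[OF DG s] by (simp add: comp_def)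
  qed
  define B where "B \<sigma> = (\<integral>r. (if \<sigma> * U r \<ge> 0 then \<sigma> * G r else 0)\<^sup>2 \<partial>radial_measure)" for \<sigma>
  have BA: "0 \<le> B \<sigma> \<and> B \<sigma> \<le> part_energy u g \<sigma>" if \<sigma>: "\<bar>\<sigma>\<bar> = 1" for \<sigma>
  proof
    show "0 \<le> B \<sigma>" by (simp add: B_def)
    define h where "h x = (if \<sigma> * u' x \<ge> 0 then \<sigma> * rg x else 0)" for x
    have hm[measurable]: "h \<in> borel_measurable borel" unfolding h_def by measurable
    have hL: "L2 disc_measure h"
      by (rule L2_bound[OF rgL, where c = 1]) (auto simp: h_def abs_mult \<sigma>)
    have "B \<sigma> = (\<integral>r. (angular_mean h r)\<^sup>2 \<partial>radial_measure)"
      unfolding B_def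
    proof (rule integral_cong_AE)
      show "AE r in radial_measure. (if \<sigma> * U r \<ge> 0 then \<sigma> * G r else 0)\<^sup>2 = (angular_mean h r)\<^sup>2"
        using uU
      proof eventually_elim
        case (elim r)
        have "angular_mean h r = (\<integral>\<theta>. (if \<sigma> * U r \<ge> 0 then \<sigma> * rg (polar r \<theta>) else 0) \<partial>angular_measure)"
          unfolding angular_mean_def h_def using elim by (intro integral_cong_AE) (auto elim!: eventually_mono)
        also have "\<dots> = (if \<sigma> * U r \<ge> 0 then \<sigma> * G r else 0)"
          by (simp add: G_def angular_mean_def)
        finally show ?case by simp
      qed
    qed measurable
    also have "\<dots> \<le> (\<integral>x. (h x)\<^sup>2 \<partial>disc_measure)" by (rule angular_mean_L2(2)[OF hm hL])
    also have "\<dots> \<le> (\<integral>x. (if \<sigma> * u x > 0 then (norm (g x))\<^sup>2 else 0) \<partial>disc_measure)"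
    proof (rule integral_mono_AE)
      show "integrable disc_measure (\<lambda>x. (h x)\<^sup>2)" using hL by (simp add: L2_def)
      have n: "integrable disc_measure (\<lambda>x. (norm (g x))\<^sup>2)"
        using g unfolding has_weak_gradient_def square_integrable_on_def by simp
      have [measurable]: "g \<in> borel_measurable disc_measure" by (rule has_weak_gradient_measurable[OF g])
      show "integrable disc_measure (\<lambda>x. if \<sigma> * u x > 0 then (norm (g x))\<^sup>2 else 0)"
        by (rule Bochner_Integration.integrable_bound[OF n]) auto
      show "AE x in disc_measure. (h x)\<^sup>2 \<le> (if \<sigma> * u x > 0 then (norm (g x))\<^sup>2 else 0)"
        using uu' ga gb weak_gradient_zero_on_zeros[OF u g]
      proof eventually_elim
        case (elim x)
        have r: "(rg x)\<^sup>2 \<le> (norm (g x))\<^sup>2"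
          using radial_component_square_le[of x "a x" "b x"] elim by (simp add: rg_def norm_squared_2)
        have s2: "\<sigma>\<^sup>2 = 1" using \<sigma> by (metis power2_abs power_one)
        show ?case
        proof (cases "\<sigma> * u x > 0")
          case True
          then show ?thesis using r elim s2 by (simp add: h_def power_mult_distrib)
        next
          case False
          have "\<sigma> * u' x < 0 \<or> u x = 0"
          proof (cases "u x = 0")
            case nz: False
            have "\<sigma> \<noteq> 0" using \<sigma> by auto
            then have "\<sigma> * u' x \<noteq> 0" using nz elim by simp
            moreover have "\<sigma> * u' x \<le> 0" using False elim by simp
            ultimately show ?thesis by (simp add: less_le)
          qed simp
          then have "h x = 0"
          proof
            assume "u x = 0"
            then have "norm (g x) = 0" using elim by simp
            then have "rg x = 0" using r by simp
            then show ?thesis by (simp add: h_def)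
          qed (simp add: h_def)
          then show ?thesis using False by simp
        qed
      qed
    qed
    finally show "B \<sigma> \<le> part_energy u g \<sigma>" by (simp add: part_energy_def)
  qed
  have transfer: "integrable disc_measure f \<and> (\<integral>x. f x \<partial>disc_measure) = (\<integral>r. \<Psi> r (U r) \<partial>radial_measure)"
    if f: "\<And>x. f x = \<Psi> (norm x) (u x)" and \<Psi>: "(\<lambda>p. \<Psi> (fst p) (snd p)) \<in> borel_measurable (borel \<Otimes>\<^sub>M borel)"
      and i: "integrable radial_measure (\<lambda>r. \<Psi> r (U r))" for f and \<Psi> :: "real \<Rightarrow> real \<Rightarrow> real"
  proof -
    define f' where "f' x = \<Psi> (norm x) (u' x)" for x
    have pair: "(\<lambda>x. \<Psi> (p x) (q x)) \<in> borel_measurable M"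
      if "p \<in> borel_measurable M" "q \<in> borel_measurable M" for p q and M :: "'z measure"
      using measurable_compose[OF measurable_Pair[OF that] \<Psi>] by simp
    have f'm: "f' \<in> borel_measurable borel" unfolding f'_def by (rule pair) measurable
    have fm: "f \<in> borel_measurable disc_measure" unfolding f by (rule pair) measurable
    have ff': "AE x in disc_measure. f x = f' x" using uu' by eventually_elim (simp add: f f'_def)
    have Vm: "(\<lambda>r. \<Psi> r (U r)) \<in> borel_measurable borel" by (rule pair) measurable
    have ae: "AE r in radial_measure. AE \<theta> in angular_measure. f' (polar r \<theta>) = \<Psi> r (U r)"
      using uU radial_measure_AE by eventually_elim (auto simp: f'_def elim!: eventually_mono)
    note t = radial_transfer[OF f'm Vm ae i]
    have "integrable disc_measure f \<longleftrightarrow> integrable disc_measure f'"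
      by (rule integrable_cong_AE[OF fm borel_measurable_disc[OF f'm] ff'])
    moreover have "(\<integral>x. f x \<partial>disc_measure) = (\<integral>x. f' x \<partial>disc_measure)"
      by (rule integral_cong_AE[OF fm borel_measurable_disc[OF f'm] ff'])
    ultimately show ?thesis using t by simp
  qed
  {
    fix \<sigma> :: real assume \<sigma>: "\<bar>\<sigma>\<bar> = 1"
    interpret S: radial_sequence "\<lambda>k r. \<sigma> * F k r" "\<lambda>k r. \<sigma> * D k r" "\<lambda>r. \<sigma> * U r" "\<lambda>r. \<sigma> * G r"
      using seq[OF \<sigma>, of "\<lambda>k. k"] by (simp add: strict_mono_def)
    have t: "integrable disc_measure (\<lambda>x. (max (\<sigma> * u x) 0) ^ 4) \<and>
      (\<integral>x. (max (\<sigma> * u x) 0) ^ 4 \<partial>disc_measure) = (\<integral>r. (max (\<sigma> * U r) 0) ^ 4 \<partial>radial_measure)"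
      by (rule transfer[of _ "\<lambda>r v. (max (\<sigma> * v) 0) ^ 4"]) (use S.limit_ladyzhenskaya in auto)
    have "(\<integral>r. (max (\<sigma> * U r) 0) ^ 4 \<partial>radial_measure) \<le> 16 * (B \<sigma>)\<^sup>2"
      using S.limit_ladyzhenskaya(2) by (simp add: B_def)
    also have "\<dots> \<le> 16 * (part_energy u g \<sigma>)\<^sup>2"
      using BA[OF \<sigma>] by (intro mult_left_mono power_mono) auto
    finally show "integrable disc_measure (\<lambda>x. (max (\<sigma> * u x) 0) ^ 4) \<and>
      (\<integral>x. (max (\<sigma> * u x) 0) ^ 4 \<partial>disc_measure) \<le> 16 * (part_energy u g \<sigma>)\<^sup>2"
      using t by simp
  }
  have "\<exists>\<sigma> s. \<bar>\<sigma>\<bar> = (1::real) \<and> strict_mono (s :: nat \<Rightarrow> nat) \<and> (\<forall>k. \<sigma> * F (s k) r0 \<le> 0)"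
  proof (cases "\<exists>\<^sub>\<infinity>k. F k r0 \<le> 0")
    case True
    then have inf: "infinite {k. F k r0 \<le> 0}" by (simp add: INFM_iff_infinite)
    have "F (enumerate {k. F k r0 \<le> 0} k) r0 \<le> 0" for k using enumerate_in_set[OF inf, of k] by simp
    then show ?thesis
      using strict_mono_enumerate[OF inf] by (intro exI[of _ 1] exI[of _ "enumerate {k. F k r0 \<le> 0}"]) auto
  next
    case False
    then have "\<exists>\<^sub>\<infinity>k. - F k r0 \<le> 0"
      by (auto simp: not_INFM not_le intro: MOST_INFM elim!: MOST_mono)
    then have inf: "infinite {k. - F k r0 \<le> 0}" by (simp add: INFM_iff_infinite)
    have "- F (enumerate {k. - F k r0 \<le> 0} k) r0 \<le> 0" for k using enumerate_in_set[OF inf, of k] by simp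
    then show ?thesis
      using strict_mono_enumerate[OF inf] by (intro exI[of _ "-1"] exI[of _ "enumerate {k. - F k r0 \<le> 0}"]) auto
  qed
  then obtain \<sigma> s where \<sigma>: "\<bar>\<sigma>\<bar> = (1::real)" and s: "strict_mono (s :: nat \<Rightarrow> nat)" and neg: "\<And>k. \<sigma> * F (s k) r0 \<le> 0" by auto
  interpret S: radial_sequence "\<lambda>k r. \<sigma> * F (s k) r" "\<lambda>k r. \<sigma> * D (s k) r" "\<lambda>r. \<sigma> * U r" "\<lambda>r. \<sigma> * G r"
    by (rule seq[OF \<sigma> s])
  have le: "((2 + \<alpha>) / 2 * \<kappa>)\<^sup>2 * (\<integral>r. r powr \<alpha> * (max (\<sigma> * U r) 0)\<^sup>2 \<partial>radial_measure) \<le> B \<sigma>"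
    unfolding B_def by (rule S.limit_picone[OF \<alpha> \<kappa> r0 zeros neg])
  have "integrable radial_measure (\<lambda>r. r powr \<alpha> * (max (\<sigma> * U r) 0)\<^sup>2)"
  proof (rule Bochner_Integration.integrable_bound)
    show "integrable radial_measure (\<lambda>r. (\<sigma> * U r)\<^sup>2)" using L2_cmult[OF UL] by (simp add: L2_def)
    show "AE r in radial_measure. norm (r powr \<alpha> * (max (\<sigma> * U r) 0)\<^sup>2) \<le> norm ((\<sigma> * U r)\<^sup>2)"
      using radial_measure_AE
    proof eventually_elim
      case (elim r)
      have "r powr \<alpha> \<le> 1" using elim \<alpha> by (intro powr_le1) auto
      moreover have "(max (\<sigma> * U r) 0)\<^sup>2 \<le> (\<sigma> * U r)\<^sup>2" by (auto simp: max_def)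
      ultimately have "r powr \<alpha> * (max (\<sigma> * U r) 0)\<^sup>2 \<le> 1 * (\<sigma> * U r)\<^sup>2" by (intro mult_mono) auto
      then show ?case by simp
    qed
  qed measurable
  then have "(\<integral>x. norm x powr \<alpha> * (max (\<sigma> * u x) 0)\<^sup>2 \<partial>disc_measure) = (\<integral>r. r powr \<alpha> * (max (\<sigma> * U r) 0)\<^sup>2 \<partial>radial_measure)"
    using transfer[of "\<lambda>x. norm x powr \<alpha> * (max (\<sigma> * u x) 0)\<^sup>2" "\<lambda>r v. r powr \<alpha> * (max (\<sigma> * v) 0)\<^sup>2"] by simp
  then show "\<exists>\<sigma>. \<bar>\<sigma>\<bar> = 1 \<and>
      ((2 + \<alpha>) / 2 * \<kappa>)\<^sup>2 * (\<integral>x. norm x powr \<alpha> * (max (\<sigma> * u x) 0)\<^sup>2 \<partial>disc_measure) \<le> part_energy u g \<sigma>"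
    using le BA[OF \<sigma>] \<sigma> by (intro exI[of _ \<sigma>]) auto
qed

section \<open>Functions with separated variables\<close>

text \<open>Polynomials in the coordinates that equal \<open>r\<^sup>n cos (n \<theta>)\<close> and \<open>r\<^sup>n sin (n \<theta>)\<close> in polar coordinates.\<close>

definition re_power :: "nat \<Rightarrow> real^2 \<Rightarrow> real" where
  "re_power n x = Re (Complex (x $ 1) (x $ 2) ^ n)"

definition im_power :: "nat \<Rightarrow> real^2 \<Rightarrow> real" where
  "im_power n x = Im (Complex (x $ 1) (x $ 2) ^ n)"

lemma smooth_re_im_power: "smooth (re_power n) \<and> smooth (im_power n)"
proof (induction n)
  case 0
  have "re_power 0 = (\<lambda>x. 1)" "im_power 0 = (\<lambda>x. 0)" by (auto simp: re_power_def im_power_def)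
  then show ?case by (simp add: smooth.const)
next
  case (Suc n)
  have "re_power (Suc n) = (\<lambda>x. x $ 1 * re_power n x - x $ 2 * im_power n x)"
    "im_power (Suc n) = (\<lambda>x. x $ 1 * im_power n x + x $ 2 * re_power n x)"
    by (auto simp: re_power_def im_power_def)
  then show ?case using Suc
    by (auto intro!: smooth_diff smooth.add smooth.mult smooth.coord)
qed

lemma re_power_polar: "re_power n (polar r \<theta>) = r ^ n * cos (real n * \<theta>)" for \<theta> :: real
proof -
  have "Complex (r * cos \<theta>) (r * sin \<theta>) = rcis r \<theta>" by (simp add: complex_eq_iff)
  then show ?thesis by (simp add: re_power_def DeMoivre2)
qed

lemma flat_1_le: "0 \<le> flat 1 y" "flat 1 y \<le> 1"
proof -
  show "0 \<le> flat 1 y" by (simp add: flat_def)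
  show "flat 1 y \<le> 1"
    using ramp'_bounds(2)[of 1 y] flat_0_bounds(1)[of y] by (simp add: ramp'_def)
qed

lemma angular_mean_cos_sin_squared:
  assumes "n \<ge> (1::nat)"
  shows "(\<integral>\<theta>. (cos (real n * \<theta>))\<^sup>2 \<partial>angular_measure) = 1 / 2" "(\<integral>\<theta>. (sin (real n * \<theta>))\<^sup>2 \<partial>angular_measure) = 1 / 2"
proof -
  have c: "continuous_on UNIV (\<lambda>\<theta>::real. (cos (real n * \<theta>))\<^sup>2)" "continuous_on UNIV (\<lambda>\<theta>::real. (sin (real n * \<theta>))\<^sup>2)"
    by (intro continuous_intros)+
  have np: "sin (real n * pi) = 0" by simp
  define k where "k = inverse (2 * real n)"
  have d1: "((\<lambda>\<theta>. 1 / 2 * \<theta> + k * (sin (real n * \<theta>) * cos (real n * \<theta>))) has_real_derivative (cos (real n * \<theta>))\<^sup>2) (at \<theta>)" for \<theta> :: real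
  proof -
    have "((\<lambda>\<theta>. 1 / 2 * \<theta> + k * (sin (real n * \<theta>) * cos (real n * \<theta>))) has_real_derivative
       1 / 2 + k * (sin (real n * \<theta>) * (- sin (real n * \<theta>) * n) + cos (real n * \<theta>) * n * cos (real n * \<theta>))) (at \<theta>)"
      by (rule derivative_eq_intros refl | simp)+
    moreover have "1 / 2 + k * (sin (real n * \<theta>) * (- sin (real n * \<theta>) * n) + cos (real n * \<theta>) * n * cos (real n * \<theta>)) = (cos (real n * \<theta>))\<^sup>2"
    proof -
      have "k * (sin (real n * \<theta>) * (- sin (real n * \<theta>) * n) + cos (real n * \<theta>) * n * cos (real n * \<theta>)) = (k * n) * ((cos (real n * \<theta>))\<^sup>2 - (sin (real n * \<theta>))\<^sup>2)"
        by (simp add: power2_eq_square algebra_simps)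
      also have "k * n = 1 / 2" using assms by (simp add: k_def)
      finally have e: "k * (sin (real n * \<theta>) * (- sin (real n * \<theta>) * n) + cos (real n * \<theta>) * n * cos (real n * \<theta>)) = 1 / 2 * ((cos (real n * \<theta>))\<^sup>2 - (sin (real n * \<theta>))\<^sup>2)" .
      show ?thesis unfolding e using sin_cos_squared_add[of "n * \<theta>"] by (simp add: field_simps)
    qed
    ultimately show ?thesis by simp
  qed
  have "((\<lambda>\<theta>. (cos (real n * \<theta>))\<^sup>2) has_integral (1 / 2 * pi + k * (sin (n * pi) * cos (n * pi))) - (1 / 2 * (- pi) + k * (sin (n * - pi) * cos (n * - pi)))) {-pi..pi}"
    by (rule fundamental_theorem_of_calculus, use pi_gt_zero in simp, rule has_vector_derivative_at_within,
        rule d1[unfolded has_real_derivative_iff_has_vector_derivative])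
  then have "integral {-pi..pi} (\<lambda>\<theta>. (cos (real n * \<theta>))\<^sup>2) = pi" by (simp add: integral_unique)
  then show c1: "(\<integral>\<theta>. (cos (real n * \<theta>))\<^sup>2 \<partial>angular_measure) = 1 / 2"
    using angular_integral_continuous[OF c(1)] by simp
  have "(\<integral>\<theta>. (sin (real n * \<theta>))\<^sup>2 \<partial>angular_measure) = (\<integral>\<theta>. 1 - (cos (real n * \<theta>))\<^sup>2 \<partial>angular_measure)"
    by (simp add: sin_squared_eq)
  also have "\<dots> = 1 - (\<integral>\<theta>. (cos (real n * \<theta>))\<^sup>2 \<partial>angular_measure)"
  proof (subst Bochner_Integration.integral_diff)
    show "integrable angular_measure (\<lambda>\<theta>. (cos (real n * \<theta>))\<^sup>2)"
      by (rule angular.integrable_const_bound[where B = 1]) (auto simp: abs_square_le_1)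
  qed auto
  finally show "(\<integral>\<theta>. (sin (real n * \<theta>))\<^sup>2 \<partial>angular_measure) = 1 / 2" using c1 by simp
qed

text \<open>The radial and the tangential derivative are the components of the gradient in a rotated
  orthonormal frame.\<close>

lemma polar_gradient_squared:
  fixes w :: "real^2 \<Rightarrow> real"
  assumes diff: "\<And>x. w differentiable (at x)" and w: "\<And>r \<theta>. r > 0 \<Longrightarrow> w (polar r \<theta>) = R r * cos (real n * \<theta>)"
    and R: "(R has_real_derivative R') (at r)" and r: "r > 0"
  shows "(norm (gradient w (polar r \<theta>)))\<^sup>2 = (R' * cos (real n * \<theta>))\<^sup>2 + (n * (R r / r) * sin (real n * \<theta>))\<^sup>2"
proof -
  define p where "p = partial_deriv w 1 (polar r \<theta>)"
  define q where "q = partial_deriv w 2 (polar r \<theta>)"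
  have "((\<lambda>r. R r * cos (real n * \<theta>)) has_real_derivative R' * cos (real n * \<theta>)) (at r)"
    by (rule DERIV_cmult_right[OF R])
  then have "((\<lambda>r. w (polar r \<theta>)) has_real_derivative R' * cos (real n * \<theta>)) (at r)"
    by (rule has_field_derivative_transform_within_open[where S = "{0<..}"]) (use r w in auto)
  from DERIV_unique[OF polar_radial_deriv[OF diff] this]
  have 1: "p * cos \<theta> + q * sin \<theta> = R' * cos (real n * \<theta>)" by (simp add: p_def q_def)
  have c: "((\<lambda>\<theta>. polar r \<theta>) has_derivative (\<lambda>h. h *\<^sub>R vector [- r * sin \<theta>, r * cos \<theta>])) (at \<theta>)"
  proof (rule has_derivative_componentwise_within[THEN iffD2], intro ballI)
    fix b :: "real^2" assume "b \<in> Basis"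
    then consider "b = axis 1 1" | "b = axis 2 1" by (auto simp: Basis_real_2)
    then show "((\<lambda>\<theta>. polar r \<theta> \<bullet> b) has_derivative (\<lambda>h. h *\<^sub>R vector [- r * sin \<theta>, r * cos \<theta>] \<bullet> b)) (at \<theta>)"
      by cases (auto simp: inner_axis intro!: derivative_eq_intros)
  qed
  from has_derivative_compose[OF c has_derivative_partials[OF diff]]
  have "((\<lambda>\<theta>. w (polar r \<theta>)) has_derivative (\<lambda>h. p * (h * (- r * sin \<theta>)) + q * (h * (r * cos \<theta>)))) (at \<theta>)"
    by (simp add: sum_2 p_def q_def)
  moreover have "(\<lambda>h. p * (h * (- r * sin \<theta>)) + q * (h * (r * cos \<theta>))) = (*) (p * (- r * sin \<theta>) + q * (r * cos \<theta>))"
    by (rule ext) (simp add: algebra_simps)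
  ultimately have "((\<lambda>\<theta>. w (polar r \<theta>)) has_real_derivative (p * (- r * sin \<theta>) + q * (r * cos \<theta>))) (at \<theta>)"
    by (simp only: has_field_derivative_def)
  moreover have "((\<lambda>\<theta>. w (polar r \<theta>)) has_real_derivative (R r * (- sin (real n * \<theta>) * n))) (at \<theta>)"
    unfolding w[OF r] by (rule derivative_eq_intros refl | simp)+
  ultimately have "p * (- r * sin \<theta>) + q * (r * cos \<theta>) = R r * (- sin (real n * \<theta>) * n)" by (rule DERIV_unique)
  then have 2: "q * cos \<theta> - p * sin \<theta> = - (n * (R r / r) * sin (real n * \<theta>))" using r by (simp add: field_simps)
  have "(norm (gradient w (polar r \<theta>)))\<^sup>2 = (p\<^sup>2 + q\<^sup>2) * ((cos \<theta>)\<^sup>2 + (sin \<theta>)\<^sup>2)"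
    by (simp add: norm_squared_2 p_def q_def)
  also have "\<dots> = (p * cos \<theta> + q * sin \<theta>)\<^sup>2 + (q * cos \<theta> - p * sin \<theta>)\<^sup>2"
    unfolding power2_eq_square by (simp only: algebra_simps)
  finally show ?thesis unfolding 1 2 by simp
qed

text \<open>For \<open>n \<ge> 1\<close> the squares of \<open>cos (n \<theta>)\<close> and \<open>sin (n \<theta>)\<close> both have the mean 1/2.\<close>

lemma separated_disc_integral:
  fixes P S :: "real \<Rightarrow> real"
  assumes n: "n \<ge> (1::nat)" and f[measurable]: "f \<in> borel_measurable borel" and fi: "integrable disc_measure f"
    and fp: "\<And>r \<theta>. 0 < r \<Longrightarrow> r < 1 \<Longrightarrow> f (polar r \<theta>) = P r * (cos (real n * \<theta>))\<^sup>2 + S r * (sin (real n * \<theta>))\<^sup>2"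
    and [measurable]: "P \<in> borel_measurable borel" "S \<in> borel_measurable borel"
  shows "(\<integral>x. f x \<partial>disc_measure) = (\<integral>r. P r + S r \<partial>radial_measure) / 2"
proof -
  have i: "integrable angular_measure (\<lambda>\<theta>. (cos (real n * \<theta>))\<^sup>2)" "integrable angular_measure (\<lambda>\<theta>. (sin (real n * \<theta>))\<^sup>2)"
    by (rule angular.integrable_const_bound[where B = 1]; auto simp: abs_square_le_1)+
  have "(\<integral>x. f x \<partial>disc_measure) = (\<integral>r. \<integral>\<theta>. f (polar r \<theta>) \<partial>angular_measure \<partial>radial_measure)"
    by (rule disc_polar_integral[OF f fi])
  also have "\<dots> = (\<integral>r. (P r + S r) / 2 \<partial>radial_measure)"
  proof (rule integral_cong_AE)
    show "AE r in radial_measure. (\<integral>\<theta>. f (polar r \<theta>) \<partial>angular_measure) = (P r + S r) / 2"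
      using radial_measure_AE
    proof eventually_elim
      case (elim r)
      then have "(\<integral>\<theta>. f (polar r \<theta>) \<partial>angular_measure) = (\<integral>\<theta>. P r * (cos (real n * \<theta>))\<^sup>2 + S r * (sin (real n * \<theta>))\<^sup>2 \<partial>angular_measure)"
        by (simp add: fp)
      also have "\<dots> = P r * (\<integral>\<theta>. (cos (real n * \<theta>))\<^sup>2 \<partial>angular_measure) + S r * (\<integral>\<theta>. (sin (real n * \<theta>))\<^sup>2 \<partial>angular_measure)"
        using i by simp
      finally show ?case using angular_mean_cos_sin_squared[OF n] by (simp add: add_divide_distrib)
    qed
    show "(\<lambda>r. \<integral>\<theta>. f (polar r \<theta>) \<partial>angular_measure) \<in> borel_measurable radial_measure"
      using measurable_angular_mean[OF f] unfolding angular_mean_def by simp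
  qed measurable
  also have "\<dots> = (\<integral>r. P r + S r \<partial>radial_measure) / 2" by simp
  finally show ?thesis .
qed

section \<open>A test function with small Rayleigh quotient\<close>

text \<open>With \<open>\<gamma> = (2 + \<alpha>) / 2\<close> the profile is \<open>r\<^sup>b B\<^sub>\<beta>(\<kappa>\<^sup>2 r\<^bsup>2\<gamma>\<^esup> / 4)\<close> for \<open>b = \<gamma> \<beta>\<close>, a multiple of
  \<open>J\<^sub>\<beta>(\<kappa> r\<^sup>\<gamma>)\<close>; the assumption \<open>zero\<close> says that it vanishes at 1. It is written as \<open>r\<^sup>n T(r\<^sup>2)\<close>, because
  \<open>r\<^sup>n cos (n \<theta>)\<close> is a polynomial and only the factor \<open>T\<close>, which is smooth away from the origin, has to be
  regularised. The function \<open>\<Theta>\<close> is \<open>s T'(s)\<close>.\<close>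

locale angular_profile =
  fixes \<alpha> \<beta> \<kappa> :: real and n :: nat
  assumes \<alpha>: "\<alpha> \<ge> 0" and \<kappa>: "\<kappa> > 0" and n: "n \<ge> 1" and \<beta>: "\<beta> > 0"
    and n\<beta>: "real n < (2 + \<alpha>) / 2 * \<beta>"
    and zero: "bessel_series \<beta> (\<kappa>\<^sup>2 / 4) = 0"
begin

definition "\<gamma> = (2 + \<alpha>) / 2"
definition "c = \<kappa>\<^sup>2 / 4"
definition "b = \<gamma> * \<beta>"
definition "a = (b - n) / 2"
definition "E s = bessel_series \<beta> (c * s powr \<gamma>)"
definition "E' s = bessel_series' \<beta> (c * s powr \<gamma>)"
definition "T s = s powr a * E s"
definition "\<Theta> s = s powr a * (a * E s + \<gamma> * (c * s powr \<gamma>) * E' s)"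

lemma \<gamma>: "\<gamma> \<ge> 1" using \<alpha> by (simp add: \<gamma>_def)
lemma c: "c > 0" using \<kappa> by (simp add: c_def)
lemma bn: "real n < b" using n\<beta> by (simp add: b_def \<gamma>_def)
lemma b1: "b > 1" using bn n by simp
lemma a: "a > 0" using bn by (simp add: a_def)
lemma E1: "E 1 = 0" using zero by (simp add: E_def c_def)

lemma E_deriv: "s > 0 \<Longrightarrow> (E has_real_derivative E' s * (c * (\<gamma> * s powr (\<gamma> - 1)))) (at s)"
  unfolding E_def E'_def
  by (rule bessel_series_has_deriv) (use \<beta> in \<open>auto intro!: DERIV_cmult has_real_derivative_powr\<close>)

lemma T_deriv: 
  assumes s: "s > 0" shows "(T has_real_derivative \<Theta> s / s) (at s)"
proof -
  have "(T has_real_derivative s powr a * (E' s * (c * (\<gamma> * s powr (\<gamma> - 1)))) + a * s powr (a - 1) * E s) (at s)"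
    unfolding T_def by (rule DERIV_mult'[OF has_real_derivative_powr[OF s] E_deriv[OF s]])
  moreover have "s powr a * (E' s * (c * (\<gamma> * s powr (\<gamma> - 1)))) + a * s powr (a - 1) * E s = \<Theta> s / s"
    using s by (simp add: \<Theta>_def powr_diff field_simps)
  ultimately show ?thesis by simp
qed

lemma T_continuous: "s > 0 \<Longrightarrow> isCont T s"
  using T_deriv DERIV_isCont by blast

lemma cont_powr: "p > 0 \<Longrightarrow> continuous_on {0..1} (\<lambda>s::real. s powr p)"
  by (intro continuous_on_powr' continuous_intros) auto

lemma cont_E: "continuous_on {0..1} E" and cont_E': "continuous_on {0..1} E'"
  unfolding E_def E'_def using \<beta> \<gamma> by (auto intro!: continuous_intros cont_powr)

lemma cont_\<Theta>: "continuous_on {0..1} \<Theta>"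
  unfolding \<Theta>_def by (intro continuous_intros cont_powr a cont_E cont_E') (use \<gamma> in auto)

lemma \<Theta>_continuous: "s > 0 \<Longrightarrow> s < 1 \<Longrightarrow> isCont \<Theta> s"
  using continuous_on_interior[OF cont_\<Theta>, of s] by (simp add: interior_atLeastAtMost_real)

text \<open>\<open>T\<close> vanishes at 1, hence at least linearly there; \<open>\<Theta>\<close> is continuous up to the origin, although
  \<open>T'\<close> need not be.\<close>

lemma T_bounds:
  obtains K where "K > 0" "\<And>s. 0 < s \<Longrightarrow> s \<le> 1 \<Longrightarrow> \<bar>T s\<bar> \<le> K * (1 - s)" "\<And>s. 0 < s \<Longrightarrow> s \<le> 1 \<Longrightarrow> \<bar>\<Theta> s\<bar> \<le> K"
proof -
  have bd: "\<exists>K>0. \<forall>s\<in>{0..1}. \<bar>f s\<bar> \<le> K" if "continuous_on {0..1} f" for f :: "real \<Rightarrow> real"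
  proof -
    have "bounded (f ` {0..1})" using compact_continuous_image[OF that] by (simp add: compact_imp_bounded)
    then show ?thesis unfolding bounded_pos by auto
  qed
  obtain K1 where K1: "K1 > 0" "\<forall>s\<in>{0..1}. \<bar>E' s\<bar> \<le> K1" using bd[OF cont_E'] by auto
  obtain K2 where K2: "K2 > 0" "\<forall>s\<in>{0..1}. \<bar>\<Theta> s\<bar> \<le> K2" using bd[OF cont_\<Theta>] by auto
  define L where "L = K1 * (c * \<gamma>)"
  have L: "L > 0" using K1 c \<gamma> by (simp add: L_def)
  have T: "\<bar>T s\<bar> \<le> L * (1 - s)" if s: "0 < s" "s \<le> 1" for s
  proof -
    have "\<bar>E 1 - E s\<bar> \<le> L * \<bar>1 - s\<bar>"
    proof (cases "s = 1")
      case False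
      then have "s < 1" using s by simp
      have "\<exists>z>s. z < 1 \<and> E 1 - E s = (1 - s) * (E' z * (c * (\<gamma> * z powr (\<gamma> - 1))))"
        by (rule MVT2[OF \<open>s < 1\<close>]) (use s in \<open>auto intro: E_deriv\<close>)
      then obtain z where z: "s < z" "z < 1" "E 1 - E s = (1 - s) * (E' z * (c * (\<gamma> * z powr (\<gamma> - 1))))" by auto
      have "z powr (\<gamma> - 1) \<le> 1" using z s \<gamma> by (intro powr_le1) auto
      then have "\<bar>E' z\<bar> * (c * (\<gamma> * z powr (\<gamma> - 1))) \<le> K1 * (c * (\<gamma> * 1))"
        using z s c \<gamma> K1 by (intro mult_mono mult_left_mono) auto
      then have "\<bar>1 - s\<bar> * (\<bar>E' z\<bar> * (c * (\<gamma> * z powr (\<gamma> - 1)))) \<le> \<bar>1 - s\<bar> * L"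
        by (intro mult_left_mono) (auto simp: L_def)
      then show ?thesis unfolding z(3) using c \<gamma> by (simp add: abs_mult mult.commute)
    qed simp
    then have e: "\<bar>E s\<bar> \<le> L * (1 - s)" using s by (simp add: E1)
    have "s powr a \<le> 1" using s a by (intro powr_le1) auto
    then have "s powr a * \<bar>E s\<bar> \<le> 1 * (L * (1 - s))" using e by (intro mult_mono) auto
    then show ?thesis by (simp add: T_def abs_mult)
  qed
  show ?thesis
  proof (rule that[of "max L K2"])
    fix s :: real assume s: "0 < s" "s \<le> 1"
    have "L * (1 - s) \<le> max L K2 * (1 - s)" using s by (intro mult_right_mono) auto
    then show "\<bar>T s\<bar> \<le> max L K2 * (1 - s)" using T[OF s] by linarith
    have "\<bar>\<Theta> s\<bar> \<le> K2" using K2 s by auto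
    then show "\<bar>\<Theta> s\<bar> \<le> max L K2" by (simp add: le_max_iff_disj)
  qed (use L in auto)
qed

text \<open>The argument of \<open>T\<close> is shifted by \<open>\<delta> k\<close>, away from the singularity at 0, and the cut-off factor \<open>flat 0 (y k s)\<close>
  vanishes for \<open>s \<ge> 1 - \<delta> k\<close>. The same \<open>\<delta> k\<close> is used for both: then the shifted \<open>T\<close> is small, of the order
  of \<open>\<delta> k\<close> times \<open>y k s\<close>, where the derivative of the cut-off factor is large.\<close>

definition "y k s = real (Suc k) * (1 - s) - 1"
definition "\<delta> k = inverse (real (Suc k))"
definition "h k s = T (s + \<delta> k) * flat 0 (y k s)"
definition "h' k s = \<Theta> (s + \<delta> k) / (s + \<delta> k) * flat 0 (y k s) - T (s + \<delta> k) * (flat 2 (y k s) * real (Suc k))"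
definition "R k r = r ^ n * h k (r\<^sup>2)"
definition "R' k r = real n * r ^ (n - 1) * h k (r\<^sup>2) + r ^ n * (h' k (r\<^sup>2) * (2 * r))"
definition "w k x = re_power n x * h k ((norm x)\<^sup>2)"
definition "R0 r = r ^ n * T (r\<^sup>2)"
definition "R0' r = r ^ (n - 1) * (real n * T (r\<^sup>2) + 2 * \<Theta> (r\<^sup>2))"

lemma \<delta>: "\<delta> k > 0" by (simp add: \<delta>_def)

lemma y_eq: "y k s = (1 - (s + \<delta> k)) / \<delta> k"
  by (simp add: y_def \<delta>_def field_simps)

lemma h_deriv: "s \<ge> 0 \<Longrightarrow> (h k has_real_derivative h' k s) (at s)"
proof -
  assume s: "s \<ge> 0"
  have 1: "((\<lambda>s. T (s + \<delta> k)) has_real_derivative \<Theta> (s + \<delta> k) / (s + \<delta> k) * 1) (at s)"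
    by (rule DERIV_chain2[OF T_deriv]) (use s \<delta>[of k] in \<open>auto intro!: derivative_eq_intros\<close>)
  have f0: "(flat 0 has_real_derivative flat 2 z) (at z)" for z using flat_deriv[of 0 z] by (simp add: numeral_2_eq_2)
  have 2: "((\<lambda>s. flat 0 (y k s)) has_real_derivative flat 2 (y k s) * (- real (Suc k))) (at s)"
    by (rule DERIV_chain2[OF f0]) (auto simp: y_def intro!: derivative_eq_intros)
  from DERIV_mult'[OF 1 2] show ?thesis
    by (simp add: h_def[abs_def] h'_def algebra_simps)
qed

lemma R_deriv: "r \<ge> 0 \<Longrightarrow> (R k has_real_derivative R' k r) (at r)"
proof -
  assume r: "r \<ge> 0"
  have s: "((\<lambda>r. r\<^sup>2) has_real_derivative 2 * r) (at r)" by (auto intro!: derivative_eq_intros)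
  have 1: "((\<lambda>r. h k (r\<^sup>2)) has_real_derivative h' k (r\<^sup>2) * (2 * r)) (at r)"
    by (rule DERIV_chain2[OF h_deriv s]) simp
  have 2: "((\<lambda>r. r ^ n) has_real_derivative real n * r ^ (n - 1)) (at r)"
    by (auto intro!: derivative_eq_intros)
  from DERIV_mult'[OF 2 1] show ?thesis by (simp add: R_def[abs_def] R'_def add.commute)
qed

lemma w_polar: "w k (polar r \<theta>) = R k r * cos (real n * \<theta>)" for \<theta> :: real
  by (simp add: w_def re_power_polar R_def)

lemma w_smooth: "smooth (w k)"
proof -
  have pos: "(norm x)\<^sup>2 + \<delta> k > 0" for x :: "real^2" using \<delta>[of k] by (intro add_nonneg_pos) auto
  have N: "smooth (\<lambda>x::real^2. (norm x)\<^sup>2 + \<delta> k)" by (intro smooth.add smooth.const smooth_norm_squared)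
  have "smooth (\<lambda>x. re_power n x * ((((norm x)\<^sup>2 + \<delta> k) powr a * bessel_series \<beta> (c * ((norm x)\<^sup>2 + \<delta> k) powr \<gamma>))
      * flat 0 (real (Suc k) * (1 - (norm x)\<^sup>2) - 1)))"
    using smooth_re_im_power \<beta>
    by (intro smooth.mult smooth.powr[OF N pos] smooth.bessel smooth.flat smooth_diff smooth.const smooth_norm_squared) auto
  then show ?thesis by (simp add: w_def[abs_def] h_def T_def E_def y_def)
qed

lemma w_zero: "x \<notin> cball 0 (sqrt (1 - \<delta> k)) \<Longrightarrow> w k x = 0"
proof -
  assume "x \<notin> cball 0 (sqrt (1 - \<delta> k))"
  then have "sqrt (1 - \<delta> k) < norm x" by simp
  moreover have "\<delta> k \<le> 1" by (simp add: \<delta>_def field_simps)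
  ultimately have "(sqrt (1 - \<delta> k))\<^sup>2 < (norm x)\<^sup>2" by (intro power_strict_mono) auto
  then have "1 - ((norm x)\<^sup>2 + \<delta> k) < 0" using \<open>\<delta> k \<le> 1\<close> by simp
  then have "y k ((norm x)\<^sup>2) < 0" unfolding y_eq using \<delta>[of k] by (rule divide_neg_pos)
  then show ?thesis by (simp add: w_def h_def flat_def)
qed

lemma support_subset: "cball 0 (sqrt (1 - \<delta> k)) \<subseteq> disc"
proof -
  have "sqrt (1 - \<delta> k) < 1" using \<delta>[of k] by simp
  then show ?thesis by (simp only: cball_subset_ball_iff) simp
qed

text \<open>The bounds do not depend on \<open>k\<close>. In the derivative of the cut-off factor, \<open>1 / \<delta> k\<close> is compensated by the
  linear decay of \<open>T\<close> at 1, since \<open>y * flat 2 y = flat 1 y\<close> is bounded.\<close>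

lemma h_bounds:
  assumes K: "K > 0" "\<And>s. 0 < s \<Longrightarrow> s \<le> 1 \<Longrightarrow> \<bar>T s\<bar> \<le> K * (1 - s)" "\<And>s. 0 < s \<Longrightarrow> s \<le> 1 \<Longrightarrow> \<bar>\<Theta> s\<bar> \<le> K"
    and s: "0 < s" "s < 1"
  shows "\<bar>h k s\<bar> \<le> K" "s * \<bar>h' k s\<bar> \<le> 2 * K"
proof -
  define \<tau> where "\<tau> = s + \<delta> k"
  have \<tau>: "\<tau> > 0" "s < \<tau>" using s \<delta>[of k] by (auto simp: \<tau>_def)
  have "\<bar>h k s\<bar> \<le> K \<and> s * \<bar>h' k s\<bar> \<le> 2 * K"
  proof (cases "\<tau> < 1")
    case False
    then have "y k s \<le> 0" unfolding y_eq using \<delta>[of k] by (simp add: \<tau>_def divide_le_0_iff)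
    then have "h k s = 0" "h' k s = 0" by (auto simp: h_def h'_def flat_def)
    then show ?thesis using K(1) by simp
  next
    case True
    have yk: "y k s = (1 - \<tau>) * real (Suc k)" by (simp add: y_eq \<tau>_def \<delta>_def divide_inverse)
    have Tt: "\<bar>T \<tau>\<bar> \<le> K * (1 - \<tau>)" using K(2) \<tau> True by simp
    have Tt2: "\<bar>T \<tau>\<bar> \<le> K"
    proof -
      have "K * (1 - \<tau>) \<le> K * 1" using K(1) \<tau> by (intro mult_left_mono) auto
      then show ?thesis using Tt by simp
    qed
    have 1: "\<bar>h k s\<bar> \<le> K"
    proof -
      have "\<bar>T \<tau>\<bar> * flat 0 (y k s) \<le> K * 1" using Tt2 flat_0_bounds K(1) by (intro mult_mono) auto
      then show ?thesis using flat_0_bounds(1)[of "y k s"] by (simp add: h_def abs_mult \<tau>_def)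
    qed
    have A: "s * \<bar>\<Theta> \<tau> / \<tau> * flat 0 (y k s)\<bar> \<le> K"
    proof -
      have "s / \<tau> \<le> 1" using \<tau> by simp
      then have "s / \<tau> * (\<bar>\<Theta> \<tau>\<bar> * flat 0 (y k s)) \<le> 1 * (K * 1)"
        using K True \<tau> s flat_0_bounds by (intro mult_mono) auto
      moreover have "s * \<bar>\<Theta> \<tau> / \<tau> * flat 0 (y k s)\<bar> = s / \<tau> * (\<bar>\<Theta> \<tau>\<bar> * flat 0 (y k s))"
        using \<tau> flat_0_bounds(1)[of "y k s"] by (simp add: abs_mult abs_divide)
      ultimately show ?thesis by simp
    qed
    have B: "s * \<bar>T \<tau> * (flat 2 (y k s) * real (Suc k))\<bar> \<le> K"
    proof -
      have f2: "flat 2 (y k s) \<ge> 0" by (simp add: flat_def)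
      have "\<bar>T \<tau>\<bar> * (flat 2 (y k s) * real (Suc k)) \<le> K * (1 - \<tau>) * (flat 2 (y k s) * real (Suc k))"
        using f2 by (intro mult_right_mono Tt) auto
      also have "\<dots> = K * (y k s * flat 2 (y k s))" by (simp add: yk mult_ac)
      also have "y k s * flat 2 (y k s) = flat 1 (y k s)" using flat_pos_mult[of "y k s" 1] by (simp add: numeral_2_eq_2)
      also have "K * flat 1 (y k s) \<le> K * 1" using flat_1_le K(1) by (intro mult_left_mono) auto
      finally have "\<bar>T \<tau>\<bar> * (flat 2 (y k s) * real (Suc k)) \<le> K" by simp
      then have "s * (\<bar>T \<tau>\<bar> * (flat 2 (y k s) * real (Suc k))) \<le> 1 * K" using s f2 by (intro mult_mono) auto
      then show ?thesis using f2 by (simp add: abs_mult)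
    qed
    have "s * \<bar>h' k s\<bar> \<le> s * (\<bar>\<Theta> \<tau> / \<tau> * flat 0 (y k s)\<bar> + \<bar>T \<tau> * (flat 2 (y k s) * real (Suc k))\<bar>)"
      unfolding h'_def \<tau>_def[symmetric] using s by (intro mult_left_mono abs_triangle_ineq4) auto
    also have "\<dots> \<le> 2 * K" using A B by (simp add: distrib_left)
    finally show ?thesis using 1 by simp
  qed
  then show "\<bar>h k s\<bar> \<le> K" "s * \<bar>h' k s\<bar> \<le> 2 * K" by auto
qed

lemma h_limits:
  assumes s: "0 < s" "s < 1"
  shows "(\<lambda>k. h k s) \<longlonglongrightarrow> T s" "(\<lambda>k. h' k s) \<longlonglongrightarrow> \<Theta> s / s"
proof -
  have d0: "\<delta> \<longlonglongrightarrow> 0" unfolding \<delta>_def by (rule LIMSEQ_inverse_real_of_nat)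
  then have sd: "(\<lambda>k. s + \<delta> k) \<longlonglongrightarrow> s + 0" by (intro tendsto_intros)
  then have sd: "(\<lambda>k. s + \<delta> k) \<longlonglongrightarrow> s" by simp
  have Tl: "(\<lambda>k. T (s + \<delta> k)) \<longlonglongrightarrow> T s" by (rule isCont_tendsto_compose[OF T_continuous[OF s(1)] sd])
  have \<Theta>l: "(\<lambda>k. \<Theta> (s + \<delta> k)) \<longlonglongrightarrow> \<Theta> s" by (rule isCont_tendsto_compose[OF \<Theta>_continuous[OF s] sd])
  have fl: "(\<lambda>k. flat 0 (y k s)) \<longlonglongrightarrow> 1"
    using flat_0_scaled_tendsto[of 1 "1 - s"] s by (simp add: y_def)
  show "(\<lambda>k. h k s) \<longlonglongrightarrow> T s" unfolding h_def using tendsto_mult[OF Tl fl] by simp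
  have f2: "(\<lambda>k. flat 2 (y k s) * real (Suc k)) \<longlonglongrightarrow> 0"
  proof -
    have "(\<lambda>k. flat 0 (y k s) * (\<delta> k / (1 - s - \<delta> k)\<^sup>2)) \<longlonglongrightarrow> 1 * (0 / (1 - s - 0)\<^sup>2)"
      by (intro tendsto_intros fl d0) (use s in auto)
    then have "(\<lambda>k. flat 0 (y k s) * (\<delta> k / (1 - s - \<delta> k)\<^sup>2)) \<longlonglongrightarrow> 0" by simp
    moreover have "\<forall>\<^sub>F k in sequentially. \<delta> k < 1 - s"
      using order_tendstoD(2)[OF d0, of "1 - s"] s by simp
    then have "\<forall>\<^sub>F k in sequentially. flat 0 (y k s) * (\<delta> k / (1 - s - \<delta> k)\<^sup>2) = flat 2 (y k s) * real (Suc k)"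
    proof eventually_elim
      case (elim k)
      have yk: "y k s = (1 - s - \<delta> k) / \<delta> k" by (simp add: y_eq)
      have "y k s > 0" unfolding yk using elim \<delta>[of k] by simp
      moreover have "real (Suc k) = 1 / \<delta> k" by (simp add: \<delta>_def divide_inverse)
      ultimately have "flat 2 (y k s) * real (Suc k) = flat 0 (y k s) / (y k s)\<^sup>2 / \<delta> k" by (simp add: flat_def)
      also have "\<dots> = flat 0 (y k s) * (\<delta> k / (1 - s - \<delta> k)\<^sup>2)"
        unfolding yk using \<delta>[of k] by (simp add: power_divide power2_eq_square)
      finally show ?case by simp
    qed
    ultimately show ?thesis by (rule Lim_transform_eventually)
  qed
  have "(\<lambda>k. h' k s) \<longlonglongrightarrow> \<Theta> s / s * 1 - T s * 0"
    unfolding h'_def by (intro tendsto_intros \<Theta>l sd fl Tl f2) (use s in auto)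
  then show "(\<lambda>k. h' k s) \<longlonglongrightarrow> \<Theta> s / s" by simp
qed

definition "lam = (\<gamma> * \<kappa>)\<^sup>2"

lemma measurable_profile [measurable]:
  "T \<in> borel_measurable borel" "\<Theta> \<in> borel_measurable borel"
  "R k \<in> borel_measurable borel" "R' k \<in> borel_measurable borel"
  "R0 \<in> borel_measurable borel" "R0' \<in> borel_measurable borel"
proof -
  have [measurable]: "bessel_series \<beta> \<in> borel_measurable borel" "bessel_series' \<beta> \<in> borel_measurable borel"
    using \<beta> by (auto intro!: borel_measurable_continuous_onI continuous_on_bessel_series[of \<beta> UNIV "\<lambda>x. x"]
        continuous_on_bessel_series'[of \<beta> UNIV "\<lambda>x. x"] continuous_on_id)
  have fm[measurable]: "flat m \<in> borel_measurable borel" for m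
    using flat_deriv by (intro borel_measurable_continuous_onI DERIV_continuous_on) (auto intro: has_field_derivative_at_within)
  have [measurable]: "E \<in> borel_measurable borel" "E' \<in> borel_measurable borel"
    unfolding E_def E'_def by measurable
  show [measurable]: "T \<in> borel_measurable borel" "\<Theta> \<in> borel_measurable borel"
    unfolding T_def \<Theta>_def by measurable
  have [measurable]: "h k \<in> borel_measurable borel" "h' k \<in> borel_measurable borel"
    unfolding h_def h'_def y_def by measurable
  show "R k \<in> borel_measurable borel" "R' k \<in> borel_measurable borel"
    unfolding R_def R'_def by measurable
  show "R0 \<in> borel_measurable borel" "R0' \<in> borel_measurable borel"
    unfolding R0_def R0'_def by measurable
qed

lemma R_bounds:
  obtains K where "K > 0" "\<And>k r. 0 < r \<Longrightarrow> r < 1 \<Longrightarrow> \<bar>R k r\<bar> \<le> K" "\<And>k r. 0 < r \<Longrightarrow> r < 1 \<Longrightarrow> \<bar>R k r / r\<bar> \<le> K"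
    "\<And>k r. 0 < r \<Longrightarrow> r < 1 \<Longrightarrow> \<bar>R' k r\<bar> \<le> K"
proof -
  obtain K where K: "K > 0" "\<And>s. 0 < s \<Longrightarrow> s \<le> 1 \<Longrightarrow> \<bar>T s\<bar> \<le> K * (1 - s)" "\<And>s. 0 < s \<Longrightarrow> s \<le> 1 \<Longrightarrow> \<bar>\<Theta> s\<bar> \<le> K"
    by (rule T_bounds, rule that)
  define K' where "K' = (real n + 4) * K"
  have KK: "K \<le> K'" using K(1) by (simp add: K'_def algebra_simps)
  have *: "\<bar>R k r\<bar> \<le> K' \<and> \<bar>R k r / r\<bar> \<le> K' \<and> \<bar>R' k r\<bar> \<le> K'" if r: "0 < r" "r < 1" for k r
  proof -
    have s: "0 < r\<^sup>2" "r\<^sup>2 < 1" using r by (auto simp: power_less_one_iff)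
    note hb = h_bounds[OF K s, of k]
    have rn: "r ^ n = r ^ (n - 1) * r" using n by (simp add: power_eq_if)
    have p1: "0 \<le> r ^ (n - 1)" "r ^ (n - 1) \<le> 1" using r by (auto intro: power_le_one)
    have a: "r ^ (n - 1) * \<bar>h k (r\<^sup>2)\<bar> \<le> 1 * K" using p1 hb(1) by (intro mult_mono) auto
    have b: "r ^ (n - 1) * (r\<^sup>2 * \<bar>h' k (r\<^sup>2)\<bar>) \<le> 1 * (2 * K)"
      by (rule mult_mono[OF p1(2) hb(2)]) auto
    have Rr: "\<bar>R k r / r\<bar> = r ^ (n - 1) * \<bar>h k (r\<^sup>2)\<bar>" using r p1 by (simp add: R_def rn abs_mult)
    have "\<bar>R k r\<bar> = r * \<bar>R k r / r\<bar>" using r by (simp add: abs_mult)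
    also have "\<dots> \<le> 1 * K" using r a Rr by (intro mult_mono) auto
    finally have 1: "\<bar>R k r\<bar> \<le> K" by simp
    have "\<bar>R' k r\<bar> \<le> \<bar>real n * r ^ (n - 1) * h k (r\<^sup>2)\<bar> + \<bar>r ^ n * (h' k (r\<^sup>2) * (2 * r))\<bar>"
      unfolding R'_def by (rule abs_triangle_ineq)
    also have "\<dots> = real n * (r ^ (n - 1) * \<bar>h k (r\<^sup>2)\<bar>) + 2 * (r ^ (n - 1) * (r\<^sup>2 * \<bar>h' k (r\<^sup>2)\<bar>))"
      using r p1 by (simp add: rn abs_mult power2_eq_square mult_ac)
    also have "\<dots> \<le> real n * (1 * K) + 2 * (1 * (2 * K))" using a b by (intro add_mono mult_left_mono) auto
    also have "\<dots> = K'" by (simp add: K'_def algebra_simps)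
    finally show ?thesis using 1 a Rr KK by auto
  qed
  show ?thesis
    by (rule that[of K']) (use * K(1) KK in auto)
qed

lemma R_limits:
  assumes r: "0 < r" "r < 1"
  shows "(\<lambda>k. R k r) \<longlonglongrightarrow> R0 r" "(\<lambda>k. R' k r) \<longlonglongrightarrow> R0' r"
proof -
  have s: "0 < r\<^sup>2" "r\<^sup>2 < 1" using r by (auto simp: power_less_one_iff)
  show "(\<lambda>k. R k r) \<longlonglongrightarrow> R0 r" unfolding R_def R0_def by (intro tendsto_intros h_limits s)
  have rn: "r ^ n = r ^ (n - 1) * r" using n by (simp add: power_eq_if)
  have "(\<lambda>k. R' k r) \<longlonglongrightarrow> real n * r ^ (n - 1) * T (r\<^sup>2) + r ^ n * (\<Theta> (r\<^sup>2) / r\<^sup>2 * (2 * r))"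
    unfolding R'_def by (intro tendsto_intros h_limits s)
  also have "real n * r ^ (n - 1) * T (r\<^sup>2) + r ^ n * (\<Theta> (r\<^sup>2) / r\<^sup>2 * (2 * r)) = R0' r"
    using r by (simp add: R0'_def rn power2_eq_square field_simps)
  finally show "(\<lambda>k. R' k r) \<longlonglongrightarrow> R0' r" .
qed

lemma w_test: "test_function disc (w k)"
  by (rule smooth_test_function[OF w_smooth compact_cball support_subset w_zero])

lemma w_measurable [measurable]: "w k \<in> borel_measurable borel"
  by (rule borel_measurable_continuous_onI[OF test_function_continuous[OF w_test]])

lemma gradient_w_measurable [measurable]: "(\<lambda>x. (norm (gradient (w k) x))\<^sup>2) \<in> borel_measurable borel"
proof -
  have [measurable]: "partial_deriv (w k) i \<in> borel_measurable borel" for i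
    by (rule borel_measurable_continuous_onI[OF test_function_partial_continuous[OF w_test]])
  have e: "(norm (gradient (w k) x))\<^sup>2 = (partial_deriv (w k) 1 x)\<^sup>2 + (partial_deriv (w k) 2 x)\<^sup>2" for x
    by (simp add: norm_squared_2)
  show ?thesis unfolding e by measurable
qed

lemma w_gradient: "has_weak_gradient disc (w k) (gradient (w k))"
  by (rule test_function_weak_gradient[OF w_test])

lemma gradient_w_integrable: "integrable disc_measure (\<lambda>x. (norm (gradient (w k) x))\<^sup>2)"
  using w_gradient unfolding has_weak_gradient_def square_integrable_on_def by simp

definition "G k = (\<integral>x. (norm (gradient (w k) x))\<^sup>2 \<partial>disc_measure)"
definition "Q k = (\<integral>x. norm x powr \<alpha> * (w k x)\<^sup>2 \<partial>disc_measure)"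

lemma norm_powr_measurable [measurable]: "(\<lambda>x::real^2. norm x powr \<alpha>) \<in> borel_measurable borel"
  by measurable

lemma norm_powr_le: "x \<in> disc \<Longrightarrow> norm x powr \<alpha> \<le> 1"
  using \<alpha> by (intro powr_le1) auto

lemma G_eq: "G k = (\<integral>r. (R' k r)\<^sup>2 + (n * (R k r / r))\<^sup>2 \<partial>radial_measure) / 2"
  unfolding G_def
proof (rule separated_disc_integral[OF n gradient_w_measurable gradient_w_integrable])
  fix r \<theta> :: real assume r: "0 < r" "r < 1"
  show "(norm (gradient (w k) (polar r \<theta>)))\<^sup>2 = (R' k r)\<^sup>2 * (cos (real n * \<theta>))\<^sup>2 + (n * (R k r / r))\<^sup>2 * (sin (real n * \<theta>))\<^sup>2"
    using polar_gradient_squared[of "w k" "R k" n "R' k r" r \<theta>] smooth_differentiable[OF w_smooth] w_polar R_deriv[of r k] r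
    by (simp add: power_mult_distrib power_divide)
qed measurable

lemma Q_eq: "Q k = (\<integral>r. r powr \<alpha> * (R k r)\<^sup>2 \<partial>radial_measure) / 2"
proof -
  have i: "integrable disc_measure (\<lambda>x. norm x powr \<alpha> * (w k x)\<^sup>2)"
  proof (rule Bochner_Integration.integrable_bound)
    show "integrable disc_measure (\<lambda>x. (w k x)\<^sup>2)" using test_function_L2[OF w_test] by (simp add: L2_def)
    show "AE x in disc_measure. norm (norm x powr \<alpha> * (w k x)\<^sup>2) \<le> norm ((w k x)\<^sup>2)"
      using norm_powr_le by (intro AE_I2) (auto intro!: mult_left_le_one_le)
  qed measurable
  have "Q k = (\<integral>r. r powr \<alpha> * (R k r)\<^sup>2 + 0 \<partial>radial_measure) / 2"
    unfolding Q_def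
    by (rule separated_disc_integral[OF n _ i]) (auto simp: w_polar power_mult_distrib)
  then show ?thesis by simp
qed

text \<open>The tangential derivative alone suffices, as \<open>n \<ge> 1\<close> and \<open>r \<le> 1\<close>.\<close>

lemma Q_le_G: "Q k \<le> G k"
proof -
  obtain K where K: "K > 0" "\<And>k r. 0 < r \<Longrightarrow> r < 1 \<Longrightarrow> \<bar>R k r\<bar> \<le> K" "\<And>k r. 0 < r \<Longrightarrow> r < 1 \<Longrightarrow> \<bar>R k r / r\<bar> \<le> K"
    "\<And>k r. 0 < r \<Longrightarrow> r < 1 \<Longrightarrow> \<bar>R' k r\<bar> \<le> K"
    by (rule R_bounds, rule that)
  have sq: "x\<^sup>2 \<le> K\<^sup>2" if "\<bar>x\<bar> \<le> K" for x using power_mono[OF that, of 2] by simp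
  have le: "AE r in radial_measure. r powr \<alpha> * (R k r)\<^sup>2 \<le> (R' k r)\<^sup>2 + (n * (R k r / r))\<^sup>2
      \<and> (R' k r)\<^sup>2 + (n * (R k r / r))\<^sup>2 \<le> K\<^sup>2 + n\<^sup>2 * K\<^sup>2"
    using radial_measure_AE
  proof eventually_elim
    case (elim r)
    have "r powr \<alpha> \<le> 1" using elim \<alpha> by (intro powr_le1) auto
    moreover have "(R k r)\<^sup>2 \<le> (n * (R k r / r))\<^sup>2"
    proof -
      have "\<bar>R k r\<bar> = r * \<bar>R k r / r\<bar>" using elim by simp
      also have "\<dots> \<le> real n * \<bar>R k r / r\<bar>" using elim n by (intro mult_right_mono) auto
      finally have "\<bar>R k r\<bar> \<le> \<bar>n * (R k r / r)\<bar>" by (simp add: abs_mult)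
      then show ?thesis by (simp only: abs_le_square_iff)
    qed
    ultimately have "r powr \<alpha> * (R k r)\<^sup>2 \<le> 1 * (n * (R k r / r))\<^sup>2" by (intro mult_mono) auto
    moreover have "(R' k r)\<^sup>2 \<le> K\<^sup>2" "(R k r / r)\<^sup>2 \<le> K\<^sup>2" using K elim by (auto intro!: sq)
    then have "(R' k r)\<^sup>2 + n\<^sup>2 * (R k r / r)\<^sup>2 \<le> K\<^sup>2 + n\<^sup>2 * K\<^sup>2" by (intro add_mono mult_left_mono) auto
    moreover have "(n * (R k r / r))\<^sup>2 = n\<^sup>2 * (R k r / r)\<^sup>2" by (simp add: power_mult_distrib power_divide)
    ultimately show ?case by (simp add: add_increasing)
  qed
  have i1: "integrable radial_measure (\<lambda>r. (R' k r)\<^sup>2 + (n * (R k r / r))\<^sup>2)"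
    by (rule radial.integrable_const_bound[where B = "K\<^sup>2 + n\<^sup>2 * K\<^sup>2"]) (use le in \<open>auto elim!: eventually_mono\<close>)
  have i2: "integrable radial_measure (\<lambda>r. r powr \<alpha> * (R k r)\<^sup>2)"
    by (rule Bochner_Integration.integrable_bound[OF i1]) (use le in \<open>auto elim!: eventually_mono\<close>)
  have "(\<integral>r. r powr \<alpha> * (R k r)\<^sup>2 \<partial>radial_measure) \<le> (\<integral>r. (R' k r)\<^sup>2 + (n * (R k r / r))\<^sup>2 \<partial>radial_measure)"
    by (rule integral_mono_AE[OF i2 i1]) (use le in \<open>auto elim!: eventually_mono\<close>)
  then show ?thesis unfolding G_eq Q_eq by simp
qed

text \<open>Twice the limit of the integrand of \<open>G k - lam * Q k\<close>, after averaging over the angle.\<close>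

definition "\<Phi> r = (R0' r)\<^sup>2 + (n * (R0 r / r))\<^sup>2 - lam * (r powr \<alpha> * (R0 r)\<^sup>2)"

text \<open>Dominated convergence, with the bounds that are uniform in \<open>k\<close>.\<close>

lemma G_minus_Q_limit: "(\<lambda>k. G k - lam * Q k) \<longlonglongrightarrow> (\<integral>r. \<Phi> r \<partial>radial_measure) / 2"
proof -
  obtain K where K: "K > 0" "\<And>k r. 0 < r \<Longrightarrow> r < 1 \<Longrightarrow> \<bar>R k r\<bar> \<le> K" "\<And>k r. 0 < r \<Longrightarrow> r < 1 \<Longrightarrow> \<bar>R k r / r\<bar> \<le> K"
    "\<And>k r. 0 < r \<Longrightarrow> r < 1 \<Longrightarrow> \<bar>R' k r\<bar> \<le> K"
    by (rule R_bounds, rule that)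
  have sq: "x\<^sup>2 \<le> K\<^sup>2" if "\<bar>x\<bar> \<le> K" for x using power_mono[OF that, of 2] by simp
  define f where "f k r = (R' k r)\<^sup>2 + (n * (R k r / r))\<^sup>2" for k r
  define g where "g k r = r powr \<alpha> * (R k r)\<^sup>2" for k r
  have bf: "AE r in radial_measure. \<bar>f k r\<bar> \<le> K\<^sup>2 + n\<^sup>2 * K\<^sup>2" for k
    using radial_measure_AE
  proof eventually_elim
    case (elim r)
    have "(R' k r)\<^sup>2 \<le> K\<^sup>2" "(R k r / r)\<^sup>2 \<le> K\<^sup>2" using K elim by (auto intro!: sq)
    then have "(R' k r)\<^sup>2 + n\<^sup>2 * (R k r / r)\<^sup>2 \<le> K\<^sup>2 + n\<^sup>2 * K\<^sup>2" by (intro add_mono mult_left_mono) auto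
    then show ?case by (simp add: f_def power_mult_distrib power_divide)
  qed
  have bg: "AE r in radial_measure. \<bar>g k r\<bar> \<le> K\<^sup>2" for k
    using radial_measure_AE
  proof eventually_elim
    case (elim r)
    have "r powr \<alpha> \<le> 1" using elim \<alpha> by (intro powr_le1) auto
    moreover have "(R k r)\<^sup>2 \<le> K\<^sup>2" using K elim by (auto intro!: sq)
    ultimately have "r powr \<alpha> * (R k r)\<^sup>2 \<le> 1 * K\<^sup>2" by (intro mult_mono) auto
    then show ?case by (simp add: g_def)
  qed
  have [measurable]: "f k \<in> borel_measurable borel" "g k \<in> borel_measurable borel" for k
    unfolding f_def g_def by measurable
  have fi: "integrable radial_measure (f k)" for k
    by (rule radial.integrable_const_bound[where B = "K\<^sup>2 + n\<^sup>2 * K\<^sup>2"]) (use bf[of k] in auto)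
  have gi: "integrable radial_measure (g k)" for k
    by (rule radial.integrable_const_bound[where B = "K\<^sup>2"]) (use bg[of k] in auto)
  have lim: "(\<lambda>k. \<integral>r. f k r - lam * g k r \<partial>radial_measure) \<longlonglongrightarrow> (\<integral>r. \<Phi> r \<partial>radial_measure)"
  proof (rule integral_dominated_convergence)
    show "\<Phi> \<in> borel_measurable radial_measure" unfolding \<Phi>_def[abs_def] by measurable
    show "integrable radial_measure (\<lambda>r. (K\<^sup>2 + n\<^sup>2 * K\<^sup>2) + \<bar>lam\<bar> * K\<^sup>2)" by simp
    show "AE r in radial_measure. (\<lambda>k. f k r - lam * g k r) \<longlonglongrightarrow> \<Phi> r"
      using radial_measure_AE
    proof eventually_elim
      case (elim r)
      then show ?case unfolding f_def g_def \<Phi>_def by (intro tendsto_intros R_limits) auto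
    qed
    show "AE r in radial_measure. norm (f k r - lam * g k r) \<le> (K\<^sup>2 + n\<^sup>2 * K\<^sup>2) + \<bar>lam\<bar> * K\<^sup>2" for k
      using bf[of k] bg[of k]
    proof eventually_elim
      case (elim r)
      have "\<bar>f k r - lam * g k r\<bar> \<le> \<bar>f k r\<bar> + \<bar>lam\<bar> * \<bar>g k r\<bar>"
        using abs_triangle_ineq4[of "f k r" "lam * g k r"] by (simp add: abs_mult)
      also have "\<dots> \<le> (K\<^sup>2 + n\<^sup>2 * K\<^sup>2) + \<bar>lam\<bar> * K\<^sup>2" using elim by (intro add_mono mult_left_mono) auto
      finally show ?case by simp
    qed
  qed measurable
  have eq: "(\<integral>r. f k r - lam * g k r \<partial>radial_measure) / 2 = G k - lam * Q k" for k
    unfolding G_eq Q_eq f_def[symmetric] g_def[symmetric] using fi gi by (simp add: diff_divide_distrib)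
  have "(\<lambda>k. (\<integral>r. f k r - lam * g k r \<partial>radial_measure) / 2) \<longlonglongrightarrow> (\<integral>r. \<Phi> r \<partial>radial_measure) / 2"
    by (intro tendsto_divide lim tendsto_const) simp
  then show ?thesis unfolding eq .
qed

text \<open>The limit profile \<open>R0\<close> in closed form: \<open>\<rho>\<close> is a multiple of \<open>J\<^sub>\<beta>(\<kappa> r\<^sup>\<gamma>)\<close> and \<open>N = r \<rho>'\<close>.\<close>

definition "t r = c * r powr (2 * \<gamma>)"
definition "e r = bessel_series \<beta> (t r)"
definition "\<rho> r = r powr b * e r"
definition "N r = r powr b * (b * e r + 2 * \<gamma> * (t r * bessel_series' \<beta> (t r)))"

lemma R0_eq:
  assumes r: "r > 0"
  shows "R0 r = \<rho> r" "r * R0' r = N r"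
proof -
  have r2: "r\<^sup>2 = r powr 2" using r by simp
  have 1: "(r\<^sup>2) powr \<gamma> = r powr (2 * \<gamma>)" unfolding r2 by (simp only: powr_powr)
  have "(r\<^sup>2) powr a = r powr (2 * a)" unfolding r2 by (simp only: powr_powr)
  also have "2 * a = b - n" by (simp add: a_def)
  finally have 2: "r ^ n * (r\<^sup>2) powr a = r powr b" using r by (simp add: powr_diff powr_realpow)
  show "R0 r = \<rho> r" unfolding R0_def T_def E_def 1 \<rho>_def e_def t_def 2[symmetric] by simp
  have rn: "r ^ n = r * r ^ (n - 1)" using n by (simp add: power_eq_if)
  have "r * R0' r = r ^ n * (real n * T (r\<^sup>2) + 2 * \<Theta> (r\<^sup>2))" unfolding R0'_def rn by simp
  also have "\<dots> = r ^ n * (r\<^sup>2) powr a * ((real n + 2 * a) * E (r\<^sup>2) + 2 * \<gamma> * (c * (r\<^sup>2) powr \<gamma>) * E' (r\<^sup>2))"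
    unfolding T_def \<Theta>_def by (simp add: algebra_simps)
  also have "real n + 2 * a = b" by (simp add: a_def field_simps)
  finally show "r * R0' r = N r" unfolding 2 E_def E'_def 1 N_def e_def t_def by (simp add: mult.assoc)
qed

lemma t_deriv: "r > 0 \<Longrightarrow> (t has_real_derivative 2 * \<gamma> * t r / r) (at r)"
proof -
  assume r: "r > 0"
  have "(t has_real_derivative c * (2 * \<gamma> * r powr (2 * \<gamma> - 1))) (at r)"
    unfolding t_def by (intro DERIV_cmult has_real_derivative_powr r)
  then show ?thesis using r by (simp add: t_def powr_diff mult_ac)
qed

lemma \<rho>_deriv:
  assumes r: "r > 0" shows "(\<rho> has_real_derivative N r / r) (at r)"
proof -
  have "((\<lambda>r. bessel_series \<beta> (t r)) has_real_derivative bessel_series' \<beta> (t r) * (2 * \<gamma> * t r / r)) (at r)"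
    by (rule bessel_series_has_deriv[OF _ t_deriv[OF r]]) (use \<beta> in simp)
  from DERIV_mult'[OF has_real_derivative_powr[OF r, of b] this]
  have "(\<rho> has_real_derivative r powr b * (bessel_series' \<beta> (t r) * (2 * \<gamma> * t r / r)) + b * r powr (b - 1) * e r) (at r)"
    by (simp add: \<rho>_def[abs_def] e_def)
  moreover have "r powr b * (bessel_series' \<beta> (t r) * (2 * \<gamma> * t r / r)) + b * r powr (b - 1) * e r = N r / r"
    using r by (simp add: N_def powr_diff field_simps)
  ultimately show ?thesis by simp
qed

text \<open>The Bessel equation for \<open>\<rho>\<close>: \<open>r (r \<rho>')' = (b\<^sup>2 - \<Lambda> r\<^bsup>2\<gamma>\<^esup>) \<rho>\<close>.\<close>

lemma N_deriv:
  assumes r: "r > 0" shows "(N has_real_derivative (b\<^sup>2 - lam * r powr (2 * \<gamma>)) * \<rho> r / r) (at r)"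
proof -
  define p where "p = (\<lambda>r. t r * bessel_series' \<beta> (t r))"
  have e': "(e has_real_derivative bessel_series' \<beta> (t r) * (2 * \<gamma> * t r / r)) (at r)"
    unfolding e_def by (rule bessel_series_has_deriv[OF _ t_deriv[OF r]]) (use \<beta> in simp)
  have "((\<lambda>s. s * bessel_series' \<beta> s) has_real_derivative - \<beta> * bessel_series' \<beta> (t r) - bessel_series \<beta> (t r)) (at (t r))"
    by (rule bessel_ode) (use \<beta> in simp)
  from DERIV_chain2[OF this t_deriv[OF r]]
  have p': "(p has_real_derivative (- \<beta> * bessel_series' \<beta> (t r) - e r) * (2 * \<gamma> * t r / r)) (at r)"
    by (simp add: p_def e_def)
  have "(N has_real_derivative r powr b * (b * (bessel_series' \<beta> (t r) * (2 * \<gamma> * t r / r)) + 2 * \<gamma> * ((- \<beta> * bessel_series' \<beta> (t r) - e r) * (2 * \<gamma> * t r / r)))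
     + b * r powr (b - 1) * (b * e r + 2 * \<gamma> * p r)) (at r)"
    unfolding N_def p_def[symmetric]
    using DERIV_mult'[OF has_real_derivative_powr[OF r, of b] DERIV_add[OF DERIV_cmult[OF e', of b] DERIV_cmult[OF p', of "2 * \<gamma>"]]]
    by (simp add: p_def)
  moreover have "r powr b * (b * (bessel_series' \<beta> (t r) * (2 * \<gamma> * t r / r)) + 2 * \<gamma> * ((- \<beta> * bessel_series' \<beta> (t r) - e r) * (2 * \<gamma> * t r / r)))
     + b * r powr (b - 1) * (b * e r + 2 * \<gamma> * p r) = (b\<^sup>2 - lam * r powr (2 * \<gamma>)) * \<rho> r / r"
  proof -
    have l: "lam * r powr (2 * \<gamma>) = 4 * \<gamma>\<^sup>2 * t r"
      by (simp add: lam_def t_def c_def power_mult_distrib)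
    have q: "r powr (b - 1) = r powr b / r" using r by (simp add: powr_diff)
    define X where "X = r powr b"
    define Y where "Y = t r"
    define Z where "Z = bessel_series' \<beta> (t r)"
    define W where "W = e r"
    have "X * (b * (Z * (2 * \<gamma> * Y / r)) + 2 * \<gamma> * ((- \<beta> * Z - W) * (2 * \<gamma> * Y / r))) + b * (X / r) * (b * W + 2 * \<gamma> * (Y * Z))
       = (X / r) * (b * (Z * (2 * \<gamma> * Y)) + 2 * \<gamma> * ((- \<beta> * Z - W) * (2 * \<gamma> * Y)) + b * (b * W + 2 * \<gamma> * (Y * Z)))"
      using r by (simp add: field_simps)
    also have "\<dots> = (X / r) * ((b\<^sup>2 - 4 * \<gamma>\<^sup>2 * Y) * W)"
      unfolding b_def by (simp add: power2_eq_square algebra_simps)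
    finally have *: "X * (b * (Z * (2 * \<gamma> * Y / r)) + 2 * \<gamma> * ((- \<beta> * Z - W) * (2 * \<gamma> * Y / r))) + b * (X / r) * (b * W + 2 * \<gamma> * (Y * Z))
       = (b\<^sup>2 - 4 * \<gamma>\<^sup>2 * Y) * (X * W) / r" by (simp add: mult_ac)
    then show ?thesis unfolding l q p_def \<rho>_def unfolding X_def Y_def Z_def W_def .
  qed
  ultimately show ?thesis by simp
qed

lemma profile_continuous: "continuous_on {0..1} e" "continuous_on {0..1} \<rho>" "continuous_on {0..1} N"
proof -
  have ct: "continuous_on {0..1} t" unfolding t_def by (intro continuous_intros cont_powr) (use \<gamma> in auto)
  show ce: "continuous_on {0..1} e"
    unfolding e_def by (rule continuous_on_bessel_series[OF _ ct]) (use \<beta> in simp)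
  have cb: "continuous_on {0..1} (\<lambda>r. bessel_series' \<beta> (t r))"
    by (rule continuous_on_bessel_series'[OF _ ct]) (use \<beta> in simp)
  have cp: "continuous_on {0..1} (\<lambda>r::real. r powr b)" by (rule cont_powr) (use b1 in simp)
  show "continuous_on {0..1} \<rho>" unfolding \<rho>_def by (rule continuous_on_mult[OF cp ce])
  show "continuous_on {0..1} N"
    unfolding N_def by (intro continuous_on_mult continuous_on_add continuous_on_const cp ce cb ct)
qed

text \<open>Integrating the derivative of \<open>\<rho> N = r \<rho> \<rho>'\<close>, which vanishes at 0 and 1, shows that the Rayleigh quotient
  for the angular frequency \<open>b\<close> is exactly \<open>lam\<close>. Lowering the frequency to \<open>n < b\<close> leaves a negative
  multiple of \<open>\<integral>\<rho>\<^sup>2 / r\<close>.\<close>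

lemma \<Phi>_negative: "(\<integral>r. \<Phi> r \<partial>radial_measure) < 0"
proof -
  define m where "m r = \<rho> r * ((b\<^sup>2 - lam * r powr (2 * \<gamma>)) * \<rho> r / r) + N r / r * N r" for r
  define g where "g r = r powr (2 * b - 1) * (e r)\<^sup>2" for r
  have z0: "\<rho> 0 = 0" "N 0 = 0" "g 0 = 0" using b1 by (simp_all add: \<rho>_def N_def g_def)
  have z1: "\<rho> 1 = 0" using zero by (simp add: \<rho>_def e_def t_def c_def)
  have m: "(m has_integral (\<rho> 1 * N 1 - \<rho> 0 * N 0)) {0..1}"
  proof (rule fundamental_theorem_of_calculus_interior)
    show "continuous_on {0..1} (\<lambda>r. \<rho> r * N r)" by (intro continuous_on_mult profile_continuous)
    fix r :: real assume "r \<in> {0<..<1}"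
    then have r: "r > 0" by simp
    have "((\<lambda>r. \<rho> r * N r) has_real_derivative m r) (at r)"
      unfolding m_def by (rule DERIV_mult'[OF \<rho>_deriv[OF r] N_deriv[OF r]])
    then show "((\<lambda>r. \<rho> r * N r) has_vector_derivative m r) (at r)"
      by (simp only: has_real_derivative_iff_has_vector_derivative)
  qed simp
  have cg: "continuous_on {0..1} g"
    unfolding g_def by (intro continuous_on_mult continuous_on_power cont_powr profile_continuous) (use b1 in simp)
  define I where "I = integral {0..1} g"
  have hg: "(g has_integral I) {0..1}" unfolding I_def by (intro integrable_integral integrable_continuous_real cg)
  have I: "I > 0"
  proof -
    have "I \<ge> 0" unfolding I_def by (intro integral_nonneg integrable_continuous_real cg) (simp add: g_def)
    moreover have "I \<noteq> 0"
    proof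
      assume "I = 0"
      then have z: "g r = 0" if "r \<in> cbox 0 1" for r
        using integral_cbox_eq_0_iff[of 0 1 g] cg that unfolding I_def by (simp add: g_def)
      have ez: "e r = 0" if "0 < r" "r \<le> 1" for r using z[of r] that by (simp add: g_def)
      have "(e \<longlongrightarrow> e 0) (at 0 within {0..1})" using profile_continuous(1) by (simp add: continuous_on)
      then have "(e \<longlongrightarrow> e 0) (at_right 0)" by (simp add: at_within_Icc_at_right)
      moreover have "(e \<longlongrightarrow> 0) (at_right 0)"
        using ez by (intro tendsto_eventually eventually_at_rightI[of 0 1]) auto
      ultimately have "e 0 = 0" by (rule tendsto_unique[OF trivial_limit_at_right_real])
      then show False by (simp add: e_def t_def bessel_series_0)
    qed
    ultimately show ?thesis by simp
  qed
  obtain K where K: "K > 0" "\<And>s. 0 < s \<Longrightarrow> s \<le> 1 \<Longrightarrow> \<bar>T s\<bar> \<le> K * (1 - s)" "\<And>s. 0 < s \<Longrightarrow> s \<le> 1 \<Longrightarrow> \<bar>\<Theta> s\<bar> \<le> K"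
    by (rule T_bounds, rule that)
  define C where "C = ((real n + 2) * K)\<^sup>2 + (real n * K)\<^sup>2 + lam * K\<^sup>2"
  have lam0: "lam \<ge> 0" by (simp add: lam_def)
  have bound: "\<bar>\<Phi> r\<bar> \<le> C" if r: "0 \<le> r" "r \<le> 1" for r
  proof -
    have T: "\<bar>T (r\<^sup>2)\<bar> \<le> K \<and> \<bar>\<Theta> (r\<^sup>2)\<bar> \<le> K"
    proof (cases "r = 0")
      case True
      then show ?thesis using K(1) a by (simp add: T_def \<Theta>_def)
    next
      case False
      then have s: "0 < r\<^sup>2" "r\<^sup>2 \<le> 1" using r by (auto simp: power_le_one)
      have "K * (1 - r\<^sup>2) \<le> K * 1" using K(1) by (intro mult_left_mono) auto
      then show ?thesis using K(2,3)[OF s] by auto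
    qed
    have p1: "0 \<le> r ^ (n - 1)" "r ^ (n - 1) \<le> 1" using r by (auto intro: power_le_one)
    have rn: "r ^ n = r * r ^ (n - 1)" using n by (simp add: power_eq_if)
    have 1: "\<bar>R0 r / r\<bar> \<le> K"
    proof (cases "r = 0")
      case False
      then have "\<bar>R0 r / r\<bar> = r ^ (n - 1) * \<bar>T (r\<^sup>2)\<bar>" using r p1 by (simp add: R0_def rn abs_mult)
      also have "\<dots> \<le> 1 * K" using p1 T by (intro mult_mono) auto
      finally show ?thesis by simp
    qed (use K(1) in simp)
    have 2: "\<bar>R0 r\<bar> \<le> K"
    proof -
      have "\<bar>R0 r\<bar> = r ^ n * \<bar>T (r\<^sup>2)\<bar>" using r by (simp add: R0_def abs_mult)
      also have "\<dots> \<le> 1 * K" using r T by (intro mult_mono power_le_one) auto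
      finally show ?thesis by simp
    qed
    have 3: "\<bar>R0' r\<bar> \<le> (real n + 2) * K"
    proof -
      have "\<bar>real n * T (r\<^sup>2) + 2 * \<Theta> (r\<^sup>2)\<bar> \<le> real n * \<bar>T (r\<^sup>2)\<bar> + 2 * \<bar>\<Theta> (r\<^sup>2)\<bar>"
        using abs_triangle_ineq[of "real n * T (r\<^sup>2)" "2 * \<Theta> (r\<^sup>2)"] by (simp add: abs_mult)
      also have "\<dots> \<le> real n * K + 2 * K" using T by (intro add_mono mult_left_mono) auto
      finally have "\<bar>real n * T (r\<^sup>2) + 2 * \<Theta> (r\<^sup>2)\<bar> \<le> (real n + 2) * K" by (simp add: algebra_simps)
      then have "r ^ (n - 1) * \<bar>real n * T (r\<^sup>2) + 2 * \<Theta> (r\<^sup>2)\<bar> \<le> 1 * ((real n + 2) * K)"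
        using p1 by (intro mult_mono) auto
      then show ?thesis using p1 by (simp add: R0'_def abs_mult)
    qed
    have "(R0' r)\<^sup>2 \<le> ((real n + 2) * K)\<^sup>2" using power_mono[OF 3, of 2] by simp
    moreover have "(n * (R0 r / r))\<^sup>2 \<le> (real n * K)\<^sup>2"
    proof -
      have "\<bar>n * (R0 r / r)\<bar> = real n * \<bar>R0 r / r\<bar>" by (simp only: abs_mult abs_of_nat)
      also have "\<dots> \<le> real n * K" using 1 by (intro mult_left_mono) auto
      finally have "\<bar>n * (R0 r / r)\<bar> \<le> real n * K" .
      from power_mono[OF this abs_ge_zero, of 2] show ?thesis by (simp only: power2_abs)
    qed
    moreover have "lam * (r powr \<alpha> * (R0 r)\<^sup>2) \<le> lam * (1 * K\<^sup>2)"
    proof (intro mult_left_mono mult_mono)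
      show "r powr \<alpha> \<le> 1" using r \<alpha> by (intro powr_le1) auto
      show "(R0 r)\<^sup>2 \<le> K\<^sup>2" using power_mono[OF 2, of 2] by simp
    qed (use lam0 in auto)
    moreover have "0 \<le> (R0' r)\<^sup>2" "0 \<le> (n * (R0 r / r))\<^sup>2" "0 \<le> lam * (r powr \<alpha> * (R0 r)\<^sup>2)" using lam0 by auto
    ultimately show ?thesis unfolding \<Phi>_def C_def abs_le_iff mult_1 by linarith
  qed
  have \<Phi>m: "\<Phi> \<in> borel_measurable borel" unfolding \<Phi>_def[abs_def] by measurable
  have h1: "((\<lambda>r. r * \<Phi> r) has_integral (\<integral>r. \<Phi> r \<partial>radial_measure) / (2 * pi)) {0..1}"
    by (rule radial_integral(2)[OF \<Phi>m bound])
  have "((\<lambda>r. m r - (b\<^sup>2 - n\<^sup>2) * g r) has_integral (\<rho> 1 * N 1 - \<rho> 0 * N 0) - (b\<^sup>2 - n\<^sup>2) * I) {0..1}"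
    by (intro has_integral_diff has_integral_mult_right m hg)
  moreover have "m r - (b\<^sup>2 - n\<^sup>2) * g r = r * \<Phi> r" if "r \<in> {0..1}" for r
  proof (cases "r = 0")
    case True
    then show ?thesis using z0 by (simp add: m_def)
  next
    case False
    then have r: "r > 0" using that by simp
    have R0': "R0' r = N r / r" using R0_eq(2)[OF r] r by (simp add: field_simps)
    have pw: "r powr (2 * \<gamma>) = r\<^sup>2 * r powr \<alpha>"
    proof -
      have "2 * \<gamma> = 2 + \<alpha>" by (simp add: \<gamma>_def)
      then show ?thesis using r by (simp add: powr_add)
    qed
    have g: "g r = (\<rho> r)\<^sup>2 / r"
    proof -
      have "r powr (2 * b - 1) = (r powr b)\<^sup>2 / r" using r by (simp add: powr_diff power2_eq_square flip: powr_add)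
      then show ?thesis by (simp add: g_def \<rho>_def power_mult_distrib)
    qed
    show ?thesis unfolding \<Phi>_def m_def R0' R0_eq(1)[OF r] pw g
      using r by (simp add: field_simps power2_eq_square)
  qed
  ultimately have "((\<lambda>r. r * \<Phi> r) has_integral (\<rho> 1 * N 1 - \<rho> 0 * N 0) - (b\<^sup>2 - n\<^sup>2) * I) {0..1}"
    by (rule has_integral_eq[rotated]) auto
  from has_integral_unique[OF h1 this] have "(\<integral>r. \<Phi> r \<partial>radial_measure) / (2 * pi) = - ((b\<^sup>2 - n\<^sup>2) * I)"
    using z0 z1 by simp
  moreover have "(real n)\<^sup>2 < b\<^sup>2" using bn by (intro power_strict_mono) auto
  then have "(b\<^sup>2 - n\<^sup>2) * I > 0" using I by simp
  ultimately have "(\<integral>r. \<Phi> r \<partial>radial_measure) / (2 * pi) < 0" by linarith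
  then show ?thesis by (simp add: divide_less_0_iff)
qed

lemma good_test_function: obtains k where "G k < lam * Q k" "0 < Q k"
proof -
  have "\<forall>\<^sub>F k in sequentially. G k - lam * Q k < 0"
    by (rule order_tendstoD(2)[OF G_minus_Q_limit]) (use \<Phi>_negative in simp)
  then obtain k where k: "G k - lam * Q k < 0" by (auto simp: eventually_sequentially)
  have "0 \<le> G k" by (simp add: G_def)
  then have "0 < lam * Q k" using k by linarith
  then have "0 < Q k" by (auto simp: lam_def zero_less_mult_iff)
  then show ?thesis using k by (intro that[of k]) auto
qed

end

section \<open>Rotations\<close>

text \<open>The piece of the shifted interval that sticks out beyond \<open>\<pi>\<close> is moved back by one period.\<close>

lemma angular_shift:
  fixes g :: "real \<Rightarrow> real"
  assumes [measurable]: "g \<in> borel_measurable borel" and per: "\<And>\<theta>. g (\<theta> + 2 * pi) = g \<theta>"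
    and s: "0 \<le> s" "s \<le> 2 * pi" and i: "integrable angular_measure g"
  shows "(\<integral>\<theta>. g (\<theta> + s) \<partial>angular_measure) = (\<integral>\<theta>. g \<theta> \<partial>angular_measure)"
proof -
  have ang: "(\<integral>\<theta>. f \<theta> \<partial>angular_measure) = (\<integral>\<theta>. indicator {-pi<..<pi} \<theta> * f \<theta> \<partial>lborel) / (2 * pi)"
    "integrable angular_measure f \<longleftrightarrow> integrable lborel (\<lambda>\<theta>. indicator {-pi<..<pi} \<theta> * f \<theta>)"
    if [measurable]: "f \<in> borel_measurable borel" for f :: "real \<Rightarrow> real"
  proof -
    have d: "angular_measure = density lborel (\<lambda>\<theta>. ennreal (1 / (2 * pi) * indicator {-pi<..<pi} \<theta>))"
      unfolding angular_measure_def by (intro density_cong) (auto simp: indicator_def)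
    have "(\<integral>\<theta>. f \<theta> \<partial>angular_measure) = (\<integral>\<theta>. (1 / (2 * pi) * indicator {-pi<..<pi} \<theta>) *\<^sub>R f \<theta> \<partial>lborel)"
      unfolding d by (rule integral_density) auto
    also have "\<dots> = (\<integral>\<theta>. 1 / (2 * pi) * (indicator {-pi<..<pi} \<theta> * f \<theta>) \<partial>lborel)" by (simp add: mult.assoc)
    also have "\<dots> = 1 / (2 * pi) * (\<integral>\<theta>. indicator {-pi<..<pi} \<theta> * f \<theta> \<partial>lborel)" by (rule integral_mult_right_zero)
    finally show "(\<integral>\<theta>. f \<theta> \<partial>angular_measure) = (\<integral>\<theta>. indicator {-pi<..<pi} \<theta> * f \<theta> \<partial>lborel) / (2 * pi)" by simp
    have "integrable angular_measure f \<longleftrightarrow> integrable lborel (\<lambda>\<theta>. (1 / (2 * pi) * indicator {-pi<..<pi} \<theta>) *\<^sub>R f \<theta>)"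
      unfolding d by (rule integrable_density) auto
    also have "\<dots> \<longleftrightarrow> integrable lborel (\<lambda>\<theta>. 1 / (2 * pi) * (indicator {-pi<..<pi} \<theta> * f \<theta>))" by (simp add: mult.assoc)
    also have "\<dots> \<longleftrightarrow> integrable lborel (\<lambda>\<theta>. indicator {-pi<..<pi} \<theta> * f \<theta>)"
      by (subst integrable_mult_left_iff) simp
    finally show "integrable angular_measure f \<longleftrightarrow> integrable lborel (\<lambda>\<theta>. indicator {-pi<..<pi} \<theta> * f \<theta>)" .
  qed
  have shift: "(\<integral>\<theta>. f (\<theta> + c) \<partial>lborel) = (\<integral>\<theta>. f \<theta> \<partial>lborel)" for f :: "real \<Rightarrow> real" and c
    using lborel_integral_real_affine[of 1 f c] by (simp add: add.commute)
  have i0: "integrable lborel (\<lambda>\<theta>. indicator {-pi<..<pi} \<theta> * g \<theta>)" using i by (simp add: ang(2))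
  define A where "A = {-pi<..<s - pi}"
  define B where "B = {s - pi<..<pi}"
  have iA: "integrable lborel (\<lambda>\<theta>. indicator A \<theta> * g \<theta>)"
    by (rule Bochner_Integration.integrable_bound[OF i0]) (use s in \<open>auto simp: A_def indicator_def\<close>)
  have iB: "integrable lborel (\<lambda>\<theta>. indicator B \<theta> * g \<theta>)"
    by (rule Bochner_Integration.integrable_bound[OF i0]) (use s in \<open>auto simp: B_def indicator_def\<close>)
  define A2 where "A2 = {pi<..<s + pi}"
  have eA: "indicator A2 (\<theta> + 2 * pi) * g (\<theta> + 2 * pi) = indicator A \<theta> * g \<theta>" for \<theta>
    using per[of \<theta>] by (auto simp: A_def A2_def indicator_def)
  have iA2: "integrable lborel (\<lambda>\<theta>. indicator A2 \<theta> * g \<theta>)"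
  proof -
    have "integrable lborel (\<lambda>\<theta>. indicator A2 (\<theta> + 2 * pi) * g (\<theta> + 2 * pi))" unfolding eA by (rule iA)
    then have "integrable lborel (\<lambda>\<theta>. indicator A2 (2 * pi + 1 * \<theta>) * g (2 * pi + 1 * \<theta>))" by (simp add: add.commute)
    then show ?thesis using lborel_integrable_real_affine_iff[of 1 "\<lambda>\<theta>. indicator A2 \<theta> * g \<theta>" "2 * pi"] by simp
  qed
  have A2A: "(\<integral>\<theta>. indicator A2 \<theta> * g \<theta> \<partial>lborel) = (\<integral>\<theta>. indicator A \<theta> * g \<theta> \<partial>lborel)"
    using shift[of "\<lambda>\<theta>. indicator A2 \<theta> * g \<theta>" "2 * pi"] unfolding eA by simp
  have "(\<integral>\<theta>. indicator {-pi<..<pi} \<theta> * g (\<theta> + s) \<partial>lborel) = (\<integral>\<theta>. indicator {s - pi<..<s + pi} (\<theta> + s) * g (\<theta> + s) \<partial>lborel)"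
    by (intro Bochner_Integration.integral_cong) (auto simp: indicator_def)
  also have "\<dots> = (\<integral>\<theta>. indicator {s - pi<..<s + pi} \<theta> * g \<theta> \<partial>lborel)" by (rule shift)
  also have "\<dots> = (\<integral>\<theta>. indicator B \<theta> * g \<theta> + indicator A2 \<theta> * g \<theta> \<partial>lborel)"
  proof (rule integral_cong_AE)
    show "AE \<theta> in lborel. indicator {s - pi<..<s + pi} \<theta> * g \<theta> = indicator B \<theta> * g \<theta> + indicator A2 \<theta> * g \<theta>"
      using AE_lborel_singleton[of pi] by eventually_elim (use s in \<open>auto simp: A2_def B_def indicator_def\<close>)
  qed (auto simp: A2_def B_def)
  also have "\<dots> = (\<integral>\<theta>. indicator B \<theta> * g \<theta> \<partial>lborel) + (\<integral>\<theta>. indicator A \<theta> * g \<theta> \<partial>lborel)"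
    using iB iA2 A2A by simp
  also have "\<dots> = (\<integral>\<theta>. indicator B \<theta> * g \<theta> + indicator A \<theta> * g \<theta> \<partial>lborel)" using iB iA by simp
  also have "\<dots> = (\<integral>\<theta>. indicator {-pi<..<pi} \<theta> * g \<theta> \<partial>lborel)"
  proof (rule integral_cong_AE)
    show "AE \<theta> in lborel. indicator B \<theta> * g \<theta> + indicator A \<theta> * g \<theta> = indicator {-pi<..<pi} \<theta> * g \<theta>"
      using AE_lborel_singleton[of "s - pi"] by eventually_elim (use s in \<open>auto simp: A_def B_def indicator_def\<close>)
  qed (auto simp: A_def B_def)
  finally show ?thesis by (simp add: ang(1))
qed

lemma rotated_disc_integral:
  fixes f f' :: "real^2 \<Rightarrow> real"
  assumes f[measurable]: "f \<in> borel_measurable borel" and f'[measurable]: "f' \<in> borel_measurable borel"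
    and i: "integrable disc_measure f" and i': "integrable disc_measure f'" and s: "0 \<le> s" "s \<le> 2 * pi"
    and rot: "\<And>r \<theta>. 0 < r \<Longrightarrow> r < 1 \<Longrightarrow> f' (polar r \<theta>) = f (polar r (\<theta> + s))"
  shows "(\<integral>x. f' x \<partial>disc_measure) = (\<integral>x. f x \<partial>disc_measure)"
proof -
  have "integrable (radial_measure \<Otimes>\<^sub>M angular_measure) (\<lambda>(r, \<theta>). f (polar r \<theta>))" using i by (simp add: disc_polar_integrable)
  from polar.AE_integrable_fst'[OF this]
  have ae: "AE r in radial_measure. integrable angular_measure (\<lambda>\<theta>. f (polar r \<theta>))" by simp
  have "(\<integral>x. f' x \<partial>disc_measure) = (\<integral>r. angular_mean f' r \<partial>radial_measure)"
    unfolding angular_mean_def by (rule disc_polar_integral[OF f' i'])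
  also have "\<dots> = (\<integral>r. angular_mean f r \<partial>radial_measure)"
  proof (rule integral_cong_AE)
    show "AE r in radial_measure. angular_mean f' r = angular_mean f r"
      using ae radial_measure_AE
    proof eventually_elim
      case (elim r)
      have "polar r (\<theta> + 2 * pi) = polar r \<theta>" for \<theta> by (simp add: vec_eq_iff forall_2)
      then have "(\<integral>\<theta>. f (polar r (\<theta> + s)) \<partial>angular_measure) = (\<integral>\<theta>. f (polar r \<theta>) \<partial>angular_measure)"
        using elim by (intro angular_shift[OF _ _ s]) auto
      then show ?case using elim rot by (simp add: angular_mean_def)
    qed
  qed (use measurable_angular_mean[OF f] measurable_angular_mean[OF f'] in auto)
  also have "\<dots> = (\<integral>x. f x \<partial>disc_measure)"
    unfolding angular_mean_def by (rule disc_polar_integral[symmetric, OF f i])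
  finally show ?thesis .
qed

section \<open>The energy of radial functions in the Nehari set\<close>

lemma test_function_H1_0:
  assumes \<phi>: "test_function disc \<phi>"
  shows "\<phi> \<in> H1_0 disc"
proof -
  have L: "L2 disc_measure \<phi>" by (rule test_function_L2[OF \<phi>])
  have w: "has_weak_gradient disc \<phi> (gradient \<phi>)" by (rule test_function_weak_gradient[OF \<phi>])
  have "has_weak_gradient disc (\<lambda>x. 1 * \<phi> x + (-1) * \<phi> x) (\<lambda>x. 1 *\<^sub>R gradient \<phi> x + (-1) *\<^sub>R gradient \<phi> x)"
    by (rule has_weak_gradient_linear[OF L L w w])
  then have z: "has_weak_gradient disc (\<lambda>x. \<phi> x - \<phi> x) (\<lambda>x. 0)" by simp
  have "(\<integral>x. (norm (weak_gradient disc (\<lambda>x. \<phi> x - \<phi> x) x))\<^sup>2 \<partial>disc_measure) = (\<integral>x. 0 \<partial>disc_measure)"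
  proof (rule integral_cong_AE)
    have "weak_gradient disc (\<lambda>x. \<phi> x - \<phi> x) \<in> borel_measurable disc_measure"
      by (rule has_weak_gradient_measurable[OF weak_gradient_works(1)[OF z]])
    then show "(\<lambda>x. (norm (weak_gradient disc (\<lambda>x. \<phi> x - \<phi> x) x))\<^sup>2) \<in> borel_measurable disc_measure" by measurable
    show "AE x in disc_measure. (norm (weak_gradient disc (\<lambda>x. \<phi> x - \<phi> x) x))\<^sup>2 = 0"
      using weak_gradient_works(2)[OF z] by eventually_elim simp
  qed simp
  then have "H1_norm disc (\<lambda>x. \<phi> x - \<phi> x) = 0" by (simp add: H1_norm_def)
  then have "\<forall>\<epsilon>>0. \<exists>\<psi>. test_function disc \<psi> \<and> H1_norm disc (\<lambda>x. \<phi> x - \<psi> x) < \<epsilon>"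
    using \<phi> by (intro allI impI exI[of _ \<phi>]) auto
  moreover have "\<phi> \<in> H1 disc" unfolding H1_def using L w by (auto simp: square_integrable_real)
  ultimately show ?thesis unfolding H1_0_def by simp
qed

definition part_mass :: "real \<Rightarrow> real \<Rightarrow> (real^2 \<Rightarrow> real) \<Rightarrow> real \<Rightarrow> real" where
  "part_mass \<alpha> q u \<sigma> = (\<integral>x. norm x powr \<alpha> * (max (\<sigma> * u x) 0) powr q \<partial>disc_measure)"

text \<open>Only the set where \<open>u\<close> has the sign \<open>\<sigma>\<close> contributes to the derivative in the direction of this part.\<close>

lemma energy_deriv_part:
  assumes u: "u \<in> H1_0 disc" and g: "has_weak_gradient disc u g" and \<sigma>: "\<bar>\<sigma>\<bar> = 1"
  shows "energy_deriv \<alpha> p u (\<lambda>x. max (\<sigma> * u x) 0) = \<sigma> * (part_energy u g \<sigma> - part_mass \<alpha> (p + 1) u \<sigma>)"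
proof -
  have [measurable]: "u \<in> borel_measurable disc_measure" using H1_0_L2[OF u] by auto
  have gm[measurable]: "g \<in> borel_measurable disc_measure" by (rule has_weak_gradient_measurable[OF g])
  note pg = signed_part_weak_gradient[OF u g \<sigma>]
  have s: "\<sigma> = 1 \<or> \<sigma> = -1" using \<sigma> by (auto simp: abs_if split: if_splits)
  have "(\<integral>x. weak_gradient disc u x \<bullet> weak_gradient disc (\<lambda>x. max (\<sigma> * u x) 0) x \<partial>disc_measure)
      = (\<integral>x. \<sigma> * (if \<sigma> * u x > 0 then (norm (g x))\<^sup>2 else 0) \<partial>disc_measure)"
  proof (rule integral_cong_AE)
    show "(\<lambda>x. weak_gradient disc u x \<bullet> weak_gradient disc (\<lambda>x. max (\<sigma> * u x) 0) x) \<in> borel_measurable disc_measure"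
      by (intro borel_measurable_inner has_weak_gradient_measurable[OF weak_gradient_works(1)[OF g]]
          has_weak_gradient_measurable[OF weak_gradient_works(1)[OF pg]])
    show "AE x in disc_measure. weak_gradient disc u x \<bullet> weak_gradient disc (\<lambda>x. max (\<sigma> * u x) 0) x
        = \<sigma> * (if \<sigma> * u x > 0 then (norm (g x))\<^sup>2 else 0)"
      using weak_gradient_works(2)[OF g] weak_gradient_works(2)[OF pg]
      by eventually_elim (simp add: power2_norm_eq_inner)
  qed measurable
  also have "\<dots> = \<sigma> * part_energy u g \<sigma>" by (simp add: part_energy_def)
  finally have 1: "(\<integral>x. weak_gradient disc u x \<bullet> weak_gradient disc (\<lambda>x. max (\<sigma> * u x) 0) x \<partial>disc_measure) = \<sigma> * part_energy u g \<sigma>" .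
  have "norm x powr \<alpha> * \<bar>u x\<bar> powr (p - 1) * u x * max (\<sigma> * u x) 0
      = \<sigma> * (norm x powr \<alpha> * (max (\<sigma> * u x) 0) powr (p + 1))" for x
  proof (cases "\<sigma> * u x > 0")
    case True
    define y where "y = \<sigma> * u x"
    have y: "y > 0" "\<bar>u x\<bar> = y" "u x = \<sigma> * y" using True s by (auto simp: y_def)
    have "y powr (p + 1) = y powr (p - 1) * (y * y)"
      using y(1) powr_add[of y "p - 1" 2] by (simp add: power2_eq_square add.commute)
    moreover have "max (\<sigma> * u x) 0 = y" using y(1) by (simp add: y_def)
    ultimately show ?thesis unfolding y(2) by (subst y(3)) (simp add: mult_ac)
  next
    case False
    then have "max (\<sigma> * u x) 0 = 0" by simp
    then show ?thesis by simp
  qed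
  note integrand = this
  have 2: "(\<integral>x. norm x powr \<alpha> * \<bar>u x\<bar> powr (p - 1) * u x * max (\<sigma> * u x) 0 \<partial>disc_measure) = \<sigma> * part_mass \<alpha> (p + 1) u \<sigma>"
    by (simp only: integrand part_mass_def integral_mult_right_zero)
  show ?thesis unfolding energy_deriv_def 1 2 by (simp add: right_diff_distrib)
qed

lemma pos_neg_part_eq: "pos_part u = (\<lambda>x. max (1 * u x) 0)" "neg_part u = (\<lambda>x. max (-1 * u x) 0)"
  by (auto simp: pos_part_def neg_part_def)

lemma powr_sum_parts:
  fixes y :: real
  assumes "q > 0"
  shows "\<bar>y\<bar> powr q = (max (1 * y) 0) powr q + (max (-1 * y) 0) powr q"
  using assms by (auto simp: max_def)

text \<open>The tangent at 1 lies above the concave function \<open>z powr s\<close>.\<close>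

lemma power_bernoulli:
  fixes z s :: real
  assumes "z \<ge> 0" "0 < s" "s < 1"
  shows "z powr s \<le> 1 - s + s * z"
proof (cases "z = 0")
  case False
  have "z powr s * 1 powr (1 - s) \<le> s * z + (1 - s) * 1"
    by (rule Youngs_inequality_0) (use assms False in auto)
  then show ?thesis by simp
qed (use assms in simp)

text \<open>Let \<open>A\<close> be the Dirichlet integral of the part singled out by \<open>radial_bounds\<close>. For every \<open>\<tau> > 0\<close> the
  exponent \<open>p + 1 = 2 + 2 s\<close> is interpolated by \<open>y\<^bsup>p+1\<^esup> \<le> \<tau>\<^sup>s ((1 - s) y\<^sup>2 + s y\<^sup>4 / \<tau>)\<close>. If
  \<open>\<tau>\<close> is chosen with \<open>\<tau>\<^sup>s = \<Lambda>\<close>, the Nehari identity and the two bounds give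
  \<open>A \<le> (1 - s) A + 16 s \<Lambda> A\<^sup>2 / \<tau>\<close>, and the terms of order 1 cancel, so that \<open>A \<ge> \<tau> / (16 \<Lambda>)\<close>.\<close>

lemma radial_energy_bound:
  assumes N: "u \<in> nodal_Nehari \<alpha> p n" and rad: "radial u"
    and \<alpha>: "\<alpha> \<ge> 0" and \<kappa>: "\<kappa> > 0" and r0: "0 < r0" "r0 < 1"
    and zeros: "\<And>r. 0 \<le> r \<Longrightarrow> r \<le> 1 \<Longrightarrow>
        bessel_series 0 (\<kappa>\<^sup>2 / 4 * r powr (2 * ((2 + \<alpha>) / 2))) = 0 \<longleftrightarrow> r = r0 \<or> r = 1"
    and p: "1 < p" "p < 2"
  defines "lam \<equiv> ((2 + \<alpha>) / 2 * \<kappa>)\<^sup>2"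
  shows "(1 / 2 - 1 / (p + 1)) * (lam powr (2 / (p - 1)) / (16 * lam)) \<le> energy \<alpha> p u"
proof -
  have u: "u \<in> H1_0 disc" using N by (simp add: nodal_Nehari_def H1_0_sym_def)
  then obtain g0 where "has_weak_gradient disc u g0" by (auto simp: H1_0_def H1_def)
  define g where "g = weak_gradient disc u"
  have g: "has_weak_gradient disc u g" unfolding g_def by (rule weak_gradient_works(1)[OF \<open>has_weak_gradient disc u g0\<close>])
  have uL: "L2 disc_measure u" by (rule H1_0_L2[OF u])
  have um[measurable]: "u \<in> borel_measurable disc_measure" using uL by auto
  have gm[measurable]: "g \<in> borel_measurable disc_measure" by (rule has_weak_gradient_measurable[OF g])
  have nm[measurable]: "(\<lambda>x::real^2. norm x powr \<alpha>) \<in> borel_measurable disc_measure" by (intro borel_measurable_disc) measurable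
  have lam: "lam > 0" using \<alpha> \<kappa> by (simp add: lam_def)
  define s where "s = (p - 1) / 2"
  have s: "0 < s" "s < 1" using p by (auto simp: s_def)
  define \<tau> where "\<tau> = lam powr (1 / s)"
  have \<tau>: "\<tau> > 0" using lam by (simp add: \<tau>_def)
  have \<tau>s: "\<tau> powr s = lam" using lam s by (simp add: \<tau>_def powr_powr)
  have w: "norm x powr \<alpha> \<le> 1" if "x \<in> space disc_measure" for x using that \<alpha> by (auto intro!: powr_le1)
  define A where "A \<sigma> = part_energy u g \<sigma>" for \<sigma>
  define P where "P \<sigma> = part_mass \<alpha> (p + 1) u \<sigma>" for \<sigma>
  define Q where "Q \<sigma> = (\<integral>x. norm x powr \<alpha> * (max (\<sigma> * u x) 0)\<^sup>2 \<partial>disc_measure)" for \<sigma>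
  define Y where "Y \<sigma> = (\<integral>x. (max (\<sigma> * u x) 0) ^ 4 \<partial>disc_measure)" for \<sigma>
  have rb1: "\<exists>\<sigma>. \<bar>\<sigma>\<bar> = 1 \<and> lam * Q \<sigma> \<le> A \<sigma>"
    unfolding lam_def A_def Q_def by (rule radial_bounds(1)[OF u g rad \<alpha> \<kappa> r0]) (rule zeros)
  have rb2: "integrable disc_measure (\<lambda>x. (max (\<sigma> * u x) 0) ^ 4) \<and> Y \<sigma> \<le> 16 * (A \<sigma>)\<^sup>2" if "\<bar>\<sigma>\<bar> = 1" for \<sigma>
    unfolding A_def Y_def by (rule radial_bounds(2)[OF u g rad \<alpha> \<kappa> r0 _ that]) (rule zeros)
  have young: "y powr (p + 1) \<le> (1 - s) * lam * y\<^sup>2 + s * (lam / \<tau>) * y ^ 4" if "y \<ge> 0" for y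
  proof (cases "y = 0")
    case False
    then have y: "y > 0" using that by simp
    have "(y\<^sup>2 / \<tau>) powr s \<le> 1 - s + s * (y\<^sup>2 / \<tau>)" by (rule power_bernoulli) (use \<tau> s in auto)
    moreover have "(y\<^sup>2 / \<tau>) powr s = (y\<^sup>2) powr s / lam" using \<tau> \<tau>s by (simp add: powr_divide)
    ultimately have 1: "(y\<^sup>2) powr s \<le> lam * (1 - s + s * (y\<^sup>2 / \<tau>))" using lam by (simp add: divide_le_eq mult.commute)
    have "y\<^sup>2 = y powr 2" using y by simp
    then have "(y\<^sup>2) powr s = y powr (2 * s)" by (simp only: powr_powr)
    moreover have "p + 1 = 2 + 2 * s" by (simp add: s_def field_simps)
    ultimately have "y powr (p + 1) = y\<^sup>2 * (y\<^sup>2) powr s"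
      using y by (simp add: powr_add)
    also have "\<dots> \<le> y\<^sup>2 * (lam * (1 - s + s * (y\<^sup>2 / \<tau>)))" using 1 by (intro mult_left_mono) auto
    also have "\<dots> = (1 - s) * lam * y\<^sup>2 + s * (lam / \<tau>) * y ^ 4"
      by (simp add: power2_eq_square power4_eq_xxxx algebra_simps)
    finally show ?thesis .
  qed (use p in simp)
  have iQ: "integrable disc_measure (\<lambda>x. norm x powr \<alpha> * (max (\<sigma> * u x) 0)\<^sup>2)" if \<sigma>: "\<bar>\<sigma>\<bar> = 1" for \<sigma>
  proof (rule Bochner_Integration.integrable_bound)
    show "integrable disc_measure (\<lambda>x. (\<sigma> * u x)\<^sup>2)" using L2_cmult[OF uL] by (simp add: L2_def)
    show "AE x in disc_measure. norm (norm x powr \<alpha> * (max (\<sigma> * u x) 0)\<^sup>2) \<le> norm ((\<sigma> * u x)\<^sup>2)"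
    proof (rule AE_I2)
      fix x assume "x \<in> space disc_measure"
      moreover have "(max (\<sigma> * u x) 0)\<^sup>2 \<le> (\<sigma> * u x)\<^sup>2" by (auto simp: max_def)
      ultimately have "norm x powr \<alpha> * (max (\<sigma> * u x) 0)\<^sup>2 \<le> 1 * (\<sigma> * u x)\<^sup>2" using w by (intro mult_mono) auto
      then show "norm (norm x powr \<alpha> * (max (\<sigma> * u x) 0)\<^sup>2) \<le> norm ((\<sigma> * u x)\<^sup>2)" by simp
    qed
  qed measurable
  have le: "norm x powr \<alpha> * (max (\<sigma> * u x) 0) powr (p + 1)
      \<le> (1 - s) * lam * (norm x powr \<alpha> * (max (\<sigma> * u x) 0)\<^sup>2) + s * (lam / \<tau>) * (max (\<sigma> * u x) 0) ^ 4"
    if x: "x \<in> space disc_measure" for x \<sigma>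
  proof -
    define y where "y = max (\<sigma> * u x) 0"
    have y: "y \<ge> 0" by (simp add: y_def)
    have "norm x powr \<alpha> * y powr (p + 1) \<le> norm x powr \<alpha> * ((1 - s) * lam * y\<^sup>2 + s * (lam / \<tau>) * y ^ 4)"
      using young[OF y] by (intro mult_left_mono) auto
    also have "\<dots> = (1 - s) * lam * (norm x powr \<alpha> * y\<^sup>2) + norm x powr \<alpha> * (s * (lam / \<tau>) * y ^ 4)"
      by (simp add: algebra_simps)
    also have "norm x powr \<alpha> * (s * (lam / \<tau>) * y ^ 4) \<le> 1 * (s * (lam / \<tau>) * y ^ 4)"
      using w[OF x] s lam \<tau> y by (intro mult_right_mono) auto
    finally show ?thesis by (simp add: y_def)
  qed
  have i2: "integrable disc_measure (\<lambda>x. (1 - s) * lam * (norm x powr \<alpha> * (max (\<sigma> * u x) 0)\<^sup>2) + s * (lam / \<tau>) * (max (\<sigma> * u x) 0) ^ 4)"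
    if "\<bar>\<sigma>\<bar> = 1" for \<sigma>
    using iQ[OF that] rb2[OF that] by (intro Bochner_Integration.integrable_add integrable_mult_right) auto
  have iP: "integrable disc_measure (\<lambda>x. norm x powr \<alpha> * (max (\<sigma> * u x) 0) powr (p + 1))" if \<sigma>: "\<bar>\<sigma>\<bar> = 1" for \<sigma>
  proof (rule Bochner_Integration.integrable_bound[OF i2[OF \<sigma>]])
    show "AE x in disc_measure. norm (norm x powr \<alpha> * (max (\<sigma> * u x) 0) powr (p + 1))
       \<le> norm ((1 - s) * lam * (norm x powr \<alpha> * (max (\<sigma> * u x) 0)\<^sup>2) + s * (lam / \<tau>) * (max (\<sigma> * u x) 0) ^ 4)"
      using le[of _ \<sigma>] by (intro AE_I2) (simp add: abs_mult order.trans[OF _ abs_ge_self])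
  qed measurable
  have PQY: "P \<sigma> \<le> (1 - s) * lam * Q \<sigma> + s * (lam / \<tau>) * Y \<sigma>" if \<sigma>: "\<bar>\<sigma>\<bar> = 1" for \<sigma>
  proof -
    have "P \<sigma> \<le> (\<integral>x. (1 - s) * lam * (norm x powr \<alpha> * (max (\<sigma> * u x) 0)\<^sup>2) + s * (lam / \<tau>) * (max (\<sigma> * u x) 0) ^ 4 \<partial>disc_measure)"
      unfolding P_def part_mass_def by (rule integral_mono[OF iP[OF \<sigma>] i2[OF \<sigma>] le])
    also have "\<dots> = (1 - s) * lam * Q \<sigma> + s * (lam / \<tau>) * Y \<sigma>"
      unfolding Q_def Y_def using iQ[OF \<sigma>] rb2[OF \<sigma>] by (subst Bochner_Integration.integral_add) auto
    finally show ?thesis .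
  qed
  have AP: "A \<sigma> = P \<sigma>" if "\<sigma> = 1 \<or> \<sigma> = -1" for \<sigma>
  proof -
    have "energy_deriv \<alpha> p u (\<lambda>x. max (\<sigma> * u x) 0) = 0"
      using N that unfolding nodal_Nehari_def pos_neg_part_eq by auto
    moreover have a: "\<bar>\<sigma>\<bar> = 1" using that by auto
    ultimately have "\<sigma> * (A \<sigma> - P \<sigma>) = 0" unfolding energy_deriv_part[OF u g a] A_def P_def by simp
    then show ?thesis using that by auto
  qed
  have pm: "\<sigma> = 1 \<or> \<sigma> = -1" if "\<bar>\<sigma>\<bar> = 1" for \<sigma> :: real using that by (auto simp: abs_if split: if_splits)
  have A0: "A \<sigma> \<ge> 0" for \<sigma> unfolding A_def part_energy_def by (intro integral_nonneg_AE AE_I2) simp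
  have Apos: "A \<sigma> > 0" if \<sigma>: "\<bar>\<sigma>\<bar> = 1" for \<sigma>
  proof (rule ccontr)
    assume "\<not> A \<sigma> > 0"
    then have "P \<sigma> = 0" using A0[of \<sigma>] AP[OF pm[OF \<sigma>]] by simp
    then have "AE x in disc_measure. norm x powr \<alpha> * (max (\<sigma> * u x) 0) powr (p + 1) = 0"
      unfolding P_def part_mass_def using integral_nonneg_eq_0_iff_AE[OF iP[OF \<sigma>]] by simp
    moreover have "AE x in disc_measure. x \<noteq> 0" unfolding AE_disc using AE_lborel_singleton[of "0::real^2"] by eventually_elim simp
    ultimately have "AE x in disc_measure. max (\<sigma> * u x) 0 = 0"
      by eventually_elim auto
    then show False using N pm[OF \<sigma>] unfolding nodal_Nehari_def pos_neg_part_eq by auto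
  qed
  obtain \<sigma> where \<sigma>: "\<bar>\<sigma>\<bar> = 1" and lQ: "lam * Q \<sigma> \<le> A \<sigma>" using rb1 by auto
  have key: "\<tau> / (16 * lam) \<le> A \<sigma>"
  proof -
    have "A \<sigma> \<le> (1 - s) * lam * Q \<sigma> + s * (lam / \<tau>) * Y \<sigma>" using PQY[OF \<sigma>] AP[OF pm[OF \<sigma>]] by simp
    also have "\<dots> \<le> (1 - s) * A \<sigma> + s * (lam / \<tau>) * (16 * (A \<sigma>)\<^sup>2)"
    proof (rule add_mono)
      show "(1 - s) * lam * Q \<sigma> \<le> (1 - s) * A \<sigma>" using lQ s mult_left_mono[of "lam * Q \<sigma>" "A \<sigma>" "1 - s"] by (simp add: mult.assoc)
      show "s * (lam / \<tau>) * Y \<sigma> \<le> s * (lam / \<tau>) * (16 * (A \<sigma>)\<^sup>2)"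
        using rb2[OF \<sigma>] s lam \<tau> by (intro mult_left_mono) auto
    qed
    finally have "s * A \<sigma> * 1 \<le> s * A \<sigma> * ((lam / \<tau>) * 16 * A \<sigma>)"
      by (simp add: power2_eq_square algebra_simps)
    then have "1 \<le> (lam / \<tau>) * 16 * A \<sigma>"
      by (rule mult_le_cancel_left_pos[THEN iffD1, rotated]) (use s Apos[OF \<sigma>] in simp)
    then show ?thesis using lam \<tau> by (simp add: field_simps)
  qed
  have iA: "integrable disc_measure (\<lambda>x. (norm (g x))\<^sup>2)" using g unfolding has_weak_gradient_def square_integrable_on_def by simp
  have iA\<sigma>: "integrable disc_measure (\<lambda>x. if \<sigma> * u x > 0 then (norm (g x))\<^sup>2 else 0)" for \<sigma>
    by (rule Bochner_Integration.integrable_bound[OF iA]) auto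
  have gA: "A 1 + A (-1) \<le> (\<integral>x. (norm (g x))\<^sup>2 \<partial>disc_measure)"
  proof -
    have "A 1 + A (-1) = (\<integral>x. (if 1 * u x > 0 then (norm (g x))\<^sup>2 else 0) + (if -1 * u x > 0 then (norm (g x))\<^sup>2 else 0) \<partial>disc_measure)"
      unfolding A_def part_energy_def by (rule Bochner_Integration.integral_add[symmetric, OF iA\<sigma> iA\<sigma>])
    also have "\<dots> \<le> (\<integral>x. (norm (g x))\<^sup>2 \<partial>disc_measure)"
      by (rule integral_mono[OF Bochner_Integration.integrable_add[OF iA\<sigma> iA\<sigma>] iA]) auto
    finally show ?thesis .
  qed
  have PP: "(\<integral>x. norm x powr \<alpha> * \<bar>u x\<bar> powr (p + 1) \<partial>disc_measure) = P 1 + P (-1)"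
  proof -
    have "(\<integral>x. norm x powr \<alpha> * \<bar>u x\<bar> powr (p + 1) \<partial>disc_measure)
        = (\<integral>x. norm x powr \<alpha> * (max (1 * u x) 0) powr (p + 1) + norm x powr \<alpha> * (max (-1 * u x) 0) powr (p + 1) \<partial>disc_measure)"
      using p by (subst powr_sum_parts) (auto simp: distrib_left)
    also have "\<dots> = P 1 + P (-1)"
      unfolding P_def part_mass_def by (rule Bochner_Integration.integral_add[OF iP iP]) auto
    finally show ?thesis .
  qed
  have "energy \<alpha> p u \<ge> (1 / 2 - 1 / (p + 1)) * (A 1 + A (-1))"
  proof -
    have "energy \<alpha> p u = 1 / 2 * (\<integral>x. (norm (g x))\<^sup>2 \<partial>disc_measure) - 1 / (p + 1) * (A 1 + A (-1))"
      unfolding energy_def PP using AP[of 1] AP[of "-1"] by (simp add: g_def)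
    then show ?thesis using gA by (simp add: left_diff_distrib)
  qed
  moreover have "A \<sigma> \<le> A 1 + A (-1)" using pm[OF \<sigma>] A0[of 1] A0[of "-1"] by auto
  then have "(1 / 2 - 1 / (p + 1)) * (\<tau> / (16 * lam)) \<le> (1 / 2 - 1 / (p + 1)) * (A 1 + A (-1))"
    using key p by (intro mult_left_mono) (auto simp: field_simps)
  moreover have "1 / s = 2 / (p - 1)" by (simp add: s_def)
  ultimately show ?thesis by (simp add: \<tau>_def)
qed

section \<open>The energy of nonradial functions in the Nehari set\<close>

text \<open>With \<open>s\<close> small the number \<open>lam * H / G\<close> stays above some \<open>q > 1\<close>, and \<open>q powr (1 / s)\<close> exceeds every
  constant as \<open>s\<close> tends to 0.\<close>

lemma exponential_beats_constant:
  fixes G Q lam m :: real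
  assumes G: "0 < G" and lam: "0 < lam" and less: "G < lam * Q" and m: "0 \<le> m"
  obtains e where "0 < e"
    "\<And>s H. 0 < s \<Longrightarrow> s < e \<Longrightarrow> Q - s * m \<le> H \<Longrightarrow>
       0 < H \<and> (G / H) powr (1 / s) * G < lam powr (1 / s) / (16 * lam)"
proof -
  define q where "q = (1 + lam * Q / G) / 2"
  have q: "1 < q" using G less by (simp add: q_def field_simps)
  have qQ: "q * G / lam < Q" using G lam less by (simp add: q_def field_simps)
  define d where "d = Q - q * G / lam"
  have d: "d > 0" using qQ by (simp add: d_def)
  \<comment> \<open>the first entry gives \<open>lam * H / G \<ge> q\<close>, the second \<open>ln q / s > 16 * lam * G\<close>\<close>
  define e where "e = min (d / (m + 1)) (ln q / (16 * lam * G))"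
  have e: "e > 0" using d m q lam G by (simp add: e_def)
  show ?thesis
  proof (rule that[OF e])
    fix s H :: real assume s: "0 < s" "s < e" and H: "Q - s * m \<le> H"
    have "s * (m + 1) < d" using s m by (simp add: e_def pos_less_divide_eq)
    then have "q * G / lam < H" using H s by (simp add: d_def algebra_simps)
    moreover have "0 < q * G / lam" using q G lam by simp
    ultimately have H0: "0 < H" and qH: "q \<le> lam * H / G" using G lam by (linarith, simp add: field_simps)
    have "16 * lam * G < ln q / s" using s lam G by (simp add: e_def field_simps)
    also have "\<dots> < exp (ln q / s)" by (rule exp_gt_self)
    also have "\<dots> = q powr (1 / s)" using q by (simp add: powr_def)
    also have "\<dots> \<le> (lam * H / G) powr (1 / s)" using qH q s by (intro powr_mono2) auto
    also have "(lam * H / G) powr (1 / s) = lam powr (1 / s) / (G / H) powr (1 / s)"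
      using lam H0 G by (simp add: powr_divide powr_mult)
    finally have "16 * lam * G < lam powr (1 / s) / (G / H) powr (1 / s)" .
    moreover have "(G / H) powr (1 / s) > 0" using G H0 by simp
    ultimately have "(G / H) powr (1 / s) * G < lam powr (1 / s) / (16 * lam)"
      using lam by (simp add: field_simps)
    then show "0 < H \<and> (G / H) powr (1 / s) * G < lam powr (1 / s) / (16 * lam)" using H0 by simp
  qed
qed

context angular_profile
begin

lemma w_H1_0: "w k \<in> H1_0 disc"
  by (rule test_function_H1_0[OF w_test])

text \<open>The rotation by \<open>\<pi> / n\<close> exchanges the positive and the negative part of \<open>w k\<close>.\<close>

lemma w_half_turn: "w k (polar r (\<theta> + pi / real n)) = - w k (polar r \<theta>)"
proof -
  have "real n * (\<theta> + pi / real n) = real n * \<theta> + pi" using n by (simp add: field_simps)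
  then show ?thesis by (simp only: w_polar) simp
qed

lemma gradient_w_half_turn:
  assumes "0 < r"
  shows "(norm (gradient (w k) (polar r (\<theta> + pi / real n))))\<^sup>2 = (norm (gradient (w k) (polar r \<theta>)))\<^sup>2"
proof -
  have e: "real n * (\<theta> + pi / real n) = real n * \<theta> + pi" using n by (simp add: field_simps)
  have g: "(norm (gradient (w k) (polar r \<theta>)))\<^sup>2 = (R' k r * cos (real n * \<theta>))\<^sup>2 + (n * (R k r / r) * sin (real n * \<theta>))\<^sup>2" for \<theta>
    by (rule polar_gradient_squared[OF smooth_differentiable[OF w_smooth] w_polar R_deriv assms]) (use assms in simp)
  show ?thesis unfolding g e by simp
qed

lemma w_powr_integrable:
  assumes "q > 0"
  shows "integrable disc_measure (\<lambda>x. norm x powr \<alpha> * \<bar>w k x\<bar> powr q)"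
    "integrable disc_measure (\<lambda>x. norm x powr \<alpha> * (max (\<sigma> * w k x) 0) powr q)"
proof -
  obtain K where K: "K > 0" "\<And>x. x \<in> disc \<Longrightarrow> \<bar>w k x\<bar> \<le> K"
    by (rule continuous_bounded_disc[OF test_function_continuous[OF w_test]], rule that)
  have b: "norm (norm x powr \<alpha> * y powr q) \<le> 1 * B powr q" if "x \<in> disc" "0 \<le> y" "y \<le> B" for x :: "real^2" and y B :: real
    unfolding real_norm_def abs_mult using that norm_powr_le[OF that(1)] assms
    by (intro mult_mono) (auto intro: powr_mono2)
  show "integrable disc_measure (\<lambda>x. norm x powr \<alpha> * \<bar>w k x\<bar> powr q)"
    by (rule disc.integrable_const_bound[where B = "1 * K powr q"]) (use K b in \<open>auto intro!: AE_I2\<close>)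
  show "integrable disc_measure (\<lambda>x. norm x powr \<alpha> * (max (\<sigma> * w k x) 0) powr q)"
  proof (rule disc.integrable_const_bound[where B = "1 * (\<bar>\<sigma>\<bar> * K) powr q"])
    have "max (\<sigma> * w k x) 0 \<le> \<bar>\<sigma>\<bar> * K" if "x \<in> disc" for x
    proof -
      have "\<sigma> * w k x \<le> \<bar>\<sigma>\<bar> * \<bar>w k x\<bar>" using abs_ge_self[of "\<sigma> * w k x"] by (simp add: abs_mult)
      also have "\<dots> \<le> \<bar>\<sigma>\<bar> * K" using K(2)[OF that] by (intro mult_left_mono) auto
      finally show ?thesis using K(1) by simp
    qed
    then show "AE x in disc_measure. norm (norm x powr \<alpha> * max (\<sigma> * w k x) 0 powr q) \<le> 1 * (\<bar>\<sigma>\<bar> * K) powr q"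
      using b by (intro AE_I2) (auto simp del: mult_1 real_norm_def)
  qed measurable
qed

lemma half_turn_angle: "0 \<le> pi / real n" "pi / real n \<le> 2 * pi"
proof -
  have "pi / real n \<le> pi / 1" using n by (intro divide_left_mono) auto
  then show "pi / real n \<le> 2 * pi" using pi_gt_zero by linarith
qed simp

lemma part_energy_w:
  assumes "\<sigma> = 1 \<or> \<sigma> = -1"
  shows "part_energy (w k) (gradient (w k)) \<sigma> = G k / 2"
proof -
  have i: "integrable disc_measure (\<lambda>x. if \<sigma> * w k x > 0 then (norm (gradient (w k) x))\<^sup>2 else 0)" for \<sigma>
    by (rule Bochner_Integration.integrable_bound[OF gradient_w_integrable]) auto
  have eq: "part_energy (w k) (gradient (w k)) (-1) = part_energy (w k) (gradient (w k)) 1"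
    unfolding part_energy_def
    by (rule rotated_disc_integral[OF _ _ i i half_turn_angle]) (auto simp: w_half_turn gradient_w_half_turn)
  have "part_energy (w k) (gradient (w k)) 1 + part_energy (w k) (gradient (w k)) (-1)
      = (\<integral>x. (if 1 * w k x > 0 then (norm (gradient (w k) x))\<^sup>2 else 0)
          + (if -1 * w k x > 0 then (norm (gradient (w k) x))\<^sup>2 else 0) \<partial>disc_measure)"
    unfolding part_energy_def by (rule Bochner_Integration.integral_add[symmetric, OF i i])
  also have "\<dots> = G k"
    unfolding G_def
  proof (rule integral_cong_AE)
    show "AE x in disc_measure. (if 1 * w k x > 0 then (norm (gradient (w k) x))\<^sup>2 else 0)
          + (if -1 * w k x > 0 then (norm (gradient (w k) x))\<^sup>2 else 0) = (norm (gradient (w k) x))\<^sup>2"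
      using weak_gradient_zero_on_zeros[OF w_H1_0 w_gradient, of k] by eventually_elim auto
  qed measurable
  finally show ?thesis using eq assms by auto
qed

lemma part_mass_w:
  assumes q: "q > 0" and "\<sigma> = 1 \<or> \<sigma> = -1"
  shows "part_mass \<alpha> q (w k) \<sigma> = (\<integral>x. norm x powr \<alpha> * \<bar>w k x\<bar> powr q \<partial>disc_measure) / 2"
proof -
  note i = w_powr_integrable(2)[OF q]
  have np: "norm (polar r \<theta>) = r" if "0 < r" for r \<theta> using that by (simp add: norm_polar)
  have eq: "part_mass \<alpha> q (w k) (-1) = part_mass \<alpha> q (w k) 1"
    unfolding part_mass_def
    by (rule rotated_disc_integral[OF _ _ i i half_turn_angle]) (auto simp: w_half_turn np)
  have "(\<integral>x. norm x powr \<alpha> * \<bar>w k x\<bar> powr q \<partial>disc_measure)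
      = (\<integral>x. norm x powr \<alpha> * (max (1 * w k x) 0) powr q + norm x powr \<alpha> * (max (-1 * w k x) 0) powr q \<partial>disc_measure)"
    by (subst powr_sum_parts[OF q]) (simp add: distrib_left)
  also have "\<dots> = part_mass \<alpha> q (w k) 1 + part_mass \<alpha> q (w k) (-1)"
    unfolding part_mass_def by (rule Bochner_Integration.integral_add[OF i i])
  finally show ?thesis using eq assms by auto
qed

text \<open>By the half-turn symmetry both parts of \<open>w k\<close> have the Dirichlet integral \<open>G k / 2\<close> and the mass \<open>H / 2\<close>. One
  factor \<open>t\<close> with \<open>t\<^bsup>p-1\<^esup> = G k / H\<close> hence satisfies both Nehari conditions.\<close>

lemma scaled_w_nodal_Nehari:
  assumes p: "1 < p" and G: "0 < G k"
  defines "H \<equiv> \<integral>x. norm x powr \<alpha> * \<bar>w k x\<bar> powr (p + 1) \<partial>disc_measure"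
  assumes H: "0 < H"
  obtains v where "v \<in> nodal_Nehari \<alpha> p n"
    "energy \<alpha> p v = (1 / 2 - 1 / (p + 1)) * ((G k / H) powr (2 / (p - 1)) * G k)"
proof -
  define t where "t = (G k / H) powr (1 / (p - 1))"
  have t: "t > 0" using G H by (simp add: t_def)
  have t2: "t\<^sup>2 = (G k / H) powr (2 / (p - 1))"
  proof -
    have "t\<^sup>2 = t powr 2" using t by simp
    also have "\<dots> = (G k / H) powr (1 / (p - 1) * 2)" by (simp only: t_def powr_powr)
    finally show ?thesis by simp
  qed
  have tp: "t powr (p + 1) * H = t\<^sup>2 * G k"
  proof -
    have "t powr (p + 1) = t powr 2 * t powr (p - 1)" by (simp add: powr_add[symmetric] add.commute)
    also have "t powr (p - 1) = G k / H" using p G H by (simp add: t_def powr_powr)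
    finally show ?thesis using H t by simp
  qed
  define v where "v x = t * w k x" for x
  define g where "g x = t *\<^sub>R gradient (w k) x" for x
  have vt: "test_function disc v"
    by (rule smooth_test_function[OF _ compact_cball support_subset[of k]])
      (auto simp: v_def[abs_def] intro!: smooth.mult smooth.const w_smooth w_zero)
  have v: "v \<in> H1_0 disc" by (rule test_function_H1_0[OF vt])
  have "has_weak_gradient disc (\<lambda>x. t * w k x + 0 * w k x) (\<lambda>x. t *\<^sub>R gradient (w k) x + 0 *\<^sub>R gradient (w k) x)"
    by (rule has_weak_gradient_linear[OF test_function_L2[OF w_test] test_function_L2[OF w_test] w_gradient w_gradient])
  then have g: "has_weak_gradient disc v g" by (simp add: v_def[abs_def] g_def[abs_def])
  have mx: "max (\<sigma> * v x) 0 = t * max (\<sigma> * w k x) 0" for \<sigma> x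
    using t max_mult_distrib_left[of t "\<sigma> * w k x" 0] by (simp add: v_def mult.left_commute)
  have pm: "part_mass \<alpha> (p + 1) v \<sigma> = t powr (p + 1) * (H / 2)" if "\<sigma> = 1 \<or> \<sigma> = -1" for \<sigma>
  proof -
    have "part_mass \<alpha> (p + 1) v \<sigma> = (\<integral>x. t powr (p + 1) * (norm x powr \<alpha> * (max (\<sigma> * w k x) 0) powr (p + 1)) \<partial>disc_measure)"
      unfolding part_mass_def mx using t by (simp add: powr_mult mult.left_commute)
    also have "\<dots> = t powr (p + 1) * part_mass \<alpha> (p + 1) (w k) \<sigma>" by (simp add: part_mass_def)
    also have "part_mass \<alpha> (p + 1) (w k) \<sigma> = H / 2" unfolding H_def by (rule part_mass_w) (use p that in auto)
    finally show ?thesis .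
  qed
  have pe: "part_energy v g \<sigma> = t\<^sup>2 * (G k / 2)" if "\<sigma> = 1 \<or> \<sigma> = -1" for \<sigma>
  proof -
    have "\<sigma> * v x > 0 \<longleftrightarrow> \<sigma> * w k x > 0" for x
      using t by (simp add: v_def mult.left_commute[of \<sigma>] zero_less_mult_iff)
    then have "part_energy v g \<sigma> = (\<integral>x. t\<^sup>2 * (if \<sigma> * w k x > 0 then (norm (gradient (w k) x))\<^sup>2 else 0) \<partial>disc_measure)"
      unfolding part_energy_def by (intro Bochner_Integration.integral_cong) (auto simp: g_def power_mult_distrib)
    also have "\<dots> = t\<^sup>2 * part_energy (w k) (gradient (w k)) \<sigma>" by (simp add: part_energy_def)
    finally show ?thesis using part_energy_w[OF that] by simp
  qed
  have ed: "energy_deriv \<alpha> p v (\<lambda>x. max (\<sigma> * v x) 0) = 0" if "\<sigma> = 1 \<or> \<sigma> = -1" for \<sigma>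
  proof -
    have a: "\<bar>\<sigma>\<bar> = 1" using that by auto
    have "t powr (p + 1) * (H / 2) = t\<^sup>2 * (G k / 2)" using tp by simp
    then show ?thesis unfolding energy_deriv_part[OF v g a] pm[OF that] pe[OF that] by simp
  qed
  have nz: "\<not> (AE x in disc_measure. max (\<sigma> * v x) 0 = 0)" if "\<sigma> = 1 \<or> \<sigma> = -1" for \<sigma>
  proof
    assume ae: "AE x in disc_measure. max (\<sigma> * v x) 0 = 0"
    have "part_mass \<alpha> (p + 1) v \<sigma> = 0"
      unfolding part_mass_def by (rule integral_eq_zero_AE) (use ae in \<open>eventually_elim, simp\<close>)
    then show False using pm[OF that] t H by simp
  qed
  have "v \<in> H1_0_sym n"
  proof -
    have "v (polar r (- \<theta>)) = v (polar r \<theta>) \<and> v (polar r (\<theta> + 2 * pi / real n)) = v (polar r \<theta>)" for r \<theta>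
    proof -
      have "real n * (\<theta> + 2 * pi / real n) = real n * \<theta> + 2 * pi" using n by (simp add: field_simps)
      then have "v (polar r (\<theta> + 2 * pi / real n)) = v (polar r \<theta>)" by (simp only: v_def w_polar) simp
      then show ?thesis by (simp add: v_def w_polar)
    qed
    then show ?thesis using v unfolding H1_0_sym_def by (auto intro!: exI[of _ v])
  qed
  then have vN: "v \<in> nodal_Nehari \<alpha> p n"
    using ed[of 1] ed[of "-1"] nz[of 1] nz[of "-1"] unfolding nodal_Nehari_def pos_neg_part_eq by simp
  have "(\<integral>x. (norm (weak_gradient disc v x))\<^sup>2 \<partial>disc_measure) = (\<integral>x. t\<^sup>2 * (norm (gradient (w k) x))\<^sup>2 \<partial>disc_measure)"
  proof (rule integral_cong_AE)
    show "(\<lambda>x. (norm (weak_gradient disc v x))\<^sup>2) \<in> borel_measurable disc_measure"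
      using has_weak_gradient_measurable[OF weak_gradient_works(1)[OF g]] by measurable
    show "AE x in disc_measure. (norm (weak_gradient disc v x))\<^sup>2 = t\<^sup>2 * (norm (gradient (w k) x))\<^sup>2"
      using weak_gradient_works(2)[OF g] by eventually_elim (simp add: g_def power_mult_distrib)
  qed measurable
  also have "\<dots> = t\<^sup>2 * G k" by (simp add: G_def)
  finally have e1: "(\<integral>x. (norm (weak_gradient disc v x))\<^sup>2 \<partial>disc_measure) = t\<^sup>2 * G k" .
  have "(\<integral>x. norm x powr \<alpha> * \<bar>v x\<bar> powr (p + 1) \<partial>disc_measure)
      = (\<integral>x. t powr (p + 1) * (norm x powr \<alpha> * \<bar>w k x\<bar> powr (p + 1)) \<partial>disc_measure)"
    using t by (simp add: v_def abs_mult powr_mult mult.left_commute)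
  also have "\<dots> = t\<^sup>2 * G k" using tp by (simp add: H_def)
  finally have "energy \<alpha> p v = (1 / 2 - 1 / (p + 1)) * (t\<^sup>2 * G k)"
    unfolding energy_def e1 by (simp add: left_diff_distrib)
  then show ?thesis using that[OF vN] by (simp add: t2)
qed

text \<open>The mass \<open>H\<close> is at least \<open>Q k\<close> minus a multiple of \<open>s = (p - 1) / 2\<close>, by \<open>y\<^sup>2 \<le> |y|\<^bsup>p+1\<^esup> + s\<close>, so that the
  strict inequality \<open>G k < lam * Q k\<close> persists for small \<open>s\<close> with \<open>H\<close> in place of \<open>Q k\<close>.\<close>

lemma low_energy_nodal:
  obtains e where "0 < e"
    "\<And>p. 1 < p \<Longrightarrow> p < 1 + e \<Longrightarrow> \<exists>v\<in>nodal_Nehari \<alpha> p n.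
       energy \<alpha> p v < (1 / 2 - 1 / (p + 1)) * (lam powr (2 / (p - 1)) / (16 * lam))"
proof -
  obtain k where k: "G k < lam * Q k" "0 < Q k" by (rule good_test_function, rule that)
  have G: "0 < G k" using k(2) Q_le_G[of k] by simp
  have lam: "lam > 0" using \<gamma> \<kappa> by (simp add: lam_def)
  define m where "m = measure disc_measure (space disc_measure)"
  have "m \<ge> 0" by (simp add: m_def)
  obtain e where e: "0 < e"
    "\<And>s H. 0 < s \<Longrightarrow> s < e \<Longrightarrow> Q k - s * m \<le> H \<Longrightarrow>
       0 < H \<and> (G k / H) powr (1 / s) * G k < lam powr (1 / s) / (16 * lam)"
    by (rule exponential_beats_constant[OF G lam k(1) \<open>m \<ge> 0\<close>], rule that)
  show ?thesis
  proof (rule that[of "2 * e"])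
    fix p :: real assume p: "1 < p" "p < 1 + 2 * e"
    define s where "s = (p - 1) / 2"
    have s: "0 < s" "s < e" using p by (auto simp: s_def)
    define H where "H = (\<integral>x. norm x powr \<alpha> * \<bar>w k x\<bar> powr (p + 1) \<partial>disc_measure)"
    have i: "integrable disc_measure (\<lambda>x. norm x powr \<alpha> * \<bar>w k x\<bar> powr (p + 1))"
      by (rule w_powr_integrable(1)) (use p in simp)
    have i2: "integrable disc_measure (\<lambda>x. norm x powr \<alpha> * \<bar>w k x\<bar> powr 2)" by (rule w_powr_integrable(1)) simp
    have le: "y\<^sup>2 \<le> \<bar>y\<bar> powr (p + 1) + s" for y :: real
    proof -
      have "(\<bar>y\<bar> powr (p + 1)) powr (1 / (1 + s)) \<le> 1 - 1 / (1 + s) + 1 / (1 + s) * \<bar>y\<bar> powr (p + 1)"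
        by (rule power_bernoulli) (use s in auto)
      moreover have "(\<bar>y\<bar> powr (p + 1)) powr (1 / (1 + s)) = y\<^sup>2"
      proof -
        have "(p + 1) * (1 / (1 + s)) = 2" using s by (simp add: s_def field_simps)
        then show ?thesis by (simp add: powr_powr)
      qed
      moreover have "1 - 1 / (1 + s) \<le> s" using s by (simp add: field_simps)
      moreover have "1 / (1 + s) * \<bar>y\<bar> powr (p + 1) \<le> 1 * \<bar>y\<bar> powr (p + 1)"
        using s by (intro mult_right_mono) auto
      ultimately show ?thesis by simp
    qed
    have "Q k = (\<integral>x. norm x powr \<alpha> * \<bar>w k x\<bar> powr 2 \<partial>disc_measure)" by (simp add: Q_def)
    also have "\<dots> \<le> (\<integral>x. norm x powr \<alpha> * \<bar>w k x\<bar> powr (p + 1) + s \<partial>disc_measure)"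
    proof (rule integral_mono[OF i2 Bochner_Integration.integrable_add[OF i]])
      fix x assume "x \<in> space disc_measure"
      then have n1: "norm x powr \<alpha> \<le> 1" using norm_powr_le by simp
      have "norm x powr \<alpha> * \<bar>w k x\<bar> powr 2 \<le> norm x powr \<alpha> * (\<bar>w k x\<bar> powr (p + 1) + s)"
        using le[of "w k x"] by (intro mult_left_mono) auto
      also have "\<dots> \<le> norm x powr \<alpha> * \<bar>w k x\<bar> powr (p + 1) + 1 * s"
        using mult_right_mono[OF n1, of s] s by (simp add: distrib_left)
      finally show "norm x powr \<alpha> * \<bar>w k x\<bar> powr 2 \<le> norm x powr \<alpha> * \<bar>w k x\<bar> powr (p + 1) + s" by simp
    qed simp
    also have "\<dots> = H + s * m" unfolding H_def m_def using i by simp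
    finally have H: "0 < H \<and> (G k / H) powr (1 / s) * G k < lam powr (1 / s) / (16 * lam)"
      by (intro e(2)[OF s]) simp
    have s2: "1 / s = 2 / (p - 1)" by (simp add: s_def)
    obtain v where v: "v \<in> nodal_Nehari \<alpha> p n"
      "energy \<alpha> p v = (1 / 2 - 1 / (p + 1)) * ((G k / H) powr (2 / (p - 1)) * G k)"
      by (rule scaled_w_nodal_Nehari[OF p(1) G H[THEN conjunct1, unfolded H_def], folded H_def], rule that)
    have "(1 / 2 - 1 / (p + 1)) * ((G k / H) powr (2 / (p - 1)) * G k) < (1 / 2 - 1 / (p + 1)) * (lam powr (2 / (p - 1)) / (16 * lam))"
      using H p unfolding s2 by (intro mult_strict_left_mono) (auto simp: field_simps)
    then show "\<exists>v\<in>nodal_Nehari \<alpha> p n. energy \<alpha> p v < (1 / 2 - 1 / (p + 1)) * (lam powr (2 / (p - 1)) / (16 * lam))"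
      using v by (intro bexI[of _ v]) auto
  qed (use e in simp)
qed

end

section \<open>Comparison of the energies\<close>

text \<open>The zeros of \<open>J\<^sub>0(\<kappa> r\<^sup>\<gamma>)\<close> in the unit interval, where \<open>\<kappa>\<close> is the second zero of \<open>J\<^sub>0\<close>.\<close>

lemma bessel_series_radial_zeros:
  fixes \<gamma> :: real
  assumes \<gamma>: "\<gamma> > 0"
  defines "\<kappa> \<equiv> Bessel_zero 2 0"
  obtains r0 where "0 < r0" "r0 < 1"
    "\<And>r. 0 \<le> r \<Longrightarrow> r \<le> 1 \<Longrightarrow> bessel_series 0 (\<kappa>\<^sup>2 / 4 * r powr (2 * \<gamma>)) = 0 \<longleftrightarrow> r = r0 \<or> r = 1"
proof -
  have \<kappa>: "\<kappa> > 0" unfolding \<kappa>_def by (rule Bessel_zero(1)) auto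
  obtain z where z: "0 < z" "z < \<kappa>"
    "\<And>y. 0 < y \<Longrightarrow> y \<le> \<kappa> \<Longrightarrow> bessel_series 0 (y\<^sup>2 / 4) = 0 \<longleftrightarrow> y = z \<or> y = \<kappa>"
    by (rule Bessel_zero_2[of 0, folded \<kappa>_def], simp, rule that)
  define r0 where "r0 = (z / \<kappa>) powr (1 / \<gamma>)"
  have r0: "0 < r0" using z \<kappa> by (simp add: r0_def)
  have r0p: "r0 powr \<gamma> = z / \<kappa>" using z \<kappa> \<gamma> by (simp add: r0_def powr_powr)
  have root: "(x powr \<gamma>) powr (1 / \<gamma>) = x" if "x > 0" for x :: real
    using that \<gamma> by (simp add: powr_powr)
  have inj: "r = r'" if "r powr \<gamma> = r' powr \<gamma>" "r > 0" "r' > 0" for r r' :: real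
    using root[OF that(2)] root[OF that(3)] unfolding that(1) by (rule trans[OF sym])
  show ?thesis
  proof (rule that[OF r0])
    have "r0 < 1 powr (1 / \<gamma>)" unfolding r0_def using z \<kappa> \<gamma> by (intro powr_less_mono2) auto
    then show "r0 < 1" by simp
    fix r :: real assume r: "0 \<le> r" "r \<le> 1"
    show "bessel_series 0 (\<kappa>\<^sup>2 / 4 * r powr (2 * \<gamma>)) = 0 \<longleftrightarrow> r = r0 \<or> r = 1"
    proof (cases "r = 0")
      case True
      then show ?thesis using r0 by (simp add: bessel_series_0)
    next
      case False
      then have r': "r > 0" using r by simp
      have "r powr (2 * \<gamma>) = (r powr \<gamma>)\<^sup>2" by (simp only: power2_eq_square powr_add[symmetric] mult_2)
      then have e: "\<kappa>\<^sup>2 / 4 * r powr (2 * \<gamma>) = (\<kappa> * r powr \<gamma>)\<^sup>2 / 4" by (simp add: power_mult_distrib)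
      have r1: "r powr \<gamma> \<le> 1" using r \<gamma> by (intro powr_le1) auto
      have "bessel_series 0 ((\<kappa> * r powr \<gamma>)\<^sup>2 / 4) = 0 \<longleftrightarrow> \<kappa> * r powr \<gamma> = z \<or> \<kappa> * r powr \<gamma> = \<kappa>"
        using r' \<kappa> r1 by (intro z(3)) (auto intro: mult_left_le)
      also have "\<dots> \<longleftrightarrow> r powr \<gamma> = r0 powr \<gamma> \<or> r powr \<gamma> = 1 powr \<gamma>"
        unfolding r0p using \<kappa> by (auto simp: field_simps)
      also have "\<dots> \<longleftrightarrow> r = r0 \<or> r = 1" using inj[OF _ r' r0] inj[OF _ r' zero_less_one] by auto
      finally show ?thesis unfolding e .
    qed
  qed
qed

theorem corollary4p4:
  fixes \<alpha> \<beta> :: real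
  assumes "\<alpha> \<ge> 0"
    and "\<beta> > 0" and "Bessel_zero 1 \<beta> = Bessel_zero 2 0"
  shows "\<exists>pbar>1. \<forall>p n u.
           1 < p \<and> p < pbar \<and> 1 \<le> n \<and> int n \<le> \<lceil>(2 + \<alpha>) / 2 * \<beta> - 1\<rceil> \<and>
           least_energy_nodal \<alpha> p n u \<longrightarrow> \<not> radial u"
proof -
  define \<kappa> where "\<kappa> = Bessel_zero 2 0"
  define b where "b = (2 + \<alpha>) / 2 * \<beta>"
  define \<mu> where "\<mu> = ((2 + \<alpha>) / 2 * \<kappa>)\<^sup>2"
  have \<kappa>: "\<kappa> > 0" unfolding \<kappa>_def by (rule Bessel_zero(1)) auto
  have "Bessel_J \<beta> \<kappa> = 0" using Bessel_zero(2)[of \<beta> 1] assms by (simp add: \<kappa>_def)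
  then have zero: "bessel_series \<beta> (\<kappa>\<^sup>2 / 4) = 0" using Bessel_J_zero_iff[of \<beta> \<kappa>] assms(2) \<kappa> by simp
  obtain r0 where r0: "0 < r0" "r0 < 1"
    "\<And>r. 0 \<le> r \<Longrightarrow> r \<le> 1 \<Longrightarrow> bessel_series 0 (\<kappa>\<^sup>2 / 4 * r powr (2 * ((2 + \<alpha>) / 2))) = 0 \<longleftrightarrow> r = r0 \<or> r = 1"
  proof (rule bessel_series_radial_zeros[of "(2 + \<alpha>) / 2", folded \<kappa>_def])
    show "0 < (2 + \<alpha>) / 2" using assms(1) by simp
  qed (rule that)
  have "\<exists>e>0. \<forall>p. 1 < p \<and> p < 1 + e \<longrightarrow> (\<exists>v\<in>nodal_Nehari \<alpha> p n.
      energy \<alpha> p v < (1 / 2 - 1 / (p + 1)) * (\<mu> powr (2 / (p - 1)) / (16 * \<mu>)))"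
    if n: "1 \<le> n" "real n < b" for n
  proof -
    interpret angular_profile \<alpha> \<beta> \<kappa> n
      by unfold_locales (use assms \<kappa> n zero in \<open>auto simp: b_def\<close>)
    have \<mu>_eq: "lam = \<mu>" unfolding \<mu>_def lam_def \<gamma>_def ..
    obtain e where "0 < e" "\<And>p. 1 < p \<Longrightarrow> p < 1 + e \<Longrightarrow> \<exists>v\<in>nodal_Nehari \<alpha> p n.
      energy \<alpha> p v < (1 / 2 - 1 / (p + 1)) * (lam powr (2 / (p - 1)) / (16 * lam))"
      by (rule low_energy_nodal, rule that)
    then show ?thesis unfolding \<mu>_eq by (intro exI[of _ e]) auto
  qed
  then obtain e where e: "\<And>n. 1 \<le> n \<Longrightarrow> real n < b \<Longrightarrow> 0 < e n"
    "\<And>n p. 1 \<le> n \<Longrightarrow> real n < b \<Longrightarrow> 1 < p \<Longrightarrow> p < 1 + e n \<Longrightarrow> \<exists>v\<in>nodal_Nehari \<alpha> p n.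
      energy \<alpha> p v < (1 / 2 - 1 / (p + 1)) * (\<mu> powr (2 / (p - 1)) / (16 * \<mu>))"
    by metis
  define M where "M = {n. 1 \<le> n \<and> real n < b}"
  have finM: "finite M"
  proof (rule finite_subset)
    show "M \<subseteq> {..nat \<lceil>b\<rceil>}" unfolding M_def by (auto, linarith)
  qed simp
  \<comment> \<open>the entry 1 keeps \<open>p\<close> below 2 and the minimum defined if no \<open>n\<close> is admissible\<close>
  define d where "d = Min (insert 1 (e ` M))"
  have d: "0 < d" "d \<le> 1" "\<And>n. n \<in> M \<Longrightarrow> d \<le> e n"
    using finM e(1) unfolding d_def by (auto simp: M_def)
  show ?thesis
  proof (intro exI[of _ "1 + d"] conjI allI impI)
    show "1 < 1 + d" using d by simp
    fix p n u
    assume *: "1 < p \<and> p < 1 + d \<and> 1 \<le> n \<and> int n \<le> \<lceil>(2 + \<alpha>) / 2 * \<beta> - 1\<rceil> \<and> least_energy_nodal \<alpha> p n u"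
    have "real n < b"
    proof -
      have "real_of_int (int n) \<le> \<lceil>b - 1\<rceil>" using * unfolding b_def of_int_le_iff by simp
      then show ?thesis using ceiling_correct[of "b - 1"] by simp
    qed
    then have nM: "n \<in> M" using * by (simp add: M_def)
    then obtain v where v: "v \<in> nodal_Nehari \<alpha> p n"
      "energy \<alpha> p v < (1 / 2 - 1 / (p + 1)) * (\<mu> powr (2 / (p - 1)) / (16 * \<mu>))"
      using e(2)[of n p] d(3)[OF nM] * by (auto simp: M_def)
    show "\<not> radial u"
    proof
      assume rad: "radial u"
      have "u \<in> nodal_Nehari \<alpha> p n" "energy \<alpha> p u \<le> energy \<alpha> p v" using * v(1) by (auto simp: least_energy_nodal_def)
      moreover have p: "1 < p" "p < 2" using * d(2) by auto
      have "(1 / 2 - 1 / (p + 1)) * (\<mu> powr (2 / (p - 1)) / (16 * \<mu>)) \<le> energy \<alpha> p u"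
        unfolding \<mu>_def
        by (rule radial_energy_bound[OF \<open>u \<in> nodal_Nehari \<alpha> p n\<close> rad assms(1) \<kappa> r0(1,2) _ p]) (rule r0(3))
      ultimately show False using v(2) by simp
    qed
  qed
qed

end
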